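(* Fix a finite set $J$ and Euclidean spaces $H$ and $H_j$, $j\in J$. Let $\mathscr{D}= \bigl((\ell_j)_{j \in J}, (q_j)_{j \in J}\bigr)$ be a simple Brascamp-Lieb datum with linear maps $\ell_j:H\to H_j$. Then there exist a constant $C > 0$ and a neighborhood $U$ of $\mathscr{D}$ in $\prod_{j \in J} \mathscr{L}(H,H_j) \times \mathbb{R}_{>0}^J$ such that for any $\mathscr{D}' \in U$ that is globally critical, we have $\operatorname{BL}(\mathscr{D}') < C$.
   Context: A Euclidean space is a finite-dimensional real Hilbert space, equipped with the Lebesgue measure induced by its inner product. $\mathscr{L}(H,H_j)$ denotes the (finite-dimensional real vector) space of linear maps from $H$ to $H_j$ with its usual topology. For fixed $J,H,(H_j)_{j\in J}$, a Brascamp-Lieb datum is a pair $\mathscr{D}=((\ell_j)_{j\in J},(q_j)_{j\in J})\in \prod_{j \in J} \mathscr{L}(H,H_j) \times \mathbb{R}_{>0}^J$. The Brascamp-Lieb constant $\operatorname{BL}(\mathscr{D})\in[0,+\infty]$ is the smallest constant such that \[ \int_{H} \prod_{j \in J} (f_{j}\circ \ell_{j})^{q_{j}} \leq \operatorname{BL}(\mathscr{D}) \prod_{j \in J} \Bigl(\int_{H_{j}} f_{j} \Bigr)^{q_{j}} \] for all collections $(f_j)_{j\in J}$ of measurable functions $f_j:H_j\to\mathbb{R}_{\ge0}$. The datum $\mathscr{D}$ is globally critical if $\sum_{j\in J} q_j\dim H_j=\dim H$. A globally critical datum $\mathscr{D}$ is said to be simple if the inequality $\sum_{j\in J} q_j\dim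 \ell_j(W)\ge\dim W$ holds as a strict inequality for any proper nonzero linear subspace $W$ of $H$.
   Formalization: "Simple" is taken to include also the non-strict inequality for W = H, i.e. that every ℓ_j is onto H_j; without it the claim fails, e.g. H = H_1 = ℝ, q_1 = 1, ℓ_1 = 0 is vacuously simple but BL = ∞. *)

theory Defs
  imports "HOL-Analysis.Analysis"
begin

text \<open>
  The Euclidean spaces \<open>H\<close> and \<open>H\<^sub>j\<close> (\<open>j \<in> J\<close>) are linear subspaces \<open>H\<close> of \<open>'a\<close> and \<open>G j\<close> of \<open>'b\<close>,
  where \<open>'a\<close> and \<open>'b\<close> are arbitrary Euclidean-space types. Every finite family of Euclidean spaces,
  of any dimensions (zero included), is of this form up to isometry.
\<close>

text \<open>
  Lebesgue measure induced by the inner product on a subspace \<open>S\<close>, carried by the Borel sets of \<open>S\<close>: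
  the image of the product Lebesgue measure under the coordinates of an orthonormal basis (compare
  \<open>lborel_def\<close>). By rotation invariance of Lebesgue measure the choice of the basis is immaterial.
  For \<open>S = {0}\<close> this is the unit point mass.
\<close>
definition orthonormal_basis_of :: "'a::euclidean_space set \<Rightarrow> 'a set \<Rightarrow> bool" where
  "orthonormal_basis_of S B \<longleftrightarrow>
     B \<subseteq> S \<and> pairwise orthogonal B \<and> (\<forall>b\<in>B. norm b = 1) \<and> span B = S"

definition subspace_lborel :: "'a::euclidean_space set \<Rightarrow> 'a measure" where
  "subspace_lborel S =
     (let B = (SOME B. orthonormal_basis_of S B)
      in distr (\<Pi>\<^sub>M b\<in>B. lborel) (restrict_space borel S) (\<lambda>c. \<Sum>b\<in>B. c b *\<^sub>R b))"

lemma orthonormal_basis_of_exists: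
  assumes "subspace S"
  shows "\<exists>B. orthonormal_basis_of S B"
  using orthonormal_basis_subspace[OF assms] unfolding orthonormal_basis_of_def by metis

lemma sets_subspace_lborel [measurable_cong]:
  "sets (subspace_lborel S) = sets (restrict_space borel S)"
  by (simp add: subspace_lborel_def Let_def)

lemma space_subspace_lborel: "space (subspace_lborel S) = S"
  by (simp add: subspace_lborel_def Let_def space_restrict_space)

text \<open>
  The space of linear maps from \<open>H\<close> to \<open>K\<close>. A linear map defined on the subspace \<open>H\<close> is represented
  by its unique linear extension to \<open>'a\<close> that vanishes on the orthogonal complement of \<open>H\<close>. This
  identification preserves the operator norm, so the norm topology inherited from bounded linear
  functions is the usual topology of the space of linear maps.
\<close>
definition linear_maps :: "'a::euclidean_space set \<Rightarrow> 'b::euclidean_space set \<Rightarrow> ('a \<Rightarrow>\<^sub>L 'b) set" where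
  "linear_maps H K = {l. blinfun_apply l ` H \<subseteq> K \<and> (\<forall>x\<in>orthogonal_comp H. blinfun_apply l x = 0)}"

type_synonym ('j, 'a, 'b) bl_datum = "('j \<Rightarrow> 'a \<Rightarrow>\<^sub>L 'b) \<times> ('j \<Rightarrow> real)"

definition bl_data ::
  "'j set \<Rightarrow> 'a::euclidean_space set \<Rightarrow> ('j \<Rightarrow> 'b::euclidean_space set) \<Rightarrow> ('j, 'a, 'b) bl_datum set" where
  "bl_data J H G = (\<Pi>\<^sub>E j\<in>J. linear_maps H (G j)) \<times> (\<Pi>\<^sub>E j\<in>J. {0<..})"

definition bl_data_topology ::
  "'j set \<Rightarrow> 'a::euclidean_space set \<Rightarrow> ('j \<Rightarrow> 'b::euclidean_space set) \<Rightarrow> ('j, 'a, 'b) bl_datum topology" where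
  "bl_data_topology J H G =
     prod_topology
       (product_topology (\<lambda>j. subtopology euclidean (linear_maps H (G j))) J)
       (product_topology (\<lambda>j. subtopology euclidean {0<..}) J)"

lemma topspace_bl_data_topology: "topspace (bl_data_topology J H G) = bl_data J H G"
  by (simp add: bl_data_topology_def bl_data_def)

text \<open>Real powers on \<open>[0, \<infinity>]\<close>, meant for positive exponents only.\<close>
definition ennreal_powr :: "ennreal \<Rightarrow> real \<Rightarrow> ennreal" where
  "ennreal_powr x q = (if x = \<infinity> then \<infinity> else ennreal (enn2real x powr q))"

text \<open>
  The infimum is taken in \<open>[0, \<infinity>]\<close>, so it is \<open>\<infinity>\<close> if no constant is admissible. Measurability is
  Borel measurability, which makes the composites with the linear maps measurable on \<open>H\<close>.
\<close>
definition BL_constant ::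
  "'j set \<Rightarrow> 'a::euclidean_space set \<Rightarrow> ('j \<Rightarrow> 'b::euclidean_space set) \<Rightarrow> ('j, 'a, 'b) bl_datum \<Rightarrow> ennreal" where
  "BL_constant J H G = (\<lambda>(l, q).
     Inf {C. \<forall>f :: 'j \<Rightarrow> 'b \<Rightarrow> real.
       (\<forall>j\<in>J. f j \<in> borel_measurable (subspace_lborel (G j)) \<and> (\<forall>y\<in>G j. 0 \<le> f j y)) \<longrightarrow>
       (\<integral>\<^sup>+ x. (\<Prod>j\<in>J. ennreal (f j (blinfun_apply (l j) x) powr q j)) \<partial>subspace_lborel H)
         \<le> C * (\<Prod>j\<in>J. ennreal_powr (\<integral>\<^sup>+ y. ennreal (f j y) \<partial>subspace_lborel (G j)) (q j))})"

definition globally_critical ::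
  "'j set \<Rightarrow> 'a::euclidean_space set \<Rightarrow> ('j \<Rightarrow> 'b::euclidean_space set) \<Rightarrow> ('j, 'a, 'b) bl_datum \<Rightarrow> bool" where
  "globally_critical J H G = (\<lambda>(l, q). (\<Sum>j\<in>J. q j * real (dim (G j))) = real (dim H))"

text \<open>
  The inequality in the definition of simplicity is understood as the finiteness criterion, imposed
  on all subspaces of \<open>H\<close> and required to be strict on the proper nonzero ones. For \<open>W = H\<close> and a
  globally critical datum it says exactly that every \<open>\<ell>\<^sub>j\<close> is onto \<open>H\<^sub>j\<close>. It cannot be dropped: with
  \<open>H = H\<^sub>1 = \<real>\<close>, \<open>q\<^sub>1 = 1\<close> and \<open>\<ell>\<^sub>1 = 0\<close> strictness on proper nonzero subspaces is vacuous, but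
  the Brascamp-Lieb constant is infinite.
\<close>
definition simple_datum ::
  "'j set \<Rightarrow> 'a::euclidean_space set \<Rightarrow> ('j \<Rightarrow> 'b::euclidean_space set) \<Rightarrow> ('j, 'a, 'b) bl_datum \<Rightarrow> bool" where
  "simple_datum J H G = (\<lambda>(l, q).
     globally_critical J H G (l, q) \<and>
     (\<forall>W. subspace W \<and> W \<subseteq> H \<longrightarrow>
        (\<Sum>j\<in>J. q j * real (dim (blinfun_apply (l j) ` W))) \<ge> real (dim W) \<and>
        (W \<noteq> {0} \<and> W \<noteq> H \<longrightarrow>
          (\<Sum>j\<in>J. q j * real (dim (blinfun_apply (l j) ` W))) > real (dim W))))"

end

theory Submission
  imports Defs "HOL-Probability.Distributions"
begin

text \<open>
  Write \<open>Z\<close> for the integral of \<open>exp (- \<pi> Q)\<close>. For linear automorphisms \<open>R\<^sub>j\<close> of \<open>H\<^sub>j\<close>, testing the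
  inequality on centred Gaussians leads to the functional
  \<open>V(R) = Z(\<Sum> q\<^sub>j |R\<^sub>j \<ell>\<^sub>j x|\<^sup>2) / \<Prod> Z(|R\<^sub>j y|\<^sup>2) powr q\<^sub>j\<close>. If \<open>V\<close> attains its maximum at \<open>R\<close>, the first-order
  condition says that the datum becomes geometric after a linear change of variables, and a geometric datum
  has constant 1: writing mixtures of Gaussians as convolutions, this follows from a discretized heat flow,
  that is a Gaussian random walk each step of which costs only a third-order error. Hence the Brascamp-Lieb
  constant is at most \<open>max V\<close>.

  For a simple datum, each orthonormal frame \<open>e\<close> of \<open>H\<close> has greedily chosen index sets \<open>I\<^sub>j\<close> such that the
  vectors \<open>\<ell>\<^sub>j e\<^sub>i\<close>, \<open>i \<in> I\<^sub>j\<close>, form a basis of \<open>H\<^sub>j\<close>, and the strict dimension inequalities for the flag spanned by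
  \<open>e\<close> become gaps \<open>\<Sum> q\<^sub>j |I\<^sub>j \<inter> {..<k}| \<ge> k + \<delta>\<close>. Being strict, these properties persist for nearby data, and by
  compactness of the set of frames they hold with uniform constants. Diagonalizing \<open>\<Sum> q\<^sub>j |R\<^sub>j \<ell>\<^sub>j x|\<^sup>2\<close>,
  Hadamard's inequality and summation by parts then bound \<open>V\<close> uniformly, and \<open>V\<close> tends to 0 as the quadratic
  form degenerates, so that the maximum is attained.
\<close>

section \<open>Haar measure on subspaces and Gaussian integrals\<close>

text \<open>No determinants occur. The Gaussian integral \<open>zf S\<close> of |T x|^2 stands for 1
  / |det T|, and its multiplicativity is a change of variables that rests on the uniqueness of Haar
  measure; this works for subspaces of any dimension without coordinates. The factor
  \<open>pi\<close> gives the standard Gaussian mass 1 in every dimension.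

  A random walk replaces the heat equation because nothing has to be differentiated under an
  integral: N steps of size N^(-1/2) cost N times O(N^(-3/2)), which tends to 0. The price is that a
  step is unbounded, so the Taylor estimate has to hold globally.

  The first-order condition needs a maximizer and not just a supremum. Near-maximizers could
  degenerate in two ways: by scaling, which global criticality makes harmless, and by a growing
  ratio of the extreme eigenvalues, which the gap \<delta> penalizes by the power \<delta> / 2 of
  that ratio. Thus \<delta> secures attainment, while the bound itself is expressed by K, the
  weights and the dimensions only. This is what makes it uniform near the given datum.\<close>

lemma nn_integral_gauss1:
  fixes a :: real
  assumes "a > 0"
  shows "(\<integral>\<^sup>+x. ennreal (exp (- pi * (a * x\<^sup>2))) \<partial>lborel) = ennreal (1 / sqrt a)"
proof -
  define s where "s = sqrt (1 / (2 * pi * a))"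
  have s: "s > 0" "s\<^sup>2 = 1 / (2 * pi * a)"
    using assms by (auto simp: s_def)
  have nd: "normal_density 0 s x = sqrt a * exp (- pi * (a * x\<^sup>2))" for x
    using assms unfolding normal_density_def s
    by (simp add: real_sqrt_divide field_simps)
  have "(\<integral>\<^sup>+x. ennreal (normal_density 0 s x) \<partial>lborel) = 1"
    using prob_space.emeasure_space_1[OF prob_space_normal_density[OF s(1), of 0]]
    by (simp add: emeasure_density)
  hence "(\<integral>\<^sup>+x. ennreal (sqrt a) * ennreal (exp (- pi * (a * x\<^sup>2))) \<partial>lborel) = 1"
    using assms by (simp add: nd ennreal_mult)
  hence *: "ennreal (sqrt a) * (\<integral>\<^sup>+x. ennreal (exp (- pi * (a * x\<^sup>2))) \<partial>lborel) = 1"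
    by (subst nn_integral_cmult[symmetric]) auto
  have "ennreal (1 / sqrt a) * (ennreal (sqrt a) * (\<integral>\<^sup>+x. ennreal (exp (- pi * (a * x\<^sup>2))) \<partial>lborel))
      = (\<integral>\<^sup>+x. ennreal (exp (- pi * (a * x\<^sup>2))) \<partial>lborel)"
    using assms by (simp flip: mult.assoc ennreal_mult)
  thus ?thesis by (simp only: * mult_1_right)
qed

text \<open>The measure lives on the Borel sets of the whole type and is merely concentrated on
  \<open>S\<close>, so one notion of measurability serves all subspaces. Gaussian mass 1 fixes the
  scale without reference to a basis. Reflection invariance is listed because the uniqueness
  argument below uses it.\<close>

definition haar_on :: "'a::euclidean_space set \<Rightarrow> 'a measure \<Rightarrow> bool" where
  "haar_on S M \<longleftrightarrow> sets M = sets borel \<and> (AE x in M. x \<in> S) \<and>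
     (\<forall>v\<in>S. distr M borel (\<lambda>x. v + x) = M) \<and> distr M borel uminus = M \<and>
     (\<integral>\<^sup>+x. ennreal (exp (- pi * (norm x)\<^sup>2)) \<partial>M) = 1"

text \<open>Families are indexed because eigenvalues, chosen index sets and the order of a flag are
  attached to the indices later.\<close>

definition orthonormal_family :: "'i set \<Rightarrow> ('i \<Rightarrow> 'a::euclidean_space) \<Rightarrow> bool" where
  "orthonormal_family I e \<longleftrightarrow> (\<forall>i\<in>I. \<forall>k\<in>I. e i \<bullet> e k = (if i = k then 1 else 0))"

definition coord_measure :: "'i set \<Rightarrow> ('i \<Rightarrow> 'a::euclidean_space) \<Rightarrow> 'a measure" where
  "coord_measure I e = distr (\<Pi>\<^sub>M i\<in>I. lborel) borel (\<lambda>c. \<Sum>i\<in>I. c i *\<^sub>R e i)"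

lemma orthonormal_family_inner_sum:
  assumes "orthonormal_family I e" "finite I" "k \<in> I"
  shows "(\<Sum>i\<in>I. c i *\<^sub>R e i) \<bullet> e k = c k"
proof -
  have "(\<Sum>i\<in>I. c i *\<^sub>R e i) \<bullet> e k = (\<Sum>i\<in>I. if i = k then c i else 0)"
    unfolding inner_sum_left using assms by (intro sum.cong) (auto simp: orthonormal_family_def)
  thus ?thesis using assms by simp
qed

lemma orthonormal_family_norm:
  assumes "orthonormal_family I e" "finite I"
  shows "(norm (\<Sum>i\<in>I. c i *\<^sub>R e i))\<^sup>2 = (\<Sum>i\<in>I. (c i)\<^sup>2)"
proof -
  have "(norm (\<Sum>i\<in>I. c i *\<^sub>R e i))\<^sup>2 = (\<Sum>k\<in>I. (\<Sum>i\<in>I. c i *\<^sub>R e i) \<bullet> (c k *\<^sub>R e k))"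
    unfolding power2_norm_eq_inner by (subst inner_sum_right) simp
  also have "\<dots> = (\<Sum>k\<in>I. (c k)\<^sup>2)"
    using orthonormal_family_inner_sum[OF assms]
    by (intro sum.cong) (auto simp: power2_eq_square)
  finally show ?thesis .
qed

lemma orthonormal_family_inj_on:
  assumes "orthonormal_family I e" shows "inj_on e I"
proof (rule inj_onI)
  fix x y assume xy: "x \<in> I" "y \<in> I" "e x = e y"
  have "e x \<bullet> e y = e x \<bullet> e x" using xy by simp
  thus "x = y" using assms xy(1,2) unfolding orthonormal_family_def by (metis zero_neq_one)
qed

lemma orthonormal_family_independent:
  assumes "orthonormal_family I e" shows "independent (e ` I)"
proof (rule pairwise_orthogonal_independent)
  show "pairwise orthogonal (e ` I)"
    using assms by (auto simp: pairwise_def orthogonal_def orthonormal_family_def)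
  show "0 \<notin> e ` I"
    using assms by (fastforce simp: orthonormal_family_def)
qed

lemma orthonormal_family_finite:
  assumes "orthonormal_family I e" shows "finite I"
  using finite_imageD[OF independent_imp_finite[OF orthonormal_family_independent[OF assms]]
      orthonormal_family_inj_on[OF assms]] .

lemma orthonormal_family_card:
  assumes "orthonormal_family I e" shows "card I = dim (span (e ` I))"
  using orthonormal_family_independent[OF assms] orthonormal_family_inj_on[OF assms]
  by (simp add: dim_eq_card_independent card_image)

lemma orthonormal_family_expand:
  assumes e: "orthonormal_family I e" and x: "x \<in> span (e ` I)"
  shows "(\<Sum>i\<in>I. (x \<bullet> e i) *\<^sub>R e i) = x"
proof -
  have fin: "finite I" using orthonormal_family_finite[OF e] .
  obtain u where u: "x = (\<Sum>v\<in>e ` I. u v *\<^sub>R v)"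
    using x fin by (auto simp: span_finite)
  have "x = (\<Sum>i\<in>I. u (e i) *\<^sub>R e i)"
    unfolding u by (subst sum.reindex[OF orthonormal_family_inj_on[OF e]]) simp
  moreover have "(\<Sum>i\<in>I. u (e i) *\<^sub>R e i) \<bullet> e k = u (e k)" if "k \<in> I" for k
    by (rule orthonormal_family_inner_sum[OF e fin that])
  ultimately show ?thesis by (metis (no_types, lifting) sum.cong)
qed

lemma orthonormal_family_spans:
  assumes e: "orthonormal_family I e" and sub: "e ` I \<subseteq> S" and S: "subspace S" and c: "card I = dim S"
  shows "span (e ` I) = S"
proof (rule subspace_dim_equal)
  show "span (e ` I) \<subseteq> S" using sub S by (simp add: span_minimal)
  show "dim S \<le> dim (span (e ` I))" using orthonormal_family_card[OF e] c by simp
qed (use S in auto)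

text \<open>A measure on a finite product is determined by boxes, and a coordinatewise map pulls
  boxes back to boxes. Translations and reflections are both covered.\<close>

lemma distr_PiM_lborel_map:
  fixes t :: "'i \<Rightarrow> real \<Rightarrow> real"
  assumes fin: "finite I" and [measurable]: "\<And>i. i \<in> I \<Longrightarrow> t i \<in> borel_measurable borel"
    and t: "\<And>i. i \<in> I \<Longrightarrow> distr lborel borel (t i) = lborel"
  shows "distr (\<Pi>\<^sub>M i\<in>I. lborel) (\<Pi>\<^sub>M i\<in>I. lborel) (\<lambda>c. \<lambda>i\<in>I. t i (c i)) = (\<Pi>\<^sub>M i\<in>I. lborel)"
proof -
  interpret product_sigma_finite "\<lambda>_::'i. lborel :: real measure" by standard
  interpret finite_product_sigma_finite "\<lambda>_::'i. lborel :: real measure" I by standard fact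
  have mt: "(\<lambda>c. \<lambda>i\<in>I. t i (c i)) \<in> (\<Pi>\<^sub>M i\<in>I. lborel) \<rightarrow>\<^sub>M (\<Pi>\<^sub>M i\<in>I. lborel)"
    by (intro measurable_restrict) measurable
  show ?thesis
  proof (rule PiM_eqI)
    fix A :: "'i \<Rightarrow> real set" assume A: "\<And>i. i \<in> I \<Longrightarrow> A i \<in> sets lborel"
    have pre: "t i -` A i \<in> sets lborel" if "i \<in> I" for i
      using measurable_sets[of "t i" borel borel "A i"] A[OF that] that by simp
    have "emeasure (distr (\<Pi>\<^sub>M i\<in>I. lborel) (\<Pi>\<^sub>M i\<in>I. lborel) (\<lambda>c. \<lambda>i\<in>I. t i (c i))) (Pi\<^sub>E I A)
       = emeasure (\<Pi>\<^sub>M i\<in>I. lborel) ((\<lambda>c. \<lambda>i\<in>I. t i (c i)) -` Pi\<^sub>E I A \<inter> space (\<Pi>\<^sub>M i\<in>I. lborel))"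
      using A by (intro emeasure_distr mt) (auto intro!: sets_PiM_I_finite fin)
    also have "(\<lambda>c. \<lambda>i\<in>I. t i (c i)) -` Pi\<^sub>E I A \<inter> space (\<Pi>\<^sub>M i\<in>I. lborel) = Pi\<^sub>E I (\<lambda>i. t i -` A i)"
      by (auto simp: space_PiM PiE_def Pi_def extensional_def)
    also have "emeasure (\<Pi>\<^sub>M i\<in>I. lborel) \<dots> = (\<Prod>i\<in>I. emeasure lborel (t i -` A i))"
      using pre by (intro measure_times) auto
    also have "\<dots> = (\<Prod>i\<in>I. emeasure lborel (A i))"
    proof (intro prod.cong refl)
      fix i assume i: "i \<in> I"
      have "emeasure (distr lborel borel (t i)) (A i) = emeasure lborel (t i -` A i \<inter> space lborel)"
        using A[OF i] i by (intro emeasure_distr) auto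
      thus "emeasure lborel (t i -` A i) = emeasure lborel (A i)" by (simp add: t[OF i])
    qed
    finally show "emeasure (distr (\<Pi>\<^sub>M i\<in>I. lborel) (\<Pi>\<^sub>M i\<in>I. lborel) (\<lambda>c. \<lambda>i\<in>I. t i (c i))) (Pi\<^sub>E I A) = (\<Prod>i\<in>I. emeasure lborel (A i))" .
  qed (use fin in auto)
qed

lemma PiM_lborel_component_measurable:
  "i \<in> I \<Longrightarrow> (\<lambda>c. c i) \<in> borel_measurable (\<Pi>\<^sub>M i\<in>I. (lborel :: real measure))"
  using measurable_component_singleton[of i I "\<lambda>_. lborel :: real measure"] by simp

lemma coord_measure_measurable [measurable]:
  fixes e :: "'i \<Rightarrow> 'a::euclidean_space"
  shows "(\<lambda>c. \<Sum>i\<in>I. c i *\<^sub>R e i) \<in> borel_measurable (\<Pi>\<^sub>M i\<in>I. lborel)"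
  by (intro borel_measurable_sum borel_measurable_scaleR PiM_lborel_component_measurable) auto

lemma nn_integral_coord_measure_diag:
  fixes I :: "'i set"
  assumes "finite I" "\<And>i. i \<in> I \<Longrightarrow> lam i > 0"
  shows "(\<integral>\<^sup>+c. ennreal (exp (- pi * (\<Sum>i\<in>I. lam i * (c i)\<^sup>2))) \<partial>(\<Pi>\<^sub>M i\<in>I. lborel)) = ennreal (\<Prod>i\<in>I. 1 / sqrt (lam i))"
proof -
  interpret product_sigma_finite "\<lambda>_::'i. lborel :: real measure" by standard
  have "(\<integral>\<^sup>+c. ennreal (exp (- pi * (\<Sum>i\<in>I. lam i * (c i)\<^sup>2))) \<partial>(\<Pi>\<^sub>M i\<in>I. lborel))
      = (\<integral>\<^sup>+c. (\<Prod>i\<in>I. ennreal (exp (- pi * (lam i * (c i)\<^sup>2)))) \<partial>(\<Pi>\<^sub>M i\<in>I. lborel))"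
    using assms(1) by (simp add: sum_distrib_left exp_sum prod_ennreal flip: sum_negf)
  also have "\<dots> = (\<Prod>i\<in>I. \<integral>\<^sup>+x. ennreal (exp (- pi * (lam i * x\<^sup>2))) \<partial>lborel)"
    by (rule product_nn_integral_prod[OF assms(1)]) measurable
  also have "\<dots> = (\<Prod>i\<in>I. ennreal (1 / sqrt (lam i)))"
    using assms by (intro prod.cong nn_integral_gauss1) auto
  also have "\<dots> = ennreal (\<Prod>i\<in>I. 1 / sqrt (lam i))"
    using assms by (intro prod_ennreal) (auto simp: less_imp_le)
  finally show ?thesis .
qed

lemma haar_on_coord_measure:
  assumes e: "orthonormal_family I e"
  shows "haar_on (span (e ` I)) (coord_measure I e)"
proof -
  let ?P = "\<Pi>\<^sub>M i\<in>I. (lborel :: real measure)"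
  let ?s = "\<lambda>c. \<Sum>i\<in>I. c i *\<^sub>R e i"
  have fin: "finite I" using orthonormal_family_finite[OF e] .
  \<comment> \<open>In the coordinates of \<open>e\<close> the map \<open>g\<close> acts by
    \<open>t i\<close> on each axis, so it suffices that every \<open>t i\<close> preserves Lebesgue
    measure on the line. Translation by \<open>v\<close> uses the shifts by
    \<open>v \<bullet> e i\<close>.\<close>
  have map: "distr (coord_measure I e) borel g = coord_measure I e"
    if g[measurable]: "g \<in> borel_measurable borel"
      and t[measurable]: "\<And>i. i \<in> I \<Longrightarrow> t i \<in> borel_measurable borel"
      and t': "\<And>i. i \<in> I \<Longrightarrow> distr lborel borel (t i) = (lborel :: real measure)"
      and gs: "\<And>c. g (?s c) = ?s (\<lambda>i\<in>I. t i (c i))" for g t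
  proof -
    have mt: "(\<lambda>c. \<lambda>i\<in>I. t i (c i)) \<in> ?P \<rightarrow>\<^sub>M ?P"
      by (intro measurable_restrict) measurable
    have "distr (coord_measure I e) borel g = distr ?P borel (g \<circ> ?s)"
      unfolding coord_measure_def by (subst distr_distr) auto
    also have "g \<circ> ?s = ?s \<circ> (\<lambda>c. \<lambda>i\<in>I. t i (c i))" using gs by auto
    also have "distr ?P borel \<dots> = distr (distr ?P ?P (\<lambda>c. \<lambda>i\<in>I. t i (c i))) borel ?s"
      by (subst distr_distr[OF _ mt]) auto
    also have "distr ?P ?P (\<lambda>c. \<lambda>i\<in>I. t i (c i)) = ?P"
      by (rule distr_PiM_lborel_map[OF fin t t'])
    finally show ?thesis by (simp add: coord_measure_def)
  qed
  have "closed (span (e ` I))" by (simp add: closed_subspace)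
  hence [measurable]: "span (e ` I) \<in> sets borel" by auto
  have 1: "AE x in coord_measure I e. x \<in> span (e ` I)"
    unfolding coord_measure_def
    by (subst AE_distr_iff) (auto intro!: AE_I2 span_sum span_scale intro: span_base)
  have 2: "distr (coord_measure I e) borel (\<lambda>x. v + x) = coord_measure I e" if v: "v \<in> span (e ` I)" for v
  proof (rule map[where t = "\<lambda>i x. (v \<bullet> e i) + x"])
    show "distr lborel borel (\<lambda>x. v \<bullet> e i + x) = lborel" for i by (rule lborel_distr_plus)
    fix c :: "_ \<Rightarrow> real"
    show "v + ?s c = ?s (\<lambda>i\<in>I. v \<bullet> e i + c i)"
      using orthonormal_family_expand[OF e v] by (simp add: scaleR_add_left sum.distrib)
  qed auto
  have 3: "distr (coord_measure I e) borel uminus = coord_measure I e"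
    by (rule map[where t = "\<lambda>i x. - x"]) (auto simp: lborel_distr_uminus sum_negf)
  have "(\<integral>\<^sup>+x. ennreal (exp (- pi * (norm x)\<^sup>2)) \<partial>coord_measure I e) =
     (\<integral>\<^sup>+c. ennreal (exp (- pi * (\<Sum>i\<in>I. 1 * (c i)\<^sup>2))) \<partial>?P)"
    unfolding coord_measure_def
    by (subst nn_integral_distr) (auto simp: orthonormal_family_norm[OF e fin])
  also have "\<dots> = 1" by (subst nn_integral_coord_measure_diag) (use fin in auto)
  finally show ?thesis
    unfolding haar_on_def using 1 2 3 by (auto simp: coord_measure_def)
qed

lemma haar_on_measurable: "haar_on S M \<Longrightarrow> sets M = sets borel"
  by (simp add: haar_on_def)

lemma haar_on_AE: "haar_on S M \<Longrightarrow> AE x in M. x \<in> S"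
  by (simp add: haar_on_def)

lemma haar_on_gauss: "haar_on S M \<Longrightarrow> (\<integral>\<^sup>+x. ennreal (exp (- pi * (norm x)\<^sup>2)) \<partial>M) = 1"
  by (simp add: haar_on_def)

lemma haar_on_translate:
  assumes "haar_on S M" "v \<in> S" and [measurable]: "g \<in> borel_measurable borel"
  shows "(\<integral>\<^sup>+x. g (v + x) \<partial>M) = (\<integral>\<^sup>+x. g x \<partial>M)"
proof -
  have [measurable_cong]: "sets M = sets borel" using assms haar_on_measurable by blast
  have "(\<integral>\<^sup>+x. g x \<partial>distr M borel (\<lambda>x. v + x)) = (\<integral>\<^sup>+x. g (v + x) \<partial>M)"
    by (rule nn_integral_distr) measurable
  thus ?thesis using assms(1,2) by (simp add: haar_on_def)
qed

lemma haar_on_reflect: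
  assumes "haar_on S M" and [measurable]: "g \<in> borel_measurable borel"
  shows "(\<integral>\<^sup>+x. g (- x) \<partial>M) = (\<integral>\<^sup>+x. g x \<partial>M)"
proof -
  have [measurable_cong]: "sets M = sets borel" using assms haar_on_measurable by blast
  have "(\<integral>\<^sup>+x. g x \<partial>distr M borel uminus) = (\<integral>\<^sup>+x. g (- x) \<partial>M)"
    by (rule nn_integral_distr) measurable
  thus ?thesis using assms(1) by (simp add: haar_on_def)
qed

text \<open>A Markov inequality: on the ball the Gaussian is at least exp (- pi R^2). Hence the
  normalization alone forces finite mass on balls, which gives sigma-finiteness and access to
  Fubini.\<close>

lemma haar_on_emeasure_cball:
  assumes "haar_on S M"
  shows "emeasure M (cball 0 R) \<le> ennreal (exp (pi * R\<^sup>2))"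
proof -
  have [measurable_cong]: "sets M = sets borel" using assms haar_on_measurable by blast
  have *: "indicator (cball 0 R) x \<le> ennreal (exp (pi * R\<^sup>2)) * ennreal (exp (- pi * (norm x)\<^sup>2))" for x :: 'a
  proof (cases "x \<in> cball 0 R")
    case True
    hence "(norm x)\<^sup>2 \<le> R\<^sup>2" by (intro power_mono) auto
    hence "1 \<le> exp (pi * R\<^sup>2 + - pi * (norm x)\<^sup>2)" by simp
    hence "ennreal 1 \<le> ennreal (exp (pi * R\<^sup>2) * exp (- pi * (norm x)\<^sup>2))"
      unfolding exp_add by (rule ennreal_leI)
    thus ?thesis using True by (simp add: ennreal_mult)
  qed auto
  have "emeasure M (cball 0 R) = (\<integral>\<^sup>+x. indicator (cball 0 R) x \<partial>M)" by simp
  also have "\<dots> \<le> (\<integral>\<^sup>+x. ennreal (exp (pi * R\<^sup>2)) * ennreal (exp (- pi * (norm x)\<^sup>2)) \<partial>M)"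
    by (intro nn_integral_mono *)
  also have "\<dots> = ennreal (exp (pi * R\<^sup>2))"
    by (subst nn_integral_cmult) (auto simp: haar_on_gauss[OF assms, simplified])
  finally show ?thesis .
qed

lemma haar_on_sigma_finite:
  assumes "haar_on S M" shows "sigma_finite_measure M"
proof
  have s: "sets M = sets borel" using assms haar_on_measurable by blast
  hence sp: "space M = UNIV" by (metis sets_eq_imp_space_eq space_borel)
  show "\<exists>A. countable A \<and> A \<subseteq> sets M \<and> \<Union> A = space M \<and> (\<forall>a\<in>A. emeasure M a \<noteq> \<infinity>)"
  proof (intro exI[of _ "range (\<lambda>n::nat. cball 0 (real n))"] conjI ballI)
    show "\<Union> (range (\<lambda>n::nat. cball 0 (real n))) = space M"
      by (auto simp: sp real_arch_simple)
    fix a :: "'a set" assume "a \<in> range (\<lambda>n::nat. cball 0 (real n))"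
    then obtain n :: nat where "a = cball 0 (real n)" by blast
    thus "emeasure M a \<noteq> \<infinity>"
      using le_less_trans[OF haar_on_emeasure_cball[OF assms, of "real n"] ennreal_less_top] by simp
  qed (auto simp: s)
qed

text \<open>
  Uniqueness of Haar measure in the following form: both sides, multiplied by a Gaussian mass, are the
  double integral of \<open>g (T x) h (y + T x)\<close> after translations and a reflection.
\<close>
lemma haar_on_linear_image:
  fixes T :: "'a::euclidean_space \<Rightarrow> 'b::euclidean_space"
  assumes M: "haar_on S M" and N: "haar_on K N" and T: "linear T" "T ` S = K"
    and S: "subspace S"
    and g[measurable]: "g \<in> borel_measurable borel"
  shows "(\<integral>\<^sup>+x. g (T x) \<partial>M) = (\<integral>\<^sup>+x. ennreal (exp (- pi * (norm (T x))\<^sup>2)) \<partial>M) * (\<integral>\<^sup>+y. g y \<partial>N)"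
proof -
  have [measurable_cong]: "sets M = sets borel" "sets N = sets borel"
    using M N haar_on_measurable by blast+
  interpret M: sigma_finite_measure M by (rule haar_on_sigma_finite[OF M])
  interpret N: sigma_finite_measure N by (rule haar_on_sigma_finite[OF N])
  interpret pair_sigma_finite M N by standard
  have [measurable]: "T \<in> borel_measurable borel"
    using T(1) by (intro borel_measurable_continuous_onI linear_continuous_on) (simp add: linear_linear)
  define h where "h = (\<lambda>y::'b. ennreal (exp (- pi * (norm y)\<^sup>2)))"
  have [measurable]: "h \<in> borel_measurable borel" by (simp add: h_def)
  have h1: "(\<integral>\<^sup>+y. h y \<partial>N) = 1" using haar_on_gauss[OF N] by (simp add: h_def)
  have "(\<integral>\<^sup>+x. g (T x) \<partial>M) = (\<integral>\<^sup>+x. g (T x) * (\<integral>\<^sup>+y. h (T x + y) \<partial>N) \<partial>M)"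
  proof (rule nn_integral_cong_AE)
    show "AE x in M. g (T x) = g (T x) * (\<integral>\<^sup>+y. h (T x + y) \<partial>N)"
      using haar_on_AE[OF M]
    proof eventually_elim
      case (elim x)
      hence "T x \<in> K" using T by auto
      thus ?case using haar_on_translate[OF N, of "T x" h] h1 by simp
    qed
  qed
  also have "\<dots> = (\<integral>\<^sup>+x. (\<integral>\<^sup>+y. g (T x) * h (T x + y) \<partial>N) \<partial>M)"
    by (intro nn_integral_cong) (simp add: nn_integral_cmult)
  also have "\<dots> = (\<integral>\<^sup>+y. (\<integral>\<^sup>+x. g (T x) * h (T x + y) \<partial>M) \<partial>N)"
    by (rule Fubini'[symmetric]) measurable
  also have "\<dots> = (\<integral>\<^sup>+y. (\<integral>\<^sup>+x. g (T x - y) * h (T x) \<partial>M) \<partial>N)"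
  proof (rule nn_integral_cong_AE)
    show "AE y in N. (\<integral>\<^sup>+x. g (T x) * h (T x + y) \<partial>M) = (\<integral>\<^sup>+x. g (T x - y) * h (T x) \<partial>M)"
      using haar_on_AE[OF N]
    proof eventually_elim
      case (elim y)
      then obtain x0 where x0: "x0 \<in> S" "T x0 = y" using T by auto
      show ?case
        using haar_on_translate[OF M x0(1), of "\<lambda>x. g (T x - y) * h (T x)"] x0 T(1)
        by (simp add: linear_add add.commute)
    qed
  qed
  also have "\<dots> = (\<integral>\<^sup>+x. (\<integral>\<^sup>+y. g (T x - y) * h (T x) \<partial>N) \<partial>M)"
    by (rule Fubini') measurable
  also have "\<dots> = (\<integral>\<^sup>+x. h (T x) * (\<integral>\<^sup>+y. g y \<partial>N) \<partial>M)"
  proof (rule nn_integral_cong_AE)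
    show "AE x in M. (\<integral>\<^sup>+y. g (T x - y) * h (T x) \<partial>N) = h (T x) * (\<integral>\<^sup>+y. g y \<partial>N)"
      using haar_on_AE[OF M]
    proof eventually_elim
      case (elim x)
      hence Tx: "T x \<in> K" using T by auto
      have "(\<integral>\<^sup>+y. g (T x - y) * h (T x) \<partial>N) = h (T x) * (\<integral>\<^sup>+y. g (T x - y) \<partial>N)"
        by (subst mult.commute) (rule nn_integral_cmult, measurable)
      also have "(\<integral>\<^sup>+y. g (T x - y) \<partial>N) = (\<integral>\<^sup>+y. g (T x + y) \<partial>N)"
        using haar_on_reflect[OF N, of "\<lambda>y. g (T x + y)"] by simp
      also have "\<dots> = (\<integral>\<^sup>+y. g y \<partial>N)"
        by (rule haar_on_translate[OF N Tx]) measurable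
      finally show ?case .
    qed
  qed
  also have "\<dots> = (\<integral>\<^sup>+x. h (T x) \<partial>M) * (\<integral>\<^sup>+y. g y \<partial>N)"
    by (rule nn_integral_multc) measurable
  finally show ?thesis by (simp add: h_def)
qed

text \<open>The change of variables is applied to the identity, whose Gaussian factor is 1 by
  normalization.\<close>

lemma haar_on_unique:
  assumes M: "haar_on S M" and N: "haar_on S N" and S: "subspace S"
  shows "M = N"
proof (rule measure_eqI)
  show s: "sets M = sets N" using M N by (simp add: haar_on_def)
  fix A assume A: "A \<in> sets M"
  hence [measurable]: "A \<in> sets borel" using M by (simp add: haar_on_def)
  show "emeasure M A = emeasure N A"
    using haar_on_linear_image[OF M N, of "\<lambda>x. x" "indicator A"] S haar_on_gauss[OF M] A s
    by (simp add: linear_ident)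
qed

text \<open>The given measure is pushed forward to the Borel sets of the ambient type, which makes
  it a \<open>haar_on\<close> measure; integrals of Borel functions are unaffected.\<close>

definition sl :: "'a::euclidean_space set \<Rightarrow> 'a measure" where
  "sl S = distr (subspace_lborel S) borel (\<lambda>x. x)"

lemma sets_sl [simp, measurable_cong]: "sets (sl S) = sets borel"
  by (simp add: sl_def)

lemma space_sl [simp]: "space (sl S) = UNIV"
  by (simp add: sl_def)

lemma ident_measurable_subspace_lborel: "(\<lambda>x. x) \<in> subspace_lborel S \<rightarrow>\<^sub>M borel"
  using measurable_ident_sets[OF sets_subspace_lborel[of S]]
  by (simp add: measurable_restrict_space1 measurable_cong_sets[OF sets_subspace_lborel refl])

lemma nn_integral_sl:
  "g \<in> borel_measurable borel \<Longrightarrow> (\<integral>\<^sup>+x. g x \<partial>sl S) = (\<integral>\<^sup>+x. g x \<partial>subspace_lborel S)"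
  unfolding sl_def by (rule nn_integral_distr[OF ident_measurable_subspace_lborel]) auto

text \<open>The choice hidden in \<open>SOME\<close> is harmless: whichever orthonormal basis is
  picked, the result is a Haar measure, and that property determines it.\<close>

lemma haar_on_sl:
  assumes "subspace S" shows "haar_on S (sl S)"
proof -
  define B where "B = (SOME B. orthonormal_basis_of S B)"
  have B: "orthonormal_basis_of S B"
    unfolding B_def by (rule someI_ex[OF orthonormal_basis_of_exists[OF assms]])
  have on: "orthonormal_family B (\<lambda>b. b)"
    using B by (fastforce simp: orthonormal_family_def orthonormal_basis_of_def pairwise_def orthogonal_def norm_eq_1)
  have sp: "span B = S" using B by (simp add: orthonormal_basis_of_def)
  have m: "(\<lambda>c. \<Sum>b\<in>B. c b *\<^sub>R b) \<in> (\<Pi>\<^sub>M b\<in>B. lborel) \<rightarrow>\<^sub>M restrict_space borel S"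
  proof (rule measurable_restrict_space2)
    show "(\<lambda>c. \<Sum>b\<in>B. c b *\<^sub>R b) \<in> space (\<Pi>\<^sub>M b\<in>B. lborel) \<rightarrow> S"
      using sp by (auto intro!: span_sum span_scale intro: span_base)
  qed measurable
  have "sl S = coord_measure B (\<lambda>b. b)"
    unfolding sl_def subspace_lborel_def coord_measure_def Let_def B_def[symmetric]
    by (subst distr_distr[OF _ m]) (auto intro: measurable_restrict_space1 measurable_ident simp: comp_def)
  thus ?thesis using haar_on_coord_measure[OF on] sp by simp
qed

text \<open>Uniqueness of Haar measure takes the place of rotation invariance: integrals may be
  computed in any convenient orthonormal basis, for instance one of eigenvectors.\<close>

lemma sl_eq_coord_measure:
  assumes "orthonormal_family I e" "span (e ` I) = S"
  shows "sl S = coord_measure I e"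
  using haar_on_unique[OF haar_on_sl haar_on_coord_measure[OF assms(1)]] assms
  by (metis subspace_span)

lemma linear_borel_measurable:
  fixes T :: "'a::euclidean_space \<Rightarrow> 'b::euclidean_space"
  shows "linear T \<Longrightarrow> T \<in> borel_measurable borel"
  by (intro borel_measurable_continuous_onI linear_continuous_on) (simp add: linear_linear)

text \<open>The partition function of the form \<open>Q\<close>. Values in [0, \<infinity>] admit
  degenerate forms: for |T x|^2 with a linear \<open>T\<close> it is infinite exactly when
  \<open>T\<close> is not injective on \<open>S\<close>.\<close>

definition zf :: "'a::euclidean_space set \<Rightarrow> ('a \<Rightarrow> real) \<Rightarrow> ennreal" where
  "zf S Q = (\<integral>\<^sup>+x. ennreal (exp (- pi * Q x)) \<partial>sl S)"

lemma sl_AE: "subspace S \<Longrightarrow> AE x in sl S. x \<in> S"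
  by (rule haar_on_AE[OF haar_on_sl])

lemma sl_sigma_finite: "subspace S \<Longrightarrow> sigma_finite_measure (sl S)"
  by (rule haar_on_sigma_finite[OF haar_on_sl])

lemma nn_integral_sl_mono:
  assumes "subspace S" "\<And>x. x \<in> S \<Longrightarrow> f x \<le> g x"
  shows "(\<integral>\<^sup>+x. f x \<partial>sl S) \<le> (\<integral>\<^sup>+x. g x \<partial>sl S)"
  using sl_AE[OF assms(1)] by (intro nn_integral_mono_AE) (auto elim!: eventually_mono intro: assms)

lemma nn_integral_sl_cong:
  assumes "subspace S" "\<And>x. x \<in> S \<Longrightarrow> f x = g x"
  shows "(\<integral>\<^sup>+x. f x \<partial>sl S) = (\<integral>\<^sup>+x. g x \<partial>sl S)"
  using sl_AE[OF assms(1)] by (intro nn_integral_cong_AE) (auto elim!: eventually_mono intro: assms)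

lemma zf_mono:
  assumes "subspace S" "\<And>x. x \<in> S \<Longrightarrow> Q x \<le> Q' x"
  shows "zf S Q' \<le> zf S Q"
  unfolding zf_def by (intro nn_integral_sl_mono[OF assms(1)] ennreal_leI) (use assms(2) in auto)

lemma zf_cong:
  assumes "subspace S" "\<And>x. x \<in> S \<Longrightarrow> Q x = Q' x"
  shows "zf S Q = zf S Q'"
  by (intro antisym zf_mono) (use assms in auto)

lemma zf_norm: "subspace S \<Longrightarrow> zf S (\<lambda>x. (norm x)\<^sup>2) = 1"
  unfolding zf_def by (rule haar_on_gauss[OF haar_on_sl])

text \<open>The change-of-variables formula, with \<open>zf\<close> in the place of the Jacobian
  factor 1 / |det T|.\<close>

lemma sl_linear_image:
  fixes T :: "'a::euclidean_space \<Rightarrow> 'b::euclidean_space"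
  assumes "subspace S" "linear T" "T ` S = K" "g \<in> borel_measurable borel"
  shows "(\<integral>\<^sup>+x. g (T x) \<partial>sl S) = zf S (\<lambda>x. (norm (T x))\<^sup>2) * (\<integral>\<^sup>+y. g y \<partial>sl K)"
proof -
  have "subspace K" using assms(1,2,3) linear_subspace_image by blast
  thus ?thesis
    unfolding zf_def using haar_on_linear_image[OF haar_on_sl haar_on_sl assms(2,3,1,4)] assms(1) by blast
qed

lemma sl_translate:
  assumes "subspace S" "v \<in> S" "g \<in> borel_measurable borel"
  shows "(\<integral>\<^sup>+x. g (v + x) \<partial>sl S) = (\<integral>\<^sup>+x. g x \<partial>sl S)"
  by (rule haar_on_translate[OF haar_on_sl]) (use assms in auto)

lemma orthonormal_family_exists:
  assumes S: "subspace S" and I: "finite I" "card I = dim S"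
  obtains e where "orthonormal_family I e" "span (e ` I) = S"
proof -
  obtain B where B: "B \<subseteq> S" "pairwise orthogonal B" "\<And>x. x \<in> B \<Longrightarrow> norm x = 1"
      "independent B" "card B = dim S" "span B = S"
    using orthonormal_basis_subspace[OF S] by blast
  have "finite B" using B(4) independent_imp_finite by blast
  then obtain e where e: "bij_betw e I B"
    using finite_same_card_bij[OF I(1)] I(2) B(5) by metis
  have "orthonormal_family I e"
    unfolding orthonormal_family_def
  proof (intro ballI)
    fix i k assume ik: "i \<in> I" "k \<in> I"
    hence m: "e i \<in> B" "e k \<in> B" using e by (auto simp: bij_betw_def)
    show "e i \<bullet> e k = (if i = k then 1 else 0)"
    proof (cases "i = k")
      case True thus ?thesis using B(3)[OF m(1)] by (simp add: norm_eq_1)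
    next
      case False
      hence "e i \<noteq> e k" using e ik by (auto simp: bij_betw_def inj_on_def)
      thus ?thesis using False B(2) m by (auto simp: pairwise_def orthogonal_def)
    qed
  qed
  moreover have "span (e ` I) = S" using e B(6) by (simp add: bij_betw_def)
  ultimately show ?thesis using that by blast
qed

text \<open>In an orthonormal eigenbasis the integral splits into one-dimensional Gaussian
  integrals. Scaled norms, rank-one perturbations and the forms \<open>N R\<close> are all evaluated
  through this.\<close>

lemma zf_diag:
  assumes e: "orthonormal_family I e" "span (e ` I) = S"
    and Q: "\<And>c. Q (\<Sum>i\<in>I. c i *\<^sub>R e i) = (\<Sum>i\<in>I. lam i * (c i)\<^sup>2)"
    and lam: "\<And>i. i \<in> I \<Longrightarrow> lam i > 0"
  shows "zf S Q = ennreal (\<Prod>i\<in>I. 1 / sqrt (lam i))"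
proof -
  have fin: "finite I" using orthonormal_family_finite[OF e(1)] .
  have S: "subspace S" using e(2) by (metis subspace_span)
  have "zf S Q = zf S (\<lambda>x. \<Sum>i\<in>I. lam i * (x \<bullet> e i)\<^sup>2)"
  proof (rule zf_cong[OF S])
    fix x assume "x \<in> S"
    hence "(\<Sum>i\<in>I. (x \<bullet> e i) *\<^sub>R e i) = x" using orthonormal_family_expand[OF e(1)] e(2) by simp
    thus "Q x = (\<Sum>i\<in>I. lam i * (x \<bullet> e i)\<^sup>2)" using Q[of "\<lambda>i. x \<bullet> e i"] by simp
  qed
  also have "\<dots> = (\<integral>\<^sup>+c. ennreal (exp (- pi * (\<Sum>i\<in>I. lam i * ((\<Sum>k\<in>I. c k *\<^sub>R e k) \<bullet> e i)\<^sup>2))) \<partial>(\<Pi>\<^sub>M i\<in>I. lborel))"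
    unfolding zf_def sl_eq_coord_measure[OF e] coord_measure_def
    by (rule nn_integral_distr) (use coord_measure_measurable in measurable)
  also have "\<dots> = (\<integral>\<^sup>+c. ennreal (exp (- pi * (\<Sum>i\<in>I. lam i * (c i)\<^sup>2))) \<partial>(\<Pi>\<^sub>M i\<in>I. lborel))"
    by (intro nn_integral_cong arg_cong[where f = ennreal] arg_cong[where f = exp] arg_cong2[where f = times] sum.cong refl)
       (simp add: orthonormal_family_inner_sum[OF e(1) fin])
  also have "\<dots> = ennreal (\<Prod>i\<in>I. 1 / sqrt (lam i))"
    by (rule nn_integral_coord_measure_diag[OF fin lam])
  finally show ?thesis .
qed

lemma zf_scaled_norm:
  assumes S: "subspace S" and c: "c > 0"
  shows "zf S (\<lambda>x. c * (norm x)\<^sup>2) = ennreal ((1 / sqrt c) ^ dim S)"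
proof -
  obtain e where e: "orthonormal_family {..<dim S} e" "span (e ` {..<dim S}) = S"
    using orthonormal_family_exists[OF S, of "{..<dim S}"] by auto
  have "zf S (\<lambda>x. c * (norm x)\<^sup>2) = ennreal (\<Prod>i\<in>{..<dim S}. 1 / sqrt c)"
    by (rule zf_diag[OF e]) (use c in \<open>simp_all add: orthonormal_family_norm[OF e(1)] sum_distrib_left\<close>)
  thus ?thesis by simp
qed

lemma sl_scale:
  assumes S: "subspace S" and c: "c > 0" and g: "g \<in> borel_measurable borel"
  shows "(\<integral>\<^sup>+x. g (c *\<^sub>R x) \<partial>sl S) = ennreal ((1 / c) ^ dim S) * (\<integral>\<^sup>+x. g x \<partial>sl S)"
proof -
  have "(\<lambda>x. c *\<^sub>R x) ` S = S"
  proof (intro equalityI subsetI)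
    fix x assume "x \<in> S"
    hence "(1 / c) *\<^sub>R x \<in> S" using S by (simp add: subspace_scale)
    thus "x \<in> (\<lambda>x. c *\<^sub>R x) ` S" using c by (intro image_eqI[of _ _ "(1 / c) *\<^sub>R x"]) auto
  qed (use S in \<open>auto simp: subspace_scale\<close>)
  hence "(\<integral>\<^sup>+x. g (c *\<^sub>R x) \<partial>sl S) = zf S (\<lambda>x. (norm (c *\<^sub>R x))\<^sup>2) * (\<integral>\<^sup>+x. g x \<partial>sl S)"
    using sl_linear_image[OF S, of "\<lambda>x. c *\<^sub>R x" S g] g by (simp add: linear_scale_self)
  also have "zf S (\<lambda>x. (norm (c *\<^sub>R x))\<^sup>2) = ennreal ((1 / c) ^ dim S)"
    using zf_scaled_norm[OF S, of "c\<^sup>2"] c by (simp add: power_mult_distrib)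
  finally show ?thesis .
qed

section \<open>Gaussian measures\<close>

text \<open>The centred Gaussian on \<open>S\<close> whose covariance is the identity divided by
  \<open>2 * pi\<close>; this convention explains the factors \<open>pi\<close> and
  \<open>2 * pi\<close> in the exponents below.\<close>

definition gauss_on :: "'a::euclidean_space set \<Rightarrow> 'a measure" where
  "gauss_on S = density (sl S) (\<lambda>x. ennreal (exp (- pi * (norm x)\<^sup>2)))"

lemma sets_gauss_on [simp, measurable_cong]: "sets (gauss_on S) = sets borel"
  by (simp add: gauss_on_def)

lemma space_gauss_on [simp]: "space (gauss_on S) = UNIV"
  by (simp add: gauss_on_def)

lemma prob_space_gauss_on: "subspace S \<Longrightarrow> prob_space (gauss_on S)"
  unfolding gauss_on_def by (rule prob_spaceI, subst emeasure_density) (use zf_norm[of S] in \<open>auto simp: zf_def\<close>)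

lemma nn_integral_gauss_on:
  "g \<in> borel_measurable borel \<Longrightarrow>
    (\<integral>\<^sup>+x. g x \<partial>gauss_on S) = (\<integral>\<^sup>+x. ennreal (exp (- pi * (norm x)\<^sup>2)) * g x \<partial>sl S)"
  unfolding gauss_on_def by (rule nn_integral_density) measurable

text \<open>Completing the square reduces this to translation by \<open>a\<close>. It says that the
  tilt factor exp (2 pi a . x - pi |a|^2) has mean 1, which makes the reweighting along the walk a
  martingale.\<close>

lemma gauss_on_mgf:
  assumes S: "subspace S" and a: "a \<in> S"
  shows "(\<integral>\<^sup>+x. ennreal (exp (2 * pi * (a \<bullet> x))) \<partial>gauss_on S) = ennreal (exp (pi * (norm a)\<^sup>2))"
proof -
  have *: "exp (- pi * (norm x)\<^sup>2) * exp (2 * pi * (a \<bullet> x)) = exp (pi * (norm a)\<^sup>2) * exp (- pi * (norm (- a + x))\<^sup>2)" for x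
    unfolding exp_add[symmetric] power2_norm_eq_inner by (simp add: algebra_simps inner_commute)
  have "(\<integral>\<^sup>+x. ennreal (exp (2 * pi * (a \<bullet> x))) \<partial>gauss_on S)
      = (\<integral>\<^sup>+x. ennreal (exp (pi * (norm a)\<^sup>2)) * ennreal (exp (- pi * (norm (- a + x))\<^sup>2)) \<partial>sl S)"
    by (subst nn_integral_gauss_on, measurable) (simp only: * ennreal_mult[symmetric] exp_ge_zero)
  also have "\<dots> = ennreal (exp (pi * (norm a)\<^sup>2)) * (\<integral>\<^sup>+x. ennreal (exp (- pi * (norm (- a + x))\<^sup>2)) \<partial>sl S)"
    by (rule nn_integral_cmult) measurable
  also have "(\<integral>\<^sup>+x. ennreal (exp (- pi * (norm (- a + x))\<^sup>2)) \<partial>sl S) = 1"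
    using sl_translate[OF S, of "- a" "\<lambda>x. ennreal (exp (- pi * (norm x)\<^sup>2))"] a zf_norm[OF S]
    by (simp add: subspace_neg[OF S] zf_def)
  finally show ?thesis by simp
qed

lemma gauss_on_integral_mgf:
  assumes S: "subspace S" and a: "a \<in> S"
  shows "has_bochner_integral (gauss_on S) (\<lambda>x. exp (2 * pi * (a \<bullet> x))) (exp (pi * (norm a)\<^sup>2))"
  by (rule has_bochner_integral_nn_integral, measurable) (use gauss_on_mgf[OF assms] in auto)

text \<open>Since c t \<le> c^2 + t^2 / 4 and 1/4 \<le> pi / 2, the exponential costs at most half
  of the Gaussian decay. The integrable majorant of the one-step remainder is of this form.\<close>

lemma gauss_on_exp_norm_integrable:
  assumes S: "subspace S"
  shows "integrable (gauss_on S) (\<lambda>x. exp (c * norm x))"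
proof (rule integrableI_nonneg)
  have *: "exp (- pi * (norm x)\<^sup>2) * exp (c * norm x) \<le> exp (c\<^sup>2) * exp (- pi * ((1/2) * (norm x)\<^sup>2))" for x :: 'a
  proof -
    have "0 \<le> (norm x / 2 - c)\<^sup>2" by simp
    hence "c * norm x \<le> c\<^sup>2 + (1/4) * (norm x)\<^sup>2" by (simp add: power2_eq_square algebra_simps)
    also have "(1/4) * (norm x)\<^sup>2 \<le> (pi / 2) * (norm x)\<^sup>2" using pi_gt3 by (intro mult_right_mono) auto
    finally show ?thesis unfolding exp_add[symmetric] exp_le_cancel_iff by (simp add: algebra_simps)
  qed
  have "(\<integral>\<^sup>+x. ennreal (exp (c * norm x)) \<partial>gauss_on S)
      \<le> (\<integral>\<^sup>+x. ennreal (exp (c\<^sup>2)) * ennreal (exp (- pi * ((1/2) * (norm x)\<^sup>2))) \<partial>sl S)"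
    using * by (subst nn_integral_gauss_on) (auto intro!: nn_integral_mono ennreal_leI simp flip: ennreal_mult)
  also have "\<dots> = ennreal (exp (c\<^sup>2)) * zf S (\<lambda>x. (1/2) * (norm x)\<^sup>2)"
    unfolding zf_def by (rule nn_integral_cmult) measurable
  also have "\<dots> < \<infinity>" by (subst zf_scaled_norm[OF S]) (simp_all flip: ennreal_mult)
  finally show "(\<integral>\<^sup>+x. ennreal (exp (c * norm x)) \<partial>gauss_on S) < \<infinity>" .
qed auto

text \<open>A combination of two independent standard Gaussians with coefficients on the unit circle
  is standard again. This splits a walk into its last increment and the rest.\<close>

lemma gauss_on_convolution:
  fixes S :: "'a::euclidean_space set"
  assumes S: "subspace S" and ab: "\<alpha> \<ge> 0" "\<alpha>\<^sup>2 + \<beta>\<^sup>2 = 1" "\<beta> \<ge> 0"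
    and g[measurable]: "g \<in> borel_measurable borel"
  shows "(\<integral>\<^sup>+y. (\<integral>\<^sup>+x. g (\<alpha> *\<^sub>R x + \<beta> *\<^sub>R y) \<partial>gauss_on S) \<partial>gauss_on S) = (\<integral>\<^sup>+w. g w \<partial>gauss_on S)"
proof (cases "\<alpha> = 0")
  \<comment> \<open>The substitution below solves w = \<alpha> x + \<beta> y for \<open>x\<close>,
    hence \<alpha> = 0 is treated apart.\<close>
  case True
  hence "\<beta> = 1" using ab by (simp add: power2_eq_1_iff)
  interpret prob_space "gauss_on S" by (rule prob_space_gauss_on[OF S])
  show ?thesis using True \<open>\<beta> = 1\<close> emeasure_space_1 by simp
next
  case False
  hence a: "\<alpha> > 0" using ab by simp
  interpret S: sigma_finite_measure "sl S" by (rule sl_sigma_finite[OF S])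
  interpret pair_sigma_finite "sl S" "sl S" by standard
  define h where "h = (\<lambda>x::'a. ennreal (exp (- pi * (norm x)\<^sup>2)))"
  define k where "k = (\<lambda>x::'a. ennreal (exp (- pi * (norm ((1/\<alpha>) *\<^sub>R x))\<^sup>2)))"
  have [measurable]: "h \<in> borel_measurable borel" "k \<in> borel_measurable borel" by (simp_all add: h_def k_def)
  define Z where "Z = ennreal ((1 / \<alpha>) ^ dim S)"
  have inner: "(\<integral>\<^sup>+x. h x * g (\<alpha> *\<^sub>R x + \<beta> *\<^sub>R y) \<partial>sl S) = Z * (\<integral>\<^sup>+w. k (w - \<beta> *\<^sub>R y) * g w \<partial>sl S)" if y: "y \<in> S" for y
  proof -
    let ?G = "\<lambda>w. k w * g (w + \<beta> *\<^sub>R y)"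
    have "(\<integral>\<^sup>+x. h x * g (\<alpha> *\<^sub>R x + \<beta> *\<^sub>R y) \<partial>sl S) = (\<integral>\<^sup>+x. ?G (\<alpha> *\<^sub>R x) \<partial>sl S)"
      using a by (simp add: h_def k_def)
    also have "\<dots> = Z * (\<integral>\<^sup>+w. ?G w \<partial>sl S)"
      unfolding Z_def by (rule sl_scale[OF S a]) measurable
    also have "(\<integral>\<^sup>+w. ?G w \<partial>sl S) = (\<integral>\<^sup>+w. k (w - \<beta> *\<^sub>R y) * g w \<partial>sl S)"
      using sl_translate[OF S, of "\<beta> *\<^sub>R y" "\<lambda>w. k (w - \<beta> *\<^sub>R y) * g w"] y
      by (simp add: subspace_scale[OF S] add.commute)
    finally show ?thesis .
  qed
  \<comment> \<open>Since \<alpha>^2 + \<beta>^2 = 1, the form |y|^2 + |w - \<beta> y|^2 /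
    \<alpha>^2 is symmetric in \<open>y\<close> and \<open>w\<close>. After Fubini the inner
    integral over \<open>y\<close> is therefore a Gaussian of mass \<alpha>^dim, which cancels the
    Jacobian \<open>Z\<close>.\<close>
  have kh: "h y * k (w - \<beta> *\<^sub>R y) = h w * k (y - \<beta> *\<^sub>R w)" for y w
  proof -
    have b: "\<beta>\<^sup>2 = 1 - \<alpha>\<^sup>2" using ab by simp
    have "(norm y)\<^sup>2 + (norm ((1/\<alpha>) *\<^sub>R (w - \<beta> *\<^sub>R y)))\<^sup>2 = (norm w)\<^sup>2 + (norm ((1/\<alpha>) *\<^sub>R (y - \<beta> *\<^sub>R w)))\<^sup>2"
    proof -
      have e: "(norm (u - \<beta> *\<^sub>R v))\<^sup>2 = (norm u)\<^sup>2 - 2 * \<beta> * (u \<bullet> v) + (1 - \<alpha>\<^sup>2) * (norm v)\<^sup>2" for u v :: 'a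
        unfolding b[symmetric] power2_norm_eq_inner
        by (simp add: algebra_simps inner_commute power2_eq_square)
      have "\<alpha>\<^sup>2 * ((norm y)\<^sup>2 + (1/\<alpha>)\<^sup>2 * (norm (w - \<beta> *\<^sub>R y))\<^sup>2) = \<alpha>\<^sup>2 * ((norm w)\<^sup>2 + (1/\<alpha>)\<^sup>2 * (norm (y - \<beta> *\<^sub>R w))\<^sup>2)"
        using a unfolding e by (simp add: field_simps power2_eq_square inner_commute)
      thus ?thesis using a by (simp add: power_mult_distrib power_divide)
    qed
    hence "exp (- pi * (norm y)\<^sup>2) * exp (- pi * (norm ((1/\<alpha>) *\<^sub>R (w - \<beta> *\<^sub>R y)))\<^sup>2)
         = exp (- pi * (norm w)\<^sup>2) * exp (- pi * (norm ((1/\<alpha>) *\<^sub>R (y - \<beta> *\<^sub>R w)))\<^sup>2)"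
      unfolding exp_add[symmetric] distrib_left[symmetric] by (simp only:)
    thus ?thesis unfolding h_def k_def
      by (simp only: ennreal_mult[symmetric] exp_ge_zero)
  qed
  have k1: "(\<integral>\<^sup>+y. k (y - \<beta> *\<^sub>R w) \<partial>sl S) = ennreal (\<alpha> ^ dim S)" if w: "w \<in> S" for w
  proof -
    have "(\<integral>\<^sup>+y. k (y - \<beta> *\<^sub>R w) \<partial>sl S) = (\<integral>\<^sup>+y. k y \<partial>sl S)"
      using sl_translate[OF S, of "- (\<beta> *\<^sub>R w)" k] w by (simp add: subspace_scale[OF S] subspace_neg[OF S])
    also have "\<dots> = ennreal (\<alpha> ^ dim S) * (\<integral>\<^sup>+y. h y \<partial>sl S)"
      using sl_scale[OF S, of "1 / \<alpha>" h] a unfolding k_def h_def by simp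
    also have "(\<integral>\<^sup>+y. h y \<partial>sl S) = 1" using zf_norm[OF S] by (simp add: h_def zf_def)
    finally show ?thesis by simp
  qed
  have "(\<integral>\<^sup>+y. (\<integral>\<^sup>+x. g (\<alpha> *\<^sub>R x + \<beta> *\<^sub>R y) \<partial>gauss_on S) \<partial>gauss_on S)
      = (\<integral>\<^sup>+y. h y * (\<integral>\<^sup>+x. h x * g (\<alpha> *\<^sub>R x + \<beta> *\<^sub>R y) \<partial>sl S) \<partial>sl S)"
    by (simp add: nn_integral_gauss_on h_def)
  also have "\<dots> = (\<integral>\<^sup>+y. (\<integral>\<^sup>+w. Z * (h y * k (w - \<beta> *\<^sub>R y) * g w) \<partial>sl S) \<partial>sl S)"
    by (intro nn_integral_sl_cong[OF S]) (simp add: inner nn_integral_cmult[symmetric] mult_ac)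
  also have "\<dots> = (\<integral>\<^sup>+y. (\<integral>\<^sup>+w. (Z * h w * g w) * k (y - \<beta> *\<^sub>R w) \<partial>sl S) \<partial>sl S)"
    by (simp add: kh mult_ac)
  also have "\<dots> = (\<integral>\<^sup>+w. (\<integral>\<^sup>+y. (Z * h w * g w) * k (y - \<beta> *\<^sub>R w) \<partial>sl S) \<partial>sl S)"
    by (rule Fubini') measurable
  also have "\<dots> = (\<integral>\<^sup>+w. (Z * ennreal (\<alpha> ^ dim S)) * (h w * g w) \<partial>sl S)"
    by (intro nn_integral_sl_cong[OF S]) (simp add: nn_integral_cmult k1 mult_ac)
  also have "Z * ennreal (\<alpha> ^ dim S) = 1"
    unfolding Z_def using a by (simp flip: ennreal_mult add: power_one_over)
  also have "(\<integral>\<^sup>+w. 1 * (h w * g w) \<partial>sl S) = (\<integral>\<^sup>+w. g w \<partial>gauss_on S)"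
    by (simp add: nn_integral_gauss_on h_def)
  finally show ?thesis .
qed

section \<open>The Gaussian random walk\<close>

lemma ln_one_plus_le_cubic:
  fixes x :: real
  assumes "x > -1"
  shows "ln (1 + x) \<le> x - x\<^sup>2 / 2 + x ^ 3 / 3"
proof -
  define f where "f = (\<lambda>x::real. x - x\<^sup>2 / 2 + x ^ 3 / 3 - ln (1 + x))"
  \<comment> \<open>The derivative has the sign of \<open>t\<close>, so \<open>f\<close> is minimal
    at 0, where it vanishes.\<close>
  have d: "(f has_real_derivative t ^ 3 / (1 + t)) (at t)" if "t > -1" for t
    unfolding f_def using that
    by (auto intro!: derivative_eq_intros simp: field_simps power2_eq_square power3_eq_cube)
  have "f 0 \<le> f x"
  proof (cases "x \<ge> 0")
    case True
    show ?thesis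
    proof (rule DERIV_nonneg_imp_nondecreasing[OF True])
      fix t assume "0 \<le> t" "t \<le> x"
      thus "\<exists>y. (f has_real_derivative y) (at t) \<and> 0 \<le> y" using d[of t] by (intro exI[of _ "t ^ 3 / (1 + t)"]) auto
    qed
  next
    case False
    show ?thesis
    proof (rule DERIV_nonpos_imp_nonincreasing[of x 0])
      fix t assume "x \<le> t" "t \<le> 0"
      moreover have "t ^ 3 / (1 + t) \<le> 0" if "t \<le> 0" "t > -1"
        using that by (intro divide_nonpos_pos) (auto simp: power3_eq_cube mult_nonneg_nonpos2 zero_le_mult_iff mult_le_0_iff)
      ultimately show "\<exists>y. (f has_real_derivative y) (at t) \<and> y \<le> 0" using d[of t] assms by (intro exI[of _ "t ^ 3 / (1 + t)"]) auto
    qed (use False in auto)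
  qed
  thus ?thesis by (simp add: f_def)
qed

lemma exp_le_cubic:
  fixes u :: real
  shows "exp u \<le> 1 + u + u\<^sup>2 / 2 + \<bar>u\<bar> ^ 3 * exp \<bar>u\<bar>"
proof -
  obtain t where t: "\<bar>t\<bar> \<le> \<bar>u\<bar>" "exp u = (\<Sum>m<3. u ^ m / fact m) + exp t / fact 3 * u ^ 3"
    using Maclaurin_exp_le[of u 3] by blast
  have "exp t / fact 3 * u ^ 3 \<le> \<bar>exp t / fact 3 * u ^ 3\<bar>" by (rule abs_ge_self)
  also have "\<dots> = exp t / 6 * \<bar>u\<bar> ^ 3" by (simp add: abs_mult power_abs fact_numeral)
  also have "\<dots> \<le> exp \<bar>u\<bar> * \<bar>u\<bar> ^ 3"
  proof (rule mult_right_mono)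
    have "exp t / 6 \<le> exp t" by simp
    also have "\<dots> \<le> exp \<bar>u\<bar>" using t(1) by simp
    finally show "exp t / 6 \<le> exp \<bar>u\<bar>" .
  qed simp
  finally show ?thesis using t(2) by (simp add: eval_nat_numeral mult.commute)
qed

lemma exp_minus_one_le: "\<bar>exp x - 1\<bar> \<le> \<bar>x\<bar> * exp \<bar>x\<bar>" for x :: real
proof -
  obtain t where t: "\<bar>t\<bar> \<le> \<bar>x\<bar>" "exp x = (\<Sum>m<1. x ^ m / fact m) + exp t / fact 1 * x ^ 1"
    using Maclaurin_exp_le[of x 1] by blast
  hence "\<bar>exp x - 1\<bar> = exp t * \<bar>x\<bar>" by (simp add: abs_mult)
  also have "\<dots> \<le> exp \<bar>x\<bar> * \<bar>x\<bar>" using t(1) by (intro mult_right_mono) auto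
  finally show ?thesis by (simp add: mult.commute)
qed

lemma exp_minus_one_minus_le: "\<bar>exp x - 1 - x\<bar> \<le> x\<^sup>2 * exp \<bar>x\<bar>" for x :: real
proof -
  obtain t where t: "\<bar>t\<bar> \<le> \<bar>x\<bar>" "exp x = (\<Sum>m<2. x ^ m / fact m) + exp t / fact 2 * x ^ 2"
    using Maclaurin_exp_le[of x 2] by blast
  hence "\<bar>exp x - 1 - x\<bar> = exp t / 2 * x\<^sup>2" by (simp add: abs_mult eval_nat_numeral)
  also have "\<dots> \<le> exp \<bar>x\<bar> * x\<^sup>2"
  proof (rule mult_right_mono)
    have "exp t / 2 \<le> exp t" by simp
    also have "\<dots> \<le> exp \<bar>x\<bar>" using t(1) by simp
    finally show "exp t / 2 \<le> exp \<bar>x\<bar>" .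
  qed simp
  finally show ?thesis by (simp add: mult.commute)
qed

text \<open>Increments are unbounded, so the expansion must hold for all X > -1 and not only near 0;
  the last factor pays for large X. For small X the logarithm of the product is expanded and then
  exponentiated, for large X the remainder dominates everything.\<close>

lemma prod_powr_taylor:
  fixes q :: "'j \<Rightarrow> real"
  assumes J: "finite J" and q: "\<And>j. j \<in> J \<Longrightarrow> q j > 0"
  shows "\<exists>K\<ge>0. \<forall>X. (\<forall>j\<in>J. X j > -1) \<longrightarrow>
     (\<Prod>j\<in>J. (1 + X j) powr q j) \<le> 1 + (\<Sum>j\<in>J. q j * X j)
        + ((\<Sum>j\<in>J. q j * X j)\<^sup>2 - (\<Sum>j\<in>J. q j * (X j)\<^sup>2)) / 2
        + K * (\<Sum>j\<in>J. \<bar>X j\<bar>) ^ 3 * (1 + (\<Sum>j\<in>J. \<bar>X j\<bar>)) powr (\<Sum>j\<in>J. q j)"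
proof -
  define Q where "Q = (\<Sum>j\<in>J. q j)"
  \<comment> \<open>The case s > 1/2 requires 8 + 5 Q, the case s \<le> 1/2 requires Q + 3/2 Q^2 + 8
    Q^3 exp Q.\<close>
  define K where "K = 8 + 5 * Q + 2 * Q\<^sup>2 + 8 * Q ^ 3 * exp Q"
  have Q0: "Q \<ge> 0" unfolding Q_def by (intro sum_nonneg less_imp_le q)
  have K0: "K \<ge> 0" using Q0 by (simp add: K_def)
  show ?thesis
  proof (intro exI[of _ K] conjI K0 allI impI)
    fix X :: "'j \<Rightarrow> real" assume X: "\<forall>j\<in>J. X j > -1"
    define L where "L = (\<Sum>j\<in>J. q j * X j)"
    define B where "B = (\<Sum>j\<in>J. q j * (X j)\<^sup>2)"
    define s where "s = (\<Sum>j\<in>J. \<bar>X j\<bar>)"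
    have s0: "s \<ge> 0" by (simp add: s_def sum_nonneg)
    have Xs: "\<bar>X j\<bar> \<le> s" if "j \<in> J" for j
      unfolding s_def using J that by (intro member_le_sum) auto
    have wsum: "(\<Sum>j\<in>J. q j * f j) \<le> Q * t" if "\<And>j. j \<in> J \<Longrightarrow> f j \<le> t" for f t
      unfolding Q_def sum_distrib_right using that q by (intro sum_mono mult_left_mono) (auto simp: less_imp_le)
    have La: "\<bar>L\<bar> \<le> Q * s"
    proof -
      have "\<bar>L\<bar> \<le> (\<Sum>j\<in>J. \<bar>q j * X j\<bar>)" unfolding L_def by (rule sum_abs)
      also have "\<dots> = (\<Sum>j\<in>J. q j * \<bar>X j\<bar>)" using q by (intro sum.cong) (auto simp: abs_mult less_imp_le)
      also have "\<dots> \<le> Q * s" using Xs by (rule wsum)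
      finally show ?thesis .
    qed
    have B: "0 \<le> B" "B \<le> Q * s\<^sup>2"
    proof -
      show "0 \<le> B" unfolding B_def using q by (intro sum_nonneg) (auto simp: less_imp_le)
      show "B \<le> Q * s\<^sup>2" unfolding B_def
      proof (rule wsum)
        fix j assume "j \<in> J"
        thus "(X j)\<^sup>2 \<le> s\<^sup>2" using Xs[of j] s0 by (simp add: abs_le_square_iff[symmetric])
      qed
    qed
    have P1: "1 \<le> (1 + s) powr Q" using s0 Q0 by (simp add: ge_one_powr_ge_zero)
    show "(\<Prod>j\<in>J. (1 + X j) powr q j) \<le> 1 + (\<Sum>j\<in>J. q j * X j)
        + ((\<Sum>j\<in>J. q j * X j)\<^sup>2 - (\<Sum>j\<in>J. q j * (X j)\<^sup>2)) / 2
        + K * (\<Sum>j\<in>J. \<bar>X j\<bar>) ^ 3 * (1 + (\<Sum>j\<in>J. \<bar>X j\<bar>)) powr (\<Sum>j\<in>J. q j)"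
      unfolding L_def[symmetric] B_def[symmetric] s_def[symmetric] Q_def[symmetric]
    proof (cases "s \<le> 1/2")
      case True
      define C where "C = (\<Sum>j\<in>J. q j * \<bar>X j\<bar> ^ 3)"
      have C: "0 \<le> C" "C \<le> Q * s ^ 3"
        unfolding C_def using q Xs s0
        by (auto intro!: sum_nonneg mult_nonneg_nonneg wsum power_mono simp: less_imp_le)
      \<comment> \<open>An upper bound for the logarithm of the product. Its part beyond
        \<open>L\<close>, named \<open>r\<close> below, is of second order in \<open>s\<close>, so
        u^2 exceeds L^2 only by a third-order amount.\<close>
      define u where "u = L - B / 2 + C"
      have "(\<Prod>j\<in>J. (1 + X j) powr q j) = exp (\<Sum>j\<in>J. q j * ln (1 + X j))"
        using X J by (subst exp_sum) (auto intro!: prod.cong simp: powr_def)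
      also have "(\<Sum>j\<in>J. q j * ln (1 + X j)) \<le> (\<Sum>j\<in>J. q j * (X j - (X j)\<^sup>2 / 2 + \<bar>X j\<bar> ^ 3))"
      proof (intro sum_mono mult_left_mono)
        fix j assume j: "j \<in> J"
        have "X j ^ 3 / 3 \<le> \<bar>X j ^ 3 / 3\<bar>" by simp
        also have "\<dots> \<le> \<bar>X j\<bar> ^ 3" by (simp add: power_abs)
        finally show "ln (1 + X j) \<le> X j - (X j)\<^sup>2 / 2 + \<bar>X j\<bar> ^ 3"
          using ln_one_plus_le_cubic[of "X j"] X j by fastforce
      qed (use q in \<open>auto simp: less_imp_le\<close>)
      also have "\<dots> = u" unfolding u_def L_def B_def C_def
        by (simp add: sum.distrib sum_subtractf algebra_simps sum_divide_distrib)
      finally have 1: "(\<Prod>j\<in>J. (1 + X j) powr q j) \<le> exp u" by simp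
      have s3: "s ^ 3 \<le> (1/2) * s\<^sup>2" "s\<^sup>2 \<le> (1/2) * s" "s ^ 3 \<le> (1/4) * s" "s ^ 4 \<le> (1/2) * s ^ 3"
      proof -
        show a: "s\<^sup>2 \<le> (1/2) * s" using mult_right_mono[OF True s0] by (simp add: power2_eq_square)
        show b: "s ^ 3 \<le> (1/2) * s\<^sup>2" using True s0 mult_right_mono[of s "1/2" "s\<^sup>2"] by (simp add: power3_eq_cube power2_eq_square)
        show "s ^ 3 \<le> (1/4) * s" using a b by simp
        show "s ^ 4 \<le> (1/2) * s ^ 3" using True s0 mult_right_mono[of s "1/2" "s^3"] by (simp add: eval_nat_numeral)
      qed
      define r where "r = C - B / 2"
      have "\<bar>r\<bar> \<le> Q * s\<^sup>2"
      proof -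
        have "\<bar>r\<bar> \<le> max C (B/2)" using B C by (auto simp: r_def)
        also have "\<dots> \<le> Q * s\<^sup>2"
          using B C s3(1) Q0 mult_left_mono[OF s3(1) Q0] by auto
        finally show ?thesis .
      qed
      note r = this
      have ua: "\<bar>u\<bar> \<le> 2 * Q * s"
        using r La mult_left_mono[OF s3(2) Q0] s0 Q0 mult_nonneg_nonneg[OF Q0 s0] unfolding u_def r_def by (auto simp: abs_if split: if_splits)
      have "u\<^sup>2 = L\<^sup>2 + 2 * L * r + r\<^sup>2" by (simp add: u_def r_def power2_eq_square algebra_simps)
      moreover have "2 * L * r \<le> 2 * Q\<^sup>2 * s ^ 3"
      proof -
        have "L * r \<le> \<bar>L\<bar> * \<bar>r\<bar>" by (metis abs_ge_self abs_mult)
        also have "\<dots> \<le> (Q * s) * (Q * s\<^sup>2)" using La r Q0 s0 by (intro mult_mono) auto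
        finally show ?thesis by (simp add: power2_eq_square power3_eq_cube algebra_simps)
      qed
      moreover have "r\<^sup>2 \<le> Q\<^sup>2 * s ^ 3"
      proof -
        have "r\<^sup>2 \<le> (Q * s\<^sup>2)\<^sup>2" using r Q0 s0 by (intro iffD1[OF abs_le_square_iff]) (auto simp: abs_mult)
        also have "\<dots> = Q\<^sup>2 * s ^ 4" by (simp add: power_mult_distrib flip: power_mult)
        also have "\<dots> \<le> Q\<^sup>2 * s ^ 3" using s3(4) zero_le_power[OF s0, of 3] by (intro mult_left_mono) (linarith, simp)
        finally show ?thesis .
      qed
      ultimately have u2: "u\<^sup>2 \<le> L\<^sup>2 + 3 * Q\<^sup>2 * s ^ 3" by linarith
      have "\<bar>u\<bar> ^ 3 * exp \<bar>u\<bar> \<le> (2 * Q * s) ^ 3 * exp Q"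
      proof (intro mult_mono power_mono ua)
        have "2 * Q * s \<le> Q" using mult_left_mono[OF True, of "2 * Q"] Q0 by simp
        thus "exp \<bar>u\<bar> \<le> exp Q" using ua by simp
      qed (use Q0 s0 in auto)
      also have "\<dots> = 8 * Q ^ 3 * exp Q * s ^ 3" by (simp add: power_mult_distrib)
      finally have u3: "\<bar>u\<bar> ^ 3 * exp \<bar>u\<bar> \<le> 8 * Q ^ 3 * exp Q * s ^ 3" .
      have "exp u \<le> 1 + u + u\<^sup>2 / 2 + \<bar>u\<bar> ^ 3 * exp \<bar>u\<bar>" by (rule exp_le_cubic)
      also have "\<dots> \<le> 1 + (L - B / 2 + Q * s ^ 3) + (L\<^sup>2 + 3 * Q\<^sup>2 * s ^ 3) / 2 + 8 * Q ^ 3 * exp Q * s ^ 3"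
        using u2 u3 C unfolding u_def by (intro add_mono divide_right_mono) auto
      also have "\<dots> = 1 + L + (L\<^sup>2 - B) / 2 + (Q + 3 / 2 * Q\<^sup>2 + 8 * Q ^ 3 * exp Q) * s ^ 3"
        by (simp add: field_simps)
      also have "(Q + 3 / 2 * Q\<^sup>2 + 8 * Q ^ 3 * exp Q) * s ^ 3 \<le> K * s ^ 3"
        unfolding K_def using Q0 s0 by (intro mult_right_mono) auto
      also have "K * s ^ 3 \<le> K * s ^ 3 * (1 + s) powr Q"
        using mult_left_mono[OF P1, of "K * s ^ 3"] K0 s0 by simp
      finally show "(\<Prod>j\<in>J. (1 + X j) powr q j) \<le> 1 + L + (L\<^sup>2 - B) / 2 + K * s ^ 3 * (1 + s) powr Q"
        using 1 by simp
    next
      case False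
      have "(\<Prod>j\<in>J. (1 + X j) powr q j) \<le> (\<Prod>j\<in>J. (1 + s) powr q j)"
      proof (intro prod_mono conjI)
        fix j assume j: "j \<in> J"
        have "X j \<le> s" using Xs[OF j] by linarith
        thus "(1 + X j) powr q j \<le> (1 + s) powr q j" using X j q[OF j] by (intro powr_mono2) (auto intro: less_imp_le)
      qed auto
      also have "\<dots> = (1 + s) powr Q" unfolding Q_def using s0 by (subst powr_sum) auto
      finally have 1: "(\<Prod>j\<in>J. (1 + X j) powr q j) \<le> (1 + s) powr Q" .
      define P where "P = (1 + s) powr Q"
      have s2: "s\<^sup>2 \<ge> 1/4" using False power_mono[of "1/2" s 2] by (simp add: power_divide)
      have s3: "s ^ 3 \<ge> 1/8" using False power_mono[of "1/2" s 3] by (simp add: power_divide)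
      have s31: "s \<le> 4 * s ^ 3" using mult_left_mono[OF s2 s0] by (simp add: power2_eq_square power3_eq_cube)
      have s32: "s\<^sup>2 \<le> 2 * s ^ 3" using False s0 mult_right_mono[of "1/2" s "s\<^sup>2"] by (simp add: power2_eq_square power3_eq_cube)
      have "P + 5 * Q * s ^ 3 \<le> 8 * s ^ 3 * P + 5 * Q * s ^ 3 * P"
      proof (intro add_mono)
        show "P \<le> 8 * s ^ 3 * P" using mult_right_mono[of 1 "8 * s ^ 3" P] s3 P1 by (simp add: P_def)
        show "5 * Q * s ^ 3 \<le> 5 * Q * s ^ 3 * P" using mult_left_mono[OF P1, of "5 * Q * s ^ 3"] Q0 s0 by (simp add: P_def)
      qed
      also have "\<dots> = (8 + 5 * Q) * s ^ 3 * P" by (simp add: algebra_simps)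
      also have "\<dots> \<le> K * s ^ 3 * P"
        unfolding K_def using Q0 s0 P1 by (intro mult_right_mono) (auto simp: P_def)
      finally have 2: "P + 5 * Q * s ^ 3 \<le> K * s ^ 3 * P" .
      have "5 * Q * s ^ 3 \<ge> Q * s + Q * s\<^sup>2 / 2"
        using mult_left_mono[OF s31 Q0] mult_left_mono[OF s32 Q0] by simp
      moreover have "L \<ge> - (Q * s)" using La by linarith
      moreover have "(L\<^sup>2 - B) / 2 \<ge> - (Q * s\<^sup>2 / 2)"
      proof -
        have "L\<^sup>2 - B \<ge> - (Q * s\<^sup>2)" using B(2) zero_le_power2[of L] by linarith
        thus ?thesis using divide_right_mono[of "- (Q * s\<^sup>2)" "L\<^sup>2 - B" 2] by simp
      qed
      ultimately show "(\<Prod>j\<in>J. (1 + X j) powr q j) \<le> 1 + L + (L\<^sup>2 - B) / 2 + K * s ^ 3 * (1 + s) powr Q"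
        using 1 2 unfolding P_def by linarith
    qed
  qed
qed

text \<open>Each factor is 1 + X with X of mean 0, so the linear term vanishes. Up to third order
  the covariance of X_j and X_k is 2 pi \<sigma>^2 (m_j . m_k), with m_j the barycentre of the
  points \<xi> j i under the weights p j i. The second-order term is thus a multiple of |\<Sum> q
  m|^2 - \<Sum> q |m|^2, which is nonpositive by \<open>cs\<close>. The constant must not depend on
  the weights, as these change along the walk.\<close>

lemma gauss_on_prod_step_prob:
  fixes S :: "'a::euclidean_space set" and \<xi> :: "'j \<Rightarrow> 'i \<Rightarrow> 'a"
  assumes S: "subspace S" and J: "finite J" and q: "\<And>j. j \<in> J \<Longrightarrow> q j > 0"
    and I: "\<And>j. j \<in> J \<Longrightarrow> finite (I j)"
    and V: "\<And>j. j \<in> J \<Longrightarrow> subspace (V j) \<and> V j \<subseteq> S"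
    and cs: "\<And>w. (\<And>j. j \<in> J \<Longrightarrow> w j \<in> V j) \<Longrightarrow>
       (norm (\<Sum>j\<in>J. q j *\<^sub>R w j))\<^sup>2 \<le> (\<Sum>j\<in>J. q j * (norm (w j))\<^sup>2)"
    and \<xi>: "\<And>j i. j \<in> J \<Longrightarrow> i \<in> I j \<Longrightarrow> \<xi> j i \<in> V j"
  shows "\<exists>C\<ge>0. \<forall>\<sigma> p. 0 < \<sigma> \<and> \<sigma> \<le> 1 \<and> (\<forall>j\<in>J. (\<forall>i\<in>I j. p j i \<ge> 0) \<and> (\<Sum>i\<in>I j. p j i) = 1) \<longrightarrow>
     (\<integral>\<^sup>+z. ennreal (\<Prod>j\<in>J. (\<Sum>i\<in>I j. p j i * exp (2 * pi * \<sigma> * (\<xi> j i \<bullet> z) - pi * \<sigma>\<^sup>2 * (norm (\<xi> j i))\<^sup>2)) powr q j) \<partial>gauss_on S)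
       \<le> ennreal (1 + C * \<sigma> ^ 3)"
proof -
  obtain K where K: "K \<ge> 0" and taylor': "\<forall>X. (\<forall>j\<in>J. X j > -1) \<longrightarrow>
     (\<Prod>j\<in>J. (1 + X j) powr q j) \<le> 1 + (\<Sum>j\<in>J. q j * X j)
        + ((\<Sum>j\<in>J. q j * X j)\<^sup>2 - (\<Sum>j\<in>J. q j * (X j)\<^sup>2)) / 2
        + K * (\<Sum>j\<in>J. \<bar>X j\<bar>) ^ 3 * (1 + (\<Sum>j\<in>J. \<bar>X j\<bar>)) powr (\<Sum>j\<in>J. q j)"
    using prod_powr_taylor[of J q, OF J q, simplified] by (elim exE conjE) simp
  define Q where "Q = (\<Sum>j\<in>J. q j)"
  have Q0: "Q \<ge> 0" unfolding Q_def by (intro sum_nonneg less_imp_le q)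
  define R where "R = (\<Sum>j\<in>J. \<Sum>i\<in>I j. norm (\<xi> j i))"
  have R0: "R \<ge> 0" by (simp add: R_def sum_nonneg)
  have R: "norm (\<xi> j i) \<le> R" if "j \<in> J" "i \<in> I j" for j i
  proof -
    have "norm (\<xi> j i) \<le> (\<Sum>i\<in>I j. norm (\<xi> j i))" using that I by (intro member_le_sum) auto
    also have "\<dots> \<le> R" unfolding R_def using that J by (intro member_le_sum) (auto intro: sum_nonneg)
    finally show ?thesis .
  qed
  define A where "A = 2 * pi * R + pi * R\<^sup>2"
  have A0: "A \<ge> 0" using R0 by (simp add: A_def)
  define n where "n = real (card J)"
  \<comment> \<open>\<open>A2\<close> bounds |exp x - 1 - x| for |x| \<le> 2 pi R^2, the range of
    the exponents in the covariances. \<open>g\<close> majorizes the Taylor remainder: 3 comes from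
    the cube, \<open>Q\<close> from the power growth.\<close>
  define A2 where "A2 = (2 * pi * R\<^sup>2)\<^sup>2 * exp (2 * pi * R\<^sup>2)"
  define g where "g = (\<lambda>z::'a. exp (2 * A * (3 + Q) * (1 + norm z)))"
  have g_int: "integrable (gauss_on S) g"
  proof -
    define c where "c = 2 * A * (3 + Q)"
    have "g = (\<lambda>z. exp c * exp (c * norm z))"
      unfolding g_def c_def[symmetric] exp_add[symmetric] by (simp only: distrib_left mult_1_right)
    moreover have "integrable (gauss_on S) (\<lambda>z. exp c * exp (c * norm z))"
      by (intro integrable_mult_right gauss_on_exp_norm_integrable[OF S])
    ultimately show ?thesis by (simp only:)
  qed
  define G where "G = (\<integral>z. g z \<partial>gauss_on S)"
  have G0: "G \<ge> 0" by (simp add: G_def g_def)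
  \<comment> \<open>The first summand is the error in the covariances, the second the mean of the
    Taylor remainder.\<close>
  define C where "C = A2 * (Q\<^sup>2 + Q) / 2 + K * n ^ 3 * (1 + n) powr Q * G"
  have A2: "A2 \<ge> 0" by (simp add: A2_def)
  have C0: "C \<ge> 0" 
    unfolding C_def using A2 Q0 K G0 by (intro add_nonneg_nonneg mult_nonneg_nonneg divide_nonneg_nonneg) (simp_all add: n_def)
  interpret P: prob_space "gauss_on S" by (rule prob_space_gauss_on[OF S])
  show ?thesis
  proof (intro exI[of _ C] conjI C0 allI impI)
    fix \<sigma> :: real and p :: "'j \<Rightarrow> 'i \<Rightarrow> real"
    assume "0 < \<sigma> \<and> \<sigma> \<le> 1 \<and> (\<forall>j\<in>J. (\<forall>i\<in>I j. p j i \<ge> 0) \<and> (\<Sum>i\<in>I j. p j i) = 1)"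
    hence \<sigma>: "0 < \<sigma>" "\<sigma> \<le> 1" and p0: "\<And>j i. j \<in> J \<Longrightarrow> i \<in> I j \<Longrightarrow> p j i \<ge> 0"
      and p1: "\<And>j. j \<in> J \<Longrightarrow> (\<Sum>i\<in>I j. p j i) = 1" by auto
    define E where "E = (\<lambda>j i z. exp (2 * pi * \<sigma> * (\<xi> j i \<bullet> z) - pi * \<sigma>\<^sup>2 * (norm (\<xi> j i))\<^sup>2))"
    define X where "X = (\<lambda>j z. \<Sum>i\<in>I j. p j i * (E j i z - 1))"
    have W: "(\<Sum>i\<in>I j. p j i * E j i z) = 1 + X j z" if "j \<in> J" for j z
      using p1[OF that] by (simp add: X_def right_diff_distrib sum_subtractf)
    have Sx: "\<xi> j i \<in> S" if "j \<in> J" "i \<in> I j" for j i using \<xi>[OF that] V[OF that(1)] by blast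
    have hE: "has_bochner_integral (gauss_on S) (E j i) 1" if "j \<in> J" "i \<in> I j" for j i
    proof -
      have "has_bochner_integral (gauss_on S) (\<lambda>z. exp (2 * pi * ((\<sigma> *\<^sub>R \<xi> j i) \<bullet> z)) * exp (- pi * \<sigma>\<^sup>2 * (norm (\<xi> j i))\<^sup>2))
          (exp (pi * (norm (\<sigma> *\<^sub>R \<xi> j i))\<^sup>2) * exp (- pi * \<sigma>\<^sup>2 * (norm (\<xi> j i))\<^sup>2))"
        by (intro has_bochner_integral_mult_left gauss_on_integral_mgf[OF S] subspace_scale[OF S] Sx that)
      moreover have "exp (pi * (norm (\<sigma> *\<^sub>R \<xi> j i))\<^sup>2) * exp (- pi * \<sigma>\<^sup>2 * (norm (\<xi> j i))\<^sup>2) = 1"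
        unfolding exp_add[symmetric] by (simp add: power_mult_distrib)
      moreover have "(\<lambda>z. exp (2 * pi * ((\<sigma> *\<^sub>R \<xi> j i) \<bullet> z)) * exp (- pi * \<sigma>\<^sup>2 * (norm (\<xi> j i))\<^sup>2)) = E j i"
        unfolding exp_add[symmetric] E_def by (simp add: mult_ac)
      ultimately show ?thesis by simp
    qed
    have hEE: "has_bochner_integral (gauss_on S) (\<lambda>z. E j i z * E k l z) (exp (2 * pi * \<sigma>\<^sup>2 * (\<xi> j i \<bullet> \<xi> k l)))"
      if "j \<in> J" "i \<in> I j" "k \<in> J" "l \<in> I k" for j i k l
    proof -
      let ?x = "\<sigma> *\<^sub>R \<xi> j i + \<sigma> *\<^sub>R \<xi> k l" and ?c = "- pi * \<sigma>\<^sup>2 * ((norm (\<xi> j i))\<^sup>2 + (norm (\<xi> k l))\<^sup>2)"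
      have "has_bochner_integral (gauss_on S) (\<lambda>z. exp (2 * pi * (?x \<bullet> z)) * exp ?c) (exp (pi * (norm ?x)\<^sup>2) * exp ?c)"
        by (intro has_bochner_integral_mult_left gauss_on_integral_mgf[OF S] subspace_scale[OF S] subspace_add[OF S] Sx that)
      moreover have "exp (pi * (norm ?x)\<^sup>2) * exp ?c = exp (2 * pi * \<sigma>\<^sup>2 * (\<xi> j i \<bullet> \<xi> k l))"
        unfolding exp_add[symmetric] power2_norm_eq_inner
        by (simp add: inner_add_left inner_add_right algebra_simps power2_eq_square inner_commute)
      moreover have "(\<lambda>z. exp (2 * pi * (?x \<bullet> z)) * exp ?c) = (\<lambda>z. E j i z * E k l z)"
        unfolding exp_add[symmetric] E_def by (simp add: algebra_simps)
      ultimately show ?thesis by simp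
    qed
    have h1: "has_bochner_integral (gauss_on S) (\<lambda>z. 1) (1::real)"
      using P.prob_space by (simp add: has_bochner_integral_iff)
    have hX: "has_bochner_integral (gauss_on S) (X j) 0" if j: "j \<in> J" for j
    proof -
      have "has_bochner_integral (gauss_on S) (X j) (\<Sum>i\<in>I j. p j i * (1 - 1))"
        unfolding X_def
        by (intro has_bochner_integral_sum has_bochner_integral_mult_right has_bochner_integral_diff hE j h1)
      thus ?thesis by simp
    qed
    define \<mu> where "\<mu> = (\<lambda>j k. \<Sum>i\<in>I j. \<Sum>l\<in>I k. p j i * p k l * (exp (2 * pi * \<sigma>\<^sup>2 * (\<xi> j i \<bullet> \<xi> k l)) - 1))"
    have hXX: "has_bochner_integral (gauss_on S) (\<lambda>z. X j z * X k z) (\<mu> j k)" if "j \<in> J" "k \<in> J" for j k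
    proof -
      have "has_bochner_integral (gauss_on S) (\<lambda>z. \<Sum>i\<in>I j. \<Sum>l\<in>I k. p j i * p k l * (E j i z * E k l z - E j i z - E k l z + 1))
         (\<Sum>i\<in>I j. \<Sum>l\<in>I k. p j i * p k l * (exp (2 * pi * \<sigma>\<^sup>2 * (\<xi> j i \<bullet> \<xi> k l)) - 1 - 1 + 1))"
        by (intro has_bochner_integral_sum has_bochner_integral_mult_right has_bochner_integral_diff has_bochner_integral_add hE hEE that h1)
      moreover have "(\<lambda>z. \<Sum>i\<in>I j. \<Sum>l\<in>I k. p j i * p k l * (E j i z * E k l z - E j i z - E k l z + 1)) = (\<lambda>z. X j z * X k z)"
        unfolding X_def sum_product by (intro ext sum.cong refl) (simp add: algebra_simps)
      ultimately show ?thesis unfolding \<mu>_def by simp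
    qed
    define m where "m = (\<lambda>j. \<Sum>i\<in>I j. p j i *\<^sub>R \<xi> j i)"
    have mV: "m j \<in> V j" if "j \<in> J" for j
      unfolding m_def using V[OF that] \<xi>[OF that] by (intro subspace_sum subspace_scale) auto
    have \<mu>: "\<bar>\<mu> j k - 2 * pi * \<sigma>\<^sup>2 * (m j \<bullet> m k)\<bar> \<le> \<sigma> ^ 3 * A2" if jk: "j \<in> J" "k \<in> J" for j k
    proof -
      have mm: "2 * pi * \<sigma>\<^sup>2 * (m j \<bullet> m k) = (\<Sum>i\<in>I j. \<Sum>l\<in>I k. p j i * p k l * (2 * pi * \<sigma>\<^sup>2 * (\<xi> j i \<bullet> \<xi> k l)))"
        unfolding m_def inner_sum_left inner_sum_right sum_distrib_left
        by (subst sum.swap, intro sum.cong refl) (simp add: mult_ac)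
      have "\<mu> j k - 2 * pi * \<sigma>\<^sup>2 * (m j \<bullet> m k) = (\<Sum>i\<in>I j. \<Sum>l\<in>I k. p j i * p k l * (exp (2 * pi * \<sigma>\<^sup>2 * (\<xi> j i \<bullet> \<xi> k l)) - 1 - 2 * pi * \<sigma>\<^sup>2 * (\<xi> j i \<bullet> \<xi> k l)))"
        unfolding mm \<mu>_def sum_subtractf[symmetric] by (intro sum.cong refl) (simp only: right_diff_distrib)
      also have "\<bar>\<dots>\<bar> \<le> (\<Sum>i\<in>I j. \<Sum>l\<in>I k. p j i * p k l * (\<sigma> ^ 3 * A2))"
      proof (intro order_trans[OF sum_abs] sum_mono)
        fix i l assume il: "i \<in> I j" "l \<in> I k"
        let ?x = "2 * pi * \<sigma>\<^sup>2 * (\<xi> j i \<bullet> \<xi> k l)"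
        have "\<bar>\<xi> j i \<bullet> \<xi> k l\<bar> \<le> norm (\<xi> j i) * norm (\<xi> k l)" by (rule Cauchy_Schwarz_ineq2)
        also have "\<dots> \<le> R * R" using R jk il R0 by (intro mult_mono) auto
        finally have "\<bar>?x\<bar> \<le> 2 * pi * \<sigma>\<^sup>2 * R\<^sup>2" by (simp add: abs_mult power2_eq_square mult_left_mono)
        hence x: "\<bar>?x\<bar> \<le> \<sigma>\<^sup>2 * (2 * pi * R\<^sup>2)" by (simp add: mult_ac)
        have s2: "\<sigma>\<^sup>2 \<le> 1" using \<sigma> by (simp add: power_le_one)
        have x': "\<bar>?x\<bar> \<le> 2 * pi * R\<^sup>2" using order_trans[OF x mult_right_mono[OF s2, of "2 * pi * R\<^sup>2"]] by simp
        have "\<bar>exp ?x - 1 - ?x\<bar> \<le> ?x\<^sup>2 * exp \<bar>?x\<bar>" by (rule exp_minus_one_minus_le)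
        also have "\<dots> \<le> (\<sigma>\<^sup>2 * (2 * pi * R\<^sup>2))\<^sup>2 * exp (2 * pi * R\<^sup>2)"
        proof (rule mult_mono)
          show "?x\<^sup>2 \<le> (\<sigma>\<^sup>2 * (2 * pi * R\<^sup>2))\<^sup>2" using x by (subst abs_le_square_iff[symmetric]) simp
          show "exp \<bar>?x\<bar> \<le> exp (2 * pi * R\<^sup>2)" using x' by simp
        qed auto
        also have "\<dots> = \<sigma> ^ 4 * A2" by (simp add: A2_def power_mult_distrib flip: power_mult)
        also have "\<dots> \<le> \<sigma> ^ 3 * A2" using \<sigma> A2 by (intro mult_right_mono power_decreasing) auto
        finally have "\<bar>exp ?x - 1 - ?x\<bar> \<le> \<sigma> ^ 3 * A2" .
        thus "\<bar>p j i * p k l * (exp ?x - 1 - ?x)\<bar> \<le> p j i * p k l * (\<sigma> ^ 3 * A2)"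
          unfolding abs_mult using p0 jk il by (intro mult_mono) auto
      qed
      also have "\<dots> = (\<Sum>i\<in>I j. p j i) * (\<Sum>l\<in>I k. p k l) * (\<sigma> ^ 3 * A2)"
        by (subst sum_product) (simp only: sum_distrib_right)
      also have "\<dots> = \<sigma> ^ 3 * A2" using p1 jk by simp
      finally show ?thesis .
    qed
    define s where "s = (\<lambda>z. \<Sum>j\<in>J. \<bar>X j z\<bar>)"
    define Y where "Y = (\<lambda>z. (\<Sum>j\<in>J. q j * X j z) + ((\<Sum>j\<in>J. \<Sum>k\<in>J. q j * q k * (X j z * X k z)) - (\<Sum>j\<in>J. q j * (X j z * X j z))) / 2)"
    have hY: "has_bochner_integral (gauss_on S) Y ((\<Sum>j\<in>J. q j * 0) + ((\<Sum>j\<in>J. \<Sum>k\<in>J. q j * q k * \<mu> j k) - (\<Sum>j\<in>J. q j * \<mu> j j)) / 2)"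
      unfolding Y_def
      by (intro has_bochner_integral_sum has_bochner_integral_mult_right has_bochner_integral_diff has_bochner_integral_add has_bochner_integral_divide_zero hX hXX)
    \<comment> \<open>Passing from \<mu> j k to 2 pi \<sigma>^2 (m_j . m_k) costs \<sigma>^3 A2 per
      pair, with total weight Q^2 for the square and Q for the diagonal sum; the main terms are
      disposed of by \<open>cs\<close>.\<close>
    have EY: "(\<integral>z. Y z \<partial>gauss_on S) \<le> \<sigma> ^ 3 * A2 * (Q\<^sup>2 + Q) / 2"
    proof -
      have "(\<Sum>j\<in>J. \<Sum>k\<in>J. q j * q k * \<mu> j k) \<le> (\<Sum>j\<in>J. \<Sum>k\<in>J. q j * q k * (2 * pi * \<sigma>\<^sup>2 * (m j \<bullet> m k) + \<sigma> ^ 3 * A2))"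
        using \<mu> q by (intro sum_mono mult_left_mono) (auto simp: abs_le_iff less_imp_le algebra_simps)
      also have "\<dots> = 2 * pi * \<sigma>\<^sup>2 * (norm (\<Sum>j\<in>J. q j *\<^sub>R m j))\<^sup>2 + Q\<^sup>2 * (\<sigma> ^ 3 * A2)"
      proof -
        have "(norm (\<Sum>j\<in>J. q j *\<^sub>R m j))\<^sup>2 = (\<Sum>j\<in>J. \<Sum>k\<in>J. q j * q k * (m j \<bullet> m k))"
          unfolding power2_norm_eq_inner inner_sum_left inner_sum_right
          by (subst sum.swap, intro sum.cong refl) (simp add: mult_ac inner_commute)
        moreover have "Q\<^sup>2 = (\<Sum>j\<in>J. \<Sum>k\<in>J. q j * q k)" by (simp add: Q_def power2_eq_square sum_product)
        ultimately show ?thesis by (simp add: distrib_left sum.distrib sum_distrib_left sum_distrib_right mult_ac)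
      qed
      finally have a: "(\<Sum>j\<in>J. \<Sum>k\<in>J. q j * q k * \<mu> j k) \<le> \<dots>" .
      have "(\<Sum>j\<in>J. q j * \<mu> j j) \<ge> (\<Sum>j\<in>J. q j * (2 * pi * \<sigma>\<^sup>2 * (m j \<bullet> m j) - \<sigma> ^ 3 * A2))"
        using \<mu> q by (intro sum_mono mult_left_mono) (auto simp: abs_le_iff less_imp_le algebra_simps)
      moreover have "(\<Sum>j\<in>J. q j * (2 * pi * \<sigma>\<^sup>2 * (m j \<bullet> m j) - \<sigma> ^ 3 * A2)) = 2 * pi * \<sigma>\<^sup>2 * (\<Sum>j\<in>J. q j * (norm (m j))\<^sup>2) - Q * (\<sigma> ^ 3 * A2)"
        unfolding power2_norm_eq_inner Q_def by (simp add: right_diff_distrib sum_subtractf sum_distrib_left sum_distrib_right mult_ac)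
      moreover have "2 * pi * \<sigma>\<^sup>2 * (norm (\<Sum>j\<in>J. q j *\<^sub>R m j))\<^sup>2 \<le> 2 * pi * \<sigma>\<^sup>2 * (\<Sum>j\<in>J. q j * (norm (m j))\<^sup>2)"
        using cs[of m] mV by (intro mult_left_mono) auto
      ultimately have "(\<Sum>j\<in>J. \<Sum>k\<in>J. q j * q k * \<mu> j k) - (\<Sum>j\<in>J. q j * \<mu> j j) \<le> Q\<^sup>2 * (\<sigma> ^ 3 * A2) + Q * (\<sigma> ^ 3 * A2)"
        using a by linarith
      also have "\<dots> = \<sigma> ^ 3 * A2 * (Q\<^sup>2 + Q)" by (simp add: algebra_simps)
      finally show ?thesis using has_bochner_integral_integral_eq[OF hY] by simp
    qed
    define k where "k = K * n ^ 3 * (1 + n) powr Q * \<sigma> ^ 3"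
    have k0: "k \<ge> 0" using K \<sigma> by (simp add: k_def n_def)
    have pt: "(\<Prod>j\<in>J. (\<Sum>i\<in>I j. p j i * E j i z) powr q j) \<le> 1 + Y z + k * g z" for z
    proof -
      have pos: "(\<Sum>i\<in>I j. p j i * E j i z) > 0" if j: "j \<in> J" for j
      proof -
        have "\<exists>i\<in>I j. p j i > 0"
        proof (rule ccontr)
          assume "\<not> ?thesis"
          hence "(\<Sum>i\<in>I j. p j i) = 0" using p0[OF j] by (intro sum.neutral) force
          thus False using p1[OF j] by simp
        qed
        then obtain i where "i \<in> I j" "p j i > 0" by blast
        thus ?thesis using p0[OF j] I[OF j] by (intro sum_pos2[of _ i]) (auto simp: E_def)
      qed
      \<comment> \<open>The factor 2 absorbs the linear factor A (1 + |z|) that |exp x - 1| \<le>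
        |x| exp |x| leaves in front of the exponential; one power of \<sigma> is kept.\<close>
      define t where "t = exp (2 * A * (1 + norm z))"
      have Xt: "\<bar>X j z\<bar> \<le> \<sigma> * t" if j: "j \<in> J" for j
      proof -
        have "\<bar>X j z\<bar> \<le> (\<Sum>i\<in>I j. p j i * (\<sigma> * t))" unfolding X_def
        proof (intro order_trans[OF sum_abs] sum_mono)
          fix i assume i: "i \<in> I j"
          let ?x = "2 * pi * \<sigma> * (\<xi> j i \<bullet> z) - pi * \<sigma>\<^sup>2 * (norm (\<xi> j i))\<^sup>2"
          have "\<bar>?x\<bar> \<le> 2 * pi * \<sigma> * \<bar>\<xi> j i \<bullet> z\<bar> + pi * \<sigma>\<^sup>2 * (norm (\<xi> j i))\<^sup>2"
            using \<sigma> by (intro order_trans[OF abs_triangle_ineq4] add_mono) (auto simp: abs_mult)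
          also have "\<dots> \<le> 2 * pi * \<sigma> * (R * norm z) + pi * \<sigma> * R\<^sup>2"
          proof (intro add_mono mult_left_mono)
            have "\<bar>\<xi> j i \<bullet> z\<bar> \<le> norm (\<xi> j i) * norm z" by (rule Cauchy_Schwarz_ineq2)
            also have "\<dots> \<le> R * norm z" using R[OF j i] by (intro mult_right_mono) auto
            finally show "\<bar>\<xi> j i \<bullet> z\<bar> \<le> R * norm z" .
            have "\<sigma>\<^sup>2 \<le> \<sigma>" using \<sigma> by (simp add: power2_eq_square mult_left_le)
            thus "pi * \<sigma>\<^sup>2 * (norm (\<xi> j i))\<^sup>2 \<le> pi * \<sigma> * R\<^sup>2" using R[OF j i] \<sigma> by (intro mult_mono power_mono) auto
          qed (use \<sigma> in auto)
          also have "\<dots> \<le> \<sigma> * (A * (1 + norm z))"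
          proof -
            have "0 \<le> \<sigma> * (2 * pi * R) + \<sigma> * (pi * R\<^sup>2 * norm z)" using \<sigma> R0 by simp
            thus ?thesis unfolding A_def by (simp add: algebra_simps)
          qed
          finally have x: "\<bar>?x\<bar> \<le> \<sigma> * (A * (1 + norm z))" .
          have y0: "0 \<le> A * (1 + norm z)" using A0 by simp
          have x': "\<bar>?x\<bar> \<le> A * (1 + norm z)" using x mult_right_mono[OF \<sigma>(2) y0] by simp
          have "\<bar>E j i z - 1\<bar> \<le> \<bar>?x\<bar> * exp \<bar>?x\<bar>" unfolding E_def by (rule exp_minus_one_le)
          also have "\<dots> \<le> (\<sigma> * (A * (1 + norm z))) * exp (A * (1 + norm z))"
            using x x' y0 \<sigma> by (intro mult_mono) auto
          also have "\<dots> \<le> (\<sigma> * exp (A * (1 + norm z))) * exp (A * (1 + norm z))"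
            using \<sigma> exp_ge_add_one_self[of "A * (1 + norm z)"] by (intro mult_right_mono mult_left_mono) (linarith | simp)+
          also have "\<dots> = \<sigma> * t" unfolding t_def by (simp add: mult.assoc flip: exp_add)
          finally have "\<bar>E j i z - 1\<bar> \<le> \<sigma> * t" .
          thus "\<bar>p j i * (E j i z - 1)\<bar> \<le> p j i * (\<sigma> * t)" using p0[OF j i] by (simp add: abs_mult mult_left_mono)
        qed
        also have "\<dots> = \<sigma> * t" using p1[OF j] by (simp flip: sum_distrib_right)
        finally show ?thesis .
      qed
      have t1: "t \<ge> 1" using A0 by (simp add: t_def)
      have n0: "n \<ge> 0" by (simp add: n_def)
      have s0: "s z \<ge> 0" by (simp add: s_def sum_nonneg)
      have st: "s z \<le> n * (\<sigma> * t)" unfolding s_def n_def using sum_bounded_above[of J "\<lambda>j. \<bar>X j z\<bar>" "\<sigma> * t"] Xt by simp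
      have "1 + s z \<le> (1 + n) * t"
      proof -
        have "n * (\<sigma> * t) \<le> n * (1 * t)" using \<sigma> t1 n0 by (intro mult_left_mono mult_right_mono) auto
        thus ?thesis using st t1 by (simp add: algebra_simps)
      qed
      hence "(1 + s z) powr Q \<le> ((1 + n) * t) powr Q" using s0 Q0 by (intro powr_mono2) auto
      also have "\<dots> = (1 + n) powr Q * t powr Q" using n0 t1 by (intro powr_mult) 
      finally have "K * s z ^ 3 * (1 + s z) powr Q \<le> K * (n * (\<sigma> * t)) ^ 3 * ((1 + n) powr Q * t powr Q)"
        using K s0 st by (intro mult_mono power_mono mult_nonneg_nonneg) auto
      moreover have "K * (n * (\<sigma> * t)) ^ 3 * ((1 + n) powr Q * t powr Q) = k * (t ^ 3 * t powr Q)"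
        unfolding k_def by (simp add: power_mult_distrib)
      moreover have "t ^ 3 * t powr Q = g z"
      proof -
        have "t ^ 3 = exp (3 * (2 * A * (1 + norm z)))" using exp_of_nat_mult[of 3 "2 * A * (1 + norm z)"] by (simp add: t_def)
        moreover have "t powr Q = exp (Q * (2 * A * (1 + norm z)))" by (simp add: t_def powr_def)
        ultimately show ?thesis unfolding g_def by (simp only: exp_add[symmetric]) (simp add: algebra_simps)
      qed
      ultimately have rem: "K * s z ^ 3 * (1 + s z) powr Q \<le> k * g z" by simp
      have eqY: "1 + (\<Sum>j\<in>J. q j * X j z) + ((\<Sum>j\<in>J. q j * X j z)\<^sup>2 - (\<Sum>j\<in>J. q j * (X j z)\<^sup>2)) / 2 = 1 + Y z"
        unfolding Y_def by (simp add: power2_eq_square sum_product mult_ac)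
      have "(\<Prod>j\<in>J. (\<Sum>i\<in>I j. p j i * E j i z) powr q j) = (\<Prod>j\<in>J. (1 + X j z) powr q j)"
        using W by (intro prod.cong) auto
      moreover have "(\<Prod>j\<in>J. (1 + X j z) powr q j) \<le> (1 + (\<Sum>j\<in>J. q j * X j z) + ((\<Sum>j\<in>J. q j * X j z)\<^sup>2 - (\<Sum>j\<in>J. q j * (X j z)\<^sup>2)) / 2) + K * s z ^ 3 * (1 + s z) powr Q"
        unfolding s_def Q_def
      proof (rule taylor'[THEN spec[of _ "\<lambda>j. X j z"], THEN mp], intro ballI)
        fix j assume "j \<in> J" thus "X j z > -1" using pos[of j] W[of j z] by linarith
      qed
      ultimately have "(\<Prod>j\<in>J. (\<Sum>i\<in>I j. p j i * E j i z) powr q j) \<le> (1 + (\<Sum>j\<in>J. q j * X j z) + ((\<Sum>j\<in>J. q j * X j z)\<^sup>2 - (\<Sum>j\<in>J. q j * (X j z)\<^sup>2)) / 2) + K * s z ^ 3 * (1 + s z) powr Q" by simp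
      thus ?thesis using rem unfolding eqY by linarith
    qed
    have Yi: "integrable (gauss_on S) Y" using hY by (simp add: has_bochner_integral_iff)
    have int: "integrable (gauss_on S) (\<lambda>z. 1 + Y z + k * g z)"
      using Yi g_int by (intro Bochner_Integration.integrable_add integrable_mult_right) auto
    have pos: "0 \<le> (\<Prod>j\<in>J. (\<Sum>i\<in>I j. p j i * E j i z) powr q j)" for z by (intro prod_nonneg) simp
    have "(\<integral>\<^sup>+z. ennreal (\<Prod>j\<in>J. (\<Sum>i\<in>I j. p j i * E j i z) powr q j) \<partial>gauss_on S) \<le> (\<integral>\<^sup>+z. ennreal (1 + Y z + k * g z) \<partial>gauss_on S)"
      using pt by (intro nn_integral_mono ennreal_leI)
    also have "\<dots> = ennreal (\<integral>z. 1 + Y z + k * g z \<partial>gauss_on S)"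
      using order_trans[OF pos pt] by (intro nn_integral_eq_integral int) auto
    also have "(\<integral>z. 1 + Y z + k * g z \<partial>gauss_on S) = 1 + (\<integral>z. Y z \<partial>gauss_on S) + k * G"
      using Yi g_int P.prob_space unfolding G_def by simp
    also have "\<dots> \<le> 1 + C * \<sigma> ^ 3"
      using EY unfolding C_def k_def by (simp add: algebra_simps)
    finally show "(\<integral>\<^sup>+z. ennreal (\<Prod>j\<in>J. (\<Sum>i\<in>I j. p j i * exp (2 * pi * \<sigma> * (\<xi> j i \<bullet> z) - pi * \<sigma>\<^sup>2 * (norm (\<xi> j i))\<^sup>2)) powr q j) \<partial>gauss_on S)
       \<le> ennreal (1 + C * \<sigma> ^ 3)"
      unfolding E_def by (simp add: ennreal_leI)
  qed
qed

text \<open>Both sides are homogeneous of degree \<open>q j\<close> in the weights with index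
  \<open>j\<close>, so these can be normalized to total 1. If one total vanishes, the integrand is
  0.\<close>

lemma gauss_on_prod_step:
  fixes S :: "'a::euclidean_space set" and \<xi> :: "'j \<Rightarrow> 'i \<Rightarrow> 'a"
  assumes S: "subspace S" and J: "finite J" and q: "\<And>j. j \<in> J \<Longrightarrow> q j > 0"
    and I: "\<And>j. j \<in> J \<Longrightarrow> finite (I j)"
    and V: "\<And>j. j \<in> J \<Longrightarrow> subspace (V j) \<and> V j \<subseteq> S"
    and cs: "\<And>w. (\<And>j. j \<in> J \<Longrightarrow> w j \<in> V j) \<Longrightarrow>
       (norm (\<Sum>j\<in>J. q j *\<^sub>R w j))\<^sup>2 \<le> (\<Sum>j\<in>J. q j * (norm (w j))\<^sup>2)"
    and \<xi>: "\<And>j i. j \<in> J \<Longrightarrow> i \<in> I j \<Longrightarrow> \<xi> j i \<in> V j"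
  shows "\<exists>C\<ge>0. \<forall>\<sigma> c. 0 < \<sigma> \<and> \<sigma> \<le> 1 \<and> (\<forall>j\<in>J. \<forall>i\<in>I j. c j i \<ge> 0) \<longrightarrow>
     (\<integral>\<^sup>+z. ennreal (\<Prod>j\<in>J. (\<Sum>i\<in>I j. c j i * exp (2 * pi * \<sigma> * (\<xi> j i \<bullet> z) - pi * \<sigma>\<^sup>2 * (norm (\<xi> j i))\<^sup>2)) powr q j) \<partial>gauss_on S)
       \<le> ennreal ((1 + C * \<sigma> ^ 3) * (\<Prod>j\<in>J. (\<Sum>i\<in>I j. c j i) powr q j))"
proof -
  have "\<exists>C\<ge>0. \<forall>\<sigma> p. 0 < \<sigma> \<and> \<sigma> \<le> 1 \<and> (\<forall>j\<in>J. (\<forall>i\<in>I j. p j i \<ge> 0) \<and> (\<Sum>i\<in>I j. p j i) = 1) \<longrightarrow>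
     (\<integral>\<^sup>+z. ennreal (\<Prod>j\<in>J. (\<Sum>i\<in>I j. p j i * exp (2 * pi * \<sigma> * (\<xi> j i \<bullet> z) - pi * \<sigma>\<^sup>2 * (norm (\<xi> j i))\<^sup>2)) powr q j) \<partial>gauss_on S)
       \<le> ennreal (1 + C * \<sigma> ^ 3)"
    by (rule gauss_on_prod_step_prob[where V = V]) (use assms in auto)
  then obtain C where C: "C \<ge> 0" and step: "\<forall>\<sigma> p. 0 < \<sigma> \<and> \<sigma> \<le> 1 \<and> (\<forall>j\<in>J. (\<forall>i\<in>I j. p j i \<ge> 0) \<and> (\<Sum>i\<in>I j. p j i) = 1) \<longrightarrow>
     (\<integral>\<^sup>+z. ennreal (\<Prod>j\<in>J. (\<Sum>i\<in>I j. p j i * exp (2 * pi * \<sigma> * (\<xi> j i \<bullet> z) - pi * \<sigma>\<^sup>2 * (norm (\<xi> j i))\<^sup>2)) powr q j) \<partial>gauss_on S)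
       \<le> ennreal (1 + C * \<sigma> ^ 3)"
    by (elim exE conjE)
  show ?thesis
  proof (intro exI[of _ C] conjI C allI impI)
    fix \<sigma> :: real and c :: "'j \<Rightarrow> 'i \<Rightarrow> real"
    assume "0 < \<sigma> \<and> \<sigma> \<le> 1 \<and> (\<forall>j\<in>J. \<forall>i\<in>I j. c j i \<ge> 0)"
    hence \<sigma>: "0 < \<sigma>" "\<sigma> \<le> 1" and c: "\<And>j i. j \<in> J \<Longrightarrow> i \<in> I j \<Longrightarrow> c j i \<ge> 0" by auto
    define E where "E = (\<lambda>j i z. exp (2 * pi * \<sigma> * (\<xi> j i \<bullet> z) - pi * \<sigma>\<^sup>2 * (norm (\<xi> j i))\<^sup>2))"
    define T where "T = (\<lambda>j. \<Sum>i\<in>I j. c j i)"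
    have T0: "T j \<ge> 0" if "j \<in> J" for j unfolding T_def using c[OF that] by (intro sum_nonneg) auto
    have "(\<integral>\<^sup>+z. ennreal (\<Prod>j\<in>J. (\<Sum>i\<in>I j. c j i * E j i z) powr q j) \<partial>gauss_on S)
       \<le> ennreal ((1 + C * \<sigma> ^ 3) * (\<Prod>j\<in>J. T j powr q j))"
    proof (cases "\<exists>j\<in>J. T j = 0")
      case True
      then obtain k where k: "k \<in> J" "T k = 0" by blast
      have "c k i = 0" if "i \<in> I k" for i
        using k(2) sum_nonneg_eq_0_iff[OF I[OF k(1)], of "c k"] c[OF k(1)] that unfolding T_def by auto
      hence "(\<Sum>i\<in>I k. c k i * E k i z) = 0" for z by (intro sum.neutral) auto
      hence "(\<Prod>j\<in>J. (\<Sum>i\<in>I j. c j i * E j i z) powr q j) = 0" for z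
        by (intro prod_zero[OF J] bexI[OF _ k(1)]) auto
      thus "(\<integral>\<^sup>+z. ennreal (\<Prod>j\<in>J. (\<Sum>i\<in>I j. c j i * E j i z) powr q j) \<partial>gauss_on S)
         \<le> ennreal ((1 + C * \<sigma> ^ 3) * (\<Prod>j\<in>J. T j powr q j))" by simp
    next
      case False
      hence T: "T j > 0" if "j \<in> J" for j using T0[OF that] that by fastforce
      define p where "p = (\<lambda>j i. c j i / T j)"
      have p: "\<forall>j\<in>J. (\<forall>i\<in>I j. p j i \<ge> 0) \<and> (\<Sum>i\<in>I j. p j i) = 1"
      proof (intro ballI conjI)
        fix j i assume "j \<in> J" "i \<in> I j" thus "p j i \<ge> 0" using c[of j i] T0[of j] by (simp add: p_def)
      next
        fix j assume j: "j \<in> J"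
        have "(\<Sum>i\<in>I j. p j i) = T j / T j" unfolding p_def sum_divide_distrib[symmetric] T_def ..
        thus "(\<Sum>i\<in>I j. p j i) = 1" using T[OF j] by simp
      qed
      let ?P = "\<Prod>j\<in>J. T j powr q j"
      have eq: "(\<Prod>j\<in>J. (\<Sum>i\<in>I j. c j i * E j i z) powr q j) = ?P * (\<Prod>j\<in>J. (\<Sum>i\<in>I j. p j i * E j i z) powr q j)" for z
        unfolding prod.distrib[symmetric]
      proof (intro prod.cong refl)
        fix j assume j: "j \<in> J"
        have "(\<Sum>i\<in>I j. c j i * E j i z) = T j * (\<Sum>i\<in>I j. p j i * E j i z)"
          using T[OF j] by (simp add: p_def sum_distrib_left)
        moreover have "(\<Sum>i\<in>I j. p j i * E j i z) \<ge> 0" using p j by (intro sum_nonneg mult_nonneg_nonneg) (auto simp: E_def)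
        ultimately show "(\<Sum>i\<in>I j. c j i * E j i z) powr q j = T j powr q j * (\<Sum>i\<in>I j. p j i * E j i z) powr q j"
          using T0[OF j] by (simp add: powr_mult)
      qed
      have P0: "?P \<ge> 0" by (intro prod_nonneg) auto
      have "(\<integral>\<^sup>+z. ennreal (\<Prod>j\<in>J. (\<Sum>i\<in>I j. c j i * E j i z) powr q j) \<partial>gauss_on S)
          = (\<integral>\<^sup>+z. ennreal ?P * ennreal (\<Prod>j\<in>J. (\<Sum>i\<in>I j. p j i * E j i z) powr q j) \<partial>gauss_on S)"
        by (intro nn_integral_cong) (simp only: eq ennreal_mult'[OF P0])
      also have "\<dots> = ennreal ?P * (\<integral>\<^sup>+z. ennreal (\<Prod>j\<in>J. (\<Sum>i\<in>I j. p j i * E j i z) powr q j) \<partial>gauss_on S)"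
        unfolding E_def by (intro nn_integral_cmult) measurable
      also have "\<dots> \<le> ennreal ?P * ennreal (1 + C * \<sigma> ^ 3)"
        unfolding E_def using \<sigma> p
        by (intro mult_left_mono step[THEN spec[of _ \<sigma>], THEN spec[of _ p], THEN mp]) (simp_all only: simp_thms zero_le)
      also have "\<dots> = ennreal ((1 + C * \<sigma> ^ 3) * ?P)" using P0 by (simp add: ennreal_mult'[symmetric] mult.commute)
      finally show "(\<integral>\<^sup>+z. ennreal (\<Prod>j\<in>J. (\<Sum>i\<in>I j. c j i * E j i z) powr q j) \<partial>gauss_on S)
         \<le> ennreal ((1 + C * \<sigma> ^ 3) * ?P)" .
    qed
    thus "(\<integral>\<^sup>+z. ennreal (\<Prod>j\<in>J. (\<Sum>i\<in>I j. c j i * exp (2 * pi * \<sigma> * (\<xi> j i \<bullet> z) - pi * \<sigma>\<^sup>2 * (norm (\<xi> j i))\<^sup>2)) powr q j) \<partial>gauss_on S)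
       \<le> ennreal ((1 + C * \<sigma> ^ 3) * (\<Prod>j\<in>J. (\<Sum>i\<in>I j. c j i) powr q j))"
      unfolding E_def T_def .
  qed
qed

text \<open>
  Conditioning on the last increment \<open>y\<close> of the Gaussian random walk multiplies the weights by
  \<open>exp (2 \<pi> \<sigma> \<xi> \<bullet> y - \<pi> \<sigma>\<^sup>2 |\<xi>|\<^sup>2)\<close>, so the bound for \<open>k\<close> steps, which is uniform in the
  weights, and the one-step bound give the bound for \<open>k + 1\<close> steps.
\<close>
lemma gauss_on_prod_steps:
  fixes S :: "'a::euclidean_space set" and \<xi> :: "'j \<Rightarrow> 'i \<Rightarrow> 'a"
  assumes S: "subspace S" and J: "finite J" and C: "C \<ge> 0" and \<sigma>: "0 < \<sigma>" "\<sigma> \<le> 1"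
    and step: "\<And>c. (\<And>j i. j \<in> J \<Longrightarrow> i \<in> I j \<Longrightarrow> c j i \<ge> 0) \<Longrightarrow>
     (\<integral>\<^sup>+z. ennreal (\<Prod>j\<in>J. (\<Sum>i\<in>I j. c j i * exp (2 * pi * \<sigma> * (\<xi> j i \<bullet> z) - pi * \<sigma>\<^sup>2 * (norm (\<xi> j i))\<^sup>2)) powr q j) \<partial>gauss_on S)
       \<le> ennreal ((1 + C * \<sigma> ^ 3) * (\<Prod>j\<in>J. (\<Sum>i\<in>I j. c j i) powr q j))"
    and c: "\<And>j i. j \<in> J \<Longrightarrow> i \<in> I j \<Longrightarrow> c j i \<ge> 0"
  shows "(\<integral>\<^sup>+z. ennreal (\<Prod>j\<in>J. (\<Sum>i\<in>I j. c j i * exp (2 * pi * (sqrt (real k) * \<sigma>) * (\<xi> j i \<bullet> z) - pi * (sqrt (real k) * \<sigma>)\<^sup>2 * (norm (\<xi> j i))\<^sup>2)) powr q j) \<partial>gauss_on S)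
       \<le> ennreal ((1 + C * \<sigma> ^ 3) ^ k * (\<Prod>j\<in>J. (\<Sum>i\<in>I j. c j i) powr q j))"
  using c
proof (induction k arbitrary: c)
  case 0
  interpret prob_space "gauss_on S" by (rule prob_space_gauss_on[OF S])
  show ?case using emeasure_space_1 by simp
next
  case (Suc k)
  define F where "F = (\<lambda>s (c :: 'j \<Rightarrow> 'i \<Rightarrow> real) z. \<Prod>j\<in>J. (\<Sum>i\<in>I j. c j i * exp (2 * pi * s * (\<xi> j i \<bullet> z) - pi * s\<^sup>2 * (norm (\<xi> j i))\<^sup>2)) powr q j)"
  have [measurable]: "F s c \<in> borel_measurable borel" for s c unfolding F_def by measurable
  \<comment> \<open>The normalized sum of k + 1 increments is \<alpha> times the normalized sum of k
    of them plus \<beta> times the remaining one.\<close>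
  define \<alpha> where "\<alpha> = sqrt (real k) / sqrt (real (Suc k))"
  define \<beta> where "\<beta> = 1 / sqrt (real (Suc k))"
  have ab: "\<alpha> \<ge> 0" "\<alpha>\<^sup>2 + \<beta>\<^sup>2 = 1" "\<beta> \<ge> 0"
    by (auto simp: \<alpha>_def \<beta>_def power_divide field_simps)
  define c' where "c' = (\<lambda>y j i. c j i * exp (2 * pi * \<sigma> * (\<xi> j i \<bullet> y) - pi * \<sigma>\<^sup>2 * (norm (\<xi> j i))\<^sup>2))"
  define r where "r = sqrt (real k) * \<sigma>"
  define r' where "r' = sqrt (real (Suc k)) * \<sigma>"
  have r': "r' * \<alpha> = r" "r' * \<beta> = \<sigma>" "r'\<^sup>2 = r\<^sup>2 + \<sigma>\<^sup>2"
    by (simp_all add: r'_def r_def \<alpha>_def \<beta>_def power_mult_distrib algebra_simps)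
  have tilt: "F r' c (\<alpha> *\<^sub>R x + \<beta> *\<^sub>R y) = F r (c' y) x" for x y
    unfolding F_def
  proof (intro prod.cong refl arg_cong2[where f = "(powr)"] sum.cong)
    fix j i
    have "2 * pi * r' * (\<xi> j i \<bullet> (\<alpha> *\<^sub>R x + \<beta> *\<^sub>R y)) = 2 * pi * (r' * \<alpha>) * (\<xi> j i \<bullet> x) + 2 * pi * (r' * \<beta>) * (\<xi> j i \<bullet> y)"
      by (simp add: inner_add_right algebra_simps)
    hence "2 * pi * r' * (\<xi> j i \<bullet> (\<alpha> *\<^sub>R x + \<beta> *\<^sub>R y)) - pi * r'\<^sup>2 * (norm (\<xi> j i))\<^sup>2
        = (2 * pi * \<sigma> * (\<xi> j i \<bullet> y) - pi * \<sigma>\<^sup>2 * (norm (\<xi> j i))\<^sup>2) + (2 * pi * r * (\<xi> j i \<bullet> x) - pi * r\<^sup>2 * (norm (\<xi> j i))\<^sup>2)"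
      unfolding r' by (simp add: algebra_simps)
    thus "c j i * exp (2 * pi * r' * (\<xi> j i \<bullet> (\<alpha> *\<^sub>R x + \<beta> *\<^sub>R y)) - pi * r'\<^sup>2 * (norm (\<xi> j i))\<^sup>2)
        = c' y j i * exp (2 * pi * r * (\<xi> j i \<bullet> x) - pi * r\<^sup>2 * (norm (\<xi> j i))\<^sup>2)"
      unfolding c'_def by (simp only: exp_add mult.assoc)
  qed
  have "(\<integral>\<^sup>+z. ennreal (F r' c z) \<partial>gauss_on S) = (\<integral>\<^sup>+y. (\<integral>\<^sup>+x. ennreal (F r' c (\<alpha> *\<^sub>R x + \<beta> *\<^sub>R y)) \<partial>gauss_on S) \<partial>gauss_on S)"
    by (rule gauss_on_convolution[OF S ab, symmetric]) measurable
  also have "\<dots> = (\<integral>\<^sup>+y. (\<integral>\<^sup>+x. ennreal (F r (c' y) x) \<partial>gauss_on S) \<partial>gauss_on S)"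
    by (simp only: tilt)
  also have "\<dots> \<le> (\<integral>\<^sup>+y. ennreal ((1 + C * \<sigma> ^ 3) ^ k * (\<Prod>j\<in>J. (\<Sum>i\<in>I j. c' y j i) powr q j)) \<partial>gauss_on S)"
    unfolding F_def r_def using Suc.prems by (intro nn_integral_mono Suc.IH) (auto simp: c'_def)
  also have "\<dots> = (\<integral>\<^sup>+y. ennreal ((1 + C * \<sigma> ^ 3) ^ k) * ennreal (\<Prod>j\<in>J. (\<Sum>i\<in>I j. c' y j i) powr q j) \<partial>gauss_on S)"
    using C \<sigma> by (intro nn_integral_cong ennreal_mult') auto
  also have "\<dots> = ennreal ((1 + C * \<sigma> ^ 3) ^ k) * (\<integral>\<^sup>+y. ennreal (\<Prod>j\<in>J. (\<Sum>i\<in>I j. c' y j i) powr q j) \<partial>gauss_on S)"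
    unfolding c'_def by (intro nn_integral_cmult) measurable
  also have "\<dots> \<le> ennreal ((1 + C * \<sigma> ^ 3) ^ k) * ennreal ((1 + C * \<sigma> ^ 3) * (\<Prod>j\<in>J. (\<Sum>i\<in>I j. c j i) powr q j))"
    unfolding c'_def using Suc.prems by (intro mult_left_mono step) auto
  also have "\<dots> = ennreal ((1 + C * \<sigma> ^ 3) ^ Suc k * (\<Prod>j\<in>J. (\<Sum>i\<in>I j. c j i) powr q j))"
    using C \<sigma> by (subst ennreal_mult'[symmetric]) (auto simp: mult_ac)
  finally show ?case unfolding F_def r'_def .
qed

text \<open>A walk of N steps of size 1 / sqrt N ends in the standard Gaussian, and its accumulated
  error factor (1 + C N^(-3/2))^N is at most exp (C / sqrt N), which tends to 1.\<close>

lemma gauss_on_prod_le: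
  fixes S :: "'a::euclidean_space set" and \<xi> :: "'j \<Rightarrow> 'i \<Rightarrow> 'a"
  assumes S: "subspace S" and J: "finite J" and q: "\<And>j. j \<in> J \<Longrightarrow> q j > 0"
    and I: "\<And>j. j \<in> J \<Longrightarrow> finite (I j)"
    and V: "\<And>j. j \<in> J \<Longrightarrow> subspace (V j) \<and> V j \<subseteq> S"
    and cs: "\<And>w. (\<And>j. j \<in> J \<Longrightarrow> w j \<in> V j) \<Longrightarrow>
       (norm (\<Sum>j\<in>J. q j *\<^sub>R w j))\<^sup>2 \<le> (\<Sum>j\<in>J. q j * (norm (w j))\<^sup>2)"
    and \<xi>: "\<And>j i. j \<in> J \<Longrightarrow> i \<in> I j \<Longrightarrow> \<xi> j i \<in> V j"
    and c: "\<And>j i. j \<in> J \<Longrightarrow> i \<in> I j \<Longrightarrow> c j i \<ge> 0"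
  shows "(\<integral>\<^sup>+z. ennreal (\<Prod>j\<in>J. (\<Sum>i\<in>I j. c j i * exp (2 * pi * (\<xi> j i \<bullet> z) - pi * (norm (\<xi> j i))\<^sup>2)) powr q j) \<partial>gauss_on S)
       \<le> ennreal (\<Prod>j\<in>J. (\<Sum>i\<in>I j. c j i) powr q j)" (is "?L \<le> ennreal ?P")
proof -
  have "\<exists>C\<ge>0. \<forall>\<sigma> c. 0 < \<sigma> \<and> \<sigma> \<le> 1 \<and> (\<forall>j\<in>J. \<forall>i\<in>I j. c j i \<ge> 0) \<longrightarrow>
     (\<integral>\<^sup>+z. ennreal (\<Prod>j\<in>J. (\<Sum>i\<in>I j. c j i * exp (2 * pi * \<sigma> * (\<xi> j i \<bullet> z) - pi * \<sigma>\<^sup>2 * (norm (\<xi> j i))\<^sup>2)) powr q j) \<partial>gauss_on S)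
       \<le> ennreal ((1 + C * \<sigma> ^ 3) * (\<Prod>j\<in>J. (\<Sum>i\<in>I j. c j i) powr q j))"
    by (rule gauss_on_prod_step[where V = V]) (use assms in auto)
  then obtain C where C: "C \<ge> 0" and step: "\<forall>\<sigma> c. 0 < \<sigma> \<and> \<sigma> \<le> 1 \<and> (\<forall>j\<in>J. \<forall>i\<in>I j. c j i \<ge> 0) \<longrightarrow>
     (\<integral>\<^sup>+z. ennreal (\<Prod>j\<in>J. (\<Sum>i\<in>I j. c j i * exp (2 * pi * \<sigma> * (\<xi> j i \<bullet> z) - pi * \<sigma>\<^sup>2 * (norm (\<xi> j i))\<^sup>2)) powr q j) \<partial>gauss_on S)
       \<le> ennreal ((1 + C * \<sigma> ^ 3) * (\<Prod>j\<in>J. (\<Sum>i\<in>I j. c j i) powr q j))"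
    by (elim exE conjE)
  have P0: "?P \<ge> 0" by (intro prod_nonneg) auto
  have *: "?L \<le> ennreal (exp (C / sqrt (real N)) * ?P)" if N: "N \<ge> 1" for N :: nat
  proof -
    define \<sigma> where "\<sigma> = 1 / sqrt (real N)"
    have \<sigma>: "0 < \<sigma>" "\<sigma> \<le> 1" using N by (auto simp: \<sigma>_def)
    have \<sigma>1: "sqrt (real N) * \<sigma> = 1" using N by (simp add: \<sigma>_def)
    have N\<sigma>: "real N * \<sigma>\<^sup>2 = 1" using N by (simp add: \<sigma>_def power_divide)
    have "(\<integral>\<^sup>+z. ennreal (\<Prod>j\<in>J. (\<Sum>i\<in>I j. c j i * exp (2 * pi * (sqrt (real N) * \<sigma>) * (\<xi> j i \<bullet> z) - pi * (sqrt (real N) * \<sigma>)\<^sup>2 * (norm (\<xi> j i))\<^sup>2)) powr q j) \<partial>gauss_on S)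
       \<le> ennreal ((1 + C * \<sigma> ^ 3) ^ N * ?P)"
    proof (rule gauss_on_prod_steps[OF S J C \<sigma>])
      fix d :: "'j \<Rightarrow> 'i \<Rightarrow> real" assume d: "\<And>j i. j \<in> J \<Longrightarrow> i \<in> I j \<Longrightarrow> d j i \<ge> 0"
      show "(\<integral>\<^sup>+z. ennreal (\<Prod>j\<in>J. (\<Sum>i\<in>I j. d j i * exp (2 * pi * \<sigma> * (\<xi> j i \<bullet> z) - pi * \<sigma>\<^sup>2 * (norm (\<xi> j i))\<^sup>2)) powr q j) \<partial>gauss_on S)
       \<le> ennreal ((1 + C * \<sigma> ^ 3) * (\<Prod>j\<in>J. (\<Sum>i\<in>I j. d j i) powr q j))"
        by (rule step[THEN spec[of _ \<sigma>], THEN spec[of _ d], THEN mp]) (use d \<sigma> in auto)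
    qed (use c in auto)
    hence "?L \<le> ennreal ((1 + C * \<sigma> ^ 3) ^ N * ?P)" by (simp only: \<sigma>1 mult_1_right power_one)
    also have "\<dots> \<le> ennreal (exp (C / sqrt (real N)) * ?P)"
    proof (intro ennreal_leI mult_right_mono P0)
      have "(1 + C * \<sigma> ^ 3) ^ N \<le> exp (C * \<sigma> ^ 3) ^ N"
        using C \<sigma> exp_ge_add_one_self[of "C * \<sigma> ^ 3"] by (intro power_mono) auto
      also have "\<dots> = exp (real N * (C * \<sigma> ^ 3))" by (simp add: exp_of_nat_mult)
      also have "real N * (C * \<sigma> ^ 3) = C * \<sigma> * (real N * \<sigma>\<^sup>2)" by (simp add: power2_eq_square power3_eq_cube)
      also have "\<dots> = C / sqrt (real N)" unfolding N\<sigma> by (simp add: \<sigma>_def)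
      finally show "(1 + C * \<sigma> ^ 3) ^ N \<le> exp (C / sqrt (real N))" .
    qed
    finally show ?thesis .
  qed
  have "(\<lambda>N. exp (C / sqrt (real N)) * ?P) \<longlonglongrightarrow> exp 0 * ?P"
    by (intro tendsto_mult tendsto_exp tendsto_const tendsto_divide_0[OF tendsto_const]
        filterlim_at_top_imp_at_infinity filterlim_compose[OF sqrt_at_top filterlim_real_sequentially])
  hence "(\<lambda>N. ennreal (exp (C / sqrt (real N)) * ?P)) \<longlonglongrightarrow> ennreal (exp 0 * ?P)"
    by (rule tendsto_ennrealI)
  hence "?L \<le> ennreal (exp 0 * ?P)"
    by (rule LIMSEQ_le_const) (use * in blast)
  thus ?thesis by simp
qed

section \<open>Geometric data\<close>

definition bl_form :: "'j set \<Rightarrow> 'a::euclidean_space set \<Rightarrow> ('j \<Rightarrow> 'a \<Rightarrow> 'b::euclidean_space) \<Rightarrow> ('j \<Rightarrow> real) \<Rightarrow> ('j \<Rightarrow> 'b \<Rightarrow> real) \<Rightarrow> ennreal" where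
  "bl_form J H L q f = (\<integral>\<^sup>+x. ennreal (\<Prod>j\<in>J. f j (L j x) powr q j) \<partial>sl H)"

lemma bl_form_mono:
  assumes "subspace H" and "\<And>j. j \<in> J \<Longrightarrow> q j \<ge> 0"
    and "\<And>j x. j \<in> J \<Longrightarrow> x \<in> H \<Longrightarrow> 0 \<le> f j (L j x) \<and> f j (L j x) \<le> g j (L j x)"
  shows "bl_form J H L q f \<le> bl_form J H L q g"
  unfolding bl_form_def
  by (intro nn_integral_sl_mono[OF assms(1)] ennreal_leI prod_mono conjI powr_mono2) (use assms in auto)

text \<open>The passages to the limit in the test functions all go through this form of Fatou's
  lemma. Positivity of the exponents makes \<open>powr\<close> continuous also where the limit
  function is 0.\<close>

lemma bl_form_fatou:
  assumes H: "subspace H" and J: "finite J" and q: "\<And>j. j \<in> J \<Longrightarrow> q j > 0"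
    and L: "\<And>j. j \<in> J \<Longrightarrow> linear (L j)"
    and [measurable]: "\<And>n j. j \<in> J \<Longrightarrow> f n j \<in> borel_measurable borel"
    and f0: "\<And>n j y. j \<in> J \<Longrightarrow> 0 \<le> f n j y"
    and lim: "\<And>j x. j \<in> J \<Longrightarrow> x \<in> H \<Longrightarrow> (\<lambda>n. f n j (L j x)) \<longlonglongrightarrow> g j (L j x)"
    and le: "\<And>n. bl_form J H L q (f n) \<le> b n" and b: "b \<longlonglongrightarrow> c"
  shows "bl_form J H L q g \<le> c"
proof -
  have [measurable]: "L j \<in> borel_measurable borel" if "j \<in> J" for j
    using L[OF that] by (rule linear_borel_measurable)
  have mf: "(\<lambda>x. ennreal (\<Prod>j\<in>J. f n j (L j x) powr q j)) \<in> borel_measurable (sl H)" for n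
  proof -
    have "(\<lambda>x. f n j (L j x) powr q j) \<in> borel_measurable (sl H)" if "j \<in> J" for j
      using that by measurable
    thus ?thesis by (intro measurable_compose[OF _ measurable_ennreal] borel_measurable_prod)
  qed
  have "bl_form J H L q g = (\<integral>\<^sup>+x. liminf (\<lambda>n. ennreal (\<Prod>j\<in>J. f n j (L j x) powr q j)) \<partial>sl H)"
    unfolding bl_form_def
  proof (rule nn_integral_sl_cong[OF H])
    fix x assume x: "x \<in> H"
    have "(\<lambda>n. ennreal (\<Prod>j\<in>J. f n j (L j x) powr q j)) \<longlonglongrightarrow> ennreal (\<Prod>j\<in>J. g j (L j x) powr q j)"
    proof (intro tendsto_ennrealI tendsto_prod tendsto_powr' tendsto_const lim x)
      fix j assume j: "j \<in> J"
      show "g j (L j x) \<noteq> 0 \<or> (q j > 0 \<and> (\<forall>\<^sub>F n in sequentially. f n j (L j x) \<ge> 0))"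
        using q[OF j] f0[OF j] by simp
    qed
    thus "ennreal (\<Prod>j\<in>J. g j (L j x) powr q j) = liminf (\<lambda>n. ennreal (\<Prod>j\<in>J. f n j (L j x) powr q j))"
      by (intro lim_imp_Liminf[symmetric]) auto
  qed
  also have "\<dots> \<le> liminf (\<lambda>n. bl_form J H L q (f n))"
    unfolding bl_form_def by (rule nn_integral_liminf[OF mf])
  also have "\<dots> \<le> liminf b" by (intro Liminf_mono always_eventually allI le)
  also have "\<dots> = c" using lim_imp_Liminf[OF trivial_limit_sequentially b] .
  finally show ?thesis .
qed

text \<open>\<open>A j\<close> is the adjoint of \<open>L j\<close> between \<open>G j\<close> and
  \<open>H\<close>. That it is isometric means that \<open>L j\<close> composed with
  \<open>A j\<close> is the identity of \<open>G j\<close>; \<open>parseval\<close> means that the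
  weighted sum of the reversed compositions is the identity of \<open>H\<close>. These identities
  define geometric data.\<close>

locale geometric_datum =
  fixes J :: "'j set" and H :: "'a::euclidean_space set" and G :: "'j \<Rightarrow> 'b::euclidean_space set"
    and L :: "'j \<Rightarrow> 'a \<Rightarrow> 'b" and A :: "'j \<Rightarrow> 'b \<Rightarrow> 'a" and q :: "'j \<Rightarrow> real"
  assumes J: "finite J" and H: "subspace H" and G: "\<And>j. j \<in> J \<Longrightarrow> subspace (G j)"
    and q: "\<And>j. j \<in> J \<Longrightarrow> q j > 0"
    and L: "\<And>j. j \<in> J \<Longrightarrow> linear (L j)" and LH: "\<And>j. j \<in> J \<Longrightarrow> L j ` H \<subseteq> G j"
    and A: "\<And>j. j \<in> J \<Longrightarrow> linear (A j)" and AG: "\<And>j. j \<in> J \<Longrightarrow> A j ` G j \<subseteq> H"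
    and adj: "\<And>j x w. j \<in> J \<Longrightarrow> x \<in> H \<Longrightarrow> w \<in> G j \<Longrightarrow> A j w \<bullet> x = w \<bullet> L j x"
    and iso: "\<And>j w. j \<in> J \<Longrightarrow> w \<in> G j \<Longrightarrow> norm (A j w) = norm w"
    and parseval: "\<And>x. x \<in> H \<Longrightarrow> (\<Sum>j\<in>J. q j * (norm (L j x))\<^sup>2) = (norm x)\<^sup>2"
    and crit: "(\<Sum>j\<in>J. q j * real (dim (G j))) = real (dim H)"
begin

text \<open>By Parseval the map sending x to the family sqrt (q j) L_j x is an isometry; this is the
  contractivity of its adjoint, proved by pairing the sum with itself. It supplies the condition
  \<open>cs\<close> of the random walk.\<close>

lemma norm_sum_le:
  assumes w: "\<And>j. j \<in> J \<Longrightarrow> w j \<in> A j ` G j"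
  shows "(norm (\<Sum>j\<in>J. q j *\<^sub>R w j))\<^sup>2 \<le> (\<Sum>j\<in>J. q j * (norm (w j))\<^sup>2)"
proof -
  have "\<exists>v. \<forall>j\<in>J. v j \<in> G j \<and> w j = A j (v j)" using w by (intro bchoice) auto
  then obtain v where v: "\<And>j. j \<in> J \<Longrightarrow> v j \<in> G j" "\<And>j. j \<in> J \<Longrightarrow> w j = A j (v j)" by blast
  define x where "x = (\<Sum>j\<in>J. q j *\<^sub>R w j)"
  have wH: "w j \<in> H" if "j \<in> J" for j using v[OF that] AG[OF that] by auto
  have x: "x \<in> H" unfolding x_def using wH H by (intro subspace_sum subspace_scale) auto
  have "(norm x)\<^sup>2 = (\<Sum>j\<in>J. q j * (w j \<bullet> x))"
    unfolding power2_norm_eq_inner by (subst (1) x_def) (simp add: inner_sum_left)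
  also have "\<dots> \<le> (\<Sum>j\<in>J. q j * (((norm (w j))\<^sup>2 + (norm (L j x))\<^sup>2) / 2))"
  proof (intro sum_mono mult_left_mono)
    fix j assume j: "j \<in> J"
    have "w j \<bullet> x = v j \<bullet> L j x" using adj[OF j x v(1)[OF j]] v(2)[OF j] by simp
    also have "\<dots> \<le> norm (v j) * norm (L j x)" by (rule norm_cauchy_schwarz)
    also have "norm (v j) = norm (w j)" using iso[OF j v(1)[OF j]] v(2)[OF j] by simp
    also have "norm (w j) * norm (L j x) \<le> ((norm (w j))\<^sup>2 + (norm (L j x))\<^sup>2) / 2"
      using sum_squares_bound[of "norm (w j)" "norm (L j x)"] by simp
    finally show "w j \<bullet> x \<le> ((norm (w j))\<^sup>2 + (norm (L j x))\<^sup>2) / 2" .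
  qed (use q in \<open>auto simp: less_imp_le\<close>)
  also have "\<dots> = ((\<Sum>j\<in>J. q j * (norm (w j))\<^sup>2) + (\<Sum>j\<in>J. q j * (norm (L j x))\<^sup>2)) / 2"
    unfolding sum.distrib[symmetric] sum_divide_distrib by (intro sum.cong refl) (simp add: distrib_left)
  finally have "(norm x)\<^sup>2 \<le> ((\<Sum>j\<in>J. q j * (norm (w j))\<^sup>2) + (norm x)\<^sup>2) / 2" unfolding parseval[OF x] .
  thus ?thesis unfolding x_def by simp
qed

text \<open>When |L_j x - a|^2 is expanded, the squares |L_j x|^2 add up to |x|^2 by Parseval and
  form the density of \<open>gauss_on\<close>; the remaining factors are the tilts of the walk with
  \<xi> j i = A j (a j i).\<close>

lemma bl_form_gauss_mixture:
  assumes I: "\<And>j. j \<in> J \<Longrightarrow> finite (I j)" and a: "\<And>j i. j \<in> J \<Longrightarrow> i \<in> I j \<Longrightarrow> a j i \<in> G j"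
    and c: "\<And>j i. j \<in> J \<Longrightarrow> i \<in> I j \<Longrightarrow> c j i \<ge> 0"
  shows "bl_form J H L q (\<lambda>j y. \<Sum>i\<in>I j. c j i * exp (- pi * (norm (y - a j i))\<^sup>2)) \<le> ennreal (\<Prod>j\<in>J. (\<Sum>i\<in>I j. c j i) powr q j)"
proof -
  define E where "E = (\<lambda>j i z. exp (2 * pi * (A j (a j i) \<bullet> z) - pi * (norm (A j (a j i)))\<^sup>2))"
  have "bl_form J H L q (\<lambda>j y. \<Sum>i\<in>I j. c j i * exp (- pi * (norm (y - a j i))\<^sup>2))
     = (\<integral>\<^sup>+x. ennreal (exp (- pi * (norm x)\<^sup>2)) * ennreal (\<Prod>j\<in>J. (\<Sum>i\<in>I j. c j i * E j i x) powr q j) \<partial>sl H)"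
    unfolding bl_form_def
  proof (rule nn_integral_sl_cong[OF H])
    fix x assume x: "x \<in> H"
    have "(\<Sum>i\<in>I j. c j i * exp (- pi * (norm (L j x - a j i))\<^sup>2)) powr q j
        = exp (- pi * (q j * (norm (L j x))\<^sup>2)) * (\<Sum>i\<in>I j. c j i * E j i x) powr q j" if j: "j \<in> J" for j
    proof -
      have "c j i * exp (- pi * (norm (L j x - a j i))\<^sup>2) = exp (- pi * (norm (L j x))\<^sup>2) * (c j i * E j i x)" if i: "i \<in> I j" for i
      proof -
        have eq: "- pi * (norm (L j x - a j i))\<^sup>2 = - pi * (norm (L j x))\<^sup>2 + (2 * pi * (a j i \<bullet> L j x) - pi * (norm (a j i))\<^sup>2)"
          unfolding power2_norm_eq_inner by (simp add: inner_diff_left inner_diff_right inner_commute algebra_simps)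
        show ?thesis unfolding E_def iso[OF j a[OF j i]] adj[OF j x a[OF j i]] eq exp_add by (rule mult.left_commute)
      qed
      hence "(\<Sum>i\<in>I j. c j i * exp (- pi * (norm (L j x - a j i))\<^sup>2)) = exp (- pi * (norm (L j x))\<^sup>2) * (\<Sum>i\<in>I j. c j i * E j i x)"
        unfolding sum_distrib_left by (rule sum.cong[OF refl])
      moreover have "(\<Sum>i\<in>I j. c j i * E j i x) \<ge> 0" using c[OF j] by (intro sum_nonneg mult_nonneg_nonneg) (auto simp: E_def)
      ultimately show ?thesis by (simp add: powr_mult exp_powr_real mult_ac)
    qed
    hence "(\<Prod>j\<in>J. (\<Sum>i\<in>I j. c j i * exp (- pi * (norm (L j x - a j i))\<^sup>2)) powr q j)
        = (\<Prod>j\<in>J. exp (- pi * (q j * (norm (L j x))\<^sup>2))) * (\<Prod>j\<in>J. (\<Sum>i\<in>I j. c j i * E j i x) powr q j)"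
      unfolding prod.distrib[symmetric] by (rule prod.cong[OF refl])
    moreover have "(\<Prod>j\<in>J. exp (- pi * (q j * (norm (L j x))\<^sup>2))) = exp (- pi * (norm x)\<^sup>2)"
      unfolding exp_sum[OF J, symmetric] sum_distrib_left[symmetric] parseval[OF x] ..
    ultimately show "ennreal (\<Prod>j\<in>J. (\<Sum>i\<in>I j. c j i * exp (- pi * (norm (L j x - a j i))\<^sup>2)) powr q j)
       = ennreal (exp (- pi * (norm x)\<^sup>2)) * ennreal (\<Prod>j\<in>J. (\<Sum>i\<in>I j. c j i * E j i x) powr q j)"
      by (simp only: ennreal_mult' exp_ge_zero)
  qed
  also have "\<dots> = (\<integral>\<^sup>+x. ennreal (\<Prod>j\<in>J. (\<Sum>i\<in>I j. c j i * E j i x) powr q j) \<partial>gauss_on H)"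
    unfolding E_def by (rule nn_integral_gauss_on[symmetric]) measurable
  also have "\<dots> \<le> ennreal (\<Prod>j\<in>J. (\<Sum>i\<in>I j. c j i) powr q j)"
    unfolding E_def
  proof (rule gauss_on_prod_le[where V = "\<lambda>j. A j ` G j" and \<xi> = "\<lambda>j i. A j (a j i)" and J = J and I = I and c = c and q = q and S = H, OF H J])
    show "subspace (A j ` G j) \<and> A j ` G j \<subseteq> H" if "j \<in> J" for j
      using linear_subspace_image[OF A[OF that] G[OF that]] AG[OF that] by blast
    show "A j (a j i) \<in> A j ` G j" if "j \<in> J" "i \<in> I j" for j i using a[OF that] by (rule imageI)
    show "(norm (\<Sum>j\<in>J. q j *\<^sub>R w j))\<^sup>2 \<le> (\<Sum>j\<in>J. q j * (norm (w j))\<^sup>2)"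
      if "\<And>j. j \<in> J \<Longrightarrow> w j \<in> A j ` G j" for w using that by (rule norm_sum_le)
    show "q j > 0" "finite (I j)" if "j \<in> J" for j using q[OF that] I[OF that] by auto
    show "c j i \<ge> 0" if "j \<in> J" "i \<in> I j" for j i using c[OF that] .
  qed
  finally show ?thesis .
qed

text \<open>The measure with density \<open>f j\<close> is replaced by finitely many atoms of the
  same total mass, which turns the convolution into a Gaussian mixture; the atoms are then
  refined.\<close>

lemma bl_form_gauss_convolution:
  assumes [measurable]: "\<And>j. j \<in> J \<Longrightarrow> f j \<in> borel_measurable borel" and f0: "\<And>j y. 0 \<le> f j y"
    and f: "\<And>j. j \<in> J \<Longrightarrow> (\<integral>\<^sup>+y. ennreal (f j y) \<partial>sl (G j)) = ennreal (b j)" and b: "\<And>j. j \<in> J \<Longrightarrow> 0 \<le> b j"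
  shows "bl_form J H L q (\<lambda>j y. \<integral>a. f j a * exp (- pi * (norm (y - a))\<^sup>2) \<partial>sl (G j)) \<le> ennreal (\<Prod>j\<in>J. b j powr q j)"
proof -
  define Q where "Q j F \<longleftrightarrow> (\<forall>n. simple_function (sl (G j)) (F n)) \<and> (\<forall>n. range (F n) \<subseteq> G j) \<and> (\<forall>y\<in>G j. (\<lambda>n. F n y) \<longlonglongrightarrow> y)"
    for j and F :: "nat \<Rightarrow> 'b \<Rightarrow> 'b"
  have "\<forall>j\<in>J. \<exists>F. Q j F"
  proof
    fix j assume j: "j \<in> J"
    obtain e where e: "orthonormal_family {..<dim (G j)} e" "span (e ` {..<dim (G j)}) = G j"
      using orthonormal_family_exists[OF G[OF j], of "{..<dim (G j)}"] by auto
    obtain F where F: "\<And>n. simple_function (sl (G j)) (F n)" "\<And>y. (\<lambda>n. F n y) \<longlonglongrightarrow> y"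
      using borel_measurable_implies_sequence_metric[of "\<lambda>x. x" "sl (G j)" undefined] by (auto simp: measurable_ident_sets)
    \<comment> \<open>The orthogonal projection onto \<open>G j\<close>. Simple approximations of
      the identity may leave \<open>G j\<close>, but the centres of a mixture have to lie in
      it.\<close>
    define P where "P = (\<lambda>y. \<Sum>i<dim (G j). (y \<bullet> e i) *\<^sub>R e i)"
    have "(\<lambda>n. P (F n y)) \<longlonglongrightarrow> y" if "y \<in> G j" for y
    proof -
      have "(\<lambda>n. P (F n y)) \<longlonglongrightarrow> P y" unfolding P_def by (intro tendsto_intros F)
      thus ?thesis using orthonormal_family_expand[OF e(1), of y] e(2) that by (simp add: P_def)
    qed
    moreover have "P y \<in> G j" for y
    proof -
      have "P y \<in> span (e ` {..<dim (G j)})" unfolding P_def by (intro span_sum span_scale span_base) auto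
      thus ?thesis using e(2) by simp
    qed
    moreover have "simple_function (sl (G j)) (\<lambda>y. P (F n y))" for n
      by (rule simple_function_compose1[OF F(1)])
    ultimately show "\<exists>F. Q j F"
      unfolding Q_def by (intro exI[of _ "\<lambda>n y. P (F n y)"]) auto
  qed
  from bchoice[OF this] obtain F where "\<forall>j\<in>J. Q j (F j)" ..
  hence F: "\<And>j n. j \<in> J \<Longrightarrow> simple_function (sl (G j)) (F j n)"
     "\<And>j n. j \<in> J \<Longrightarrow> range (F j n) \<subseteq> G j" "\<And>j y. j \<in> J \<Longrightarrow> y \<in> G j \<Longrightarrow> (\<lambda>n. F j n y) \<longlonglongrightarrow> y"
    unfolding Q_def by simp_all
  have fin: "finite (range (F j n))" if "j \<in> J" for j n using F(1)[OF that, of n] by (simp add: simple_function_def)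
  have mF: "F j n \<in> borel_measurable borel" if "j \<in> J" for j n
    using borel_measurable_simple_function[OF F(1)[OF that, of n]] by simp
  have fi: "integrable (sl (G j)) (f j)" "(\<integral>y. f j y \<partial>sl (G j)) = b j" if j: "j \<in> J" for j
  proof -
    have "has_bochner_integral (sl (G j)) (f j) (b j)"
      using f[OF j] b[OF j] f0 j by (intro has_bochner_integral_nn_integral) auto
    thus "integrable (sl (G j)) (f j)" "(\<integral>y. f j y \<partial>sl (G j)) = b j" by (auto simp: has_bochner_integral_iff)
  qed
  \<comment> \<open>The mass that \<open>f j\<close> gives to the cell of all points approximated by
    \<open>v\<close>.\<close>
  define c where "c = (\<lambda>n j v. \<integral>a. f j a * indicator (F j n -` {v}) a \<partial>sl (G j))"
  have sF: "F j n -` {v} \<in> sets (sl (G j))" if "j \<in> J" for j n v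
    using measurable_sets[OF mF[OF that], of "{v}"] by simp
  have ci: "integrable (sl (G j)) (\<lambda>a. f j a * indicator (F j n -` {v}) a)" if "j \<in> J" for j n v
    by (rule integrable_real_mult_indicator[OF sF fi(1)]) (use that in auto)
  have c0: "c n j v \<ge> 0" for n j v unfolding c_def using f0 by (intro Bochner_Integration.integral_nonneg) (auto simp: mult_nonneg_nonneg)
  have part: "(\<Sum>v\<in>range (F j n). g v * (f j a * indicator (F j n -` {v}) a)) = f j a * g (F j n a)" if j: "j \<in> J" for j n a and g :: "'b \<Rightarrow> real"
  proof -
    have "(\<Sum>v\<in>range (F j n). g v * (f j a * indicator (F j n -` {v}) a)) = (\<Sum>v\<in>range (F j n). if v = F j n a then f j a * g v else 0)"
      by (intro sum.cong refl) (auto simp: indicator_def)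
    thus ?thesis using fin[OF j] by simp
  qed
  have mix: "(\<Sum>v\<in>range (F j n). c n j v * g v) = (\<integral>a. f j a * g (F j n a) \<partial>sl (G j))" if j: "j \<in> J" for j n and g :: "'b \<Rightarrow> real"
  proof -
    have "(\<Sum>v\<in>range (F j n). c n j v * g v) = (\<integral>a. (\<Sum>v\<in>range (F j n). g v * (f j a * indicator (F j n -` {v}) a)) \<partial>sl (G j))"
      unfolding c_def using ci[OF j] by (subst Bochner_Integration.integral_sum) (auto simp: mult.commute intro: integrable_mult_right)
    thus ?thesis unfolding part[OF j] .
  qed
  have c1: "(\<Sum>v\<in>range (F j n). c n j v) = b j" if j: "j \<in> J" for j n
    using mix[OF j, of n "\<lambda>_. 1"] fi(2)[OF j] by simp
  show ?thesis
  proof (rule bl_form_fatou[OF H J q L, where f = "\<lambda>n j y. \<Sum>v\<in>range (F j n). c n j v * exp (- pi * (norm (y - v))\<^sup>2)" and b = "\<lambda>_. ennreal (\<Prod>j\<in>J. b j powr q j)"])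
    show "bl_form J H L q (\<lambda>j y. \<Sum>v\<in>range (F j n). c n j v * exp (- pi * (norm (y - v))\<^sup>2)) \<le> ennreal (\<Prod>j\<in>J. b j powr q j)" for n
    proof -
      have "bl_form J H L q (\<lambda>j y. \<Sum>v\<in>range (F j n). c n j v * exp (- pi * (norm (y - v))\<^sup>2)) \<le> ennreal (\<Prod>j\<in>J. (\<Sum>v\<in>range (F j n). c n j v) powr q j)"
        by (rule bl_form_gauss_mixture[of "\<lambda>j. range (F j n)" "\<lambda>j v. v"]) (use fin subsetD[OF F(2) rangeI] c0 in auto)
      moreover have "(\<Prod>j\<in>J. (\<Sum>v\<in>range (F j n). c n j v) powr q j) = (\<Prod>j\<in>J. b j powr q j)"
        by (rule prod.cong[OF refl]) (simp only: c1)
      ultimately show ?thesis by (simp only:)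
    qed
    show "(\<lambda>n. \<Sum>v\<in>range (F j n). c n j v * exp (- pi * (norm (L j x - v))\<^sup>2)) \<longlonglongrightarrow> (\<integral>a. f j a * exp (- pi * (norm (L j x - a))\<^sup>2) \<partial>sl (G j))"
      if j: "j \<in> J" and x: "x \<in> H" for j x
      unfolding mix[OF j]
    proof (rule integral_dominated_convergence[where w = "f j"])
      show "AE a in sl (G j). (\<lambda>n. f j a * exp (- pi * (norm (L j x - F j n a))\<^sup>2)) \<longlonglongrightarrow> f j a * exp (- pi * (norm (L j x - a))\<^sup>2)"
        using sl_AE[OF G[OF j]]
      proof eventually_elim
        case (elim a) thus ?case by (intro tendsto_intros F(3)[OF j])
      qed
      show "AE a in sl (G j). norm (f j a * exp (- pi * (norm (L j x - F j n a))\<^sup>2)) \<le> f j a" for n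
        using f0[of j] by (intro AE_I2) (simp add: abs_mult mult_left_le)
    qed (use j mF[OF j] fi(1)[OF j] in measurable)
    show "0 \<le> (\<Sum>v\<in>range (F j n). c n j v * exp (- pi * (norm (y - v))\<^sup>2))" for n j y
      using c0 by (intro sum_nonneg) simp
  qed auto
qed

lemma sl_translate_integral:
  fixes g :: "'c::euclidean_space \<Rightarrow> real"
  assumes S: "subspace S" and v: "v \<in> S" and [measurable]: "g \<in> borel_measurable borel"
  shows "(\<integral>x. g (v + x) \<partial>sl S) = (\<integral>x. g x \<partial>sl S)"
proof -
  have "distr (sl S) borel (\<lambda>x. v + x) = sl S" using haar_on_sl[OF S] v by (simp add: haar_on_def)
  moreover have "(\<integral>x. g x \<partial>distr (sl S) borel (\<lambda>x. v + x)) = (\<integral>x. g (v + x) \<partial>sl S)"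
    by (rule integral_distr) auto
  ultimately show ?thesis by simp
qed

text \<open>Dilations turn the unit-width convolution into one of width \<epsilon>. Global
  criticality makes the powers of \<epsilon> on the two sides cancel, and as \<epsilon> tends to 0
  the convolution returns to \<open>f j\<close> by continuity and boundedness.\<close>

lemma bl_form_continuous:
  assumes cont: "\<And>j. j \<in> J \<Longrightarrow> continuous_on UNIV (f j)" and bdd: "\<And>j y. j \<in> J \<Longrightarrow> f j y \<le> B"
    and f0: "\<And>j y. 0 \<le> f j y"
    and f: "\<And>j. j \<in> J \<Longrightarrow> (\<integral>\<^sup>+y. ennreal (f j y) \<partial>sl (G j)) = ennreal (b j)" and b: "\<And>j. j \<in> J \<Longrightarrow> 0 \<le> b j"
  shows "bl_form J H L q f \<le> ennreal (\<Prod>j\<in>J. b j powr q j)"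
proof -
  have [measurable]: "f j \<in> borel_measurable borel" if "j \<in> J" for j
    using cont[OF that] by (rule borel_measurable_continuous_onI)
  define \<epsilon> where "\<epsilon> = (\<lambda>n::nat. 1 / (real n + 1))"
  have \<epsilon>: "\<epsilon> n > 0" for n by (simp add: \<epsilon>_def add_pos_nonneg)
  have \<epsilon>0: "\<epsilon> \<longlonglongrightarrow> 0" unfolding \<epsilon>_def using LIMSEQ_inverse_real_of_nat by (simp add: inverse_eq_divide add.commute)
  define C where "C = (\<lambda>n j y. \<integral>a. f j (\<epsilon> n *\<^sub>R a) * exp (- pi * (norm (y - a))\<^sup>2) \<partial>sl (G j))"
  have C0: "0 \<le> C n j y" for n j y unfolding C_def using f0 by (intro Bochner_Integration.integral_nonneg) auto
  have mC [measurable]: "C n j \<in> borel_measurable borel" if j: "j \<in> J" for n j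
  proof -
    interpret sigma_finite_measure "sl (G j)" by (rule sl_sigma_finite[OF G[OF j]])
    show ?thesis unfolding C_def using j by (intro borel_measurable_lebesgue_integral) measurable
  qed
  have bC: "bl_form J H L q (C n) \<le> ennreal ((1 / \<epsilon> n) ^ dim H * (\<Prod>j\<in>J. b j powr q j))" for n
  proof -
    have "bl_form J H L q (C n) \<le> ennreal (\<Prod>j\<in>J. ((1 / \<epsilon> n) ^ dim (G j) * b j) powr q j)"
      unfolding C_def
    proof (rule bl_form_gauss_convolution)
      fix j assume j: "j \<in> J"
      show "(\<lambda>y. f j (\<epsilon> n *\<^sub>R y)) \<in> borel_measurable borel" using j by measurable
      have "(\<integral>\<^sup>+y. ennreal (f j (\<epsilon> n *\<^sub>R y)) \<partial>sl (G j)) = ennreal ((1 / \<epsilon> n) ^ dim (G j)) * (\<integral>\<^sup>+y. ennreal (f j y) \<partial>sl (G j))"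
        using j by (intro sl_scale[OF G[OF j] \<epsilon>]) measurable
      thus "(\<integral>\<^sup>+y. ennreal (f j (\<epsilon> n *\<^sub>R y)) \<partial>sl (G j)) = ennreal ((1 / \<epsilon> n) ^ dim (G j) * b j)"
        using \<epsilon>[of n] b[OF j] by (simp add: f[OF j] ennreal_mult)
      show "0 \<le> (1 / \<epsilon> n) ^ dim (G j) * b j" using \<epsilon>[of n] b[OF j] by simp
    qed (use f0 in auto)
    moreover have "(\<Prod>j\<in>J. ((1 / \<epsilon> n) ^ dim (G j) * b j) powr q j) = (1 / \<epsilon> n) ^ dim H * (\<Prod>j\<in>J. b j powr q j)"
    proof -
      have "(\<Prod>j\<in>J. ((1 / \<epsilon> n) ^ dim (G j) * b j) powr q j) = (\<Prod>j\<in>J. ((1 / \<epsilon> n) powr (q j * real (dim (G j)))) * b j powr q j)"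
        using \<epsilon>[of n] b by (intro prod.cong refl) (simp add: powr_mult powr_powr mult.commute flip: powr_realpow)
      moreover have "(1 / \<epsilon> n) powr (\<Sum>j\<in>J. q j * real (dim (G j))) = (1 / \<epsilon> n) ^ dim H"
        unfolding crit using \<epsilon>[of n] by (simp add: powr_realpow)
      ultimately show ?thesis using \<epsilon>[of n] by (simp add: prod.distrib powr_sum)
    qed
    ultimately show ?thesis by (simp only:)
  qed
  show ?thesis
  proof (rule bl_form_fatou[OF H J q L, where f = "\<lambda>n j y. C n j ((1 / \<epsilon> n) *\<^sub>R y)" and b = "\<lambda>_. ennreal (\<Prod>j\<in>J. b j powr q j)"])
    show "(\<lambda>y. C n j ((1 / \<epsilon> n) *\<^sub>R y)) \<in> borel_measurable borel" if "j \<in> J" for n j using that by measurable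
    show "bl_form J H L q (\<lambda>j y. C n j ((1 / \<epsilon> n) *\<^sub>R y)) \<le> ennreal (\<Prod>j\<in>J. b j powr q j)" for n
    proof -
      have [measurable]: "L j \<in> borel_measurable borel" if "j \<in> J" for j
        using L[OF that] by (rule linear_borel_measurable)
      have mL: "(\<lambda>x. ennreal (\<Prod>j\<in>J. C n j (L j x) powr q j)) \<in> borel_measurable borel"
      proof -
        have "(\<lambda>x. C n j (L j x) powr q j) \<in> borel_measurable borel" if "j \<in> J" for j
          using that by measurable
        thus ?thesis by (intro measurable_compose[OF _ measurable_ennreal] borel_measurable_prod)
      qed
      have "bl_form J H L q (\<lambda>j y. C n j ((1 / \<epsilon> n) *\<^sub>R y)) = (\<integral>\<^sup>+x. ennreal (\<Prod>j\<in>J. C n j (L j ((1 / \<epsilon> n) *\<^sub>R x)) powr q j) \<partial>sl H)"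
        unfolding bl_form_def using L by (intro nn_integral_cong arg_cong[where f = ennreal] prod.cong refl) (simp add: linear_cmul)
      also have "\<dots> = ennreal ((1 / (1 / \<epsilon> n)) ^ dim H) * bl_form J H L q (C n)"
        unfolding bl_form_def using \<epsilon>[of n] by (intro sl_scale[OF H _ mL]) auto
      also have "\<dots> \<le> ennreal ((1 / (1 / \<epsilon> n)) ^ dim H) * ennreal ((1 / \<epsilon> n) ^ dim H * (\<Prod>j\<in>J. b j powr q j))"
        by (intro mult_left_mono bC) auto
      also have "\<dots> = ennreal ((1 / (1 / \<epsilon> n)) ^ dim H * ((1 / \<epsilon> n) ^ dim H * (\<Prod>j\<in>J. b j powr q j)))"
        using \<epsilon>[of n] by (intro ennreal_mult'[symmetric]) auto
      finally show ?thesis using \<epsilon>[of n] by (simp add: power_one_over)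
    qed
    fix j x assume j: "j \<in> J" and x: "x \<in> H"
    define y where "y = L j x"
    have y: "y \<in> G j" unfolding y_def using LH[OF j] x by auto
    have C': "C n j ((1 / \<epsilon> n) *\<^sub>R y) = (\<integral>a. f j (y + \<epsilon> n *\<^sub>R a) * exp (- pi * (norm a)\<^sup>2) \<partial>sl (G j))" for n
    proof -
      let ?v = "(1 / \<epsilon> n) *\<^sub>R y" and ?g = "\<lambda>a. f j (\<epsilon> n *\<^sub>R a) * exp (- pi * (norm ((1 / \<epsilon> n) *\<^sub>R y - a))\<^sup>2)"
      have "(\<integral>a. ?g (?v + a) \<partial>sl (G j)) = (\<integral>a. ?g a \<partial>sl (G j))"
        using j y by (intro sl_translate_integral[OF G[OF j]] subspace_scale[OF G[OF j]]) measurable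
      moreover have "?g (?v + a) = f j (y + \<epsilon> n *\<^sub>R a) * exp (- pi * (norm a)\<^sup>2)" for a
        using \<epsilon>[of n] by (simp add: scaleR_add_right)
      ultimately show ?thesis unfolding C_def by simp
    qed
    have gi: "integrable (sl (G j)) (\<lambda>a. exp (- pi * (norm a)\<^sup>2))" "(\<integral>a. exp (- pi * (norm a)\<^sup>2) \<partial>sl (G j)) = 1"
    proof -
      have "has_bochner_integral (sl (G j)) (\<lambda>a. exp (- pi * (norm a)\<^sup>2)) 1"
        using zf_norm[OF G[OF j]] by (intro has_bochner_integral_nn_integral) (auto simp: zf_def)
      thus "integrable (sl (G j)) (\<lambda>a. exp (- pi * (norm a)\<^sup>2))" "(\<integral>a. exp (- pi * (norm a)\<^sup>2) \<partial>sl (G j)) = 1"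
        by (auto simp: has_bochner_integral_iff)
    qed
    have "(\<lambda>n. C n j ((1 / \<epsilon> n) *\<^sub>R y)) \<longlonglongrightarrow> (\<integral>a. f j y * exp (- pi * (norm a)\<^sup>2) \<partial>sl (G j))"
      unfolding C'
    proof (rule integral_dominated_convergence[where w = "\<lambda>a. B * exp (- pi * (norm a)\<^sup>2)"])
      show "AE a in sl (G j). (\<lambda>n. f j (y + \<epsilon> n *\<^sub>R a) * exp (- pi * (norm a)\<^sup>2)) \<longlonglongrightarrow> f j y * exp (- pi * (norm a)\<^sup>2)"
      proof (intro AE_I2 tendsto_mult tendsto_const)
        fix a
        have "(\<lambda>n. y + \<epsilon> n *\<^sub>R a) \<longlonglongrightarrow> y + 0 *\<^sub>R a" by (intro tendsto_intros \<epsilon>0)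
        moreover have "isCont (f j) y" using cont[OF j] by (simp add: continuous_on_eq_continuous_at)
        ultimately show "(\<lambda>n. f j (y + \<epsilon> n *\<^sub>R a)) \<longlonglongrightarrow> f j y" by (auto intro: isCont_tendsto_compose)
      qed
      show "AE a in sl (G j). norm (f j (y + \<epsilon> n *\<^sub>R a) * exp (- pi * (norm a)\<^sup>2)) \<le> B * exp (- pi * (norm a)\<^sup>2)" for n
        using f0 bdd[OF j] by (intro AE_I2) (simp add: abs_mult mult_right_mono)
      show "integrable (sl (G j)) (\<lambda>a. B * exp (- pi * (norm a)\<^sup>2))" by (intro integrable_mult_right gi)
    qed (use j in measurable)
    thus "(\<lambda>n. C n j ((1 / \<epsilon> n) *\<^sub>R L j x)) \<longlonglongrightarrow> f j (L j x)"
      using gi(2) by (simp add: y_def)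
  qed (use C0 in auto)
qed

end

section \<open>From continuous to Borel test functions\<close>

lemma sl_outer_regular:
  assumes S: "subspace S" and E: "E \<in> sets borel" "E \<subseteq> cball 0 m" and d: "d > 0"
  obtains U where "open U" "E \<subseteq> U" "bounded U" "emeasure (sl S) U \<le> emeasure (sl S) E + ennreal d"
proof -
  \<comment> \<open>Outer regularity is applied to a finite measure, hence the restriction to a ball
    slightly larger than the one that contains \<open>E\<close>.\<close>
  let ?B = "ball 0 (m + 1) :: 'a set"
  define M where "M = density (sl S) (indicator ?B)"
  have M: "emeasure M X = emeasure (sl S) (X \<inter> ?B)" if "X \<in> sets borel" for X
  proof -
    have "emeasure M X = (\<integral>\<^sup>+x. indicator ?B x * indicator X x \<partial>sl S)"
      unfolding M_def using that by (intro emeasure_density borel_measurable_indicator) auto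
    also have "\<dots> = (\<integral>\<^sup>+x. indicator (X \<inter> ?B) x \<partial>sl S)"
      by (intro nn_integral_cong) (auto simp: indicator_def)
    also have "\<dots> = emeasure (sl S) (X \<inter> ?B)" using that by (intro nn_integral_indicator) auto
    finally show ?thesis .
  qed
  have fin: "emeasure (sl S) X < \<infinity>" if "X \<in> sets borel" "X \<subseteq> cball 0 (m + 1)" for X
  proof -
    have "emeasure (sl S) X \<le> emeasure (sl S) (cball 0 (m + 1))" using that by (intro emeasure_mono) auto
    also have "\<dots> < \<infinity>" using le_less_trans[OF haar_on_emeasure_cball[OF haar_on_sl[OF S]] ennreal_less_top] by simp
    finally show ?thesis .
  qed
  have Ms: "sets M = sets borel" by (simp add: M_def)
  have "emeasure M (space M) = emeasure (sl S) (UNIV \<inter> ?B)" using M[of UNIV] by (simp add: M_def)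
  also have "\<dots> < \<infinity>" by (rule fin) auto
  finally have Mf: "emeasure M (space M) \<noteq> \<infinity>" by simp
  have EB: "E \<inter> ?B = E" using E(2) by (fastforce simp: dist_norm)
  have Ef: "emeasure M E < \<infinity>" using M[OF E(1)] fin[of E] E by (force simp: EB)
  have "emeasure M E < emeasure M E + ennreal d"
  proof (cases "emeasure M E")
    case (real r)
    thus ?thesis using d by (simp add: ennreal_lessI flip: ennreal_plus)
  qed (use Ef in auto)
  hence "(INF U \<in> {U. E \<subseteq> U \<and> open U}. emeasure M U) < emeasure M E + ennreal d"
    using outer_regular[OF Ms Mf E(1)] by simp
  then obtain U where U: "E \<subseteq> U" "open U" "emeasure M U < emeasure M E + ennreal d"
    unfolding INF_less_iff by auto
  show ?thesis
  proof (rule that[of "U \<inter> ?B"])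
    show "emeasure (sl S) (U \<inter> ?B) \<le> emeasure (sl S) E + ennreal d"
      using U(3) M[of U] M[OF E(1)] U(2) EB by (simp add: less_imp_le)
    show "bounded (U \<inter> ?B)" by (rule bounded_subset[OF bounded_ball]) auto
  qed (use U EB in auto)
qed

text \<open>Continuous minorants of the indicator of an open set that converge to it pointwise, as
  required for Fatou's lemma.\<close>

definition bump :: "'a::euclidean_space set \<Rightarrow> nat \<Rightarrow> 'a \<Rightarrow> real" where
  "bump U n y = min 1 (real n * infdist y (- U))"

lemma bump_continuous: "continuous_on UNIV (bump U n)"
  unfolding bump_def by (intro continuous_intros)

lemma bump_bounds:
  assumes "open U"
  shows "0 \<le> bump U n y" "bump U n y \<le> indicator U y"
proof -
  show "0 \<le> bump U n y" by (simp add: bump_def infdist_nonneg)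
  show "bump U n y \<le> indicator U y"
    by (cases "y \<in> U") (auto simp: bump_def)
qed

lemma bump_tendsto:
  assumes U: "open U" "bounded U"
  shows "(\<lambda>n. bump U n y) \<longlonglongrightarrow> indicator U y"
proof (cases "y \<in> U")
  case True
  \<comment> \<open>Boundedness of \<open>U\<close> enters here: for the whole space the complement
    is empty, \<open>infdist\<close> takes its default value 0 and the bumps would vanish
    identically.\<close>
  have "- U \<noteq> {}" using U(2) not_bounded_UNIV by (metis Compl_empty_eq double_complement)
  hence pos: "infdist y (- U) > 0"
    using True U(1) in_closed_iff_infdist_zero[of "- U" y] infdist_nonneg[of y "- U"] by (force simp: closed_Compl less_le)
  obtain N :: nat where N: "1 / infdist y (- U) \<le> real N" using real_arch_simple by blast
  have "\<forall>\<^sub>F n in sequentially. bump U n y = 1"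
    using eventually_ge_at_top[of N]
  proof eventually_elim
    case (elim n)
    have "1 / infdist y (- U) \<le> real n" using N elim by linarith
    hence "1 \<le> real n * infdist y (- U)" using pos by (simp add: field_simps)
    thus ?case by (simp add: bump_def)
  qed
  thus ?thesis using True by (simp add: tendsto_eventually)
qed (auto simp: bump_def)

context geometric_datum
begin

lemma bl_form_continuous_le:
  assumes cont: "\<And>j. j \<in> J \<Longrightarrow> continuous_on UNIV (f j)" and bdd: "\<And>j y. j \<in> J \<Longrightarrow> f j y \<le> B"
    and f0: "\<And>j y. 0 \<le> f j y"
    and f: "\<And>j. j \<in> J \<Longrightarrow> (\<integral>\<^sup>+y. ennreal (f j y) \<partial>sl (G j)) \<le> ennreal (b j)" and b: "\<And>j. j \<in> J \<Longrightarrow> 0 \<le> b j"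
  shows "bl_form J H L q f \<le> ennreal (\<Prod>j\<in>J. b j powr q j)"
proof -
  define d where "d j = enn2real (\<integral>\<^sup>+y. ennreal (f j y) \<partial>sl (G j))" for j
  have d: "(\<integral>\<^sup>+y. ennreal (f j y) \<partial>sl (G j)) = ennreal (d j)" if "j \<in> J" for j
    unfolding d_def using le_less_trans[OF f[OF that] ennreal_less_top] by simp
  have d0: "0 \<le> d j" for j by (simp add: d_def)
  have "bl_form J H L q f \<le> ennreal (\<Prod>j\<in>J. d j powr q j)"
    by (rule bl_form_continuous[OF cont bdd f0 d d0])
  also have "\<dots> \<le> ennreal (\<Prod>j\<in>J. b j powr q j)"
  proof (intro ennreal_leI prod_mono conjI powr_mono2)
    fix j assume j: "j \<in> J"
    show "d j \<le> b j" using f[OF j] d[OF j] b[OF j] by (simp add: ennreal_le_iff)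
    show "0 \<le> q j" using q[OF j] by simp
  qed (use d0 in auto)
  finally show ?thesis .
qed

text \<open>Bumps below the indicators have no larger integrals than the step functions themselves,
  and they converge pointwise, so the bound for continuous functions passes to the limit.\<close>

lemma bl_form_open_step:
  assumes V: "\<And>j. j \<in> J \<Longrightarrow> finite (V j)" and U: "\<And>j v. j \<in> J \<Longrightarrow> v \<in> V j \<Longrightarrow> open (U j v) \<and> bounded (U j v)"
    and V0: "\<And>j v. j \<in> J \<Longrightarrow> v \<in> V j \<Longrightarrow> 0 \<le> v"
    and f: "\<And>j. j \<in> J \<Longrightarrow> (\<integral>\<^sup>+y. ennreal (\<Sum>v\<in>V j. v * indicator (U j v) y) \<partial>sl (G j)) \<le> ennreal (b j)" and b: "\<And>j. j \<in> J \<Longrightarrow> 0 \<le> b j"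
  shows "bl_form J H L q (\<lambda>j y. \<Sum>v\<in>V j. v * indicator (U j v) y) \<le> ennreal (\<Prod>j\<in>J. b j powr q j)"
proof -
  define g where "g n j y = (if j \<in> J then \<Sum>v\<in>V j. v * bump (U j v) n y else 0)" for n j y
  have g0: "0 \<le> g n j y" for n j y
    unfolding g_def using V0 bump_bounds(1)[OF U[THEN conjunct1]] by (auto intro!: sum_nonneg mult_nonneg_nonneg)
  have gle: "g n j y \<le> (\<Sum>v\<in>V j. v * indicator (U j v) y)" if "j \<in> J" for n j y
    unfolding g_def using V0 bump_bounds(2)[OF U[THEN conjunct1]] that by (auto intro!: sum_mono mult_left_mono)
  have gc: "continuous_on UNIV (g n j)" if "j \<in> J" for n j
    unfolding g_def using that by (auto intro!: continuous_on_sum continuous_on_mult bump_continuous continuous_on_const)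
  define B where "B = (\<Sum>j\<in>J. \<Sum>v\<in>V j. v)"
  have gB: "g n j y \<le> B" if j: "j \<in> J" for n j y
  proof -
    have "g n j y \<le> (\<Sum>v\<in>V j. v * 1)"
      by (rule order_trans[OF gle[OF j]], intro sum_mono mult_left_mono) (use V0 j in \<open>auto simp: indicator_def\<close>)
    also have "\<dots> = (\<Sum>v\<in>V j. v)" by simp
    also have "\<dots> \<le> B" unfolding B_def
      by (rule member_le_sum[OF j _ J]) (use V0 in \<open>auto intro: sum_nonneg\<close>)
    finally show ?thesis .
  qed
  show ?thesis
  proof (rule bl_form_fatou[OF H J q L, where f = g and b = "\<lambda>_. ennreal (\<Prod>j\<in>J. b j powr q j)"])
    show "bl_form J H L q (g n) \<le> ennreal (\<Prod>j\<in>J. b j powr q j)" for n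
    proof (rule bl_form_continuous_le[OF gc gB g0])
      fix j assume j: "j \<in> J"
      have "(\<integral>\<^sup>+y. ennreal (g n j y) \<partial>sl (G j)) \<le> (\<integral>\<^sup>+y. ennreal (\<Sum>v\<in>V j. v * indicator (U j v) y) \<partial>sl (G j))"
        by (intro nn_integral_mono ennreal_leI gle[OF j])
      thus "(\<integral>\<^sup>+y. ennreal (g n j y) \<partial>sl (G j)) \<le> ennreal (b j)" using f[OF j] by (rule order_trans)
    qed (use b in auto)
    show "(\<lambda>n. g n j (L j x)) \<longlonglongrightarrow> (\<Sum>v\<in>V j. v * indicator (U j v) (L j x))" if j: "j \<in> J" for j x
      unfolding g_def using j U by (auto intro!: tendsto_sum tendsto_mult tendsto_const bump_tendsto)
    show "g n j \<in> borel_measurable borel" if "j \<in> J" for n j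
      by (rule borel_measurable_continuous_onI[OF gc[OF that]])
  qed (use g0 in auto)
qed

text \<open>A general Borel level set cannot be approximated from below by bumps, so it is
  majorized: each one is enlarged to an open set whose measure is larger by at most
  \<open>d\<close>. The integral of \<open>f j\<close> grows by at most \<open>d * W j\<close>, and
  \<open>d\<close> tends to 0.\<close>

lemma bl_form_simple:
  assumes mf[measurable]: "\<And>j. j \<in> J \<Longrightarrow> f j \<in> borel_measurable borel" and fin: "\<And>j. j \<in> J \<Longrightarrow> finite (range (f j))"
    and f0: "\<And>j y. 0 \<le> f j y" and supp: "\<And>j y. j \<in> J \<Longrightarrow> f j y \<noteq> 0 \<Longrightarrow> y \<in> cball 0 m"
    and f: "\<And>j. j \<in> J \<Longrightarrow> (\<integral>\<^sup>+y. ennreal (f j y) \<partial>sl (G j)) = ennreal (b j)" and b: "\<And>j. j \<in> J \<Longrightarrow> 0 \<le> b j"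
  shows "bl_form J H L q f \<le> ennreal (\<Prod>j\<in>J. b j powr q j)"
proof -
  \<comment> \<open>The value 0 is removed because its level set is unbounded, whereas the covering
    open sets have to be bounded.\<close>
  define V where "V j = range (f j) - {0}" for j
  have V: "finite (V j)" if "j \<in> J" for j using fin[OF that] by (simp add: V_def)
  have V0: "0 \<le> v" if "v \<in> V j" for j v using that f0 by (auto simp: V_def)
  have rep: "f j y = (\<Sum>v\<in>V j. v * indicator (f j -` {v}) y)" if j: "j \<in> J" for j y
  proof -
    have "(\<Sum>v\<in>V j. v * indicator (f j -` {v}) y) = (\<Sum>v\<in>V j. if v = f j y then v else 0)"
      by (intro sum.cong refl) (auto simp: indicator_def)
    also have "\<dots> = f j y" using V[OF j] by (simp add: V_def)
    finally show ?thesis by simp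
  qed
  have sE: "f j -` {v} \<in> sets borel" if "j \<in> J" for j v
    using measurable_sets[OF mf[OF that], of "{v}"] by simp
  have Esub: "f j -` {v} \<subseteq> cball 0 m" if "j \<in> J" "v \<in> V j" for j v
    using supp[OF that(1)] that(2) unfolding V_def by blast
  define R where "R j v d U \<longleftrightarrow> open U \<and> bounded U \<and> f j -` {v} \<subseteq> U \<and> emeasure (sl (G j)) U \<le> emeasure (sl (G j)) (f j -` {v}) + ennreal d"
    for j v d U
  have R: "\<exists>U. R j v d U" if "j \<in> J" "v \<in> V j" "d > 0" for j v d
    unfolding R_def by (rule sl_outer_regular[OF G[OF that(1)] sE[OF that(1)] Esub[OF that(1,2)] that(3)]) (intro exI conjI)
  define U where "U j v d = (SOME U. R j v d U)" for j v d
  have U: "open (U j v d) \<and> bounded (U j v d) \<and> f j -` {v} \<subseteq> U j v d \<and>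
       emeasure (sl (G j)) (U j v d) \<le> emeasure (sl (G j)) (f j -` {v}) + ennreal d" if "j \<in> J" "v \<in> V j" "d > 0" for j v d
    using someI_ex[OF R[OF that]] unfolding U_def R_def .
  define W where "W j = (\<Sum>v\<in>V j. v)" for j
  have W0: "W j \<ge> 0" if "j \<in> J" for j unfolding W_def using V0 by (intro sum_nonneg) auto
  have bd: "bl_form J H L q f \<le> ennreal (\<Prod>j\<in>J. (b j + d * W j) powr q j)" if d: "d > 0" for d
  proof -
    have "bl_form J H L q f \<le> bl_form J H L q (\<lambda>j y. \<Sum>v\<in>V j. v * indicator (U j v d) y)"
    proof (rule bl_form_mono[OF H])
      fix j x assume j: "j \<in> J"
      show "0 \<le> f j (L j x) \<and> f j (L j x) \<le> (\<Sum>v\<in>V j. v * indicator (U j v d) (L j x))"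
      proof
        have "v * indicator (f j -` {v}) (L j x) \<le> v * indicator (U j v d) (L j x)" if "v \<in> V j" for v
          using V0[OF that] U[OF j that d] by (intro mult_left_mono) (auto simp: indicator_def)
        thus "f j (L j x) \<le> (\<Sum>v\<in>V j. v * indicator (U j v d) (L j x))"
          by (subst rep[OF j]) (rule sum_mono)
      qed (rule f0)
    qed (use q in \<open>auto simp: less_imp_le\<close>)
    also have "\<dots> \<le> ennreal (\<Prod>j\<in>J. (b j + d * W j) powr q j)"
    proof (rule bl_form_open_step[OF V])
      fix j assume j: "j \<in> J"
      have io: "(\<integral>\<^sup>+y. ennreal (\<Sum>v\<in>V j. v * indicator (X v) y) \<partial>sl (G j)) = (\<Sum>v\<in>V j. ennreal v * emeasure (sl (G j)) (X v))"
        if X: "\<And>v. v \<in> V j \<Longrightarrow> X v \<in> sets borel" for X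
      proof -
        have "(\<integral>\<^sup>+y. ennreal (\<Sum>v\<in>V j. v * indicator (X v) y) \<partial>sl (G j)) = (\<integral>\<^sup>+y. (\<Sum>v\<in>V j. ennreal v * indicator (X v) y) \<partial>sl (G j))"
          using V0 by (intro nn_integral_cong) (auto simp: sum_ennreal[symmetric] ennreal_mult' ennreal_indicator intro!: sum.cong)
        also have "\<dots> = (\<Sum>v\<in>V j. \<integral>\<^sup>+y. ennreal v * indicator (X v) y \<partial>sl (G j))"
          using X by (intro nn_integral_sum) auto
        also have "\<dots> = (\<Sum>v\<in>V j. ennreal v * emeasure (sl (G j)) (X v))"
          using X by (intro sum.cong refl nn_integral_cmult_indicator) auto
        finally show ?thesis .
      qed
      have "(\<integral>\<^sup>+y. ennreal (\<Sum>v\<in>V j. v * indicator (U j v d) y) \<partial>sl (G j)) = (\<Sum>v\<in>V j. ennreal v * emeasure (sl (G j)) (U j v d))"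
        by (rule io) (use U[OF j _ d] in auto)
      also have "\<dots> \<le> (\<Sum>v\<in>V j. ennreal v * (emeasure (sl (G j)) (f j -` {v}) + ennreal d))"
        using U[OF j _ d] by (intro sum_mono mult_left_mono) auto
      also have "\<dots> = (\<Sum>v\<in>V j. ennreal v * emeasure (sl (G j)) (f j -` {v})) + (\<Sum>v\<in>V j. ennreal (v * d))"
        using V0 d by (simp add: distrib_left sum.distrib ennreal_mult')
      also have "(\<Sum>v\<in>V j. ennreal v * emeasure (sl (G j)) (f j -` {v})) = ennreal (b j)"
        using io[of "\<lambda>v. f j -` {v}"] sE[OF j] f[OF j] by (simp flip: rep[OF j])
      also have "(\<Sum>v\<in>V j. ennreal (v * d)) = ennreal (d * W j)"
        using V0 d by (subst sum_ennreal) (auto simp: W_def sum_distrib_left mult.commute)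
      also have "ennreal (b j) + ennreal (d * W j) = ennreal (b j + d * W j)"
        using b[OF j] d W0[OF j] by (intro ennreal_plus[symmetric]) auto
      finally show "(\<integral>\<^sup>+y. ennreal (\<Sum>v\<in>V j. v * indicator (U j v d) y) \<partial>sl (G j)) \<le> ennreal (b j + d * W j)" .
      show "0 \<le> b j + d * W j" using b[OF j] d W0[OF j] by auto
    qed (use U d V0 in auto)
    finally show ?thesis .
  qed
  define d where "d n = 1 / (real n + 1)" for n :: nat
  have d0: "d \<longlonglongrightarrow> 0" unfolding d_def using LIMSEQ_inverse_real_of_nat by (simp add: inverse_eq_divide add.commute)
  have "(\<lambda>n. ennreal (\<Prod>j\<in>J. (b j + d n * W j) powr q j)) \<longlonglongrightarrow> ennreal (\<Prod>j\<in>J. (b j + 0 * W j) powr q j)"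
  proof (intro tendsto_ennrealI tendsto_prod tendsto_powr' tendsto_const tendsto_add tendsto_mult d0)
    fix j assume j: "j \<in> J"
    show "b j + 0 * W j \<noteq> 0 \<or> 0 < q j \<and> (\<forall>\<^sub>F n in sequentially. 0 \<le> b j + d n * W j)"
      using q[OF j] b[OF j] W0[OF j] by (simp add: d_def)
  qed
  hence "bl_form J H L q f \<le> ennreal (\<Prod>j\<in>J. (b j + 0 * W j) powr q j)"
  proof (rule LIMSEQ_le_const)
    show "\<exists>N. \<forall>n\<ge>N. bl_form J H L q f \<le> ennreal (\<Prod>j\<in>J. (b j + d n * W j) powr q j)"
      by (intro exI allI impI bd) (simp add: d_def add_pos_nonneg)
  qed
  thus ?thesis by simp
qed

end

lemma ennreal_powr_mono:
  assumes "x \<le> y" "q \<ge> 0"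
  shows "ennreal_powr x q \<le> ennreal_powr y q"
proof (cases "y = \<infinity>")
  case False
  hence "x \<noteq> \<infinity>" using assms by (auto simp: top_unique)
  moreover have "enn2real x \<le> enn2real y" using assms False by (intro enn2real_mono) (auto simp: less_top)
  ultimately show ?thesis using False assms unfolding ennreal_powr_def by (auto intro!: ennreal_leI powr_mono2)
qed (simp add: ennreal_powr_def)

lemma prod_mono_ennreal:
  fixes f g :: "'i \<Rightarrow> ennreal"
  assumes "\<And>i. i \<in> A \<Longrightarrow> f i \<le> g i"
  shows "prod f A \<le> prod g A"
  using assms by (induction A rule: infinite_finite_induct) (auto intro: mult_mono)

lemma ennreal_powr_ennreal: "0 \<le> r \<Longrightarrow> ennreal_powr (ennreal r) q = ennreal (r powr q)"
  by (simp add: ennreal_powr_def)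

text \<open>Simple functions increasing to \<open>f j\<close> are cut off to balls, which keeps
  their integrals finite even if that of \<open>f j\<close> is not. Their right-hand sides are
  bounded by the one for \<open>f\<close>, and Fatou's lemma finishes.\<close>

theorem (in geometric_datum) bl_form_le:
  assumes mf[measurable]: "\<And>j. j \<in> J \<Longrightarrow> f j \<in> borel_measurable borel" and f0: "\<And>j y. 0 \<le> f j y"
  shows "bl_form J H L q f \<le> (\<Prod>j\<in>J. ennreal_powr (\<integral>\<^sup>+y. ennreal (f j y) \<partial>sl (G j)) (q j))"
proof -
  define P where "P j s \<longleftrightarrow> (\<forall>n. s n \<in> borel_measurable borel \<and> finite (range (s n)) \<and> (\<forall>y. 0 \<le> s n y \<and> s n y \<le> f j y)) \<and> (\<forall>y. (\<lambda>n. s n y) \<longlonglongrightarrow> f j y)"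
    for j and s :: "nat \<Rightarrow> 'b \<Rightarrow> real"
  have "\<forall>j\<in>J. \<exists>s. P j s"
  proof
    fix j assume j: "j \<in> J"
    obtain s where s': "incseq s \<and> (\<forall>i. simple_function borel (s i)) \<and> (\<forall>x. bdd_above (range (\<lambda>i. s i x))) \<and>
             (\<forall>i x. 0 \<le> s i x) \<and> f j = (SUP i. s i)"
      using borel_measurable_implies_simple_function_sequence_real[OF mf[OF j] f0[of j]] by (elim exE)
    have s: "incseq s" "\<And>i. simple_function borel (s i)" "\<And>x. bdd_above (range (\<lambda>i. s i x))"
       "\<And>i x. 0 \<le> s i x" "f j = (SUP i. s i)"
      using s' by simp_all
    have fs: "f j y = (SUP i. s i y)" for y unfolding s(5) by (simp add: image_comp)
    have inc: "incseq (\<lambda>i. s i y)" for y using s(1) by (auto simp: incseq_def le_fun_def)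
    have "s i y \<le> f j y" for i y unfolding fs by (rule cSUP_upper[OF UNIV_I s(3)])
    moreover have "(\<lambda>n. s n y) \<longlonglongrightarrow> f j y" for y unfolding fs by (rule LIMSEQ_incseq_SUP[OF s(3) inc])
    moreover have "finite (range (s n))" for n using s(2)[of n] by (simp add: simple_function_def)
    moreover have "s n \<in> borel_measurable borel" for n by (rule borel_measurable_simple_function[OF s(2)])
    ultimately show "\<exists>s. P j s" unfolding P_def using s(4) by (intro exI[of _ s]) simp
  qed
  from bchoice[OF this] obtain s where s: "\<forall>j\<in>J. P j (s j)" ..
  define g where "g n j y = (if j \<in> J then s j n y * indicator (cball 0 (real n)) y else 0)" for n :: nat and j y
  have g0: "0 \<le> g n j y" for n j y using s by (simp add: g_def P_def)
  have gf: "g n j y \<le> f j y" for n j y using s f0[of j y] by (auto simp: g_def P_def indicator_def)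
  have mg: "g n j \<in> borel_measurable borel" if "j \<in> J" for n j
  proof -
    have "s j n \<in> borel_measurable borel" using s that by (simp add: P_def)
    hence "(\<lambda>y. s j n y * indicator (cball 0 (real n)) y) \<in> borel_measurable borel"
      by (intro borel_measurable_times borel_measurable_indicator) auto
    thus ?thesis unfolding g_def using that by simp
  qed
  show ?thesis
  proof (rule bl_form_fatou[OF H J q L, where f = g and b = "\<lambda>_. \<Prod>j\<in>J. ennreal_powr (\<integral>\<^sup>+y. ennreal (f j y) \<partial>sl (G j)) (q j)"])
    show "(\<lambda>n. g n j (L j x)) \<longlonglongrightarrow> f j (L j x)" if j: "j \<in> J" for j x
    proof -
      have "\<forall>\<^sub>F n in sequentially. s j n (L j x) = g n j (L j x)"
      proof -
        obtain N :: nat where N: "norm (L j x) \<le> real N" using real_arch_simple by blast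
        show ?thesis using eventually_ge_at_top[of N]
          by eventually_elim (use N j in \<open>auto simp: g_def\<close>)
      qed
      moreover have "(\<lambda>n. s j n (L j x)) \<longlonglongrightarrow> f j (L j x)" using s j by (simp add: P_def)
      ultimately show ?thesis by (rule Lim_transform_eventually[rotated])
    qed
    show "bl_form J H L q (g n) \<le> (\<Prod>j\<in>J. ennreal_powr (\<integral>\<^sup>+y. ennreal (f j y) \<partial>sl (G j)) (q j))" for n
    proof -
      define b where "b j = enn2real (\<integral>\<^sup>+y. ennreal (g n j y) \<partial>sl (G j))" for j
      have b0: "0 \<le> b j" for j by (simp add: b_def)
      have b: "(\<integral>\<^sup>+y. ennreal (g n j y) \<partial>sl (G j)) = ennreal (b j)" if j: "j \<in> J" for j
      proof -
        have fr: "finite (range (s j n))" using s j by (simp add: P_def)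
        have "(\<integral>\<^sup>+y. ennreal (g n j y) \<partial>sl (G j)) \<le> (\<integral>\<^sup>+y. ennreal (Max (range (s j n))) * indicator (cball 0 (real n)) y \<partial>sl (G j))"
          using j fr by (intro nn_integral_mono) (auto simp: g_def indicator_def intro!: ennreal_leI Max_ge)
        also have "\<dots> = ennreal (Max (range (s j n))) * emeasure (sl (G j)) (cball 0 (real n))"
          by (rule nn_integral_cmult_indicator) simp
        also have "\<dots> < \<infinity>"
          using le_less_trans[OF haar_on_emeasure_cball[OF haar_on_sl[OF G[OF j]], of "real n"] ennreal_less_top]
          by (simp add: ennreal_mult_less_top)
        finally show ?thesis unfolding b_def by simp
      qed
      have "bl_form J H L q (g n) \<le> ennreal (\<Prod>j\<in>J. b j powr q j)"
      proof (rule bl_form_simple[OF mg _ g0 _ b])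
        fix j assume j: "j \<in> J"
        have fr: "finite (range (s j n))" using s j by (simp add: P_def)
        have "range (g n j) \<subseteq> insert 0 (range (s j n))" using j by (auto simp: g_def indicator_def)
        thus "finite (range (g n j))" using fr finite_subset by blast
        show "y \<in> cball 0 (real n)" if "g n j y \<noteq> 0" for y using that j by (auto simp: g_def indicator_def split: if_splits)
      qed (auto simp: b0)
      also have "\<dots> = (\<Prod>j\<in>J. ennreal_powr (\<integral>\<^sup>+y. ennreal (g n j y) \<partial>sl (G j)) (q j))"
        by (subst prod_ennreal[symmetric]) (auto intro!: prod.cong simp: b ennreal_powr_ennreal b0)
      also have "\<dots> \<le> (\<Prod>j\<in>J. ennreal_powr (\<integral>\<^sup>+y. ennreal (f j y) \<partial>sl (G j)) (q j))"
      proof (intro prod_mono_ennreal ennreal_powr_mono)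
        fix j assume j: "j \<in> J"
        show "(\<integral>\<^sup>+y. ennreal (g n j y) \<partial>sl (G j)) \<le> (\<integral>\<^sup>+y. ennreal (f j y) \<partial>sl (G j))"
          by (intro nn_integral_mono ennreal_leI gf)
        show "0 \<le> q j" using q[OF j] by simp
      qed
      finally show ?thesis .
    qed
  qed (use g0 mg in auto)
qed

section \<open>Quadratic forms and their Gaussian integrals\<close>

text \<open>Splits off a prescribed unit vector as the first member of a frame. It serves the
  rank-one formula, the induction of the spectral theorem and the nondegeneracy of the maps
  \<open>L j\<close>.\<close>

lemma orthonormal_family_cons:
  fixes S :: "'a::euclidean_space set"
  assumes S: "subspace S" and w: "w \<in> S" "norm w = 1"
  defines "S' \<equiv> {x \<in> S. w \<bullet> x = 0}"
  shows "subspace S'" "dim S = Suc (dim S')"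
    and "\<And>e. orthonormal_family {..<dim S'} e \<Longrightarrow> e ` {..<dim S'} \<subseteq> S' \<Longrightarrow>
       orthonormal_family {..<Suc (dim S')} (\<lambda>i. case i of 0 \<Rightarrow> w | Suc k \<Rightarrow> e k)"
proof -
  show S': "subspace S'"
    unfolding S'_def using S by (auto simp: subspace_def inner_add_right)
  have ww: "w \<bullet> w = 1" using w by (simp add: norm_eq_1)
  show cons: "orthonormal_family {..<Suc (dim S')} (\<lambda>i. case i of 0 \<Rightarrow> w | Suc k \<Rightarrow> e k)"
    if e: "orthonormal_family {..<dim S'} e" "e ` {..<dim S'} \<subseteq> S'" for e
    unfolding orthonormal_family_def
  proof (intro ballI)
    fix i k assume ik: "i \<in> {..<Suc (dim S')}" "k \<in> {..<Suc (dim S')}"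
    have "w \<bullet> e m = 0" "e m \<bullet> w = 0" if "m < dim S'" for m
      using e(2) that by (auto simp: S'_def inner_commute)
    thus "(case i of 0 \<Rightarrow> w | Suc k \<Rightarrow> e k) \<bullet> (case k of 0 \<Rightarrow> w | Suc k \<Rightarrow> e k) = (if i = k then 1 else 0)"
      using ik ww e(1) by (auto simp: orthonormal_family_def split: nat.splits)
  qed
  obtain e where e: "orthonormal_family {..<dim S'} e" "span (e ` {..<dim S'}) = S'"
    using orthonormal_family_exists[OF S', of "{..<dim S'}"] by auto
  let ?e = "\<lambda>i. case i of 0 \<Rightarrow> w | Suc k \<Rightarrow> e k"
  have sub: "e ` {..<dim S'} \<subseteq> S'" using span_superset[of "e ` {..<dim S'}"] e(2) by simp
  have on: "orthonormal_family {..<Suc (dim S')} ?e" by (rule cons[OF e(1) sub])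
  have im: "?e ` {..<Suc (dim S')} = insert w (e ` {..<dim S'})"
    by (subst lessThan_Suc_eq_insert_0) (auto simp: image_image)
  have "span (?e ` {..<Suc (dim S')}) = S"
  proof
    have "insert w (e ` {..<dim S'}) \<subseteq> S" using w sub by (auto simp: S'_def)
    thus "span (?e ` {..<Suc (dim S')}) \<subseteq> S" unfolding im by (rule span_minimal) (rule S)
    show "S \<subseteq> span (?e ` {..<Suc (dim S')})"
    proof
      fix x assume x: "x \<in> S"
      have "x - (w \<bullet> x) *\<^sub>R w \<in> S'"
        unfolding S'_def using x w S ww by (simp add: subspace_diff subspace_scale inner_diff_right)
      hence "x - (w \<bullet> x) *\<^sub>R w \<in> span (e ` {..<dim S'})" using e(2) by simp
      thus "x \<in> span (?e ` {..<Suc (dim S')})" unfolding im span_insert by blast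
    qed
  qed
  thus "dim S = Suc (dim S')" using orthonormal_family_card[OF on] by simp
qed

text \<open>In a basis that starts with u / |u| the form is diagonal with eigenvalues 1 + \<kappa>
  |u|^2, 1, ..., 1. This is the matrix determinant lemma for a rank-one perturbation of the
  identity.\<close>

lemma zf_rank_one:
  assumes S: "subspace S" and u: "u \<in> S" and k: "1 + \<kappa> * (norm u)\<^sup>2 > 0"
  shows "zf S (\<lambda>x. (norm x)\<^sup>2 + \<kappa> * (u \<bullet> x)\<^sup>2) = ennreal (1 / sqrt (1 + \<kappa> * (norm u)\<^sup>2))"
proof (cases "u = 0")
  case True thus ?thesis using zf_norm[OF S] by simp
next
  case False
  define w where "w = u /\<^sub>R norm u"
  have w: "w \<in> S" "norm w = 1" using False u S by (auto simp: w_def subspace_scale)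
  define S' where "S' = {x \<in> S. w \<bullet> x = 0}"
  note c = orthonormal_family_cons[OF S w, folded S'_def]
  obtain e where e: "orthonormal_family {..<dim S'} e" "span (e ` {..<dim S'}) = S'"
    using orthonormal_family_exists[OF c(1), of "{..<dim S'}"] by auto
  have sub: "e ` {..<dim S'} \<subseteq> S'" using span_superset[of "e ` {..<dim S'}"] e(2) by simp
  let ?e = "\<lambda>i. case i of 0 \<Rightarrow> w | Suc k \<Rightarrow> e k"
  have on: "orthonormal_family {..<Suc (dim S')} ?e" by (rule c(3)[OF e(1) sub])
  have "S' \<subseteq> S" by (auto simp: S'_def)
  hence "e i \<in> S" if "i < dim S'" for i using sub that by auto
  hence es: "?e ` {..<Suc (dim S')} \<subseteq> S" using w by (auto split: nat.splits)
  have sp: "span (?e ` {..<Suc (dim S')}) = S"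
    by (rule orthonormal_family_spans[OF on es S]) (simp add: c(2))
  let ?lam = "\<lambda>i::nat. if i = 0 then 1 + \<kappa> * (norm u)\<^sup>2 else 1"
  have "zf S (\<lambda>x. (norm x)\<^sup>2 + \<kappa> * (u \<bullet> x)\<^sup>2) = ennreal (\<Prod>i\<in>{..<Suc (dim S')}. 1 / sqrt (?lam i))"
  proof (rule zf_diag[OF on sp])
    fix d :: "nat \<Rightarrow> real"
    let ?x = "\<Sum>i\<in>{..<Suc (dim S')}. d i *\<^sub>R ?e i"
    have "u = norm u *\<^sub>R w" using False by (simp add: w_def)
    hence "u \<bullet> ?x = norm u * (?x \<bullet> w)" by (metis inner_commute inner_scaleR_left)
    also have "?x \<bullet> w = d 0" using orthonormal_family_inner_sum[OF on, of 0 d] by simp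
    finally have ux: "(u \<bullet> ?x)\<^sup>2 = (norm u)\<^sup>2 * (d 0)\<^sup>2" by (simp add: power_mult_distrib)
    have nx: "(norm ?x)\<^sup>2 = (\<Sum>i\<in>{..<Suc (dim S')}. (d i)\<^sup>2)"
      by (rule orthonormal_family_norm[OF on]) simp
    have "(\<Sum>i\<in>{..<Suc (dim S')}. ?lam i * (d i)\<^sup>2) = (\<Sum>i\<in>{..<Suc (dim S')}. (d i)\<^sup>2) + \<kappa> * ((norm u)\<^sup>2 * (d 0)\<^sup>2)"
      unfolding sum.lessThan_Suc_shift by (simp add: algebra_simps)
    thus "(norm ?x)\<^sup>2 + \<kappa> * (u \<bullet> ?x)\<^sup>2 = (\<Sum>i\<in>{..<Suc (dim S')}. ?lam i * (d i)\<^sup>2)"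
      by (simp only: ux nx)
  qed (use k in auto)
  also have "(\<Prod>i\<in>{..<Suc (dim S')}. 1 / sqrt (?lam i)) = 1 / sqrt (1 + \<kappa> * (norm u)\<^sup>2)"
    unfolding prod.lessThan_Suc_shift by simp
  finally show ?thesis .
qed

text \<open>The substitute for multiplicativity of the determinant.\<close>

lemma zf_compose:
  fixes T :: "'a::euclidean_space \<Rightarrow> 'b::euclidean_space"
  assumes "subspace S" "linear T" "T ` S = K" and Q: "Q \<in> borel_measurable borel"
  shows "zf S (\<lambda>x. Q (T x)) = zf S (\<lambda>x. (norm (T x))\<^sup>2) * zf K Q"
proof -
  have "(\<lambda>y. ennreal (exp (- pi * Q y))) \<in> borel_measurable borel" using Q by measurable
  from sl_linear_image[OF assms(1-3) this] show ?thesis by (simp add: zf_def)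
qed

lemma zf_inverse:
  fixes T :: "'a::euclidean_space \<Rightarrow> 'b::euclidean_space"
  assumes S: "subspace S" and T: "linear T" "T ` S = K" and T': "linear T'" "\<And>x. x \<in> S \<Longrightarrow> T' (T x) = x"
  shows "zf S (\<lambda>x. (norm (T x))\<^sup>2) * zf K (\<lambda>y. (norm (T' y))\<^sup>2) = 1"
proof -
  have [measurable]: "T' \<in> borel_measurable borel" using T'(1) by (rule linear_borel_measurable)
  have "zf S (\<lambda>x. (norm (T' (T x)))\<^sup>2) = zf S (\<lambda>x. (norm (T x))\<^sup>2) * zf K (\<lambda>y. (norm (T' y))\<^sup>2)"
    by (rule zf_compose[OF S T]) measurable
  moreover have "zf S (\<lambda>x. (norm (T' (T x)))\<^sup>2) = zf S (\<lambda>x. (norm x)\<^sup>2)"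
    by (rule zf_cong[OF S]) (simp add: T'(2))
  ultimately show ?thesis using zf_norm[OF S] by simp
qed

definition zr :: "'a::euclidean_space set \<Rightarrow> ('a \<Rightarrow> real) \<Rightarrow> real" where
  "zr S Q = enn2real (zf S Q)"

text \<open>With a left inverse of \<open>T\<close> on \<open>S\<close>, 1 becomes a product of two
  such integrals; hence neither can be 0 or infinite.\<close>

lemma zf_linear_pos_finite:
  fixes T :: "'a::euclidean_space \<Rightarrow> 'b::euclidean_space"
  assumes S: "subspace S" and T: "linear T" "inj_on T S"
  shows "zf S (\<lambda>x. (norm (T x))\<^sup>2) = ennreal (zr S (\<lambda>x. (norm (T x))\<^sup>2))" "zr S (\<lambda>x. (norm (T x))\<^sup>2) > 0"
proof -
  obtain T' where T': "linear T'" "\<forall>x\<in>S. T' (T x) = x"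
    using linear_exists_left_inverse_on[OF T(1) S T(2)] by blast
  have i: "zf S (\<lambda>x. (norm (T x))\<^sup>2) * zf (T ` S) (\<lambda>y. (norm (T' y))\<^sup>2) = 1"
    by (rule zf_inverse[OF S T(1) refl T'(1)]) (use T'(2) in auto)
  have "zf S (\<lambda>x. (norm (T x))\<^sup>2) \<noteq> 0" using i by auto
  moreover have "zf S (\<lambda>x. (norm (T x))\<^sup>2) \<noteq> top" using i by (auto simp: ennreal_top_mult split: if_splits)
  ultimately show "zf S (\<lambda>x. (norm (T x))\<^sup>2) = ennreal (zr S (\<lambda>x. (norm (T x))\<^sup>2))" "zr S (\<lambda>x. (norm (T x))\<^sup>2) > 0"
    unfolding zr_def by (auto simp: less_top zero_less_iff_neq_zero enn2real_positive_iff)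
qed

text \<open>The spectral theorem by induction on the dimension: a minimizer of the form on the unit
  sphere comes first, its orthogonal complement is treated recursively. Taking minima yields the
  eigenvalues in increasing order, which the summation by parts relies on.\<close>

lemma spectral_orthonormal:
  fixes B :: "'a::euclidean_space \<Rightarrow> 'a \<Rightarrow> real"
  assumes B: "bilinear B" and sym: "\<And>x y. B x y = B y x" and "subspace S"
  shows "\<exists>e. orthonormal_family {..<dim S} e \<and> e ` {..<dim S} \<subseteq> S \<and>
     (\<forall>i<dim S. \<forall>k<dim S. i \<noteq> k \<longrightarrow> B (e i) (e k) = 0) \<and>
     (\<forall>i k. i \<le> k \<longrightarrow> k < dim S \<longrightarrow> B (e i) (e i) \<le> B (e k) (e k))"
  using \<open>subspace S\<close>
proof (induction "dim S" arbitrary: S)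
  case 0
  hence d: "dim S = 0" by simp
  show ?case unfolding d by (intro exI[of _ "\<lambda>_. 0"]) (auto simp: orthonormal_family_def)
next
  case (Suc n)
  have bb: "bounded_bilinear B" using B by (simp add: bilinear_conv_bounded_bilinear)
  let ?K = "S \<inter> sphere 0 1"
  have "compact ?K" using closed_subspace[OF Suc.prems] by (intro closed_Int_compact) auto
  moreover have "?K \<noteq> {}"
  proof -
    have "S \<noteq> {0}" using Suc.hyps(2) by auto
    then obtain x where x: "x \<in> S" "x \<noteq> 0" using Suc.prems subspace_0 by blast
    hence "x /\<^sub>R norm x \<in> ?K" using Suc.prems by (simp add: subspace_scale)
    thus ?thesis by blast
  qed
  moreover have "continuous_on ?K (\<lambda>x. B x x)"
    by (intro bounded_bilinear.continuous_on[OF bb] continuous_on_id)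
  ultimately obtain w where w': "w \<in> ?K" and min: "\<And>x. x \<in> ?K \<Longrightarrow> B w w \<le> B x x"
    using continuous_attains_inf[of ?K "\<lambda>x. B x x"] by blast
  have w: "w \<in> S" "norm w = 1" using w' by auto
  define S' where "S' = {x \<in> S. w \<bullet> x = 0}"
  note c = orthonormal_family_cons[OF Suc.prems w, folded S'_def]
  have n: "n = dim S'" using c(2) Suc.hyps(2) by simp
  obtain e where e: "orthonormal_family {..<dim S'} e" "e ` {..<dim S'} \<subseteq> S'"
     "\<forall>i<dim S'. \<forall>k<dim S'. i \<noteq> k \<longrightarrow> B (e i) (e k) = 0"
     "\<forall>i k. i \<le> k \<longrightarrow> k < dim S' \<longrightarrow> B (e i) (e i) \<le> B (e k) (e k)"
    using Suc.hyps(1)[OF n c(1)] by blast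
  let ?e = "\<lambda>i. case i of 0 \<Rightarrow> w | Suc k \<Rightarrow> e k"
  have on: "orthonormal_family {..<Suc (dim S')} ?e" by (rule c(3)[OF e(1,2)])
  have "S' \<subseteq> S" by (auto simp: S'_def)
  hence "e i \<in> S" if "i < dim S'" for i using e(2) that by auto
  hence es: "?e ` {..<Suc (dim S')} \<subseteq> S" using w by (auto split: nat.splits)
  \<comment> \<open>The first-order condition at the minimum: moving \<open>w\<close> in a direction
    orthogonal to it changes the norm only to second order, so a nonzero B w y would lower the
    Rayleigh quotient.\<close>
  have orth: "B w y = 0" if y: "y \<in> S'" for y
  proof (rule ccontr)
    assume ne: "B w y \<noteq> 0"
    have yS: "y \<in> S" "w \<bullet> y = 0" using y by (auto simp: S'_def)
    define a where "a = B y y - B w w * (norm y)\<^sup>2"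
    have quad: "0 \<le> 2 * t * B w y + t\<^sup>2 * a" for t
    proof -
      define x where "x = w + t *\<^sub>R y"
      have xS: "x \<in> S" unfolding x_def using yS w Suc.prems by (simp add: subspace_add subspace_scale)
      have nx: "(norm x)\<^sup>2 = 1 + t\<^sup>2 * (norm y)\<^sup>2"
        unfolding x_def power2_norm_eq_inner using w(2) yS(2)
        by (simp add: inner_add_left inner_add_right norm_eq_1 inner_commute power2_eq_square)
      hence "norm x \<noteq> 0" by (smt (verit) power_zero_numeral zero_le_power2 mult_nonneg_nonneg)
      have "x /\<^sub>R norm x \<in> ?K" using xS \<open>norm x \<noteq> 0\<close> Suc.prems by (simp add: subspace_scale)
      hence "B w w \<le> B (x /\<^sub>R norm x) (x /\<^sub>R norm x)" by (rule min)
      also have "\<dots> = B x x / (norm x)\<^sup>2"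
        by (simp add: bilinear_lmul[OF B] bilinear_rmul[OF B] power2_eq_square divide_inverse)
      finally have "B w w * (norm x)\<^sup>2 \<le> B x x" using \<open>norm x \<noteq> 0\<close> by (simp add: pos_le_divide_eq)
      moreover have "B x x = B w w + 2 * t * B w y + t\<^sup>2 * B y y"
        unfolding x_def using sym[of y w]
        by (simp add: bilinear_ladd[OF B] bilinear_radd[OF B] bilinear_lmul[OF B] bilinear_rmul[OF B] power2_eq_square algebra_simps)
      ultimately show ?thesis unfolding nx a_def by (simp add: algebra_simps)
    qed
    \<comment> \<open>Small enough for the linear term to outweigh the quadratic one; the summand 1
      keeps the denominator positive.\<close>
    define t where "t = - B w y / (\<bar>a\<bar> + 1)"
    have "2 * t * B w y + t\<^sup>2 * a \<le> 2 * t * B w y + t\<^sup>2 * (\<bar>a\<bar> + 1)"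
      by (intro add_left_mono mult_left_mono) auto
    also have "t\<^sup>2 * (\<bar>a\<bar> + 1) = - t * B w y"
      unfolding t_def by (simp add: power2_eq_square divide_simps)
    finally have "2 * t * B w y + t\<^sup>2 * a \<le> t * B w y" by simp
    also have "t * B w y = - ((B w y)\<^sup>2 / (\<bar>a\<bar> + 1))" unfolding t_def by (simp add: power2_eq_square)
    also have "\<dots> < 0" using ne by (simp add: divide_pos_pos)
    finally show False using quad[of t] by simp
  qed
  have d: "dim S = Suc (dim S')" by (rule c(2))
  show ?case unfolding d
  proof (intro exI[of _ ?e] conjI on es allI impI)
    fix i k assume "i < Suc (dim S')" "k < Suc (dim S')" "i \<noteq> k"
    moreover have "B w (e m) = 0" "B (e m) w = 0" if "m < dim S'" for m
      using orth[of "e m"] sym[of w "e m"] e(2) that by auto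
    ultimately show "B (?e i) (?e k) = 0"
      using e(3) by (auto split: nat.splits)
  next
    fix i k assume ik: "i \<le> k" "k < Suc (dim S')"
    have "B w w \<le> B (e m) (e m)" if "m < dim S'" for m
    proof (rule min)
      have "e m \<in> S'" using e(2) that by auto
      moreover have "e m \<bullet> e m = 1" using e(1) that by (simp add: orthonormal_family_def)
      ultimately show "e m \<in> ?K" by (simp add: S'_def norm_eq_1)
    qed
    thus "B (?e i) (?e i) \<le> B (?e k) (?e k)"
      using ik e(4) by (auto split: nat.splits)
  qed
qed

lemma ennreal_powr_mult:
  assumes "c > 0" "q > 0"
  shows "ennreal_powr (ennreal c * x) q = ennreal (c powr q) * ennreal_powr x q"
proof (cases "x = \<infinity>")
  case True thus ?thesis using assms by (simp add: ennreal_powr_def ennreal_mult_top)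
next
  case False
  then obtain r where r: "x = ennreal r" "r \<ge> 0" by (cases x) auto
  have "ennreal_powr (ennreal c * x) q = ennreal_powr (ennreal (c * r)) q" 
    unfolding r(1) using r assms by (subst ennreal_mult[symmetric]) auto
  also have "\<dots> = ennreal ((c * r) powr q)" using r assms by (intro ennreal_powr_ennreal) auto
  also have "\<dots> = ennreal (c powr q) * ennreal (r powr q)" using r assms by (simp add: powr_mult ennreal_mult)
  finally show ?thesis using r by (simp add: ennreal_powr_ennreal)
qed

section \<open>The Gaussian functional and its maximizers\<close>

locale bl_setting =
  fixes J :: "'j set" and H :: "'a::euclidean_space set" and G :: "'j \<Rightarrow> 'b::euclidean_space set"
    and L :: "'j \<Rightarrow> 'a \<Rightarrow> 'b" and q :: "'j \<Rightarrow> real"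
  assumes J: "finite J" and H: "subspace H" and G: "\<And>j. j \<in> J \<Longrightarrow> subspace (G j)"
    and q: "\<And>j. j \<in> J \<Longrightarrow> q j > 0"
    and L: "\<And>j. j \<in> J \<Longrightarrow> linear (L j)" and LH: "\<And>j. j \<in> J \<Longrightarrow> L j ` H \<subseteq> G j"
    and crit: "(\<Sum>j\<in>J. q j * real (dim (G j))) = real (dim H)"
begin

definition N :: "('j \<Rightarrow> 'b \<Rightarrow> 'b) \<Rightarrow> 'a \<Rightarrow> real" where
  "N R x = (\<Sum>j\<in>J. q j * (norm (R j (L j x)))\<^sup>2)"

text \<open>Each \<open>R j\<close> is linear on the whole ambient type, so that its composite with
  \<open>L j\<close> is linear there, but it is required to be an automorphism on \<open>G j\<close>
  only.\<close>

definition frames :: "('j \<Rightarrow> 'b \<Rightarrow> 'b) set" where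
  "frames = {R. \<forall>j\<in>J. linear (R j) \<and> R j ` G j = G j \<and> inj_on (R j) (G j)}"

definition V :: "('j \<Rightarrow> 'b \<Rightarrow> 'b) \<Rightarrow> real" where
  "V R = zr H (N R) / (\<Prod>j\<in>J. zr (G j) (\<lambda>y. (norm (R j y))\<^sup>2) powr q j)"

lemma N_diagonal:
  assumes R: "R \<in> frames" and pd: "\<And>x. x \<in> H \<Longrightarrow> x \<noteq> 0 \<Longrightarrow> N R x > 0"
  obtains e lam where "orthonormal_family {..<dim H} e" "span (e ` {..<dim H}) = H"
    "\<And>c. N R (\<Sum>i<dim H. c i *\<^sub>R e i) = (\<Sum>i<dim H. lam i * (c i)\<^sup>2)"
    "\<And>i. i < dim H \<Longrightarrow> lam i > 0" "\<And>i k. i \<le> k \<Longrightarrow> k < dim H \<Longrightarrow> lam i \<le> lam k"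
    "\<And>i. i < dim H \<Longrightarrow> lam i = N R (e i)"
proof -
  define B where "B x y = (\<Sum>j\<in>J. q j * (R j (L j x) \<bullet> R j (L j y)))" for x y
  have lin: "linear (\<lambda>x. R j (L j x))" if "j \<in> J" for j
    using linear_compose[OF L[OF that], of "R j"] R that by (simp add: frames_def comp_def)
  have add: "R j (L j (x + y)) = R j (L j x) + R j (L j y)" "R j (L j (c *\<^sub>R x)) = c *\<^sub>R R j (L j x)" if "j \<in> J" for j x y c
    using linear_add[OF lin[OF that]] linear_cmul[OF lin[OF that]] by simp_all
  have B: "bilinear B"
    unfolding bilinear_def B_def
    by (intro conjI allI linearI) (auto simp: add inner_add_left inner_add_right sum.distrib sum_distrib_left algebra_simps intro!: sum.cong)
  have sym: "B x y = B y x" for x y unfolding B_def by (simp add: inner_commute)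
  have NB: "N R x = B x x" for x unfolding N_def B_def by (simp add: power2_norm_eq_inner)
  obtain e where e: "orthonormal_family {..<dim H} e" "e ` {..<dim H} \<subseteq> H"
     "\<forall>i<dim H. \<forall>k<dim H. i \<noteq> k \<longrightarrow> B (e i) (e k) = 0"
     "\<forall>i k. i \<le> k \<longrightarrow> k < dim H \<longrightarrow> B (e i) (e i) \<le> B (e k) (e k)"
    using spectral_orthonormal[of B, OF B sym H] by blast
  have sp: "span (e ` {..<dim H}) = H" by (rule orthonormal_family_spans[OF e(1,2) H]) simp
  show ?thesis
  proof (rule that[of e "\<lambda>i. B (e i) (e i)"])
    fix c :: "nat \<Rightarrow> real"
    have "N R (\<Sum>i<dim H. c i *\<^sub>R e i) = (\<Sum>(i,k)\<in>{..<dim H}\<times>{..<dim H}. B (c i *\<^sub>R e i) (c k *\<^sub>R e k))"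
      unfolding NB by (rule bilinear_sum[OF B])
    also have "\<dots> = (\<Sum>i<dim H. \<Sum>k<dim H. B (c i *\<^sub>R e i) (c k *\<^sub>R e k))"
      by (simp add: sum.cartesian_product)
    also have "\<dots> = (\<Sum>i<dim H. \<Sum>k<dim H. if k = i then B (e i) (e i) * (c i)\<^sup>2 else 0)"
      using e(3) by (intro sum.cong refl) (auto simp: bilinear_lmul[OF B] bilinear_rmul[OF B] power2_eq_square)
    finally show "N R (\<Sum>i<dim H. c i *\<^sub>R e i) = (\<Sum>i<dim H. B (e i) (e i) * (c i)\<^sup>2)" by simp
  next
    fix i assume i: "i < dim H"
    have "e i \<bullet> e i = 1" using e(1) i by (simp add: orthonormal_family_def)
    hence "e i \<noteq> 0" by auto
    thus "0 < B (e i) (e i)" using pd[of "e i"] e(2) i unfolding NB by auto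
  qed (use e sp NB in auto)
qed

lemma denominator_pos:
  assumes R: "R \<in> frames"
  shows "(\<Prod>j\<in>J. zr (G j) (\<lambda>y. (norm (R j y))\<^sup>2) powr q j) > 0"
proof (intro prod_pos)
  fix j assume j: "j \<in> J"
  have "zr (G j) (\<lambda>y. (norm (R j y))\<^sup>2) > 0"
    by (rule zf_linear_pos_finite(2)[OF G[OF j]]) (use R j in \<open>auto simp: frames_def\<close>)
  thus "zr (G j) (\<lambda>y. (norm (R j y))\<^sup>2) powr q j > 0" by simp
qed

text \<open>In the variables in which \<open>N R\<close> is the norm of \<open>H\<close> and R_j
  acts as the identity on \<open>G j\<close>, the maps become M_j = R_j L_j T. They satisfy Parseval
  by construction; maximality is what makes their adjoints isometric. Undoing the two changes of
  variables turns the constant 1 into exactly \<open>V R\<close>.\<close>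

lemma bl_form_le_V:
  assumes R: "R \<in> frames" and pd: "\<And>x. x \<in> H \<Longrightarrow> x \<noteq> 0 \<Longrightarrow> N R x > 0"
    and max: "\<And>R'. R' \<in> frames \<Longrightarrow> V R' \<le> V R"
    and mf: "\<And>j. j \<in> J \<Longrightarrow> f j \<in> borel_measurable borel" and f0: "\<And>j y. 0 \<le> f j y"
  shows "bl_form J H L q f \<le> ennreal (V R) * (\<Prod>j\<in>J. ennreal_powr (\<integral>\<^sup>+y. ennreal (f j y) \<partial>sl (G j)) (q j))"
proof -
  obtain e lam where e: "orthonormal_family {..<dim H} e" "span (e ` {..<dim H}) = H"
    and Ne: "\<And>c. N R (\<Sum>i<dim H. c i *\<^sub>R e i) = (\<Sum>i<dim H. lam i * (c i)\<^sup>2)"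
    and lam: "\<And>i. i < dim H \<Longrightarrow> lam i > 0"
    and "\<And>i k. i \<le> k \<Longrightarrow> k < dim H \<Longrightarrow> lam i \<le> lam k" "\<And>i. i < dim H \<Longrightarrow> lam i = N R (e i)"
    by (rule N_diagonal[OF R pd]) simp_all
  have Rj: "linear (R j)" "R j ` G j = G j" "inj_on (R j) (G j)" if "j \<in> J" for j using R that by (auto simp: frames_def)
  have eH: "e i \<in> H" if "i < dim H" for i using span_base[of "e i" "e ` {..<dim H}"] e(2) that by auto
  \<comment> \<open>The inverse square root of the form \<open>N R\<close>, written in its
    eigenbasis.\<close>
  define T where "T x = (\<Sum>i<dim H. ((x \<bullet> e i) / sqrt (lam i)) *\<^sub>R e i)" for x
  have T: "linear T"
    unfolding T_def by (rule linearI) (simp_all add: inner_add_left add_divide_distrib scaleR_add_left sum.distrib scaleR_sum_right)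
  have TH: "T x \<in> H" for x
    unfolding T_def using eH H by (intro subspace_sum subspace_scale) auto
  have NT: "N R (T x) = (norm x)\<^sup>2" if x: "x \<in> H" for x
  proof -
    have "N R (T x) = (\<Sum>i<dim H. lam i * ((x \<bullet> e i) / sqrt (lam i))\<^sup>2)" unfolding T_def by (rule Ne)
    also have "\<dots> = (\<Sum>i<dim H. (x \<bullet> e i)\<^sup>2)"
      using lam by (intro sum.cong refl) (simp add: power_divide less_imp_le order_less_imp_not_eq2)
    also have "\<dots> = (norm (\<Sum>i<dim H. (x \<bullet> e i) *\<^sub>R e i))\<^sup>2"
      by (rule orthonormal_family_norm[OF e(1), symmetric]) simp
    also have "(\<Sum>i<dim H. (x \<bullet> e i) *\<^sub>R e i) = x" by (rule orthonormal_family_expand[OF e(1)]) (use e(2) x in simp)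
    finally show ?thesis .
  qed
  have N0: "N R 0 = 0" unfolding N_def using linear_0[OF L] linear_0[OF Rj(1)] by (simp cong: sum.cong)
  have injT: "inj_on T H"
  proof (rule inj_onI)
    fix x y assume xy: "x \<in> H" "y \<in> H" "T x = T y"
    have "T (x - y) = 0" using xy(3) T by (simp add: linear_diff)
    hence "(norm (x - y))\<^sup>2 = 0" using NT[of "x - y"] xy H N0 by (simp add: subspace_diff)
    thus "x = y" by simp
  qed
  have surT: "T ` H = H"
  proof (rule subspace_dim_equal)
    show "dim H \<le> dim (T ` H)" using dim_image_eq[OF T] injT H by (simp add: span_eq_iff[THEN iffD2])
  qed (use TH T H in \<open>auto simp: linear_subspace_image\<close>)
  define zT where "zT = zr H (\<lambda>x. (norm (T x))\<^sup>2)"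
  have zT: "zf H (\<lambda>x. (norm (T x))\<^sup>2) = ennreal zT" "zT > 0"
    unfolding zT_def by (rule zf_linear_pos_finite[OF H T injT])+
  have lin: "linear (\<lambda>x. R j (L j x))" if "j \<in> J" for j
    using linear_compose[OF L[OF that] Rj(1)[OF that]] by (simp add: comp_def)
  define M where "M j x = R j (L j (T x))" for j x
  have M: "linear (M j)" if "j \<in> J" for j
    unfolding M_def using linear_compose[OF T lin[OF that]] by (simp add: comp_def)
  have MG: "M j x \<in> G j" if "j \<in> J" for j x
    unfolding M_def using LH[OF that] Rj(2)[OF that] TH[of x] by auto
  define A where "A j w = (\<Sum>i<dim H. (w \<bullet> M j (e i)) *\<^sub>R e i)" for j w
  have Alin: "linear (A j)" for j
    unfolding A_def by (rule linearI) (simp_all add: inner_add_left scaleR_add_left sum.distrib scaleR_sum_right)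
  have AH: "A j w \<in> H" for j w unfolding A_def using eH H by (intro subspace_sum subspace_scale) auto
  have adj: "A j w \<bullet> x = w \<bullet> M j x" if j: "j \<in> J" and x: "x \<in> H" for j w x
  proof -
    have "M j x = M j (\<Sum>i<dim H. (x \<bullet> e i) *\<^sub>R e i)"
      using orthonormal_family_expand[OF e(1), of x] e(2) x by simp
    also have "\<dots> = (\<Sum>i<dim H. (x \<bullet> e i) *\<^sub>R M j (e i))"
      by (simp add: linear_sum[OF M[OF j]] linear_cmul[OF M[OF j]])
    finally show ?thesis unfolding A_def by (simp add: inner_sum_left inner_sum_right inner_commute mult.commute)
  qed
  have mN: "N R' \<in> borel_measurable borel" if "R' \<in> frames" for R'
  proof -
    have "(\<lambda>x. q j * (norm (R' j (L j x)))\<^sup>2) \<in> borel_measurable borel" if j: "j \<in> J" for j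
    proof -
      have "linear (\<lambda>x. R' j (L j x))"
        using linear_compose[OF L[OF j], of "R' j"] \<open>R' \<in> frames\<close> j by (simp add: frames_def comp_def)
      hence [measurable]: "(\<lambda>x. R' j (L j x)) \<in> borel_measurable borel" by (rule linear_borel_measurable)
      show ?thesis by measurable
    qed
    thus ?thesis unfolding N_def by (rule borel_measurable_sum)
  qed
  have zN: "zf H (N R') = ennreal (1 / zT) * zf H (\<lambda>x. N R' (T x))" if "R' \<in> frames" for R'
  proof -
    have "zf H (\<lambda>x. N R' (T x)) = ennreal zT * zf H (N R')"
      using zf_compose[OF H T surT mN[OF that]] zT(1) by simp
    hence "ennreal (1 / zT) * zf H (\<lambda>x. N R' (T x)) = (ennreal (1 / zT) * ennreal zT) * zf H (N R')" by (simp add: mult.assoc)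
    also have "ennreal (1 / zT) * ennreal zT = 1" using zT(2) by (simp flip: ennreal_mult)
    finally show ?thesis by simp
  qed
  have zNR: "zf H (N R) = ennreal (1 / zT)"
  proof -
    have "zf H (\<lambda>x. N R (T x)) = zf H (\<lambda>x. (norm x)\<^sup>2)" by (rule zf_cong[OF H NT])
    thus ?thesis using zN[OF R] zf_norm[OF H] by simp
  qed
  define z where "z R' j = zr (G j) (\<lambda>y. (norm (R' j y))\<^sup>2)" for R' :: "'j \<Rightarrow> 'b \<Rightarrow> 'b" and j
  have z: "zf (G j) (\<lambda>y. (norm (R j y))\<^sup>2) = ennreal (z R j)" "z R j > 0" if "j \<in> J" for j
    unfolding z_def using zf_linear_pos_finite[OF G[OF that] Rj(1,3)[OF that]] by auto
  define P where "P = (\<Prod>j\<in>J. z R j powr q j)"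
  have P: "P > 0" unfolding P_def z_def by (rule denominator_pos[OF R])
  have VR: "V R = (1 / zT) / P" unfolding V_def P_def z_def zr_def using zNR zT(2) by simp
  \<comment> \<open>\<open>R j\<close> is followed by a stretching \<open>E\<close> of the single
    direction \<open>w\<close>. By the rank-one formula V is multiplied by the square root of (1 +
    \<epsilon>)^q / (1 + q \<epsilon> |u|^2), with q = q j and u = A j w. The quotient is at most 1
    on both sides of \<epsilon> = 0, so the derivative of \<open>h\<close> vanishes there and |u| =
    1.\<close>
  have iso: "norm (A j w) = 1" if j: "j \<in> J" and w: "w \<in> G j" "norm w = 1" for j w
  proof -
    define u where "u = A j w"
    define h where "h \<epsilon> = 1 + q j * \<epsilon> * (norm u)\<^sup>2 - (1 + \<epsilon>) powr q j" for \<epsilon>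
    \<comment> \<open>Keeps both 1 + \<epsilon> and 1 + q_j \<epsilon> |u|^2 positive.\<close>
    define d where "d = min 1 (1 / (q j * (norm u)\<^sup>2 + 1))"
    have a0: "q j * (norm u)\<^sup>2 \<ge> 0" using q[OF j] by simp
    have d: "d > 0" unfolding d_def using a0 by simp
    have h0: "0 \<le> h \<epsilon>" if "\<bar>\<epsilon>\<bar> < d" for \<epsilon>
    proof -
      have e1: "1 + \<epsilon> > 0" using that by (auto simp: d_def)
      have k: "1 + (q j * \<epsilon>) * (norm u)\<^sup>2 > 0"
      proof -
        have "\<bar>\<epsilon>\<bar> < 1 / (q j * (norm u)\<^sup>2 + 1)" using that by (simp add: d_def)
        hence "\<bar>\<epsilon>\<bar> * (q j * (norm u)\<^sup>2 + 1) < 1" using a0 by (simp add: pos_less_divide_eq)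
        moreover have "- \<epsilon> * (q j * (norm u)\<^sup>2) \<le> \<bar>\<epsilon>\<bar> * (q j * (norm u)\<^sup>2 + 1)" using a0 by (intro mult_mono) auto
        ultimately show ?thesis by (simp add: mult_ac)
      qed
      \<comment> \<open>Chosen such that |E y|^2 = |y|^2 + \<epsilon> (w . y)^2, a rank-one change
        linear in \<epsilon>.\<close>
      define \<eta> where "\<eta> = sqrt (1 + \<epsilon>) - 1"
      have \<eta>: "(1 + \<eta>)\<^sup>2 = 1 + \<epsilon>" "1 + \<eta> > 0" using e1 by (simp_all add: \<eta>_def)
      define E where "E y = y + (\<eta> * (w \<bullet> y)) *\<^sub>R w" for y
      have E: "linear E" unfolding E_def by (rule linearI) (simp_all add: inner_add_right algebra_simps)
      have EG: "E y \<in> G j" if "y \<in> G j" for y unfolding E_def using that w G[OF j] by (simp add: subspace_add subspace_scale)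
      have ww: "w \<bullet> w = 1" using w by (simp add: norm_eq_1)
      have Enorm: "(norm (E y))\<^sup>2 = (norm y)\<^sup>2 + \<epsilon> * (w \<bullet> y)\<^sup>2" for y
      proof -
        have "(norm (E y))\<^sup>2 = (norm y)\<^sup>2 + ((1 + \<eta>)\<^sup>2 - 1) * (w \<bullet> y)\<^sup>2"
          unfolding power2_norm_eq_inner E_def using ww
          by (simp add: inner_add_left inner_add_right inner_commute power2_eq_square algebra_simps)
        thus ?thesis unfolding \<eta> by simp
      qed
      have Einj: "inj_on E (G j)"
      proof (rule inj_onI)
        fix x y assume "E x = E y"
        hence "E (x - y) = 0" using E by (simp add: linear_diff)
        moreover have "w \<bullet> E (x - y) = (1 + \<eta>) * (w \<bullet> (x - y))" unfolding E_def using ww by (simp add: inner_add_right algebra_simps)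
        ultimately have "w \<bullet> (x - y) = 0" using \<eta>(2) by simp
        hence "x - y = 0" using \<open>E (x - y) = 0\<close> unfolding E_def by simp
        thus "x = y" by simp
      qed
      have Esur: "E ` G j = G j"
      proof (rule subspace_dim_equal)
        show "dim (G j) \<le> dim (E ` G j)" using dim_image_eq[OF E] Einj G[OF j] by (simp add: span_eq_iff[THEN iffD2])
      qed (use EG E G[OF j] in \<open>auto simp: linear_subspace_image\<close>)
      define R' where "R' = R(j := \<lambda>y. E (R j y))"
      have R': "R' \<in> frames"
        unfolding frames_def
      proof (intro CollectI ballI)
        fix i assume i: "i \<in> J"
        show "linear (R' i) \<and> R' i ` G i = G i \<and> inj_on (R' i) (G i)"
        proof (cases "i = j")
          case True
          have "linear (\<lambda>y. E (R j y))" using linear_compose[OF Rj(1)[OF j] E] by (simp add: comp_def)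
          moreover have "(\<lambda>y. E (R j y)) ` G j = E ` (R j ` G j)" by (rule image_image[symmetric])
          moreover have "inj_on (\<lambda>y. E (R j y)) (G j)"
            using comp_inj_on[OF Rj(3)[OF j], of E] Einj Rj(2)[OF j] by (simp add: comp_def)
          ultimately show ?thesis using True Esur Rj(2)[OF j] by (simp add: R'_def)
        qed (use Rj i in \<open>simp add: R'_def\<close>)
      qed
      have N': "N R' x = N R x + (q j * \<epsilon>) * (w \<bullet> R j (L j x))\<^sup>2" for x
      proof -
        have "N R' x = q j * (norm (E (R j (L j x))))\<^sup>2 + (\<Sum>i\<in>J - {j}. q i * (norm (R i (L i x)))\<^sup>2)"
          unfolding N_def by (subst sum.remove[OF J j]) (auto simp: R'_def intro!: sum.cong)
        moreover have "N R x = q j * (norm (R j (L j x)))\<^sup>2 + (\<Sum>i\<in>J - {j}. q i * (norm (R i (L i x)))\<^sup>2)"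
          unfolding N_def by (rule sum.remove[OF J j])
        ultimately show ?thesis by (simp add: Enorm algebra_simps)
      qed
      have "zf H (\<lambda>x. N R' (T x)) = zf H (\<lambda>x. (norm x)\<^sup>2 + (q j * \<epsilon>) * (u \<bullet> x)\<^sup>2)"
      proof (rule zf_cong[OF H])
        fix x assume x: "x \<in> H"
        show "N R' (T x) = (norm x)\<^sup>2 + (q j * \<epsilon>) * (u \<bullet> x)\<^sup>2"
          unfolding N' NT[OF x] u_def adj[OF j x] M_def ..
      qed
      also have "\<dots> = ennreal (1 / sqrt (1 + (q j * \<epsilon>) * (norm u)\<^sup>2))"
        by (rule zf_rank_one[OF H _ k]) (simp add: u_def AH)
      finally have zNR': "zf H (N R') = ennreal (1 / zT * (1 / sqrt (1 + (q j * \<epsilon>) * (norm u)\<^sup>2)))"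
        using zN[OF R'] zT(2) k by (simp add: ennreal_mult[symmetric] del: times_divide_eq_left times_divide_eq_right mult_1_right)
      have "zf (G j) (\<lambda>y. (norm (E (R j y)))\<^sup>2) = ennreal (z R j) * zf (G j) (\<lambda>y. (norm (E y))\<^sup>2)"
      proof -
        have [measurable]: "E \<in> borel_measurable borel" using E by (rule linear_borel_measurable)
        have "(\<lambda>y. (norm (E y))\<^sup>2) \<in> borel_measurable borel" by measurable
        from zf_compose[OF G[OF j] Rj(1,2)[OF j] this] show ?thesis unfolding z(1)[OF j] .
      qed
      also have "zf (G j) (\<lambda>y. (norm (E y))\<^sup>2) = ennreal (1 / sqrt (1 + \<epsilon> * (norm w)\<^sup>2))"
        unfolding Enorm using e1 w by (intro zf_rank_one[OF G[OF j]]) auto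
      also have "sqrt (1 + \<epsilon> * (norm w)\<^sup>2) = 1 + \<eta>" using w by (simp add: \<eta>_def)
      finally have "zf (G j) (\<lambda>y. (norm (R' j y))\<^sup>2) = ennreal (z R j / (1 + \<eta>))"
        unfolding R'_def using z(2)[OF j] \<eta>(2) by (simp flip: ennreal_mult)
      moreover have "z R' j = enn2real (zf (G j) (\<lambda>y. (norm (R' j y))\<^sup>2))" by (simp only: z_def zr_def)
      ultimately have zR': "z R' j = z R j / (1 + \<eta>)" using z(2)[OF j] \<eta>(2) by simp
      have "(\<Prod>i\<in>J. z R' i powr q i) = z R' j powr q j * (\<Prod>i\<in>J - {j}. z R i powr q i)"
        by (subst prod.remove[OF J j]) (auto simp: z_def R'_def intro!: prod.cong)
      also have "\<dots> = P / (1 + \<eta>) powr q j"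
        unfolding P_def prod.remove[OF J j] zR' using z(2)[OF j] \<eta>(2) by (simp add: powr_divide)
      finally have P': "(\<Prod>i\<in>J. z R' i powr q i) = P / (1 + \<eta>) powr q j" .
      have "V R' = (1 / zT * (1 / sqrt (1 + (q j * \<epsilon>) * (norm u)\<^sup>2))) / (P / (1 + \<eta>) powr q j)"
        unfolding V_def z_def[symmetric] P' unfolding zr_def zNR' using zT(2) k by simp
      also have "\<dots> = V R * ((1 + \<eta>) powr q j / sqrt (1 + (q j * \<epsilon>) * (norm u)\<^sup>2))"
        unfolding VR by simp
      finally have "V R * ((1 + \<eta>) powr q j / sqrt (1 + (q j * \<epsilon>) * (norm u)\<^sup>2)) \<le> V R"
        using max[OF R'] by simp
      moreover have "V R > 0" unfolding VR using zT(2) P by simp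
      ultimately have "(1 + \<eta>) powr q j / sqrt (1 + (q j * \<epsilon>) * (norm u)\<^sup>2) \<le> 1"
        using mult_le_cancel_left_pos[of "V R" "(1 + \<eta>) powr q j / sqrt (1 + (q j * \<epsilon>) * (norm u)\<^sup>2)" 1] by (simp only: mult_1_right)
      hence le: "(1 + \<eta>) powr q j \<le> sqrt (1 + (q j * \<epsilon>) * (norm u)\<^sup>2)" using k by simp
      have "(1 + \<epsilon>) powr q j = ((1 + \<eta>) powr q j)\<^sup>2"
        unfolding \<eta>(1)[symmetric] using \<eta>(2) by (simp add: power2_eq_square powr_mult)
      also have "\<dots> \<le> (sqrt (1 + (q j * \<epsilon>) * (norm u)\<^sup>2))\<^sup>2" using le by (intro power_mono) auto
      also have "\<dots> = 1 + (q j * \<epsilon>) * (norm u)\<^sup>2" using k by simp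
      finally show ?thesis unfolding h_def by simp
    qed
    have "DERIV h 0 :> q j * (norm u)\<^sup>2 - q j"
      unfolding h_def by (auto intro!: derivative_eq_intros)
    moreover have "\<forall>y. \<bar>0 - y\<bar> < d \<longrightarrow> h 0 \<le> h y" using h0 by (simp add: h_def[of 0])
    ultimately have "q j * (norm u)\<^sup>2 - q j = 0" using DERIV_local_min d by blast
    hence "(norm u)\<^sup>2 = 1" using q[OF j] by simp
    moreover have "norm u \<ge> 0" by simp
    ultimately have "norm u = 1" by (simp add: power2_eq_1_iff)
    thus ?thesis unfolding u_def .
  qed
  interpret geo: geometric_datum J H G M A q
  proof (rule geometric_datum.intro)
    fix j w assume j: "j \<in> J" and w: "w \<in> G j"
    show "norm (A j w) = norm w"
    proof (cases "w = 0")
      case True thus ?thesis using linear_0[OF Alin] by simp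
    next
      case False
      have "norm (A j (w /\<^sub>R norm w)) = 1"
        by (rule iso[OF j]) (use w False G[OF j] in \<open>auto simp: subspace_scale\<close>)
      thus ?thesis using False by (simp add: linear_cmul[OF Alin] field_simps)
    qed
  next
    fix x assume x: "x \<in> H"
    show "(\<Sum>j\<in>J. q j * (norm (M j x))\<^sup>2) = (norm x)\<^sup>2" using NT[OF x] by (simp add: N_def M_def)
  qed (use J H G q M MG Alin AH adj crit in auto)
  \<comment> \<open>Left inverses of the \<open>R j\<close> transport the test functions: f_j
    composed with S_j, evaluated at M_j x, is f_j at L_j (T x).\<close>
  have "\<forall>j\<in>J. \<exists>S. linear S \<and> (\<forall>y\<in>G j. S (R j y) = y)"
    using linear_exists_left_inverse_on[OF Rj(1) G Rj(3)] by blast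
  from bchoice[OF this] obtain S where "\<forall>j\<in>J. linear (S j) \<and> (\<forall>y\<in>G j. S j (R j y) = y)" ..
  hence S: "linear (S j)" "\<And>y. y \<in> G j \<Longrightarrow> S j (R j y) = y" if "j \<in> J" for j using that by auto
  have mS: "S j \<in> borel_measurable borel" if "j \<in> J" for j using S(1)[OF that] by (rule linear_borel_measurable)
  have mg: "(\<lambda>x. ennreal (\<Prod>j\<in>J. f j (L j x) powr q j)) \<in> borel_measurable borel"
  proof -
    have "(\<lambda>x. f j (L j x) powr q j) \<in> borel_measurable borel" if "j \<in> J" for j
    proof -
      have [measurable]: "(\<lambda>x. f j (L j x)) \<in> borel_measurable borel"
        by (rule measurable_compose[OF linear_borel_measurable[OF L[OF that]] mf[OF that]])
      show ?thesis by measurable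
    qed
    thus ?thesis by (intro measurable_compose[OF _ measurable_ennreal] borel_measurable_prod)
  qed
  have "bl_form J H M q (\<lambda>j y. f j (S j y)) = (\<integral>\<^sup>+x. ennreal (\<Prod>j\<in>J. f j (L j (T x)) powr q j) \<partial>sl H)"
    unfolding bl_form_def
  proof (rule nn_integral_sl_cong[OF H])
    fix x assume "x \<in> H"
    have "S j (M j x) = L j (T x)" if "j \<in> J" for j
      unfolding M_def using LH[OF that] TH[of x] by (intro S(2)[OF that]) auto
    thus "ennreal (\<Prod>j\<in>J. f j (S j (M j x)) powr q j) = ennreal (\<Prod>j\<in>J. f j (L j (T x)) powr q j)"
      by (simp cong: prod.cong)
  qed
  also have "\<dots> = ennreal zT * bl_form J H L q f"
    unfolding bl_form_def zT(1)[symmetric] by (rule sl_linear_image[OF H T surT mg])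
  finally have 1: "bl_form J H M q (\<lambda>j y. f j (S j y)) = ennreal zT * bl_form J H L q f" .
  have "bl_form J H M q (\<lambda>j y. f j (S j y)) \<le> (\<Prod>j\<in>J. ennreal_powr (\<integral>\<^sup>+y. ennreal (f j (S j y)) \<partial>sl (G j)) (q j))"
    by (rule geo.bl_form_le) (use measurable_compose[OF mS mf] f0 in auto)
  also have "\<dots> = (\<Prod>j\<in>J. ennreal ((1 / z R j) powr q j) * ennreal_powr (\<integral>\<^sup>+y. ennreal (f j y) \<partial>sl (G j)) (q j))"
  proof (rule prod.cong[OF refl])
    fix j assume j: "j \<in> J"
    have m: "(\<lambda>y. ennreal (f j (S j y))) \<in> borel_measurable borel"
      by (rule measurable_compose[OF measurable_compose[OF mS[OF j] mf[OF j]] measurable_ennreal])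
    have "(\<integral>\<^sup>+y. ennreal (f j y) \<partial>sl (G j)) = (\<integral>\<^sup>+y. ennreal (f j (S j (R j y))) \<partial>sl (G j))"
      by (rule nn_integral_sl_cong[OF G[OF j]]) (simp add: S(2)[OF j])
    also have "\<dots> = ennreal (z R j) * (\<integral>\<^sup>+y. ennreal (f j (S j y)) \<partial>sl (G j))"
      unfolding z(1)[OF j, symmetric] by (rule sl_linear_image[OF G[OF j] Rj(1,2)[OF j] m])
    finally have "ennreal (1 / z R j) * (\<integral>\<^sup>+y. ennreal (f j y) \<partial>sl (G j)) = (ennreal (1 / z R j) * ennreal (z R j)) * (\<integral>\<^sup>+y. ennreal (f j (S j y)) \<partial>sl (G j))"
      by (simp add: mult.assoc)
    also have "ennreal (1 / z R j) * ennreal (z R j) = 1" using z(2)[OF j] by (simp flip: ennreal_mult)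
    finally have "(\<integral>\<^sup>+y. ennreal (f j (S j y)) \<partial>sl (G j)) = ennreal (1 / z R j) * (\<integral>\<^sup>+y. ennreal (f j y) \<partial>sl (G j))" by simp
    thus "ennreal_powr (\<integral>\<^sup>+y. ennreal (f j (S j y)) \<partial>sl (G j)) (q j) = ennreal ((1 / z R j) powr q j) * ennreal_powr (\<integral>\<^sup>+y. ennreal (f j y) \<partial>sl (G j)) (q j)"
      using ennreal_powr_mult[of "1 / z R j" "q j"] z(2)[OF j] q[OF j] by simp
  qed
  also have "\<dots> = ennreal (1 / P) * (\<Prod>j\<in>J. ennreal_powr (\<integral>\<^sup>+y. ennreal (f j y) \<partial>sl (G j)) (q j))"
  proof -
    have "(\<Prod>j\<in>J. ennreal ((1 / z R j) powr q j)) = ennreal (1 / P)"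
      unfolding P_def using z(2) by (subst prod_ennreal) (auto simp: powr_divide prod_dividef less_imp_le)
    thus ?thesis by (simp add: prod.distrib)
  qed
  finally have 2: "bl_form J H M q (\<lambda>j y. f j (S j y)) \<le> \<dots>" .
  have "bl_form J H L q f = (ennreal (1 / zT) * ennreal zT) * bl_form J H L q f"
    using zT(2) by (simp flip: ennreal_mult)
  also have "\<dots> = ennreal (1 / zT) * bl_form J H M q (\<lambda>j y. f j (S j y))" by (simp only: 1 mult.assoc)
  also have "\<dots> \<le> ennreal (1 / zT) * (ennreal (1 / P) * (\<Prod>j\<in>J. ennreal_powr (\<integral>\<^sup>+y. ennreal (f j y) \<partial>sl (G j)) (q j)))"
    by (rule mult_left_mono[OF 2]) simp
  also have "\<dots> = (ennreal (1 / zT) * ennreal (1 / P)) * (\<Prod>j\<in>J. ennreal_powr (\<integral>\<^sup>+y. ennreal (f j y) \<partial>sl (G j)) (q j))"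
    by (simp only: mult.assoc)
  also have "ennreal (1 / zT) * ennreal (1 / P) = ennreal (V R)"
    unfolding VR using zT(2) P by (subst ennreal_mult[symmetric]) auto
  finally show ?thesis .
qed

end

section \<open>Coercivity and existence of maximizers\<close>

lemma finite_family_convergent_subsequence:
  fixes x :: "nat \<Rightarrow> 'k \<Rightarrow> 'v::heine_borel"
  assumes "finite A" "\<And>a. a \<in> A \<Longrightarrow> bounded (range (\<lambda>m. x m a))"
  shows "\<exists>r l. strict_mono (r :: nat \<Rightarrow> nat) \<and> (\<forall>a\<in>A. (\<lambda>m. x (r m) a) \<longlonglongrightarrow> l a)"
  using assms
proof (induction A rule: finite_induct)
  case empty
  show ?case by (intro exI[of _ "\<lambda>m. m"]) (auto simp: strict_mono_def)
next
  case (insert b A)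
  then obtain r l where r: "strict_mono (r :: nat \<Rightarrow> nat)" "\<forall>a\<in>A. (\<lambda>m. x (r m) a) \<longlonglongrightarrow> l a" by auto
  have "bounded (range (\<lambda>m. x (r m) b))" using insert.prems[of b] by (rule bounded_subset) auto
  then obtain c s where s: "strict_mono (s :: nat \<Rightarrow> nat)" "((\<lambda>m. x (r m) b) \<circ> s) \<longlonglongrightarrow> c"
    using bounded_imp_convergent_subsequence by blast
  have "(\<lambda>m. x (r (s m)) a) \<longlonglongrightarrow> l a" if "a \<in> A" for a
    using LIMSEQ_subseq_LIMSEQ[OF r(2)[rule_format, OF that] s(1)] by (simp add: comp_def)
  thus ?case using s strict_mono_o[OF r(1) s(1)] insert.hyps
    by (intro exI[of _ "r \<circ> s"] exI[of _ "l(b := c)"]) (auto simp: comp_def)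
qed

text \<open>Summation by parts against the increments of \<open>x\<close>: each proper partial sum
  of \<theta> is at least \<delta>, each increment is nonnegative, and the increments telescope. The
  boundary term drops out since the total of \<theta> is 0.\<close>

lemma abel_sum_le:
  fixes \<theta> x :: "nat \<Rightarrow> real"
  assumes S: "\<And>k. 0 < k \<Longrightarrow> k < n \<Longrightarrow> (\<Sum>i<k. \<theta> i) \<ge> \<delta>" and S0: "(\<Sum>i<n. \<theta> i) = 0"
    and x: "\<And>i k. i \<le> k \<Longrightarrow> k < n \<Longrightarrow> x i \<le> x k" and n: "n > 0"
  shows "(\<Sum>i<n. \<theta> i * x i) \<le> - \<delta> * (x (n - 1) - x 0)"
proof -
  have "(\<Sum>i<Suc m. \<theta> i * x i) \<le> (\<Sum>i<Suc m. \<theta> i) * x m - \<delta> * (x m - x 0)" if "m < n" for m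
    using that
  proof (induction m)
    case (Suc m)
    have "0 \<le> ((\<Sum>i<Suc m. \<theta> i) - \<delta>) * (x (Suc m) - x m)"
      using S[of "Suc m"] x[of m "Suc m"] Suc.prems by (intro mult_nonneg_nonneg) auto
    thus ?case using Suc.IH Suc.prems by (simp add: algebra_simps)
  qed simp
  from this[of "n - 1"] show ?thesis using n S0 by simp
qed

text \<open>\<open>\<Phi>\<close> sends the orthonormal basis \<open>b\<close> to the vectors
  \<open>v\<close>. The hypothesis \<open>coef\<close> is linear independence in quantitative form
  and bounds the inverse of \<open>\<Phi>\<close>. The summand 1 next to the cardinality keeps the
  factor positive in dimension 0.\<close>

lemma frame_map:
  fixes v :: "'i \<Rightarrow> 'b::euclidean_space"
  assumes G: "subspace G" and I: "finite I" "card I = dim G" and v: "\<And>i. i \<in> I \<Longrightarrow> v i \<in> G" and K: "K > 0"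
    and coef: "\<And>\<alpha> i. i \<in> I \<Longrightarrow> \<bar>\<alpha> i\<bar> \<le> K * norm (\<Sum>k\<in>I. \<alpha> k *\<^sub>R v k)"
    and b: "orthonormal_family I b" "span (b ` I) = G"
  defines "\<Phi> \<equiv> \<lambda>y. \<Sum>i\<in>I. (y \<bullet> b i) *\<^sub>R v i"
  shows "linear \<Phi>" "\<Phi> ` G = G" "inj_on \<Phi> G"
    and "\<And>y. y \<in> G \<Longrightarrow> (norm y)\<^sup>2 \<le> (real (card I) + 1) * K\<^sup>2 * (norm (\<Phi> y))\<^sup>2"
proof -
  show lin: "linear \<Phi>"
    unfolding \<Phi>_def by (rule linearI) (simp_all add: inner_add_left scaleR_add_left sum.distrib scaleR_sum_right)
  show bd: "(norm y)\<^sup>2 \<le> (real (card I) + 1) * K\<^sup>2 * (norm (\<Phi> y))\<^sup>2" if y: "y \<in> G" for y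
  proof -
    have "y = (\<Sum>i\<in>I. (y \<bullet> b i) *\<^sub>R b i)" using orthonormal_family_expand[OF b(1), of y] b(2) y by simp
    hence "(norm y)\<^sup>2 = (norm (\<Sum>i\<in>I. (y \<bullet> b i) *\<^sub>R b i))\<^sup>2" by simp
    also have "\<dots> = (\<Sum>i\<in>I. (y \<bullet> b i)\<^sup>2)" by (rule orthonormal_family_norm[OF b(1) I(1)])
    also have "\<dots> \<le> (\<Sum>i\<in>I. (K * norm (\<Phi> y))\<^sup>2)"
    proof (rule sum_mono)
      fix i assume "i \<in> I"
      hence "\<bar>y \<bullet> b i\<bar> \<le> K * norm (\<Phi> y)" unfolding \<Phi>_def by (rule coef)
      thus "(y \<bullet> b i)\<^sup>2 \<le> (K * norm (\<Phi> y))\<^sup>2" by (intro iffD1[OF abs_le_square_iff]) simp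
    qed
    also have "\<dots> = real (card I) * K\<^sup>2 * (norm (\<Phi> y))\<^sup>2" by (simp add: power_mult_distrib)
    also have "\<dots> \<le> (real (card I) + 1) * K\<^sup>2 * (norm (\<Phi> y))\<^sup>2" by (intro mult_right_mono) auto
    finally show ?thesis .
  qed
  show inj: "inj_on \<Phi> G"
  proof (rule inj_onI)
    fix x y assume xy: "x \<in> G" "y \<in> G" "\<Phi> x = \<Phi> y"
    hence "\<Phi> (x - y) = 0" using lin by (simp add: linear_diff)
    thus "x = y" using bd[of "x - y"] xy G by (simp add: subspace_diff)
  qed
  show "\<Phi> ` G = G"
  proof (rule subspace_dim_equal)
    show "dim G \<le> dim (\<Phi> ` G)" using dim_image_eq[OF lin] inj G by (simp add: span_eq_iff[THEN iffD2])
    show "\<Phi> ` G \<subseteq> G" unfolding \<Phi>_def using v G by (auto intro!: subspace_sum subspace_scale)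
  qed (use lin G in \<open>auto simp: linear_subspace_image\<close>)
qed

text \<open>A form of Hadamard's inequality, since \<open>1 / zr G (\<lambda>y. |R y|\<^sup>2)\<close> is the absolute value of the determinant of \<open>R\<close>.\<close>
lemma zr_hadamard:
  fixes v :: "'i \<Rightarrow> 'b::euclidean_space" and R :: "'b \<Rightarrow> 'b"
  assumes G: "subspace G" and I: "finite I" "card I = dim G" and v: "\<And>i. i \<in> I \<Longrightarrow> v i \<in> G" and K: "K > 0"
    and coef: "\<And>\<alpha> i. i \<in> I \<Longrightarrow> \<bar>\<alpha> i\<bar> \<le> K * norm (\<Sum>k\<in>I. \<alpha> k *\<^sub>R v k)"
    and R: "linear R" "inj_on R G"
  shows "1 \<le> (K * (real (card I) + 1)) ^ card I * (\<Prod>i\<in>I. norm (R (v i))) * zr G (\<lambda>y. (norm (R y))\<^sup>2)"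
    and "\<And>i. i \<in> I \<Longrightarrow> norm (R (v i)) > 0"
proof -
  define D where "D = real (card I) + 1"
  have D: "D \<ge> 1" by (simp add: D_def)
  show Rv: "norm (R (v i)) > 0" if i: "i \<in> I" for i
  proof -
    have "(\<Sum>k\<in>I. (if k = i then 1 else 0) *\<^sub>R v k) = (\<Sum>k\<in>I. if k = i then v k else 0)" by (intro sum.cong) auto
    hence "(\<Sum>k\<in>I. (if k = i then 1 else 0) *\<^sub>R v k) = v i" using i I by simp
    hence "v i \<noteq> 0" using coef[OF i, of "\<lambda>k. if k = i then 1 else 0"] by auto
    hence "R (v i) \<noteq> R 0" using R(2) v[OF i] subspace_0[OF G] by (auto simp: inj_on_def)
    thus ?thesis using linear_0[OF R(1)] by simp
  qed
  obtain b where b: "orthonormal_family I b" "span (b ` I) = G"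
    using orthonormal_family_exists[OF G I] by blast
  define \<Phi> where "\<Phi> = (\<lambda>y. \<Sum>i\<in>I. (y \<bullet> b i) *\<^sub>R v i)"
  have \<Phi>: "linear \<Phi>" "\<Phi> ` G = G"
    unfolding \<Phi>_def by (rule frame_map[OF G I v K coef b]; assumption)+
  have \<Phi>4: "(norm y)\<^sup>2 \<le> D * K\<^sup>2 * (norm (\<Phi> y))\<^sup>2" if "y \<in> G" for y
    unfolding \<Phi>_def D_def by (rule frame_map(4)[OF G I v K coef b]) (use that in simp_all)
  have [measurable]: "R \<in> borel_measurable borel" using R(1) by (rule linear_borel_measurable)
  note zR = zf_linear_pos_finite[OF G R]
  \<comment> \<open>Multiplicativity isolates the integral for \<open>R\<close>. Below, the integral
    for \<open>\<Phi>\<close> is bounded from above by \<Phi>4, and the one for the composite from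
    below by a diagonal form obtained from Cauchy-Schwarz.\<close>
  have mul: "zf G (\<lambda>y. (norm (R (\<Phi> y)))\<^sup>2) = zf G (\<lambda>y. (norm (\<Phi> y))\<^sup>2) * zf G (\<lambda>y. (norm (R y))\<^sup>2)"
  proof -
    have "(\<lambda>y. (norm (R y))\<^sup>2) \<in> borel_measurable borel" by measurable
    from zf_compose[OF G \<Phi>(1,2) this] show ?thesis .
  qed
  have DK: "D * K\<^sup>2 > 0" using D K by simp
  have "zf G (\<lambda>y. (norm (\<Phi> y))\<^sup>2) \<le> zf G (\<lambda>y. (1 / (D * K\<^sup>2)) * (norm y)\<^sup>2)"
    using \<Phi>4 DK by (intro zf_mono[OF G]) (simp add: field_simps)
  also have "\<dots> = ennreal ((1 / sqrt (1 / (D * K\<^sup>2))) ^ dim G)"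
    by (rule zf_scaled_norm[OF G]) (use DK in simp)
  also have "1 / sqrt (1 / (D * K\<^sup>2)) = sqrt D * K" using D K by (simp add: real_sqrt_divide real_sqrt_mult)
  finally have up: "zf G (\<lambda>y. (norm (\<Phi> y))\<^sup>2) \<le> ennreal ((sqrt D * K) ^ card I)" by (simp only: I(2))
  let ?lam = "\<lambda>i. D * (norm (R (v i)))\<^sup>2"
  have "ennreal (\<Prod>i\<in>I. 1 / sqrt (?lam i)) = zf G (\<lambda>y. \<Sum>i\<in>I. ?lam i * (y \<bullet> b i)\<^sup>2)"
  proof (rule zf_diag[OF b, symmetric])
    fix c :: "'i \<Rightarrow> real"
    show "(\<Sum>i\<in>I. ?lam i * ((\<Sum>i\<in>I. c i *\<^sub>R b i) \<bullet> b i)\<^sup>2) = (\<Sum>i\<in>I. ?lam i * (c i)\<^sup>2)"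
      using orthonormal_family_inner_sum[OF b(1) I(1)] by (intro sum.cong) auto
  qed (use Rv D in auto)
  also have "\<dots> \<le> zf G (\<lambda>y. (norm (R (\<Phi> y)))\<^sup>2)"
  proof (rule zf_mono[OF G])
    fix y
    have "R (\<Phi> y) = (\<Sum>i\<in>I. (y \<bullet> b i) *\<^sub>R R (v i))"
      unfolding \<Phi>_def by (simp add: linear_sum[OF R(1)] linear_cmul[OF R(1)])
    hence "norm (R (\<Phi> y)) \<le> (\<Sum>i\<in>I. \<bar>y \<bullet> b i\<bar> * norm (R (v i)))"
      using norm_sum[of "\<lambda>i. (y \<bullet> b i) *\<^sub>R R (v i)" I] by simp
    hence "(norm (R (\<Phi> y)))\<^sup>2 \<le> (\<Sum>i\<in>I. \<bar>y \<bullet> b i\<bar> * norm (R (v i)))\<^sup>2" by (intro power_mono) auto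
    also have "\<dots> \<le> (\<Sum>i\<in>I. (\<bar>y \<bullet> b i\<bar> * norm (R (v i)))\<^sup>2) * card I" by (rule sum_squared_le_sum_of_squares)
    also have "\<dots> \<le> (\<Sum>i\<in>I. (\<bar>y \<bullet> b i\<bar> * norm (R (v i)))\<^sup>2) * D"
      unfolding D_def by (intro mult_left_mono sum_nonneg) auto
    also have "\<dots> = (\<Sum>i\<in>I. ?lam i * (y \<bullet> b i)\<^sup>2)"
      by (simp add: sum_distrib_left power_mult_distrib mult_ac)
    finally show "(norm (R (\<Phi> y)))\<^sup>2 \<le> (\<Sum>i\<in>I. ?lam i * (y \<bullet> b i)\<^sup>2)" .
  qed
  also have "\<dots> \<le> ennreal ((sqrt D * K) ^ card I) * ennreal (zr G (\<lambda>y. (norm (R y))\<^sup>2))"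
    unfolding mul zR(1)[symmetric] by (rule mult_right_mono[OF up]) simp
  also have "\<dots> = ennreal ((sqrt D * K) ^ card I * zr G (\<lambda>y. (norm (R y))\<^sup>2))"
    using D K by (intro ennreal_mult'[symmetric]) simp
  finally have le: "ennreal (\<Prod>i\<in>I. 1 / sqrt (?lam i)) \<le> ennreal ((sqrt D * K) ^ card I * zr G (\<lambda>y. (norm (R y))\<^sup>2))" .
  define z where "z = zr G (\<lambda>y. (norm (R y))\<^sup>2)"
  define P where "P = (\<Prod>i\<in>I. norm (R (v i)))"
  define s where "s = sqrt D ^ card I"
  have z0: "z > 0" unfolding z_def by (rule zR(2))
  have P0: "P > 0" unfolding P_def using Rv by (intro prod_pos)
  have s0: "s > 0" unfolding s_def using D by simp
  have ss: "s * s = D ^ card I" unfolding s_def power_mult_distrib[symmetric] using D by simp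
  have e1: "(\<Prod>i\<in>I. 1 / sqrt (?lam i)) = 1 / (s * P)"
  proof -
    have "(\<Prod>i\<in>I. 1 / sqrt (?lam i)) = (\<Prod>i\<in>I. 1 / (sqrt D * norm (R (v i))))" by (simp add: real_sqrt_mult)
    also have "\<dots> = 1 / (\<Prod>i\<in>I. sqrt D * norm (R (v i)))" by (simp add: prod_dividef)
    also have "(\<Prod>i\<in>I. sqrt D * norm (R (v i))) = s * P" by (simp add: prod.distrib s_def P_def)
    finally show ?thesis .
  qed
  have e2: "(sqrt D * K) ^ card I * zr G (\<lambda>y. (norm (R y))\<^sup>2) = s * K ^ card I * z"
    unfolding s_def z_def power_mult_distrib ..
  have nn: "0 \<le> s * K ^ card I * z" using s0 K z0 by simp
  have "1 / (s * P) \<le> s * K ^ card I * z"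
    using le unfolding e1 e2 by (rule iffD1[OF ennreal_le_iff[OF nn]])
  hence "1 \<le> s * K ^ card I * z * (s * P)" by (rule iffD1[OF pos_divide_le_eq[OF mult_pos_pos[OF s0 P0]]])
  also have "\<dots> = (s * s) * K ^ card I * P * z" by simp
  also have "\<dots> = (K * D) ^ card I * P * z" unfolding ss by (simp add: power_mult_distrib)
  finally show "1 \<le> (K * (real (card I) + 1)) ^ card I * (\<Prod>i\<in>I. norm (R (v i))) * zr G (\<lambda>y. (norm (R y))\<^sup>2)"
    unfolding D_def P_def z_def .
qed

text \<open>Simplicity in quantitative form: \<open>K\<close> controls the bases selected from the
  images of a frame, \<open>\<delta>\<close> the gaps along its flag, with the same values for all
  orthonormal frames of \<open>H\<close>. Unlike strict inequalities for infinitely many subspaces,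
  this survives small perturbations. A positive dimension guarantees that there is a smallest and a
  largest eigenvalue.\<close>

locale coercive_setting = bl_setting J H G L q
  for J :: "'j set" and H :: "'a::euclidean_space set" and G :: "'j \<Rightarrow> 'b::euclidean_space set" and L q +
  fixes K \<delta> :: real
  assumes K: "K > 0" and \<delta>: "\<delta> > 0" and n: "dim H > 0"
    and coercive: "\<And>e. orthonormal_family {..<dim H} e \<Longrightarrow> e ` {..<dim H} \<subseteq> H \<Longrightarrow>
      \<exists>I. (\<forall>j\<in>J. I j \<subseteq> {..<dim H} \<and> card (I j) = dim (G j) \<and>
            (\<forall>\<alpha>. \<forall>i\<in>I j. \<bar>\<alpha> i\<bar> \<le> K * norm (\<Sum>k\<in>I j. \<alpha> k *\<^sub>R L j (e k)))) \<and>
          (\<forall>k. 0 < k \<and> k < dim H \<longrightarrow> (\<Sum>j\<in>J. q j * real (card (I j \<inter> {..<k}))) \<ge> real k + \<delta>)"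
begin

text \<open>Let x / |x| be the first vector of a frame. The gap at k = 1, or criticality if
  \<open>dim H = 1\<close>, puts the index 0 into some \<open>I j\<close>, and the coefficient bound
  for the unit coefficient at 0 excludes that \<open>L j\<close> kills \<open>x\<close>.\<close>

lemma L_nonzero:
  assumes x: "x \<in> H" "x \<noteq> 0"
  shows "\<exists>j\<in>J. L j x \<noteq> 0"
proof -
  define w where "w = x /\<^sub>R norm x"
  have w: "w \<in> H" "norm w = 1" using x H by (auto simp: w_def subspace_scale)
  define H' where "H' = {x \<in> H. w \<bullet> x = 0}"
  note c = orthonormal_family_cons[OF H w, folded H'_def]
  obtain e where e: "orthonormal_family {..<dim H'} e" "span (e ` {..<dim H'}) = H'"
    using orthonormal_family_exists[OF c(1), of "{..<dim H'}"] by auto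
  have sub: "e ` {..<dim H'} \<subseteq> H'" using span_superset[of "e ` {..<dim H'}"] e(2) by simp
  let ?e = "\<lambda>i. case i of 0 \<Rightarrow> w | Suc k \<Rightarrow> e k"
  have on: "orthonormal_family {..<Suc (dim H')} ?e" by (rule c(3)[OF e(1) sub])
  have "H' \<subseteq> H" by (auto simp: H'_def)
  hence "e i \<in> H" if "i < dim H'" for i using sub that by auto
  hence es: "?e ` {..<Suc (dim H')} \<subseteq> H" using w by (auto split: nat.splits)
  obtain I where I: "\<forall>j\<in>J. I j \<subseteq> {..<dim H} \<and> card (I j) = dim (G j) \<and>
            (\<forall>\<alpha>. \<forall>i\<in>I j. \<bar>\<alpha> i\<bar> \<le> K * norm (\<Sum>k\<in>I j. \<alpha> k *\<^sub>R L j (?e k)))"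
      and Ik: "\<forall>k. 0 < k \<and> k < dim H \<longrightarrow> (\<Sum>j\<in>J. q j * real (card (I j \<inter> {..<k}))) \<ge> real k + \<delta>"
    using coercive[of ?e] on es c(2) by auto
  have "(\<Sum>j\<in>J. q j * real (card (I j \<inter> {..<1}))) > 0"
  proof (cases "dim H = 1")
    case True
    have "(\<Sum>j\<in>J. q j * real (card (I j \<inter> {..<1}))) = (\<Sum>j\<in>J. q j * real (dim (G j)))"
    proof (intro sum.cong refl)
      fix j assume j: "j \<in> J"
      have "I j \<inter> {..<1} = I j" using I j True by auto
      thus "q j * real (card (I j \<inter> {..<1})) = q j * real (dim (G j))" using I j by simp
    qed
    thus ?thesis using crit True by simp
  next
    case False
    thus ?thesis using Ik[rule_format, of 1] n \<delta> by auto
  qed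
  then obtain j where j: "j \<in> J" "q j * real (card (I j \<inter> {..<1})) \<noteq> 0"
    using sum.neutral[of J "\<lambda>j. q j * real (card (I j \<inter> {..<1}))"] by force
  hence "I j \<inter> {..<1} \<noteq> {}" by auto
  hence 0: "0 \<in> I j" by auto
  have fin: "finite (I j)" using I j(1) finite_subset[of "I j" "{..<dim H}"] by auto
  have "(\<Sum>k\<in>I j. (if k = 0 then 1 else 0) *\<^sub>R L j (?e k)) = (\<Sum>k\<in>I j. if k = 0 then L j (?e k) else 0)"
    by (intro sum.cong) auto
  hence "(\<Sum>k\<in>I j. (if k = 0 then 1 else 0) *\<^sub>R L j (?e k)) = L j w" using 0 fin by simp
  moreover have "\<forall>\<alpha>. \<forall>i\<in>I j. \<bar>\<alpha> i\<bar> \<le> K * norm (\<Sum>k\<in>I j. \<alpha> k *\<^sub>R L j (?e k))" using I j(1) by simp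
  note this[THEN spec[of _ "\<lambda>k. if k = 0 then 1 else 0"], THEN bspec[OF _ 0]]
  ultimately have "L j w \<noteq> 0" by auto
  hence "L j x \<noteq> 0" by (simp add: w_def linear_cmul[OF L[OF j(1)]])
  thus ?thesis using j(1) by blast
qed

lemma N_pos:
  assumes R: "R \<in> frames" and x: "x \<in> H" "x \<noteq> 0"
  shows "N R x > 0"
proof -
  obtain j where j: "j \<in> J" "L j x \<noteq> 0" using L_nonzero[OF x] by blast
  have "L j x \<in> G j" using LH[OF j(1)] x by auto
  hence "R j (L j x) \<noteq> R j 0" using R j subspace_0[OF G[OF j(1)]] by (auto simp: frames_def inj_on_def)
  hence "R j (L j x) \<noteq> 0" using R j(1) linear_0[of "R j"] by (auto simp: frames_def)
  hence "q j * (norm (R j (L j x)))\<^sup>2 > 0" using q[OF j(1)] by simp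
  also have "q j * (norm (R j (L j x)))\<^sup>2 \<le> N R x"
    unfolding N_def using J j(1) q by (intro member_le_sum) (auto simp: less_imp_le)
  finally show ?thesis .
qed

text \<open>By the coefficient bound the selected images of a frame are independent, and their
  number is \<open>dim (G j)\<close>.\<close>

lemma L_surj:
  assumes j: "j \<in> J" shows "L j ` H = G j"
proof
  show "L j ` H \<subseteq> G j" by (rule LH[OF j])
  obtain e where e: "orthonormal_family {..<dim H} e" "span (e ` {..<dim H}) = H"
    using orthonormal_family_exists[OF H, of "{..<dim H}"] by auto
  have sub: "e ` {..<dim H} \<subseteq> H" using span_superset[of "e ` {..<dim H}"] e(2) by simp
  obtain I where I: "I j \<subseteq> {..<dim H}" "card (I j) = dim (G j)"
            "\<And>\<alpha> i. i \<in> I j \<Longrightarrow> \<bar>\<alpha> i\<bar> \<le> K * norm (\<Sum>k\<in>I j. \<alpha> k *\<^sub>R L j (e k))"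
    using coercive[OF e(1) sub] j by blast
  have fin: "finite (I j)" using I(1) finite_subset by blast
  obtain b where b: "orthonormal_family (I j) b" "span (b ` I j) = G j"
    using orthonormal_family_exists[OF G[OF j] fin I(2)] by blast
  have eG: "e i \<in> H" "L j (e i) \<in> G j" if "i \<in> I j" for i using that I(1) sub LH[OF j] by auto
  have surj: "(\<lambda>y. \<Sum>i\<in>I j. (y \<bullet> b i) *\<^sub>R L j (e i)) ` G j = G j"
    by (rule frame_map(2)[OF G[OF j] fin I(2) eG(2) K I(3) b])
  have mem: "(\<Sum>i\<in>I j. (y \<bullet> b i) *\<^sub>R L j (e i)) \<in> L j ` H" for y
  proof -
    have "(\<Sum>i\<in>I j. (y \<bullet> b i) *\<^sub>R L j (e i)) = L j (\<Sum>i\<in>I j. (y \<bullet> b i) *\<^sub>R e i)"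
      by (simp add: linear_sum[OF L[OF j]] linear_cmul[OF L[OF j]])
    moreover have "(\<Sum>i\<in>I j. (y \<bullet> b i) *\<^sub>R e i) \<in> H" using eG H by (intro subspace_sum subspace_scale) auto
    ultimately show ?thesis by blast
  qed
  show "G j \<subseteq> L j ` H"
    by (subst surj[symmetric]) (use mem in blast)
qed

text \<open>The product of the Hadamard constants; 1 / sqrt (q j) enters because |R_j L_j e_i|^2 is
  at most the i-th eigenvalue divided by q j. The maps themselves do not occur, which gives the same
  type of bound for all nearby data.\<close>

definition C where "C = (\<Prod>j\<in>J. ((K * (real (dim (G j)) + 1)) ^ dim (G j) * (1 / sqrt (q j)) ^ dim (G j)) powr q j)"

lemma C_pos: "C > 0"
  unfolding C_def
proof (intro prod_pos)
  fix j assume j: "j \<in> J"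
  have "(K * (real (dim (G j)) + 1)) ^ dim (G j) * (1 / sqrt (q j)) ^ dim (G j) > 0"
    using K q[OF j] by (intro mult_pos_pos zero_less_power) auto
  thus "((K * (real (dim (G j)) + 1)) ^ dim (G j) * (1 / sqrt (q j)) ^ dim (G j)) powr q j > 0"
    unfolding powr_gt_zero by linarith
qed

text \<open>Hadamard's inequality for the vectors \<open>L j (e i)\<close> with
  \<open>i \<in> I j\<close> bounds V by C exp (\<Sum> \<theta>_i ln lam_i / 2). The partial sums of
  \<theta> are the gaps and their total is 0 by criticality; since the eigenvalues increase,
  summation by parts leaves a positive power of the ratio of smallest to largest eigenvalue.\<close>

lemma V_le_ratio:
  assumes R: "R \<in> frames" and e: "orthonormal_family {..<dim H} e" "span (e ` {..<dim H}) = H"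
    and Ne: "\<And>c. N R (\<Sum>i<dim H. c i *\<^sub>R e i) = (\<Sum>i<dim H. lam i * (c i)\<^sup>2)"
    and lam: "\<And>i. i < dim H \<Longrightarrow> lam i > 0" and mono: "\<And>i k. i \<le> k \<Longrightarrow> k < dim H \<Longrightarrow> lam i \<le> lam k"
    and lame: "\<And>i. i < dim H \<Longrightarrow> lam i = N R (e i)"
  shows "V R \<le> C * (lam 0 / lam (dim H - 1)) powr (\<delta> / 2)"
proof -
  have sub: "e ` {..<dim H} \<subseteq> H" using span_superset[of "e ` {..<dim H}"] e(2) by simp
  obtain I where I': "\<forall>j\<in>J. I j \<subseteq> {..<dim H} \<and> card (I j) = dim (G j) \<and>
            (\<forall>\<alpha>. \<forall>i\<in>I j. \<bar>\<alpha> i\<bar> \<le> K * norm (\<Sum>k\<in>I j. \<alpha> k *\<^sub>R L j (e k)))"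
      and Ik: "\<forall>k. 0 < k \<and> k < dim H \<longrightarrow> (\<Sum>j\<in>J. q j * real (card (I j \<inter> {..<k}))) \<ge> real k + \<delta>"
    using coercive[OF e(1) sub] by blast
  have I: "I j \<subseteq> {..<dim H}" "card (I j) = dim (G j)" if "j \<in> J" for j using I' that by auto
  have coef: "\<bar>\<alpha> i\<bar> \<le> K * norm (\<Sum>k\<in>I j. \<alpha> k *\<^sub>R L j (e k))" if "j \<in> J" "i \<in> I j" for j \<alpha> i using I' that by simp
  have fin: "finite (I j)" if "j \<in> J" for j using I(1)[OF that] finite_subset by blast
  have Rj: "linear (R j)" "inj_on (R j) (G j)" if "j \<in> J" for j using R that by (auto simp: frames_def)
  define z where "z j = zr (G j) (\<lambda>y. (norm (R j y))\<^sup>2)" for j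
  have zpos: "z j > 0" if "j \<in> J" for j
    unfolding z_def by (rule zf_linear_pos_finite(2)[OF G[OF that] Rj[OF that]])
  have eG: "L j (e i) \<in> G j" if "j \<in> J" "i \<in> I j" for i j
  proof -
    have "e i \<in> H" using subsetD[OF I(1)[OF that(1)] that(2)] sub by auto
    thus ?thesis using LH[OF that(1)] by auto
  qed
  define M where "M j = (K * (real (dim (G j)) + 1)) ^ dim (G j) * (1 / sqrt (q j)) ^ dim (G j)" for j
  have M0: "M j > 0" if "j \<in> J" for j unfolding M_def using K q[OF that] by (intro mult_pos_pos zero_less_power) (auto simp: add_pos_nonneg)
  have iz: "1 / z j \<le> M j * (\<Prod>i\<in>I j. sqrt (lam i))" if j: "j \<in> J" for j
  proof -
    note h = zr_hadamard[OF G[OF j] fin[OF j] I(2)[OF j] eG[OF j] K coef[OF j] Rj[OF j], folded z_def]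
    have "(\<Prod>i\<in>I j. norm (R j (L j (e i)))) \<le> (\<Prod>i\<in>I j. (1 / sqrt (q j)) * sqrt (lam i))"
    proof (intro prod_mono conjI)
      fix i assume i: "i \<in> I j"
      have i': "i < dim H" using I(1)[OF j] i by auto
      have "q j * (norm (R j (L j (e i))))\<^sup>2 \<le> N R (e i)"
        unfolding N_def using J j q by (intro member_le_sum) (auto simp: less_imp_le)
      hence "(norm (R j (L j (e i))))\<^sup>2 \<le> lam i / q j" using lame[OF i'] q[OF j] by (simp add: field_simps)
      hence "norm (R j (L j (e i))) \<le> sqrt (lam i / q j)" by (rule real_le_rsqrt)
      thus "norm (R j (L j (e i))) \<le> (1 / sqrt (q j)) * sqrt (lam i)" by (simp add: real_sqrt_divide)
    qed auto
    also have "\<dots> = (1 / sqrt (q j)) ^ dim (G j) * (\<Prod>i\<in>I j. sqrt (lam i))"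
      unfolding prod.distrib by (simp add: I(2)[OF j])
    finally have p: "(\<Prod>i\<in>I j. norm (R j (L j (e i)))) \<le> (1 / sqrt (q j)) ^ dim (G j) * (\<Prod>i\<in>I j. sqrt (lam i))" .
    have "1 \<le> ((K * (real (card (I j)) + 1)) ^ card (I j) * (\<Prod>i\<in>I j. norm (R j (L j (e i))))) * z j" by (rule h(1))
    hence "1 / z j \<le> (K * (real (card (I j)) + 1)) ^ card (I j) * (\<Prod>i\<in>I j. norm (R j (L j (e i))))"
      using zpos[OF j] by (simp only: pos_divide_le_eq)
    also have "\<dots> \<le> (K * (real (card (I j)) + 1)) ^ card (I j) * ((1 / sqrt (q j)) ^ dim (G j) * (\<Prod>i\<in>I j. sqrt (lam i)))"
      using K by (intro mult_left_mono p) simp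
    finally show ?thesis unfolding M_def I(2)[OF j] by (simp only: mult.assoc)
  qed
  have zN: "zr H (N R) = (\<Prod>i<dim H. 1 / sqrt (lam i))"
  proof -
    have "zf H (N R) = ennreal (\<Prod>i<dim H. 1 / sqrt (lam i))"
      by (rule zf_diag[OF e]) (use Ne lam in auto)
    moreover have "(\<Prod>i<dim H. 1 / sqrt (lam i)) \<ge> 0" using lam by (intro prod_nonneg) (auto simp: less_imp_le)
    ultimately show ?thesis by (simp add: zr_def)
  qed
  \<comment> \<open>Up to the common factor 1/2, the exponent of the i-th eigenvalue in the bound:
    the denominators contribute the weights of those \<open>j\<close> whose index set contains
    \<open>i\<close>, and the integral over \<open>H\<close> contributes -1.\<close>
  define \<theta> where "\<theta> i = (\<Sum>j\<in>J. q j * (if i \<in> I j then 1 else 0)) - 1" for i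
  have \<theta>sum: "(\<Sum>i<k. \<theta> i) = (\<Sum>j\<in>J. q j * real (card (I j \<inter> {..<k}))) - real k" for k
  proof -
    have "(\<Sum>i<k. \<Sum>j\<in>J. q j * (if i \<in> I j then 1 else 0)) = (\<Sum>j\<in>J. q j * (\<Sum>i<k. if i \<in> I j then 1 else 0))"
      by (subst sum.swap) (simp only: sum_distrib_left)
    also have "\<dots> = (\<Sum>j\<in>J. q j * real (card (I j \<inter> {..<k})))"
    proof (intro sum.cong refl arg_cong2[where f = times])
      fix j
      have "{i \<in> {..<k}. i \<in> I j} = I j \<inter> {..<k}" by auto
      thus "(\<Sum>i<k. if i \<in> I j then 1 else 0 :: real) = real (card (I j \<inter> {..<k}))"
        by (simp add: sum.If_cases Int_commute)
    qed
    finally show ?thesis unfolding \<theta>_def by (simp add: sum_subtractf)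
  qed
  have S0: "(\<Sum>i<dim H. \<theta> i) = 0"
  proof -
    have "(\<Sum>j\<in>J. q j * real (card (I j \<inter> {..<dim H}))) = (\<Sum>j\<in>J. q j * real (dim (G j)))"
      using I by (intro sum.cong refl) (simp add: Int_absorb2)
    thus ?thesis unfolding \<theta>sum using crit by simp
  qed
  have abel: "(\<Sum>i<dim H. \<theta> i * ln (lam i)) \<le> - \<delta> * (ln (lam (dim H - 1)) - ln (lam 0))"
  proof (rule abel_sum_le)
    show "\<delta> \<le> (\<Sum>i<k. \<theta> i)" if "0 < k" "k < dim H" for k
      unfolding \<theta>sum using Ik[rule_format, of k] that by simp
    show "ln (lam i) \<le> ln (lam k)" if "i \<le> k" "k < dim H" for i k
      using mono[OF that] lam[of i] lam[of k] that by simp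
  qed (use S0 n in auto)
  have lp: "(\<Prod>i\<in>A. sqrt (lam i)) = exp ((\<Sum>i\<in>A. ln (lam i)) / 2)" if "A \<subseteq> {..<dim H}" for A
  proof -
    have "(\<Prod>i\<in>A. sqrt (lam i)) = (\<Prod>i\<in>A. exp (ln (lam i) / 2))"
    proof (intro prod.cong refl)
      fix i assume "i \<in> A"
      hence "lam i > 0" using that lam by auto
      hence "exp (ln (sqrt (lam i))) = sqrt (lam i)" by simp
      thus "sqrt (lam i) = exp (ln (lam i) / 2)" using \<open>lam i > 0\<close> by (simp add: ln_sqrt)
    qed
    also have "\<dots> = exp (\<Sum>i\<in>A. ln (lam i) / 2)" using finite_subset[OF that] by (simp add: exp_sum)
    finally show ?thesis by (simp add: sum_divide_distrib)
  qed
  define s where "s = (\<Sum>i<dim H. ln (lam i))"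
  define t where "t = (\<Sum>j\<in>J. q j * (\<Sum>i\<in>I j. ln (lam i)))"
  have 1: "V R = (\<Prod>i<dim H. 1 / sqrt (lam i)) * (\<Prod>j\<in>J. (1 / z j) powr q j)"
    unfolding V_def zN z_def[symmetric] using zpos by (simp add: powr_divide prod_dividef less_imp_le)
  have 2: "(\<Prod>j\<in>J. (1 / z j) powr q j) \<le> (\<Prod>j\<in>J. (M j * (\<Prod>i\<in>I j. sqrt (lam i))) powr q j)"
    by (intro prod_mono conjI powr_mono2 iz) (use q zpos in \<open>auto simp: less_imp_le\<close>)
  have 3: "(\<Prod>j\<in>J. (M j * (\<Prod>i\<in>I j. sqrt (lam i))) powr q j) = C * exp (t / 2)"
  proof -
    have "(M j * (\<Prod>i\<in>I j. sqrt (lam i))) powr q j = M j powr q j * exp (q j * (\<Sum>i\<in>I j. ln (lam i)) / 2)" if j: "j \<in> J" for j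
      unfolding lp[OF I(1)[OF j]] using M0[OF j] by (simp add: powr_mult exp_powr_real mult.commute)
    hence "(\<Prod>j\<in>J. (M j * (\<Prod>i\<in>I j. sqrt (lam i))) powr q j) = (\<Prod>j\<in>J. M j powr q j * exp (q j * (\<Sum>i\<in>I j. ln (lam i)) / 2))"
      by (rule prod.cong[OF refl])
    also have "\<dots> = (\<Prod>j\<in>J. M j powr q j) * exp (\<Sum>j\<in>J. q j * (\<Sum>i\<in>I j. ln (lam i)) / 2)"
      using J by (simp add: prod.distrib exp_sum)
    finally show ?thesis unfolding C_def M_def t_def by (simp add: sum_divide_distrib)
  qed
  have 4: "(\<Prod>i<dim H. 1 / sqrt (lam i)) = exp (- s / 2)"
    using lp[of "{..<dim H}"] unfolding s_def by (simp add: prod_dividef exp_minus inverse_eq_divide)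
  have 5: "(\<Sum>i<dim H. \<theta> i * ln (lam i)) = t - s"
  proof -
    have "t = (\<Sum>j\<in>J. \<Sum>i<dim H. q j * (if i \<in> I j then 1 else 0) * ln (lam i))"
      unfolding t_def
    proof (intro sum.cong refl)
      fix j assume j: "j \<in> J"
      have "{..<dim H} \<inter> {i. i \<in> I j} = I j" using I(1)[OF j] by auto
      hence "(\<Sum>i\<in>I j. ln (lam i)) = (\<Sum>i<dim H. if i \<in> I j then ln (lam i) else 0)"
        by (simp add: sum.If_cases)
      also have "q j * \<dots> = (\<Sum>i<dim H. q j * (if i \<in> I j then 1 else 0) * ln (lam i))"
        unfolding sum_distrib_left by (intro sum.cong) auto
      finally show "q j * (\<Sum>i\<in>I j. ln (lam i)) = (\<Sum>i<dim H. q j * (if i \<in> I j then 1 else 0) * ln (lam i))" .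
    qed
    also have "\<dots> = (\<Sum>i<dim H. (\<Sum>j\<in>J. q j * (if i \<in> I j then 1 else 0)) * ln (lam i))"
      by (subst sum.swap) (simp only: sum_distrib_right)
    finally show ?thesis
      unfolding \<theta>_def s_def by (simp add: left_diff_distrib sum_subtractf)
  qed
  have "V R \<le> exp (- s / 2) * (C * exp (t / 2))"
    unfolding 1 4 using 2 3 by (intro mult_left_mono) auto
  also have "\<dots> = C * exp ((t - s) / 2)"
    by (simp add: diff_divide_distrib exp_diff exp_minus inverse_eq_divide)
  also have "\<dots> \<le> C * exp (- \<delta> * (ln (lam (dim H - 1)) - ln (lam 0)) / 2)"
    using abel C_pos unfolding 5 by (intro mult_left_mono) auto
  finally have 6: "V R \<le> C * exp (- \<delta> * (ln (lam (dim H - 1)) - ln (lam 0)) / 2)" .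
  have "- \<delta> * (ln (lam (dim H - 1)) - ln (lam 0)) / 2 = \<delta> / 2 * (ln (lam 0) - ln (lam (dim H - 1)))"
    by (simp add: field_simps)
  also have "ln (lam 0) - ln (lam (dim H - 1)) = ln (lam 0 / lam (dim H - 1))"
    using lam[of 0] lam[of "dim H - 1"] n by (simp add: ln_div)
  finally have "exp (- \<delta> * (ln (lam (dim H - 1)) - ln (lam 0)) / 2) = (lam 0 / lam (dim H - 1)) powr (\<delta> / 2)"
    using lam[of 0] lam[of "dim H - 1"] n by (simp add: powr_def)
  with 6 show ?thesis by (simp only:)
qed

end

section \<open>Limits, degeneration and scaling of Gaussian integrals\<close>

lemma zf_fatou:
  assumes S: "subspace S" and Qm: "\<And>m::nat. Q m \<in> borel_measurable borel"
    and lim: "\<And>x. x \<in> S \<Longrightarrow> (\<lambda>m. Q m x) \<longlonglongrightarrow> Q' x"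
    and b: "(\<lambda>m. zf S (Q m)) \<longlonglongrightarrow> c"
  shows "zf S Q' \<le> c"
proof -
  have m: "(\<lambda>x. ennreal (exp (- pi * Q m x))) \<in> borel_measurable (sl S)" for m
    using Qm[of m] by simp
  have "zf S Q' = (\<integral>\<^sup>+x. liminf (\<lambda>m. ennreal (exp (- pi * Q m x))) \<partial>sl S)"
    unfolding zf_def
  proof (rule nn_integral_sl_cong[OF S])
    fix x assume "x \<in> S"
    hence "(\<lambda>m. ennreal (exp (- pi * Q m x))) \<longlonglongrightarrow> ennreal (exp (- pi * Q' x))"
      by (intro tendsto_ennrealI tendsto_exp tendsto_mult tendsto_const lim)
    thus "ennreal (exp (- pi * Q' x)) = liminf (\<lambda>m. ennreal (exp (- pi * Q m x)))"
      by (intro lim_imp_Liminf[symmetric]) auto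
  qed
  also have "\<dots> \<le> liminf (\<lambda>m. zf S (Q m))"
    unfolding zf_def by (rule nn_integral_liminf[OF m])
  also have "\<dots> = c" by (rule lim_imp_Liminf[OF trivial_limit_sequentially b])
  finally show ?thesis .
qed

lemma zr_dominated:
  assumes S: "subspace S" and Qm: "\<And>m::nat. Q m \<in> borel_measurable borel" and Q': "Q' \<in> borel_measurable borel"
    and lim: "\<And>x. x \<in> S \<Longrightarrow> (\<lambda>m. Q m x) \<longlonglongrightarrow> Q' x"
    and c: "c > 0" and ge: "\<And>m x. x \<in> S \<Longrightarrow> c * (norm x)\<^sup>2 \<le> Q m x"
  shows "(\<lambda>m. zr S (Q m)) \<longlonglongrightarrow> zr S Q'"
proof -
  have "(\<lambda>m. zf S (Q m)) \<longlonglongrightarrow> zf S Q'"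
    unfolding zf_def
  proof (rule nn_integral_dominated_convergence[where w = "\<lambda>x. ennreal (exp (- pi * (c * (norm x)\<^sup>2)))"])
    show "(\<lambda>x. ennreal (exp (- pi * Q m x))) \<in> borel_measurable (sl S)" for m using Qm[of m] by simp
    show "(\<lambda>x. ennreal (exp (- pi * Q' x))) \<in> borel_measurable (sl S)" using Q' by simp
    show "AE x in sl S. ennreal (exp (- pi * Q m x)) \<le> ennreal (exp (- pi * (c * (norm x)\<^sup>2)))" for m
      using sl_AE[OF S]
    proof eventually_elim
      case (elim x)
      have "- pi * Q m x \<le> - pi * (c * (norm x)\<^sup>2)" using ge[OF elim] by simp
      thus ?case by (intro ennreal_leI) (simp only: exp_le_cancel_iff)
    qed
    show "(\<integral>\<^sup>+x. ennreal (exp (- pi * (c * (norm x)\<^sup>2))) \<partial>sl S) < \<infinity>"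
      using zf_scaled_norm[OF S c] by (simp add: zf_def)
    show "AE x in sl S. (\<lambda>m. ennreal (exp (- pi * Q m x))) \<longlonglongrightarrow> ennreal (exp (- pi * Q' x))"
      using sl_AE[OF S] by eventually_elim (intro tendsto_ennrealI tendsto_exp tendsto_mult tendsto_const lim)
  qed simp
  moreover have "zf S Q' < top"
  proof -
    have "c * (norm x)\<^sup>2 \<le> Q' x" if "x \<in> S" for x
      by (rule LIMSEQ_le_const[OF lim[OF that]]) (use ge[OF that] in blast)
    hence "zf S Q' \<le> zf S (\<lambda>x. c * (norm x)\<^sup>2)" by (intro zf_mono[OF S])
    also have "\<dots> < top" by (simp add: zf_scaled_norm[OF S c])
    finally show ?thesis .
  qed
  ultimately show ?thesis unfolding zr_def by (intro tendsto_enn2real) auto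
qed

text \<open>If \<open>T\<close> kills a unit vector \<open>w\<close>, doubling the component along
  \<open>w\<close> leaves \<open>T\<close> unchanged but halves the integral. A finite integral
  would then be 0, contrary to the lower bound by a genuine Gaussian. This detects invertibility of
  a limit of automorphisms.\<close>

lemma zf_finite_imp_inj:
  fixes T :: "'a::euclidean_space \<Rightarrow> 'b::euclidean_space"
  assumes S: "subspace S" and T: "linear T" and fin: "zf S (\<lambda>x. (norm (T x))\<^sup>2) < top"
  shows "inj_on T S"
proof (rule ccontr)
  assume "\<not> inj_on T S"
  then obtain x y where xy: "x \<in> S" "y \<in> S" "T x = T y" "x \<noteq> y" by (auto simp: inj_on_def)
  define w where "w = (x - y) /\<^sub>R norm (x - y)"
  have w: "w \<in> S" "norm w = 1" using xy S by (auto simp: w_def subspace_diff subspace_scale)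
  have Tw: "T w = 0" using xy(3) T by (simp add: w_def linear_cmul linear_diff)
  have ww: "w \<bullet> w = 1" using w by (simp add: norm_eq_1)
  define E where "E v = v + (w \<bullet> v) *\<^sub>R w" for v
  have E: "linear E" unfolding E_def by (rule linearI) (simp_all add: inner_add_right algebra_simps)
  have ES: "E ` S = S"
  proof
    show "E ` S \<subseteq> S" unfolding E_def using w S by (auto intro: subspace_add subspace_scale)
    show "S \<subseteq> E ` S"
    proof
      fix v assume v: "v \<in> S"
      have "E (v - ((w \<bullet> v) / 2) *\<^sub>R w) = v"
        unfolding E_def using ww by (simp add: inner_diff_right algebra_simps flip: scaleR_add_left)
      moreover have "v - ((w \<bullet> v) / 2) *\<^sub>R w \<in> S" using v w S by (simp add: subspace_diff subspace_scale)
      ultimately show "v \<in> E ` S" by (metis image_eqI)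
    qed
  qed
  have TE: "T (E v) = T v" for v using Tw T by (simp add: E_def linear_add linear_cmul)
  have [measurable]: "T \<in> borel_measurable borel" using T by (rule linear_borel_measurable)
  define z where "z = zf S (\<lambda>x. (norm (T x))\<^sup>2)"
  have "(\<lambda>x. (norm (T x))\<^sup>2) \<in> borel_measurable borel" by measurable
  from zf_compose[OF S E ES this] have "z = zf S (\<lambda>v. (norm (E v))\<^sup>2) * z" unfolding TE z_def .
  also have "zf S (\<lambda>v. (norm (E v))\<^sup>2) = zf S (\<lambda>v. (norm v)\<^sup>2 + 3 * (w \<bullet> v)\<^sup>2)"
  proof (rule zf_cong[OF S])
    fix v
    show "(norm (E v))\<^sup>2 = (norm v)\<^sup>2 + 3 * (w \<bullet> v)\<^sup>2"
      unfolding power2_norm_eq_inner E_def using ww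
      by (simp add: inner_add_left inner_add_right inner_commute power2_eq_square algebra_simps)
  qed
  also have "\<dots> = ennreal (1 / sqrt (1 + 3 * (norm w)\<^sup>2))"
    by (rule zf_rank_one[OF S w(1)]) (simp add: w)
  finally have "z = ennreal (1 / 2) * z" using w by simp
  moreover obtain a where a: "z = ennreal a" "a \<ge> 0" using fin unfolding z_def[symmetric] by (cases z) auto
  ultimately have "ennreal a = ennreal ((1 / 2) * a)" by (subst ennreal_mult) simp_all
  hence "a = (1 / 2) * a" using a(2) by (subst (asm) ennreal_inj) simp_all
  hence z0: "z = 0" using a by simp
  obtain B where B: "B > 0" "\<And>x. norm (T x) \<le> B * norm x" using linear_bounded_pos[OF T] by blast
  have "zf S (\<lambda>x. B\<^sup>2 * (norm x)\<^sup>2) \<le> z"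
    unfolding z_def
  proof (rule zf_mono[OF S])
    fix x
    have "(norm (T x))\<^sup>2 \<le> (B * norm x)\<^sup>2" using B(2) by (intro power_mono) auto
    thus "(norm (T x))\<^sup>2 \<le> B\<^sup>2 * (norm x)\<^sup>2" by (simp add: power_mult_distrib)
  qed
  moreover have "zf S (\<lambda>x. B\<^sup>2 * (norm x)\<^sup>2) > 0"
    using B(1) by (subst zf_scaled_norm[OF S]) auto
  ultimately show False using z0 by simp
qed

lemma zr_scale:
  assumes S: "subspace S" and c: "c > 0" and Q: "Q \<in> borel_measurable borel" and hom: "\<And>x. Q (c *\<^sub>R x) = c\<^sup>2 * Q x"
  shows "zr S (\<lambda>x. c\<^sup>2 * Q x) = (1 / c) ^ dim S * zr S Q"
proof -
  have "(\<lambda>x. ennreal (exp (- pi * Q x))) \<in> borel_measurable borel" using Q by simp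
  from sl_scale[OF S c this] have "zf S (\<lambda>x. c\<^sup>2 * Q x) = ennreal ((1 / c) ^ dim S) * zf S Q"
    unfolding zf_def hom .
  thus ?thesis using c unfolding zr_def by (simp add: enn2real_mult)
qed

context bl_setting
begin

lemma N_measurable:
  assumes "R \<in> frames" shows "N R \<in> borel_measurable borel"
proof -
  have "(\<lambda>x. q j * (norm (R j (L j x)))\<^sup>2) \<in> borel_measurable borel" if j: "j \<in> J" for j
  proof -
    have "linear (\<lambda>x. R j (L j x))"
      using linear_compose[OF L[OF j], of "R j"] assms j by (simp add: frames_def comp_def)
    hence [measurable]: "(\<lambda>x. R j (L j x)) \<in> borel_measurable borel" by (rule linear_borel_measurable)
    show ?thesis by measurable
  qed
  thus ?thesis unfolding N_def by (rule borel_measurable_sum)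
qed

text \<open>Invariance of V is global criticality: the powers of \<open>c\<close> from the numerator
  and the denominator have equal exponents.\<close>

lemma frames_scale:
  assumes R: "R \<in> frames" and c: "c > 0"
  shows "(\<lambda>j y. c *\<^sub>R R j y) \<in> frames" "N (\<lambda>j y. c *\<^sub>R R j y) x = c\<^sup>2 * N R x" "V (\<lambda>j y. c *\<^sub>R R j y) = V R"
proof -
  have Rj: "linear (R j)" "R j ` G j = G j" "inj_on (R j) (G j)" if "j \<in> J" for j using R that by (auto simp: frames_def)
  show "(\<lambda>j y. c *\<^sub>R R j y) \<in> frames"
    unfolding frames_def
  proof (intro CollectI ballI conjI)
    fix j assume j: "j \<in> J"
    show "linear (\<lambda>y. c *\<^sub>R R j y)" using Rj(1)[OF j] by (rule linear_compose_scale_right)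
    show "inj_on (\<lambda>y. c *\<^sub>R R j y) (G j)" using Rj(3)[OF j] c by (auto simp: inj_on_def)
    have "(\<lambda>y. c *\<^sub>R y) ` G j = G j"
    proof
      show "G j \<subseteq> (\<lambda>y. c *\<^sub>R y) ` G j"
      proof
        fix y assume "y \<in> G j"
        hence "(1 / c) *\<^sub>R y \<in> G j" using G[OF j] by (simp add: subspace_scale)
        thus "y \<in> (\<lambda>y. c *\<^sub>R y) ` G j" using c by (intro image_eqI[of _ _ "(1 / c) *\<^sub>R y"]) auto
      qed
    qed (use G[OF j] in \<open>auto simp: subspace_scale\<close>)
    moreover have "(\<lambda>y. c *\<^sub>R R j y) ` G j = (\<lambda>y. c *\<^sub>R y) ` (R j ` G j)" by (rule image_image[symmetric])
    ultimately show "(\<lambda>y. c *\<^sub>R R j y) ` G j = G j" using Rj(2)[OF j] by simp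
  qed
  show Nc: "N (\<lambda>j y. c *\<^sub>R R j y) x = c\<^sup>2 * N R x" for x
    unfolding N_def by (simp add: power_mult_distrib sum_distrib_left mult_ac)
  have "zr H (N (\<lambda>j y. c *\<^sub>R R j y)) = zr H (\<lambda>x. c\<^sup>2 * N R x)" unfolding Nc[abs_def] ..
  also have "\<dots> = (1 / c) ^ dim H * zr H (N R)"
  proof (rule zr_scale[OF H c N_measurable[OF R]])
    fix x show "N R (c *\<^sub>R x) = c\<^sup>2 * N R x"
      unfolding N_def sum_distrib_left using L Rj(1)
      by (intro sum.cong refl) (simp add: linear_cmul power_mult_distrib)
  qed
  finally have zN: "zr H (N (\<lambda>j y. c *\<^sub>R R j y)) = (1 / c) ^ dim H * zr H (N R)" .
  have zj: "zr (G j) (\<lambda>y. (norm (c *\<^sub>R R j y))\<^sup>2) powr q j = (1 / c) powr (q j * real (dim (G j))) * zr (G j) (\<lambda>y. (norm (R j y))\<^sup>2) powr q j"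
    if j: "j \<in> J" for j
  proof -
    have [measurable]: "R j \<in> borel_measurable borel" using Rj(1)[OF j] by (rule linear_borel_measurable)
    have "(\<lambda>y. (norm (R j y))\<^sup>2) \<in> borel_measurable borel" by measurable
    hence "zr (G j) (\<lambda>y. c\<^sup>2 * (norm (R j y))\<^sup>2) = (1 / c) ^ dim (G j) * zr (G j) (\<lambda>y. (norm (R j y))\<^sup>2)"
      by (intro zr_scale[OF G[OF j] c]) (simp_all add: linear_cmul[OF Rj(1)[OF j]] power_mult_distrib)
    moreover have "((1 / c) ^ dim (G j)) powr q j = (1 / c) powr (q j * real (dim (G j)))"
      using c by (simp add: powr_powr mult.commute flip: powr_realpow)
    ultimately show ?thesis using c by (simp add: power_mult_distrib powr_mult)
  qed
  have "(\<Prod>j\<in>J. zr (G j) (\<lambda>y. (norm (c *\<^sub>R R j y))\<^sup>2) powr q j) = (1 / c) ^ dim H * (\<Prod>j\<in>J. zr (G j) (\<lambda>y. (norm (R j y))\<^sup>2) powr q j)"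
  proof -
    have "(\<Prod>j\<in>J. (1 / c) powr (q j * real (dim (G j)))) = (1 / c) powr real (dim H)"
      using c by (simp add: crit[symmetric] powr_sum)
    hence "(\<Prod>j\<in>J. (1 / c) powr (q j * real (dim (G j)))) = (1 / c) ^ dim H" using c by (simp add: powr_realpow)
    moreover have "(\<Prod>j\<in>J. zr (G j) (\<lambda>y. (norm (c *\<^sub>R R j y))\<^sup>2) powr q j)
        = (\<Prod>j\<in>J. (1 / c) powr (q j * real (dim (G j))) * zr (G j) (\<lambda>y. (norm (R j y))\<^sup>2) powr q j)"
      by (rule prod.cong[OF refl zj])
    ultimately show ?thesis by (simp only: prod.distrib)
  qed
  thus "V (\<lambda>j y. c *\<^sub>R R j y) = V R" unfolding V_def zN using c by simp
qed

end

context coercive_setting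
begin

lemma V_le_C:
  assumes R: "R \<in> frames" shows "V R \<le> C"
proof -
  obtain e lam where e: "orthonormal_family {..<dim H} e" "span (e ` {..<dim H}) = H"
    "\<And>c. N R (\<Sum>i<dim H. c i *\<^sub>R e i) = (\<Sum>i<dim H. lam i * (c i)\<^sup>2)"
    "\<And>i. i < dim H \<Longrightarrow> lam i > 0" "\<And>i k. i \<le> k \<Longrightarrow> k < dim H \<Longrightarrow> lam i \<le> lam k"
    "\<And>i. i < dim H \<Longrightarrow> lam i = N R (e i)"
    by (rule N_diagonal[OF R N_pos[OF R]]) simp_all
  have "V R \<le> C * (lam 0 / lam (dim H - 1)) powr (\<delta> / 2)" by (rule V_le_ratio[OF R e])
  also have "\<dots> \<le> C * 1"
  proof (rule mult_left_mono)
    have "lam 0 / lam (dim H - 1) \<le> 1" using e(4)[of "dim H - 1"] e(5)[of 0 "dim H - 1"] n by simp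
    thus "(lam 0 / lam (dim H - 1)) powr (\<delta> / 2) \<le> 1"
      using \<delta> e(4)[of 0] e(4)[of "dim H - 1"] n by (intro powr_le1) (auto simp: less_imp_le)
  qed (use C_pos in simp)
  finally show ?thesis by simp
qed

text \<open>Scaling makes the largest eigenvalue of \<open>N\<close> equal to 1, and
  \<open>V_le_ratio\<close> solved for the ratio of the extreme eigenvalues bounds the smallest one
  from below. Families with V bounded away from 0 thus become precompact.\<close>

lemma frames_normalize:
  assumes R: "R \<in> frames" and v: "v > 0" "v \<le> V R"
  shows "\<exists>R'\<in>frames. V R' = V R \<and> (\<forall>x\<in>H. (v / C) powr (2 / \<delta>) * (norm x)\<^sup>2 \<le> N R' x \<and> N R' x \<le> (norm x)\<^sup>2)"
proof -
  obtain e lam where e: "orthonormal_family {..<dim H} e" "span (e ` {..<dim H}) = H"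
    "\<And>c. N R (\<Sum>i<dim H. c i *\<^sub>R e i) = (\<Sum>i<dim H. lam i * (c i)\<^sup>2)"
    "\<And>i. i < dim H \<Longrightarrow> lam i > 0" "\<And>i k. i \<le> k \<Longrightarrow> k < dim H \<Longrightarrow> lam i \<le> lam k"
    "\<And>i. i < dim H \<Longrightarrow> lam i = N R (e i)"
    by (rule N_diagonal[OF R N_pos[OF R]]) simp_all
  define a where "a = lam 0"
  define b where "b = lam (dim H - 1)"
  have ab: "a > 0" "b > 0" using e(4) n by (auto simp: a_def b_def)
  have "v \<le> C * (a / b) powr (\<delta> / 2)" using V_le_ratio[OF R e] v unfolding a_def b_def by linarith
  hence "v / C \<le> (a / b) powr (\<delta> / 2)" using C_pos by (simp add: field_simps)
  hence "(v / C) powr (2 / \<delta>) \<le> ((a / b) powr (\<delta> / 2)) powr (2 / \<delta>)"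
    using v C_pos \<delta> by (intro powr_mono2) auto
  also have "\<dots> = a / b" using \<delta> ab by (simp add: powr_powr)
  finally have ratio: "(v / C) powr (2 / \<delta>) \<le> a / b" .
  have Nb: "a * (norm x)\<^sup>2 \<le> N R x" "N R x \<le> b * (norm x)\<^sup>2" if x: "x \<in> H" for x
  proof -
    have x': "(\<Sum>i<dim H. (x \<bullet> e i) *\<^sub>R e i) = x" by (rule orthonormal_family_expand[OF e(1)]) (use e(2) x in simp)
    have nx: "(norm x)\<^sup>2 = (\<Sum>i<dim H. (x \<bullet> e i)\<^sup>2)"
      using orthonormal_family_norm[OF e(1), of "\<lambda>i. x \<bullet> e i"] x' by simp
    have Nx: "N R x = (\<Sum>i<dim H. lam i * (x \<bullet> e i)\<^sup>2)" using e(3)[of "\<lambda>i. x \<bullet> e i"] x' by simp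
    show "a * (norm x)\<^sup>2 \<le> N R x" unfolding nx Nx sum_distrib_left a_def
      using e(5)[of 0] by (intro sum_mono mult_right_mono) auto
    show "N R x \<le> b * (norm x)\<^sup>2" unfolding nx Nx sum_distrib_left b_def
      using e(5)[of _ "dim H - 1"] by (intro sum_mono mult_right_mono) auto
  qed
  define c where "c = 1 / sqrt b"
  have c: "c > 0" "c\<^sup>2 = 1 / b" using ab by (auto simp: c_def power_divide)
  note sc = frames_scale[OF R c(1)]
  show ?thesis
  proof (intro bexI[of _ "\<lambda>j y. c *\<^sub>R R j y"] conjI ballI sc)
    fix x assume x: "x \<in> H"
    have "(v / C) powr (2 / \<delta>) * (norm x)\<^sup>2 \<le> (a / b) * (norm x)\<^sup>2" by (rule mult_right_mono[OF ratio]) simp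
    also have "\<dots> = (1 / b) * (a * (norm x)\<^sup>2)" by simp
    also have "\<dots> \<le> (1 / b) * N R x" using ab by (intro mult_left_mono Nb x) simp
    finally show "(v / C) powr (2 / \<delta>) * (norm x)\<^sup>2 \<le> N (\<lambda>j y. c *\<^sub>R R j y) x" unfolding sc(2) c(2) .
    have "(1 / b) * N R x \<le> (1 / b) * (b * (norm x)\<^sup>2)" using ab by (intro mult_left_mono Nb x) simp
    thus "N (\<lambda>j y. c *\<^sub>R R j y) x \<le> (norm x)\<^sup>2" unfolding sc(2) c(2) using ab by simp
  qed
qed

lemma V_pos: "R \<in> frames \<Longrightarrow> V R > 0"
proof -
  assume R: "R \<in> frames"
  obtain e lam where e: "orthonormal_family {..<dim H} e" "span (e ` {..<dim H}) = H"
    "\<And>c. N R (\<Sum>i<dim H. c i *\<^sub>R e i) = (\<Sum>i<dim H. lam i * (c i)\<^sup>2)"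
    "\<And>i. i < dim H \<Longrightarrow> lam i > 0" "\<And>i k. i \<le> k \<Longrightarrow> k < dim H \<Longrightarrow> lam i \<le> lam k"
    "\<And>i. i < dim H \<Longrightarrow> lam i = N R (e i)"
    by (rule N_diagonal[OF R N_pos[OF R]]) simp_all
  have p: "(\<Prod>i<dim H. 1 / sqrt (lam i)) > 0" using e(4) by (intro prod_pos) auto
  have "zf H (N R) = ennreal (\<Prod>i<dim H. 1 / sqrt (lam i))"
    by (rule zf_diag[OF e(1,2)]) (use e(3,4) in auto)
  hence "zr H (N R) > 0" using p by (simp add: zr_def)
  thus "V R > 0" unfolding V_def using denominator_pos[OF R] by simp
qed

text \<open>Normalized near-maximizers converge along a subsequence, but the limit might be singular
  on some \<open>G j\<close>, which the lower bound on \<open>N\<close> alone does not exclude.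
  Hence the reciprocals of the Gaussian integrals over the \<open>G j\<close> are made to converge
  as well. Their limits \<omega> are positive because the product of their powers is a factor of the
  positive supremum; Fatou's lemma then keeps the integrals of the limit finite, and finiteness
  implies injectivity.\<close>

lemma maximizer_exists: "\<exists>R\<in>frames. \<forall>R'\<in>frames. V R' \<le> V R"
proof -
  have idf: "(\<lambda>j y. y) \<in> frames"
    unfolding frames_def by (intro CollectI ballI conjI linear_ident inj_onI) simp_all
  hence ne: "frames \<noteq> {}" by (metis empty_iff)
  define Vs where "Vs = Sup (V ` frames)"
  have bdd: "bdd_above (V ` frames)" using V_le_C by (intro bdd_aboveI[of _ C]) auto
  have VVs: "V R \<le> Vs" if "R \<in> frames" for R unfolding Vs_def by (rule cSup_upper[OF imageI[OF that] bdd])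
  have Vs0: "Vs > 0" using V_pos[OF idf] VVs[OF idf] by linarith
  \<comment> \<open>The lower bound of \<open>frames_normalize\<close> for the level Vs / 2, which
    all near-maximizers below exceed since m + 2 \<ge> 2.\<close>
  define c0 where "c0 = (Vs / 2 / C) powr (2 / \<delta>)"
  have c0: "c0 > 0" unfolding c0_def powr_gt_zero using Vs0 C_pos by simp
  define W where "W m R \<longleftrightarrow> R \<in> frames \<and> V R > Vs - Vs / (real m + 2) \<and> (\<forall>x\<in>H. c0 * (norm x)\<^sup>2 \<le> N R x \<and> N R x \<le> (norm x)\<^sup>2)"
    for m :: nat and R
  have "\<exists>R. W m R" for m
  proof -
    have "Vs - Vs / (real m + 2) < Vs" using Vs0 by simp
    hence "\<exists>R\<in>frames. Vs - Vs / (real m + 2) < V R"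
      unfolding Vs_def using less_cSUP_iff[OF ne bdd] by (rule iffD1[rotated])
    then obtain R where R: "R \<in> frames" "Vs - Vs / (real m + 2) < V R" by (elim bexE)
    have "Vs / (real m + 2) \<le> Vs / 2" using Vs0 by (intro divide_left_mono) auto
    hence "Vs / 2 \<le> V R" using R(2) by linarith
    hence "\<exists>R'\<in>frames. V R' = V R \<and> (\<forall>x\<in>H. (Vs / 2 / C) powr (2 / \<delta>) * (norm x)\<^sup>2 \<le> N R' x \<and> N R' x \<le> (norm x)\<^sup>2)"
      using Vs0 by (intro frames_normalize[OF R(1)]) simp_all
    then obtain R' where R': "R' \<in> frames" "V R' = V R \<and> (\<forall>x\<in>H. (Vs / 2 / C) powr (2 / \<delta>) * (norm x)\<^sup>2 \<le> N R' x \<and> N R' x \<le> (norm x)\<^sup>2)"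
      by (elim bexE)
    have "W m R'" unfolding W_def c0_def using R' R(2) by simp
    thus ?thesis by (rule exI[of _ R'])
  qed
  hence "\<forall>m. \<exists>R. W m R" ..
  from choice[OF this] obtain X where X: "\<forall>m. W m (X m)" ..
  have Xf: "X m \<in> frames" and XV: "V (X m) > Vs - Vs / (real m + 2)"
    and XN: "\<And>x. x \<in> H \<Longrightarrow> c0 * (norm x)\<^sup>2 \<le> N (X m) x" "\<And>x. x \<in> H \<Longrightarrow> N (X m) x \<le> (norm x)\<^sup>2" for m
    using X[rule_format, of m] by (auto simp: W_def)
  have Xj: "linear (X m j)" "X m j ` G j = G j" "inj_on (X m j) (G j)" if "j \<in> J" for m j
    using Xf[of m] that by (auto simp: frames_def)
  have "\<forall>j\<in>J. \<exists>b. orthonormal_family {..<dim (G j)} b \<and> span (b ` {..<dim (G j)}) = G j"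
  proof
    fix j assume "j \<in> J"
    from orthonormal_family_exists[OF G[OF this], of "{..<dim (G j)}"]
    show "\<exists>b. orthonormal_family {..<dim (G j)} b \<and> span (b ` {..<dim (G j)}) = G j" by auto
  qed
  from bchoice[OF this] obtain b where "\<forall>j\<in>J. orthonormal_family {..<dim (G j)} (b j) \<and> span (b j ` {..<dim (G j)}) = G j" ..
  hence b: "orthonormal_family {..<dim (G j)} (b j)" "span (b j ` {..<dim (G j)}) = G j" if "j \<in> J" for j using that by auto
  have bG: "b j i \<in> G j" if "j \<in> J" "i < dim (G j)" for j i
    using span_base[of "b j i" "b j ` {..<dim (G j)}"] b(2)[OF that(1)] that(2) by auto
  \<comment> \<open>\<open>N\<close> controls the maps only on the images of the \<open>L j\<close>;
    surjectivity and a bounded right inverse of \<open>L j\<close> extend the control to all of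
    \<open>G j\<close>.\<close>
  have "\<forall>j\<in>J. \<exists>\<beta>>0. \<forall>m. \<forall>y\<in>G j. (norm (X m j y))\<^sup>2 \<le> \<beta> * (norm y)\<^sup>2"
  proof
    fix j assume j: "j \<in> J"
    obtain s where s: "range s \<subseteq> H" "linear s" "\<forall>y\<in>L j ` H. L j (s y) = y"
      using linear_exists_right_inverse_on[OF L[OF j] H] by blast
    obtain B where B: "B > 0" "\<And>x. norm (s x) \<le> B * norm x" using linear_bounded_pos[OF s(2)] by blast
    have "(norm (X m j y))\<^sup>2 \<le> (B\<^sup>2 / q j) * (norm y)\<^sup>2" if y: "y \<in> G j" for m y
    proof -
      have Ls: "L j (s y) = y" using s(3) y L_surj[OF j] by simp
      have sH: "s y \<in> H" using s(1) by auto
      have "q j * (norm (X m j (L j (s y))))\<^sup>2 \<le> N (X m) (s y)"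
        unfolding N_def using J j q by (intro member_le_sum) (auto simp: less_imp_le)
      also have "\<dots> \<le> (norm (s y))\<^sup>2" by (rule XN(2)[OF sH])
      also have "\<dots> \<le> (B * norm y)\<^sup>2" using B(2) by (intro power_mono) auto
      finally show ?thesis unfolding Ls using q[OF j] by (simp add: power_mult_distrib field_simps)
    qed
    thus "\<exists>\<beta>>0. \<forall>m. \<forall>y\<in>G j. (norm (X m j y))\<^sup>2 \<le> \<beta> * (norm y)\<^sup>2"
      using B(1) q[OF j] by (intro exI[of _ "B\<^sup>2 / q j"]) auto
  qed
  from bchoice[OF this] obtain \<beta> where "\<forall>j\<in>J. \<beta> j > 0 \<and> (\<forall>m. \<forall>y\<in>G j. (norm (X m j y))\<^sup>2 \<le> \<beta> j * (norm y)\<^sup>2)" ..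
  hence \<beta>: "\<beta> j > 0" "\<And>m y. y \<in> G j \<Longrightarrow> (norm (X m j y))\<^sup>2 \<le> \<beta> j * (norm y)\<^sup>2" if "j \<in> J" for j using that by auto
  define A where "A = Sigma J (\<lambda>j. {..<dim (G j)})"
  have "\<exists>r l. strict_mono (r :: nat \<Rightarrow> nat) \<and> (\<forall>p\<in>A. (\<lambda>m. X (r m) (fst p) (b (fst p) (snd p))) \<longlonglongrightarrow> l p)"
  proof (rule finite_family_convergent_subsequence[where x = "\<lambda>m p. X m (fst p) (b (fst p) (snd p))"])
    show "finite A" unfolding A_def using J by auto
    fix p assume "p \<in> A"
    then obtain j i where p: "p = (j, i)" "j \<in> J" "i < dim (G j)" by (auto simp: A_def)
    have "norm (X m j (b j i)) \<le> sqrt (\<beta> j * (norm (b j i))\<^sup>2)" for m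
      by (rule real_le_rsqrt[OF \<beta>(2)[OF p(2) bG[OF p(2,3)]]])
    thus "bounded (range (\<lambda>m. X m (fst p) (b (fst p) (snd p))))"
      unfolding p(1) by (intro boundedI[of _ "sqrt (\<beta> j * (norm (b j i))\<^sup>2)"]) auto
  qed
  then obtain r \<xi> where r: "strict_mono (r :: nat \<Rightarrow> nat)" "\<forall>p\<in>A. (\<lambda>m. X (r m) (fst p) (b (fst p) (snd p))) \<longlonglongrightarrow> \<xi> p" by (elim exE conjE)
  define z where "z R j = zr (G j) (\<lambda>y. (norm (R j y))\<^sup>2)" for R :: "'j \<Rightarrow> 'b \<Rightarrow> 'b" and j
  have zX: "zf (G j) (\<lambda>y. (norm (X m j y))\<^sup>2) = ennreal (z (X m) j)" "z (X m) j > 0" if "j \<in> J" for m j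
    unfolding z_def using zf_linear_pos_finite[OF G[OF that] Xj(1,3)[OF that]] by auto
  have zlow: "1 / z (X m) j \<le> sqrt (\<beta> j) ^ dim (G j)" if j: "j \<in> J" for m j
  proof -
    have "zf (G j) (\<lambda>y. \<beta> j * (norm y)\<^sup>2) \<le> zf (G j) (\<lambda>y. (norm (X m j y))\<^sup>2)"
      by (rule zf_mono[OF G[OF j] \<beta>(2)[OF j]])
    hence "(1 / sqrt (\<beta> j)) ^ dim (G j) \<le> z (X m) j"
      unfolding zf_scaled_norm[OF G[OF j] \<beta>(1)[OF j]] zX(1)[OF j] using zX(2)[OF j, of m] by (simp add: ennreal_le_iff)
    moreover have "(1 / sqrt (\<beta> j)) ^ dim (G j) > 0" using \<beta>(1)[OF j] by simp
    ultimately have "1 / z (X m) j \<le> 1 / (1 / sqrt (\<beta> j)) ^ dim (G j)" by (intro divide_left_mono) auto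
    thus ?thesis by (simp add: power_one_over)
  qed
  have "\<exists>r2 l. strict_mono (r2 :: nat \<Rightarrow> nat) \<and> (\<forall>j\<in>J. (\<lambda>m. 1 / z (X (r (r2 m))) j) \<longlonglongrightarrow> l j)"
  proof (rule finite_family_convergent_subsequence[where x = "\<lambda>m j. 1 / z (X (r m)) j"])
    show "finite J" by (rule J)
    fix j assume j: "j \<in> J"
    have "norm (1 / z (X (r m)) j) \<le> sqrt (\<beta> j) ^ dim (G j)" for m
      using zlow[OF j, of "r m"] zX(2)[OF j, of "r m"] by simp
    thus "bounded (range (\<lambda>m. 1 / z (X (r m)) j))"
      by (intro boundedI[of _ "sqrt (\<beta> j) ^ dim (G j)"]) auto
  qed
  then obtain r2 \<omega> where r2: "strict_mono (r2 :: nat \<Rightarrow> nat)" "\<forall>j\<in>J. (\<lambda>m. 1 / z (X (r (r2 m))) j) \<longlonglongrightarrow> \<omega> j" by (elim exE conjE)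
  define Y where "Y m = X (r (r2 m))" for m
  have Yf: "Y m \<in> frames" for m unfolding Y_def by (rule Xf)
  have Yj: "linear (Y m j)" "Y m j ` G j = G j" "inj_on (Y m j) (G j)" if "j \<in> J" for m j
    unfolding Y_def using Xj[OF that] by auto
  define R where "R j y = (\<Sum>i<dim (G j). (y \<bullet> b j i) *\<^sub>R \<xi> (j, i))" for j y
  have Rlin: "linear (R j)" for j
    unfolding R_def by (rule linearI) (simp_all add: inner_add_left scaleR_add_left sum.distrib scaleR_sum_right)
  have Ylim: "(\<lambda>m. Y m j y) \<longlonglongrightarrow> R j y" if j: "j \<in> J" and y: "y \<in> G j" for j y
  proof -
    have Yy: "Y m j y = (\<Sum>i<dim (G j). (y \<bullet> b j i) *\<^sub>R Y m j (b j i))" for m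
    proof -
      have "Y m j y = Y m j (\<Sum>i<dim (G j). (y \<bullet> b j i) *\<^sub>R b j i)"
        using orthonormal_family_expand[OF b(1)[OF j], of y] b(2)[OF j] y by simp
      thus ?thesis by (simp add: linear_sum[OF Yj(1)[OF j]] linear_cmul[OF Yj(1)[OF j]])
    qed
    have "(\<lambda>m. Y m j (b j i)) \<longlonglongrightarrow> \<xi> (j, i)" if i: "i < dim (G j)" for i
    proof -
      have "(\<lambda>m. X (r m) j (b j i)) \<longlonglongrightarrow> \<xi> (j, i)" using r(2) j i by (force simp: A_def)
      from LIMSEQ_subseq_LIMSEQ[OF this r2(1)] show ?thesis unfolding Y_def by (simp add: comp_def)
    qed
    hence "(\<lambda>m. \<Sum>i<dim (G j). (y \<bullet> b j i) *\<^sub>R Y m j (b j i)) \<longlonglongrightarrow> R j y"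
      unfolding R_def by (intro tendsto_sum tendsto_scaleR tendsto_const) auto
    thus ?thesis by (subst Yy)
  qed
  have RG: "R j y \<in> G j" if j: "j \<in> J" and y: "y \<in> G j" for j y
  proof (rule closed_sequentially[OF closed_subspace[OF G[OF j]] _ Ylim[OF j y]])
    show "Y m j y \<in> G j" for m using Yj(2)[OF j, of m] y by blast
  qed
  have mNR: "N R \<in> borel_measurable borel"
  proof -
    have "(\<lambda>x. q j * (norm (R j (L j x)))\<^sup>2) \<in> borel_measurable borel" if j: "j \<in> J" for j
    proof -
      have "linear (\<lambda>x. R j (L j x))" using linear_compose[OF L[OF j] Rlin] by (simp add: comp_def)
      hence [measurable]: "(\<lambda>x. R j (L j x)) \<in> borel_measurable borel" by (rule linear_borel_measurable)
      show ?thesis by measurable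
    qed
    thus ?thesis unfolding N_def by (rule borel_measurable_sum)
  qed
  have zNlim: "(\<lambda>m. zr H (N (Y m))) \<longlonglongrightarrow> zr H (N R)"
  proof (rule zr_dominated[OF H N_measurable[OF Yf] mNR _ c0])
    fix x assume x: "x \<in> H"
    show "(\<lambda>m. N (Y m) x) \<longlonglongrightarrow> N R x"
      unfolding N_def
    proof (intro tendsto_sum tendsto_mult tendsto_const tendsto_power tendsto_norm)
      fix j assume j: "j \<in> J"
      show "(\<lambda>m. Y m j (L j x)) \<longlonglongrightarrow> R j (L j x)" by (rule Ylim[OF j]) (use LH[OF j] x in auto)
    qed
    show "c0 * (norm x)\<^sup>2 \<le> N (Y m) x" for m unfolding Y_def by (rule XN(1)[OF x])
  qed
  have \<omega>lim: "(\<lambda>m. 1 / z (Y m) j) \<longlonglongrightarrow> \<omega> j" if "j \<in> J" for j using r2(2) that unfolding Y_def by simp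
  have zY: "z (Y m) j > 0" if "j \<in> J" for m j unfolding Y_def by (rule zX(2)[OF that])
  have \<omega>0: "\<omega> j \<ge> 0" if j: "j \<in> J" for j
    by (rule LIMSEQ_le_const[OF \<omega>lim[OF j]]) (use zY[OF j] in \<open>auto simp: less_imp_le\<close>)
  have Vform: "V R' = zr H (N R') * (\<Prod>j\<in>J. (1 / z R' j) powr q j)" if "\<And>j. j \<in> J \<Longrightarrow> z R' j > 0" for R'
  proof -
    have "(\<Prod>j\<in>J. (1 / z R' j) powr q j) = 1 / (\<Prod>j\<in>J. z R' j powr q j)"
      using that by (simp add: powr_divide prod_dividef less_imp_le)
    thus ?thesis unfolding V_def z_def by simp
  qed
  have "(\<lambda>m. zr H (N (Y m)) * (\<Prod>j\<in>J. (1 / z (Y m) j) powr q j)) \<longlonglongrightarrow> zr H (N R) * (\<Prod>j\<in>J. \<omega> j powr q j)"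
  proof (intro tendsto_mult zNlim tendsto_prod tendsto_powr' \<omega>lim tendsto_const)
    fix j assume j: "j \<in> J"
    show "\<omega> j \<noteq> 0 \<or> 0 < q j \<and> (\<forall>\<^sub>F m in sequentially. 0 \<le> 1 / z (Y m) j)"
      using q[OF j] zY[OF j] by (simp add: less_imp_le)
  qed
  hence lim1: "(\<lambda>m. V (Y m)) \<longlonglongrightarrow> zr H (N R) * (\<Prod>j\<in>J. \<omega> j powr q j)"
    using Vform[OF zY] by simp
  have lim2: "(\<lambda>m. V (Y m)) \<longlonglongrightarrow> Vs"
  proof (rule tendsto_sandwich[of "\<lambda>m. Vs - Vs / (real m + 2)" _ _ "\<lambda>_. Vs"])
    have "filterlim (\<lambda>m::nat. real m + 2) at_top sequentially"
      by (intro filterlim_tendsto_add_at_top[where c = 2, of "\<lambda>_. 2", simplified add.commute] filterlim_real_sequentially) auto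
    hence "(\<lambda>m::nat. Vs / (real m + 2)) \<longlonglongrightarrow> 0"
      by (intro tendsto_divide_0[OF tendsto_const] filterlim_at_top_imp_at_infinity)
    from tendsto_diff[OF tendsto_const[of Vs] this] show "(\<lambda>m::nat. Vs - Vs / (real m + 2)) \<longlonglongrightarrow> Vs" by simp
    have "Vs - Vs / (real m + 2) \<le> V (Y m)" for m
    proof -
      have "m \<le> r (r2 m)" using seq_suble[OF r(1), of "r2 m"] seq_suble[OF r2(1), of m] by linarith
      hence "Vs / (real (r (r2 m)) + 2) \<le> Vs / (real m + 2)" using Vs0 by (intro divide_left_mono) auto
      thus ?thesis using XV[of "r (r2 m)"] unfolding Y_def by linarith
    qed
    thus "\<forall>\<^sub>F m in sequentially. Vs - Vs / (real m + 2) \<le> V (Y m)" by simp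
    show "\<forall>\<^sub>F m in sequentially. V (Y m) \<le> Vs" using VVs[OF Yf] by simp
  qed auto
  have Vs_eq: "Vs = zr H (N R) * (\<Prod>j\<in>J. \<omega> j powr q j)" by (rule LIMSEQ_unique[OF lim2 lim1])
  have \<omega>pos: "\<omega> j > 0" if j: "j \<in> J" for j
  proof (rule ccontr)
    assume "\<not> \<omega> j > 0"
    hence "\<omega> j powr q j = 0" using \<omega>0[OF j] by simp
    hence "(\<Prod>j\<in>J. \<omega> j powr q j) = 0" using J j by (intro prod_zero) auto
    thus False using Vs_eq Vs0 by simp
  qed
  have zR: "zf (G j) (\<lambda>y. (norm (R j y))\<^sup>2) \<le> ennreal (1 / \<omega> j)" if j: "j \<in> J" for j
  proof (rule zf_fatou[OF G[OF j], where Q = "\<lambda>m y. (norm (Y m j y))\<^sup>2"])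
    show "(\<lambda>y. (norm (Y m j y))\<^sup>2) \<in> borel_measurable borel" for m
    proof -
      have [measurable]: "Y m j \<in> borel_measurable borel" by (rule linear_borel_measurable[OF Yj(1)[OF j]])
      show ?thesis by measurable
    qed
    show "(\<lambda>m. (norm (Y m j y))\<^sup>2) \<longlonglongrightarrow> (norm (R j y))\<^sup>2" if "y \<in> G j" for y
      by (intro tendsto_power tendsto_norm Ylim[OF j that])
    have "(\<lambda>m. 1 / (1 / z (Y m) j)) \<longlonglongrightarrow> 1 / \<omega> j"
      using \<omega>pos[OF j] by (intro tendsto_divide tendsto_const \<omega>lim[OF j]) simp
    hence "(\<lambda>m. ennreal (z (Y m) j)) \<longlonglongrightarrow> ennreal (1 / \<omega> j)" by (intro tendsto_ennrealI) simp
    thus "(\<lambda>m. zf (G j) (\<lambda>y. (norm (Y m j y))\<^sup>2)) \<longlonglongrightarrow> ennreal (1 / \<omega> j)"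
      unfolding Y_def zX(1)[OF j] .
  qed
  have Rinj: "inj_on (R j) (G j)" if j: "j \<in> J" for j
    by (rule zf_finite_imp_inj[OF G[OF j] Rlin]) (use le_less_trans[OF zR[OF j] ennreal_less_top] in simp)
  have Rf: "R \<in> frames"
    unfolding frames_def
  proof (intro CollectI ballI conjI Rlin Rinj)
    fix j assume j: "j \<in> J"
    show "R j ` G j = G j"
    proof (rule subspace_dim_equal)
      show "dim (G j) \<le> dim (R j ` G j)" using dim_image_eq[OF Rlin] Rinj[OF j] G[OF j] by (simp add: span_eq_iff[THEN iffD2])
    qed (use RG[OF j] Rlin G[OF j] in \<open>auto simp: linear_subspace_image\<close>)
  qed
  have zRj: "zf (G j) (\<lambda>y. (norm (R j y))\<^sup>2) = ennreal (z R j)" "z R j > 0" if "j \<in> J" for j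
    unfolding z_def using zf_linear_pos_finite[OF G[OF that] Rlin Rinj[OF that]] by auto
  have VR: "V R = zr H (N R) * (\<Prod>j\<in>J. (1 / z R j) powr q j)" by (rule Vform[OF zRj(2)])
  \<comment> \<open>Fatou's lemma yields only \<omega> j \<le> 1 / z R j, but this is the direction
    that makes \<open>V R\<close> large.\<close>
  have "Vs \<le> V R"
    unfolding Vs_eq VR
  proof (intro mult_left_mono prod_mono conjI powr_mono2)
    fix j assume j: "j \<in> J"
    have "z R j \<le> 1 / \<omega> j" using zR[OF j] \<omega>pos[OF j] unfolding zRj(1)[OF j] by (simp add: ennreal_le_iff)
    thus "\<omega> j \<le> 1 / z R j" using zRj(2)[OF j] \<omega>pos[OF j] by (simp add: field_simps)
    show "0 \<le> q j" using q[OF j] by simp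
    show "0 \<le> \<omega> j" by (rule \<omega>0[OF j])
  qed (auto simp: zr_def)
  thus ?thesis using Rf VVs order_trans by blast
qed

theorem bl_form_le_C:
  assumes mf: "\<And>j. j \<in> J \<Longrightarrow> f j \<in> borel_measurable borel" and f0: "\<And>j y. 0 \<le> f j y"
  shows "bl_form J H L q f \<le> ennreal C * (\<Prod>j\<in>J. ennreal_powr (\<integral>\<^sup>+y. ennreal (f j y) \<partial>sl (G j)) (q j))"
proof -
  obtain R where R: "R \<in> frames" "\<And>R'. R' \<in> frames \<Longrightarrow> V R' \<le> V R" using maximizer_exists by blast
  have "bl_form J H L q f \<le> ennreal (V R) * (\<Prod>j\<in>J. ennreal_powr (\<integral>\<^sup>+y. ennreal (f j y) \<partial>sl (G j)) (q j))"
    by (rule bl_form_le_V[OF R(1) N_pos[OF R(1)] R(2) mf f0])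
  also have "\<dots> \<le> ennreal C * (\<Prod>j\<in>J. ennreal_powr (\<integral>\<^sup>+y. ennreal (f j y) \<partial>sl (G j)) (q j))"
    by (intro mult_right_mono ennreal_leI V_le_C[OF R(1)]) simp
  finally show ?thesis .
qed

end

section \<open>Uniform coercivity near a simple datum\<close>

text \<open>One index set serves all initial segments at once. This compatibility with the whole
  flag later turns the dimensions of the images of its members into cardinalities.\<close>

lemma greedy_basis:
  fixes v :: "nat \<Rightarrow> 'b::euclidean_space"
  defines "I \<equiv> {i. v i \<notin> span (v ` {..<i})}"
  shows "span (v ` (I \<inter> {..<k})) = span (v ` {..<k}) \<and> independent (v ` (I \<inter> {..<k})) \<and> inj_on v (I \<inter> {..<k})"
proof (induction k)
  case 0
  show ?case using independent_empty by simp
next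
  case (Suc k)
  show ?case
  proof (cases "k \<in> I")
    case True
    have I: "I \<inter> {..<Suc k} = insert k (I \<inter> {..<k})" using True by auto
    have k: "v k \<notin> span (v ` (I \<inter> {..<k}))" using True Suc.IH by (simp add: I_def)
    have k': "v k \<notin> v ` (I \<inter> {..<k})" by (rule contra_subsetD[OF span_superset k])
    have "span (v ` (I \<inter> {..<Suc k})) = span (insert (v k) (v ` (I \<inter> {..<k})))" by (simp only: I image_insert)
    also have "\<dots> = span (insert (v k) (v ` {..<k}))" by (simp only: span_insert Suc.IH[THEN conjunct1])
    finally have "span (v ` (I \<inter> {..<Suc k})) = span (v ` {..<Suc k})" by (simp only: lessThan_Suc image_insert)
    moreover have "independent (v ` (I \<inter> {..<Suc k}))"
      unfolding I image_insert by (rule independent_insertI[OF k Suc.IH[THEN conjunct2, THEN conjunct1]])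
    moreover have "inj_on v (I \<inter> {..<Suc k})" unfolding I inj_on_insert using k' Suc.IH[THEN conjunct2, THEN conjunct2] by simp
    ultimately show ?thesis by blast
  next
    case False
    have I: "I \<inter> {..<Suc k} = I \<inter> {..<k}" using False by (auto simp: less_Suc_eq)
    have "v k \<in> span (v ` {..<k})" using False by (simp add: I_def)
    hence "span (v ` {..<Suc k}) = span (v ` {..<k})" by (simp add: lessThan_Suc span_redundant)
    thus ?thesis unfolding I using Suc.IH by simp
  qed
qed

text \<open>The coefficients are the values of the functionals dual to the vectors, and linear
  functionals in finite dimension are bounded.\<close>

lemma independent_coefficient_bound:
  fixes v :: "'i \<Rightarrow> 'b::euclidean_space"
  assumes I: "finite I" and inj: "inj_on v I" and ind: "independent (v ` I)"
  shows "\<exists>K>0. \<forall>\<alpha>. \<forall>i\<in>I. \<bar>\<alpha> i\<bar> \<le> K * norm (\<Sum>k\<in>I. \<alpha> k *\<^sub>R v k)"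
proof -
  have "\<forall>i\<in>I. \<exists>B>0. \<forall>\<alpha>. \<bar>\<alpha> i\<bar> \<le> B * norm (\<Sum>k\<in>I. \<alpha> k *\<^sub>R v k)"
  proof
    fix i assume i: "i \<in> I"
    obtain g :: "'b \<Rightarrow> real" where g: "linear g" "\<forall>x\<in>v ` I. g x = (if x = v i then 1 else 0)"
      using linear_independent_extend[OF ind, of "\<lambda>x. if x = v i then 1 else 0"] by blast
    obtain B where B: "B > 0" "\<And>x. norm (g x) \<le> B * norm x" using linear_bounded_pos[OF g(1)] by blast
    have "\<bar>\<alpha> i\<bar> \<le> B * norm (\<Sum>k\<in>I. \<alpha> k *\<^sub>R v k)" for \<alpha>
    proof -
      have "g (\<Sum>k\<in>I. \<alpha> k *\<^sub>R v k) = (\<Sum>k\<in>I. if k = i then \<alpha> k else 0)"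
        unfolding linear_sum[OF g(1)] linear_cmul[OF g(1)]
        using g(2) inj i by (intro sum.cong refl) (auto simp: inj_on_def)
      also have "\<dots> = \<alpha> i" using i I by simp
      finally show ?thesis using B(2)[of "\<Sum>k\<in>I. \<alpha> k *\<^sub>R v k"] by simp
    qed
    thus "\<exists>B>0. \<forall>\<alpha>. \<bar>\<alpha> i\<bar> \<le> B * norm (\<Sum>k\<in>I. \<alpha> k *\<^sub>R v k)" using B(1) by blast
  qed
  from bchoice[OF this] obtain B where B: "\<forall>i\<in>I. B i > 0 \<and> (\<forall>\<alpha>. \<bar>\<alpha> i\<bar> \<le> B i * norm (\<Sum>k\<in>I. \<alpha> k *\<^sub>R v k))" ..
  define K where "K = 1 + (\<Sum>i\<in>I. B i)"
  have "(\<Sum>i\<in>I. B i) \<ge> 0" using B by (intro sum_nonneg) (auto simp: less_imp_le)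
  hence "K > 0" by (simp add: K_def)
  moreover have "\<bar>\<alpha> i\<bar> \<le> K * norm (\<Sum>k\<in>I. \<alpha> k *\<^sub>R v k)" if i: "i \<in> I" for \<alpha> i
  proof -
    have "B i \<le> (\<Sum>i\<in>I. B i)" using B I i by (intro member_le_sum) (auto simp: less_imp_le)
    hence "B i \<le> K" by (simp add: K_def)
    hence "B i * norm (\<Sum>k\<in>I. \<alpha> k *\<^sub>R v k) \<le> K * norm (\<Sum>k\<in>I. \<alpha> k *\<^sub>R v k)" by (intro mult_right_mono) auto
    moreover have "\<bar>\<alpha> i\<bar> \<le> B i * norm (\<Sum>k\<in>I. \<alpha> k *\<^sub>R v k)" using B i by simp
    ultimately show ?thesis by linarith
  qed
  ultimately show ?thesis by blast
qed

text \<open>The error of replacing \<open>v\<close> by \<open>v'\<close> is controlled by the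
  largest coefficient; \<open>small\<close> allows half of that coefficient to be absorbed, at the
  price of doubling \<open>K\<close>.\<close>

lemma coefficient_bound_perturb:
  fixes v v' :: "'i \<Rightarrow> 'b::euclidean_space"
  assumes I: "finite I" and K: "K > 0"
    and coef: "\<And>i. i \<in> I \<Longrightarrow> \<bar>\<alpha> i\<bar> \<le> K * norm (\<Sum>k\<in>I. \<alpha> k *\<^sub>R v k)"
    and near: "\<And>k. k \<in> I \<Longrightarrow> norm (v' k - v k) \<le> \<eta>" and small: "K * \<eta> * real (card I) \<le> 1 / 2" and i: "i \<in> I"
  shows "\<bar>\<alpha> i\<bar> \<le> 2 * K * norm (\<Sum>k\<in>I. \<alpha> k *\<^sub>R v' k)"
proof -
  define a where "a = Max ((\<lambda>k. \<bar>\<alpha> k\<bar>) ` I)"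
  have ne: "(\<lambda>k. \<bar>\<alpha> k\<bar>) ` I \<noteq> {}" using i by auto
  have ak: "\<bar>\<alpha> k\<bar> \<le> a" if "k \<in> I" for k unfolding a_def using I that by (intro Max_ge) auto
  have a0: "a \<ge> 0" using ak[OF i] by linarith
  have "a \<in> (\<lambda>k. \<bar>\<alpha> k\<bar>) ` I" unfolding a_def using I ne by (intro Max_in) auto
  then obtain k0 where k0: "k0 \<in> I" "a = \<bar>\<alpha> k0\<bar>" by blast
  have "(\<Sum>k\<in>I. \<alpha> k *\<^sub>R v k) = (\<Sum>k\<in>I. \<alpha> k *\<^sub>R v' k) - (\<Sum>k\<in>I. \<alpha> k *\<^sub>R (v' k - v k))"
    by (simp add: sum_subtractf[symmetric] scaleR_diff_right)
  hence "norm (\<Sum>k\<in>I. \<alpha> k *\<^sub>R v k) \<le> norm (\<Sum>k\<in>I. \<alpha> k *\<^sub>R v' k) + norm (\<Sum>k\<in>I. \<alpha> k *\<^sub>R (v' k - v k))"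
    by (simp add: norm_triangle_ineq4)
  also have "norm (\<Sum>k\<in>I. \<alpha> k *\<^sub>R (v' k - v k)) \<le> (\<Sum>k\<in>I. a * \<eta>)"
  proof (intro order_trans[OF norm_sum] sum_mono)
    fix k assume k: "k \<in> I"
    show "norm (\<alpha> k *\<^sub>R (v' k - v k)) \<le> a * \<eta>"
      unfolding norm_scaleR using ak[OF k] near[OF k] a0 by (intro mult_mono) auto
  qed
  finally have "norm (\<Sum>k\<in>I. \<alpha> k *\<^sub>R v k) \<le> norm (\<Sum>k\<in>I. \<alpha> k *\<^sub>R v' k) + real (card I) * (a * \<eta>)" by simp
  hence "K * norm (\<Sum>k\<in>I. \<alpha> k *\<^sub>R v k) \<le> K * (norm (\<Sum>k\<in>I. \<alpha> k *\<^sub>R v' k) + real (card I) * (a * \<eta>))"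
    using K by (intro mult_left_mono) auto
  also have "\<dots> = K * norm (\<Sum>k\<in>I. \<alpha> k *\<^sub>R v' k) + (K * \<eta> * real (card I)) * a" by (simp add: algebra_simps)
  also have "\<dots> \<le> K * norm (\<Sum>k\<in>I. \<alpha> k *\<^sub>R v' k) + (1 / 2) * a" using small a0 by (intro add_left_mono mult_right_mono)
  finally have "a \<le> K * norm (\<Sum>k\<in>I. \<alpha> k *\<^sub>R v' k) + (1 / 2) * a" using coef[OF k0(1)] k0(2) by linarith
  hence "a \<le> 2 * K * norm (\<Sum>k\<in>I. \<alpha> k *\<^sub>R v' k)" by simp
  thus ?thesis using ak[OF i] by linarith
qed

text \<open>The condition of \<open>coercive_setting\<close> at a single frame, isolated so that
  constants may first depend on the frame and become uniform by compactness.\<close>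

definition coercive_at :: "'j set \<Rightarrow> 'a::euclidean_space set \<Rightarrow> ('j \<Rightarrow> 'b::euclidean_space set) \<Rightarrow> ('j \<Rightarrow> 'a \<Rightarrow> 'b) \<Rightarrow> ('j \<Rightarrow> real) \<Rightarrow> real \<Rightarrow> real \<Rightarrow> (nat \<Rightarrow> 'a) \<Rightarrow> bool" where
  "coercive_at J H G L q K \<delta> e \<longleftrightarrow>
     (\<exists>I. (\<forall>j\<in>J. I j \<subseteq> {..<dim H} \<and> card (I j) = dim (G j) \<and>
            (\<forall>\<alpha>. \<forall>i\<in>I j. \<bar>\<alpha> i\<bar> \<le> K * norm (\<Sum>k\<in>I j. \<alpha> k *\<^sub>R L j (e k)))) \<and>
          (\<forall>k. 0 < k \<and> k < dim H \<longrightarrow> (\<Sum>j\<in>J. q j * real (card (I j \<inter> {..<k}))) \<ge> real k + \<delta>))"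

lemma coercive_at_mono:
  assumes "coercive_at J H G L q K \<delta> e" "K \<le> K'" "\<delta>' \<le> \<delta>"
  shows "coercive_at J H G L q K' \<delta>' e"
proof -
  obtain I where I: "\<forall>j\<in>J. I j \<subseteq> {..<dim H} \<and> card (I j) = dim (G j) \<and>
            (\<forall>\<alpha>. \<forall>i\<in>I j. \<bar>\<alpha> i\<bar> \<le> K * norm (\<Sum>k\<in>I j. \<alpha> k *\<^sub>R L j (e k)))"
      and Ik: "\<forall>k. 0 < k \<and> k < dim H \<longrightarrow> (\<Sum>j\<in>J. q j * real (card (I j \<inter> {..<k}))) \<ge> real k + \<delta>"
    using assms(1) unfolding coercive_at_def by (elim exE conjE)
  have "\<bar>\<alpha> i\<bar> \<le> K' * norm (\<Sum>k\<in>I j. \<alpha> k *\<^sub>R L j (e k))" if "j \<in> J" "i \<in> I j" for j i \<alpha>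
  proof -
    have "\<bar>\<alpha> i\<bar> \<le> K * norm (\<Sum>k\<in>I j. \<alpha> k *\<^sub>R L j (e k))" using I that by simp
    also have "\<dots> \<le> K' * norm (\<Sum>k\<in>I j. \<alpha> k *\<^sub>R L j (e k))" using assms(2) by (intro mult_right_mono) auto
    finally show ?thesis .
  qed
  moreover have "real k + \<delta>' \<le> (\<Sum>j\<in>J. q j * real (card (I j \<inter> {..<k})))" if "0 < k" "k < dim H" for k
    using Ik[rule_format, of k] that assms(3) by simp
  ultimately show ?thesis unfolding coercive_at_def using I by (intro exI[of _ I]) simp
qed

text \<open>The index sets are chosen greedily for the given datum and frame. Independence of
  finitely many vectors and finitely many strict gaps are open conditions, so the same index sets
  serve all nearby data and frames.\<close>

lemma simple_datum_coercive_near_frame: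
  fixes l :: "'j \<Rightarrow> 'a::euclidean_space \<Rightarrow>\<^sub>L 'b::euclidean_space"
  assumes J: "finite J" and H: "subspace H" and G: "\<And>j. j \<in> J \<Longrightarrow> subspace (G j)"
    and lH: "\<And>j. j \<in> J \<Longrightarrow> blinfun_apply (l j) ` H \<subseteq> G j" and q: "\<And>j. j \<in> J \<Longrightarrow> q j > 0"
    and simple: "simple_datum J H G (l, q)" and n: "dim H > 0"
    and e: "orthonormal_family {..<dim H} e" "e ` {..<dim H} \<subseteq> H"
  shows "\<exists>K>0. \<exists>\<delta>>0. \<exists>\<rho>>0. \<forall>l' q' e'. (\<forall>j\<in>J. norm (l' j - l j) \<le> \<rho> \<and> \<bar>q' j - q j\<bar> \<le> \<rho>) \<and> (\<forall>i<dim H. norm (e' i) = 1 \<and> norm (e' i - e i) \<le> \<rho>)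
     \<longrightarrow> coercive_at J H G (\<lambda>j. blinfun_apply (l' j)) q' K \<delta> e'"
proof -
  let ?n = "dim H"
  have crit: "(\<Sum>j\<in>J. q j * real (dim (G j))) = real ?n"
    using simple by (simp add: simple_datum_def globally_critical_def)
  have sub: "(\<Sum>j\<in>J. q j * real (dim (blinfun_apply (l j) ` W))) \<ge> real (dim W)"
    "W \<noteq> {0} \<Longrightarrow> W \<noteq> H \<Longrightarrow> (\<Sum>j\<in>J. q j * real (dim (blinfun_apply (l j) ` W))) > real (dim W)"
    if "subspace W" "W \<subseteq> H" for W
    using simple that by (auto simp: simple_datum_def)
  have lin: "linear (blinfun_apply (l j))" for j by (rule bounded_linear.linear[OF blinfun.bounded_linear_right])
  define I0 where "I0 j = {i. l j (e i) \<notin> span ((\<lambda>i. l j (e i)) ` {..<i})}" for j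
  define I where "I j = I0 j \<inter> {..<?n}" for j
  note gr = greedy_basis[of "\<lambda>i. blinfun_apply (l _) (e i)", folded I0_def]
  define W where "W k = span (e ` {..<k})" for k
  have dW: "dim (W k) = k" if "k \<le> ?n" for k
  proof -
    have "orthonormal_family {..<k} e" using e(1) that by (auto simp: orthonormal_family_def)
    from orthonormal_family_card[OF this, symmetric] show ?thesis by (simp only: W_def card_lessThan)
  qed
  have WH: "W k \<subseteq> H" if "k \<le> ?n" for k
  proof -
    have "e ` {..<k} \<subseteq> H" using e(2) that by auto
    thus ?thesis unfolding W_def by (rule span_minimal) (rule H)
  qed
  \<comment> \<open>The number of chosen indices below \<open>k\<close> is the dimension of the
    image of the k-th flag member, so simplicity becomes a statement about cardinalities.\<close>
  have card: "card (I j \<inter> {..<k}) = dim (blinfun_apply (l j) ` W k)" if k: "k \<le> ?n" for j k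
  proof -
    have "I j \<inter> {..<k} = I0 j \<inter> {..<k}" using k by (auto simp: I_def)
    moreover have "blinfun_apply (l j) ` W k = span ((\<lambda>i. l j (e i)) ` {..<k})"
      unfolding W_def linear_span_image[OF lin, symmetric] by (simp add: image_image)
    moreover have "card (I0 j \<inter> {..<k}) = dim (span ((\<lambda>i. l j (e i)) ` (I0 j \<inter> {..<k})))"
      using dim_eq_card_independent[OF gr[THEN conjunct2, THEN conjunct1], of j k]
        card_image[OF gr[THEN conjunct2, THEN conjunct2], of j k] by (simp only: dim_span)
    ultimately show ?thesis by (simp only: gr[THEN conjunct1])
  qed
  have dWH: "W ?n = H"
    using e by (simp add: W_def orthonormal_family_spans[OF e(1,2) H])
  \<comment> \<open>The inequality of \<open>simple_datum\<close> for \<open>W = H\<close> enters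
    here: with positive weights, a deficit of one image would push the weighted sum below
    \<open>dim H\<close>.\<close>
  have surj: "dim (blinfun_apply (l j) ` H) = dim (G j)" if j: "j \<in> J" for j
  proof (rule ccontr)
    assume ne: "dim (blinfun_apply (l j) ` H) \<noteq> dim (G j)"
    have le: "dim (blinfun_apply (l i) ` H) \<le> dim (G i)" if "i \<in> J" for i by (rule dim_subset[OF lH[OF that]])
    have "(\<Sum>j\<in>J. q j * real (dim (blinfun_apply (l j) ` H))) < (\<Sum>j\<in>J. q j * real (dim (G j)))"
    proof (rule sum_strict_mono_ex1[OF J])
      show "\<forall>i\<in>J. q i * real (dim (blinfun_apply (l i) ` H)) \<le> q i * real (dim (G i))"
        using le q by (auto intro!: mult_left_mono simp: less_imp_le)
      show "\<exists>i\<in>J. q i * real (dim (blinfun_apply (l i) ` H)) < q i * real (dim (G i))"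
        using le[OF j] ne q[OF j] j by (intro bexI[of _ j]) auto
    qed
    thus False using sub(1)[OF H] crit by simp
  qed
  have Icard: "card (I j) = dim (G j)" if j: "j \<in> J" for j
    using card[of ?n j] surj[OF j] dWH by (simp add: I_def)
  have fin: "finite (I j)" for j by (simp add: I_def)
  define gap where "gap k = (\<Sum>j\<in>J. q j * real (card (I j \<inter> {..<k}))) - real k" for k
  have gap: "gap k > 0" if k: "0 < k" "k < ?n" for k
  proof -
    have s: "subspace (W k)" by (simp add: W_def)
    have d: "dim (W k) = k" and le: "k \<le> ?n" using k dW[of k] by simp_all
    have "W k \<noteq> {0}"
    proof
      assume "W k = {0}"
      hence "dim (W k) = 0" by simp
      thus False using d k(1) by linarith
    qed
    moreover have "W k \<noteq> H"
    proof
      assume "W k = H"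
      hence "dim (W k) = ?n" by simp
      thus False using d k(2) by linarith
    qed
    ultimately have "(\<Sum>j\<in>J. q j * real (dim (blinfun_apply (l j) ` W k))) > real (dim (W k))"
      by (rule sub(2)[OF s WH[OF le]])
    thus ?thesis unfolding gap_def card[OF le] d by linarith
  qed
  \<comment> \<open>Half of the smallest gap; the other half is reserved for the perturbation of the
    weights. The inserted 1 gives \<open>Min\<close> a nonempty set when
    \<open>dim H = 1\<close>.\<close>
  define \<delta> where "\<delta> = Min (insert 1 (gap ` {0<..<?n})) / 2"
  have \<delta>: "\<delta> > 0" unfolding \<delta>_def using gap by simp
  have gap2: "gap k \<ge> 2 * \<delta>" if "0 < k" "k < ?n" for k
  proof -
    have "Min (insert 1 (gap ` {0<..<?n})) \<le> gap k" using that by (intro Min_le) auto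
    thus ?thesis by (simp add: \<delta>_def)
  qed
  have "\<forall>j\<in>J. \<exists>K>0. \<forall>\<alpha>. \<forall>i\<in>I j. \<bar>\<alpha> i\<bar> \<le> K * norm (\<Sum>k\<in>I j. \<alpha> k *\<^sub>R l j (e k))"
    using gr[of _ ?n] fin by (intro ballI independent_coefficient_bound) (auto simp: I_def)
  from bchoice[OF this] obtain \<kappa> where \<kappa>: "\<forall>j\<in>J. \<kappa> j > 0 \<and> (\<forall>\<alpha>. \<forall>i\<in>I j. \<bar>\<alpha> i\<bar> \<le> \<kappa> j * norm (\<Sum>k\<in>I j. \<alpha> k *\<^sub>R l j (e k)))" ..
  define K where "K = 1 + (\<Sum>j\<in>J. \<kappa> j)"
  have "(\<Sum>j\<in>J. \<kappa> j) \<ge> 0" using \<kappa> by (intro sum_nonneg) (auto simp: less_imp_le)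
  hence K: "K > 0" by (simp add: K_def)
  have coef: "\<bar>\<alpha> i\<bar> \<le> K * norm (\<Sum>k\<in>I j. \<alpha> k *\<^sub>R l j (e k))" if j: "j \<in> J" and i: "i \<in> I j" for j i \<alpha>
  proof -
    have "\<kappa> j \<le> (\<Sum>j\<in>J. \<kappa> j)" using \<kappa> J j by (intro member_le_sum) (auto simp: less_imp_le)
    hence "\<kappa> j \<le> K" by (simp add: K_def)
    hence "\<kappa> j * norm (\<Sum>k\<in>I j. \<alpha> k *\<^sub>R l j (e k)) \<le> K * norm (\<Sum>k\<in>I j. \<alpha> k *\<^sub>R l j (e k))" by (intro mult_right_mono) auto
    moreover have "\<bar>\<alpha> i\<bar> \<le> \<kappa> j * norm (\<Sum>k\<in>I j. \<alpha> k *\<^sub>R l j (e k))" using \<kappa> j i by simp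
    ultimately show ?thesis by linarith
  qed
  define M where "M = 1 + (\<Sum>j\<in>J. norm (l j))"
  have M: "M > 0" unfolding M_def by (simp add: add_pos_nonneg sum_nonneg)
  \<comment> \<open>The first entry limits the loss in the gaps to \<open>\<delta>\<close>. The
    second keeps the displacement of the image vectors, at most \<open>\<rho> * M\<close>, within
    what \<open>coefficient_bound_perturb\<close> tolerates.\<close>
  define \<rho> where "\<rho> = min (\<delta> / (real (card J) * real ?n + 1)) (1 / (2 * K * real ?n * M))"
  have \<rho>: "\<rho> > 0" unfolding \<rho>_def using \<delta> K M n by (simp add: add_nonneg_pos)
  have \<rho>1: "\<rho> * (real (card J) * real ?n) \<le> \<delta>"
  proof -
    have "\<rho> \<le> \<delta> / (real (card J) * real ?n + 1)" by (simp add: \<rho>_def)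
    moreover have "0 < real (card J) * real ?n + 1" by (simp add: add_nonneg_pos)
    ultimately have "\<rho> * (real (card J) * real ?n + 1) \<le> \<delta>" by (simp add: pos_le_divide_eq)
    thus ?thesis using \<rho> by (simp add: algebra_simps)
  qed
  have \<rho>2: "K * (\<rho> * M) * real ?n \<le> 1 / 2"
  proof -
    have "\<rho> \<le> 1 / (2 * K * real ?n * M)" by (simp add: \<rho>_def)
    moreover have "0 < 2 * K * real ?n * M" using K M n by simp
    ultimately have "\<rho> * (2 * K * real ?n * M) \<le> 1" by (simp add: pos_le_divide_eq)
    thus ?thesis by (simp add: algebra_simps)
  qed
  show ?thesis
  proof (rule exI[of _ "2 * K"], rule conjI[rotated], rule exI[of _ \<delta>], rule conjI[OF \<delta>], rule exI[of _ \<rho>], rule conjI[OF \<rho>], intro allI impI)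
    show "2 * K > 0" using K by simp
    fix l' :: "'j \<Rightarrow> 'a \<Rightarrow>\<^sub>L 'b" and q' :: "'j \<Rightarrow> real" and e' :: "nat \<Rightarrow> 'a"
    assume as: "(\<forall>j\<in>J. norm (l' j - l j) \<le> \<rho> \<and> \<bar>q' j - q j\<bar> \<le> \<rho>) \<and> (\<forall>i<dim H. norm (e' i) = 1 \<and> norm (e' i - e i) \<le> \<rho>)"
    have near: "norm (l' j (e' k) - l j (e k)) \<le> \<rho> * M" if j: "j \<in> J" and k: "k \<in> I j" for j k
    proof -
      have k': "k < ?n" using k by (simp add: I_def)
      have "l' j (e' k) - l j (e k) = (l' j - l j) (e' k) + l j (e' k - e k)"
        by (simp add: blinfun.diff_left blinfun.diff_right)
      also have "norm \<dots> \<le> norm (l' j - l j) * norm (e' k) + norm (l j) * norm (e' k - e k)"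
        by (intro order_trans[OF norm_triangle_ineq] add_mono norm_blinfun)
      also have "\<dots> \<le> \<rho> * 1 + norm (l j) * \<rho>" using as j k' by (intro add_mono mult_mono) auto
      also have "\<dots> = \<rho> * (1 + norm (l j))" by (simp add: algebra_simps)
      also have "\<dots> \<le> \<rho> * M"
        unfolding M_def using \<rho> J j by (intro mult_left_mono add_left_mono member_le_sum) auto
      finally show ?thesis .
    qed
    show "coercive_at J H G (\<lambda>j. blinfun_apply (l' j)) q' (2 * K) \<delta> e'"
      unfolding coercive_at_def
    proof (intro exI[of _ I] conjI ballI allI impI)
      fix j assume j: "j \<in> J"
      show "I j \<subseteq> {..<?n}" by (simp add: I_def)
      show "card (I j) = dim (G j)" by (rule Icard[OF j])
      have cI: "card (I j) \<le> ?n" using card_mono[of "{..<?n}" "I j"] by (simp add: I_def)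
      fix \<alpha> i assume i: "i \<in> I j"
      have "K * (\<rho> * M) * real (card (I j)) \<le> K * (\<rho> * M) * real ?n"
        using cI K \<rho> M by (intro mult_left_mono) auto
      hence sm: "K * (\<rho> * M) * real (card (I j)) \<le> 1 / 2" using \<rho>2 by linarith
      show "\<bar>\<alpha> i\<bar> \<le> 2 * K * norm (\<Sum>k\<in>I j. \<alpha> k *\<^sub>R blinfun_apply (l' j) (e' k))"
        by (rule coefficient_bound_perturb[where v = "\<lambda>k. blinfun_apply (l j) (e k)", OF fin K coef[OF j] near[OF j] sm i])
    next
      fix k assume k: "0 < k \<and> k < ?n"
      have "(\<Sum>j\<in>J. q j * real (card (I j \<inter> {..<k}))) - (\<Sum>j\<in>J. q' j * real (card (I j \<inter> {..<k}))) = (\<Sum>j\<in>J. (q j - q' j) * real (card (I j \<inter> {..<k})))"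
        by (simp add: sum_subtractf[symmetric] left_diff_distrib)
      also have "\<dots> \<le> (\<Sum>j\<in>J. \<rho> * real ?n)"
      proof (rule sum_mono)
        fix j assume j: "j \<in> J"
        have "q j - q' j \<le> \<rho>" using as j by (auto simp: abs_le_iff)
        moreover have "card (I j \<inter> {..<k}) \<le> ?n" using card_mono[of "{..<?n}" "I j \<inter> {..<k}"] by (simp add: I_def le_infI1)
        ultimately show "(q j - q' j) * real (card (I j \<inter> {..<k})) \<le> \<rho> * real ?n"
          using \<rho> by (intro mult_mono) auto
      qed
      also have "\<dots> \<le> \<delta>" using \<rho>1 by (simp add: mult_ac)
      finally show "real k + \<delta> \<le> (\<Sum>j\<in>J. q' j * real (card (I j \<inter> {..<k})))"
        using gap2[of k] k unfolding gap_def by linarith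
    qed
  qed
qed

text \<open>Compactness by contradiction: otherwise there are data within 1 / (m + 1) of the given
  one and frames that violate coercivity with \<open>K = m + 1\<close> and
  \<open>\<delta> = 1 / (m + 1)\<close>. The frames subconverge to an orthonormal frame of
  \<open>H\<close>, and its neighbourhood from the local lemma eventually contains the
  violators.\<close>

lemma simple_datum_coercive_near:
  fixes l :: "'j \<Rightarrow> 'a::euclidean_space \<Rightarrow>\<^sub>L 'b::euclidean_space"
  assumes J: "finite J" and H: "subspace H" and G: "\<And>j. j \<in> J \<Longrightarrow> subspace (G j)"
    and lH: "\<And>j. j \<in> J \<Longrightarrow> blinfun_apply (l j) ` H \<subseteq> G j" and q: "\<And>j. j \<in> J \<Longrightarrow> q j > 0"
    and simple: "simple_datum J H G (l, q)" and n: "dim H > 0"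
  shows "\<exists>r>0. \<exists>K>0. \<exists>\<delta>>0. \<forall>l' q' e. (\<forall>j\<in>J. norm (l' j - l j) \<le> r \<and> \<bar>q' j - q j\<bar> \<le> r) \<and>
       orthonormal_family {..<dim H} e \<and> e ` {..<dim H} \<subseteq> H
     \<longrightarrow> coercive_at J H G (\<lambda>j. blinfun_apply (l' j)) q' K \<delta> e"
proof (rule ccontr)
  assume neg: "\<not> ?thesis"
  define bad where "bad m p \<longleftrightarrow> (\<forall>j\<in>J. norm (fst p j - l j) \<le> 1 / (real m + 1) \<and> \<bar>fst (snd p) j - q j\<bar> \<le> 1 / (real m + 1)) \<and>
       orthonormal_family {..<dim H} (snd (snd p)) \<and> snd (snd p) ` {..<dim H} \<subseteq> H \<and>
       \<not> coercive_at J H G (\<lambda>j. blinfun_apply (fst p j)) (fst (snd p)) (real m + 1) (1 / (real m + 1)) (snd (snd p))"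
    for m :: nat and p :: "('j \<Rightarrow> 'a \<Rightarrow>\<^sub>L 'b) \<times> ('j \<Rightarrow> real) \<times> (nat \<Rightarrow> 'a)"
  have "\<forall>m. \<exists>p. bad m p"
  proof
    fix m :: nat
    have "\<not> (\<forall>l' q' e. (\<forall>j\<in>J. norm (l' j - l j) \<le> 1 / (real m + 1) \<and> \<bar>q' j - q j\<bar> \<le> 1 / (real m + 1)) \<and>
       orthonormal_family {..<dim H} e \<and> e ` {..<dim H} \<subseteq> H
     \<longrightarrow> coercive_at J H G (\<lambda>j. blinfun_apply (l' j)) q' (real m + 1) (1 / (real m + 1)) e)"
    proof
      assume as: "\<forall>l' q' e. (\<forall>j\<in>J. norm (l' j - l j) \<le> 1 / (real m + 1) \<and> \<bar>q' j - q j\<bar> \<le> 1 / (real m + 1)) \<and>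
       orthonormal_family {..<dim H} e \<and> e ` {..<dim H} \<subseteq> H
     \<longrightarrow> coercive_at J H G (\<lambda>j. blinfun_apply (l' j)) q' (real m + 1) (1 / (real m + 1)) e"
      have "1 / (real m + 1) > 0" "real m + 1 > 0" by auto
      with as neg show False by blast
    qed
    then obtain l' q' e where "bad m (l', q', e)" unfolding bad_def by auto
    thus "\<exists>p. bad m p" by (rule exI)
  qed
  from choice[OF this] obtain p where p: "\<forall>m. bad m (p m)" ..
  define E where "E m = snd (snd (p m))" for m
  have Eon: "orthonormal_family {..<dim H} (E m)" and EH: "E m ` {..<dim H} \<subseteq> H" for m
    using p[rule_format, of m] unfolding bad_def E_def by auto
  have E1: "norm (E m i) = 1" if "i < dim H" for m i
    using Eon[of m] that by (simp add: orthonormal_family_def norm_eq_1)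
  have "\<exists>r e. strict_mono (r :: nat \<Rightarrow> nat) \<and> (\<forall>i\<in>{..<dim H}. (\<lambda>m. E (r m) i) \<longlonglongrightarrow> e i)"
  proof (rule finite_family_convergent_subsequence)
    fix i assume "i \<in> {..<dim H}"
    thus "bounded (range (\<lambda>m. E m i))" using E1 by (intro boundedI[of _ 1]) auto
  qed simp
  then obtain r e where r: "strict_mono (r :: nat \<Rightarrow> nat)" and re: "\<forall>i\<in>{..<dim H}. (\<lambda>m. E (r m) i) \<longlonglongrightarrow> e i"
    by (elim exE conjE)
  have eon: "orthonormal_family {..<dim H} e"
    unfolding orthonormal_family_def
  proof (intro ballI)
    fix i k assume ik: "i \<in> {..<dim H}" "k \<in> {..<dim H}"
    have "(\<lambda>m. E (r m) i \<bullet> E (r m) k) \<longlonglongrightarrow> e i \<bullet> e k" using re ik by (intro tendsto_inner) auto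
    moreover have "(\<lambda>m. E (r m) i \<bullet> E (r m) k) = (\<lambda>m. if i = k then 1 else 0)"
      using Eon ik by (auto simp: orthonormal_family_def)
    ultimately have "(\<lambda>m::nat. if i = k then 1 else 0) \<longlonglongrightarrow> e i \<bullet> e k" by simp
    thus "e i \<bullet> e k = (if i = k then 1 else 0)" by (rule LIMSEQ_unique) simp
  qed
  have eH: "e ` {..<dim H} \<subseteq> H"
  proof
    fix x assume "x \<in> e ` {..<dim H}"
    then obtain i where i: "i < dim H" "x = e i" by auto
    have lim: "(\<lambda>m. E (r m) i) \<longlonglongrightarrow> e i" using re i by simp
    show "x \<in> H" unfolding i(2)
    proof (rule closed_sequentially[OF closed_subspace[OF H] _ lim])
      show "E (r m) i \<in> H" for m using EH[of "r m"] i by auto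
    qed
  qed
  obtain K \<delta> \<rho> where K: "K > 0" and \<delta>: "\<delta> > 0" and \<rho>: "\<rho> > 0"
    and co: "\<forall>l' q' e'. (\<forall>j\<in>J. norm (l' j - l j) \<le> \<rho> \<and> \<bar>q' j - q j\<bar> \<le> \<rho>) \<and> (\<forall>i<dim H. norm (e' i) = 1 \<and> norm (e' i - e i) \<le> \<rho>)
     \<longrightarrow> coercive_at J H G (\<lambda>j. blinfun_apply (l' j)) q' K \<delta> e'"
    using simple_datum_coercive_near_frame[of J H G l q e, OF J H G lH q simple n eon eH] by auto
  have "\<forall>\<^sub>F m in sequentially. \<forall>i\<in>{..<dim H}. dist (E (r m) i) (e i) < \<rho>"
    using re \<rho> by (intro eventually_ball_finite) (auto simp: tendsto_iff)
  then obtain N1 where N1: "\<And>m i. m \<ge> N1 \<Longrightarrow> i < dim H \<Longrightarrow> dist (E (r m) i) (e i) < \<rho>"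
    unfolding eventually_sequentially by auto
  obtain N2 :: nat where N2: "max (1 / \<rho>) (max (1 / \<delta>) K) \<le> real N2" using real_arch_simple by blast
  define m where "m = max N1 N2"
  have rm: "m \<le> r m" by (rule seq_suble[OF r])
  hence big: "max (1 / \<rho>) (max (1 / \<delta>) K) \<le> real (r m) + 1" using N2 by (simp add: m_def)
  have b1: "1 / (real (r m) + 1) \<le> \<rho>" "1 / (real (r m) + 1) \<le> \<delta>" "K \<le> real (r m) + 1"
    using big \<rho> \<delta> by (auto simp: field_simps)
  have pb: "bad (r m) (p (r m))" using p by simp
  have "coercive_at J H G (\<lambda>j. blinfun_apply (fst (p (r m)) j)) (fst (snd (p (r m)))) K \<delta> (E (r m))"
  proof (rule co[THEN spec, THEN spec, THEN spec, THEN mp], intro conjI ballI allI impI)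
    fix j assume j: "j \<in> J"
    have "norm (fst (p (r m)) j - l j) \<le> 1 / (real (r m) + 1)" "\<bar>fst (snd (p (r m))) j - q j\<bar> \<le> 1 / (real (r m) + 1)"
      using pb j by (auto simp: bad_def)
    thus "norm (fst (p (r m)) j - l j) \<le> \<rho>" "\<bar>fst (snd (p (r m))) j - q j\<bar> \<le> \<rho>" using b1(1) by auto
  next
    fix i assume i: "i < dim H"
    show "norm (E (r m) i) = 1" by (rule E1[OF i])
    show "norm (E (r m) i - e i) \<le> \<rho>" using N1[of m i] i by (simp add: m_def dist_norm)
  qed
  hence "coercive_at J H G (\<lambda>j. blinfun_apply (fst (p (r m)) j)) (fst (snd (p (r m)))) (real (r m) + 1) (1 / (real (r m) + 1)) (E (r m))"
    by (rule coercive_at_mono) (use b1 in auto)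
  thus False using pb unfolding bad_def E_def by simp
qed

section \<open>Transfer to the Brascamp-Lieb constant\<close>

lemma BL_constant_le:
  assumes J: "finite J" and H: "subspace H" and G: "\<And>j. j \<in> J \<Longrightarrow> subspace (G j)"
    and lH: "\<And>j. j \<in> J \<Longrightarrow> blinfun_apply (l j) ` H \<subseteq> G j"
    and le: "\<And>f. (\<And>j. j \<in> J \<Longrightarrow> f j \<in> borel_measurable borel) \<Longrightarrow> (\<And>j y. 0 \<le> f j y) \<Longrightarrow>
       bl_form J H (\<lambda>j. blinfun_apply (l j)) q f \<le> c * (\<Prod>j\<in>J. ennreal_powr (\<integral>\<^sup>+y. ennreal (f j y) \<partial>sl (G j)) (q j))"
  shows "BL_constant J H G (l, q) \<le> c"
  unfolding BL_constant_def prod.case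
proof (rule Inf_lower, intro CollectI allI impI)
  fix f :: "'a \<Rightarrow> 'c \<Rightarrow> real"
  assume f: "\<forall>j\<in>J. f j \<in> borel_measurable (subspace_lborel (G j)) \<and> (\<forall>y\<in>G j. 0 \<le> f j y)"
  \<comment> \<open>A test function is constrained on \<open>G j\<close> only; extension by 0 makes
    it Borel and nonnegative on the whole type without changing any integral.\<close>
  define g where "g j y = (if j \<in> J \<and> y \<in> G j then f j y else 0)" for j y
  have g0: "0 \<le> g j y" for j y using f by (simp add: g_def)
  have mg: "g j \<in> borel_measurable borel" if j: "j \<in> J" for j
  proof -
    have "f j \<in> borel_measurable (restrict_space borel (G j))"
      using f j by (simp add: measurable_cong_sets[OF sets_subspace_lborel refl])
    moreover have "G j \<in> sets borel" using closed_subspace[OF G[OF j]] by auto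
    ultimately have "(\<lambda>y. if y \<in> G j then f j y else 0) \<in> borel_measurable borel"
      by (subst (asm) measurable_restrict_space_iff) auto
    thus ?thesis using j by (simp add: g_def[abs_def])
  qed
  have ig: "(\<integral>\<^sup>+y. ennreal (g j y) \<partial>sl (G j)) = (\<integral>\<^sup>+y. ennreal (f j y) \<partial>subspace_lborel (G j))" if j: "j \<in> J" for j
  proof -
    have "(\<lambda>y. ennreal (g j y)) \<in> borel_measurable borel" using mg[OF j] by simp
    hence "(\<integral>\<^sup>+y. ennreal (g j y) \<partial>sl (G j)) = (\<integral>\<^sup>+y. ennreal (g j y) \<partial>subspace_lborel (G j))" by (rule nn_integral_sl)
    also have "\<dots> = (\<integral>\<^sup>+y. ennreal (f j y) \<partial>subspace_lborel (G j))"
      using j by (intro nn_integral_cong) (simp add: g_def space_subspace_lborel)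
    finally show ?thesis .
  qed
  have mx: "(\<lambda>x. ennreal (\<Prod>j\<in>J. g j (blinfun_apply (l j) x) powr q j)) \<in> borel_measurable borel"
  proof -
    have "(\<lambda>x. g j (blinfun_apply (l j) x) powr q j) \<in> borel_measurable borel" if j: "j \<in> J" for j
    proof -
      have "blinfun_apply (l j) \<in> borel_measurable borel"
        by (rule linear_borel_measurable[OF bounded_linear.linear[OF blinfun.bounded_linear_right]])
      from measurable_compose[OF this mg[OF j]] have [measurable]: "(\<lambda>x. g j (blinfun_apply (l j) x)) \<in> borel_measurable borel" .
      show ?thesis by measurable
    qed
    thus ?thesis by (intro measurable_compose[OF _ measurable_ennreal] borel_measurable_prod)
  qed
  have "(\<integral>\<^sup>+x. (\<Prod>j\<in>J. ennreal (f j (blinfun_apply (l j) x) powr q j)) \<partial>subspace_lborel H)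
      = (\<integral>\<^sup>+x. ennreal (\<Prod>j\<in>J. g j (blinfun_apply (l j) x) powr q j) \<partial>subspace_lborel H)"
  proof (rule nn_integral_cong)
    fix x assume "x \<in> space (subspace_lborel H)"
    hence x: "x \<in> H" by (simp add: space_subspace_lborel)
    have "g j (blinfun_apply (l j) x) = f j (blinfun_apply (l j) x)" if "j \<in> J" for j
      using lH[OF that] x that by (auto simp: g_def)
    hence "(\<Prod>j\<in>J. ennreal (f j (blinfun_apply (l j) x) powr q j)) = (\<Prod>j\<in>J. ennreal (g j (blinfun_apply (l j) x) powr q j))"
      by (intro prod.cong refl) simp
    also have "\<dots> = ennreal (\<Prod>j\<in>J. g j (blinfun_apply (l j) x) powr q j)" by (rule prod_ennreal) simp
    finally show "(\<Prod>j\<in>J. ennreal (f j (blinfun_apply (l j) x) powr q j)) = ennreal (\<Prod>j\<in>J. g j (blinfun_apply (l j) x) powr q j)" .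
  qed
  also have "\<dots> = bl_form J H (\<lambda>j. blinfun_apply (l j)) q g"
    unfolding bl_form_def by (rule nn_integral_sl[OF mx, symmetric])
  also have "\<dots> \<le> c * (\<Prod>j\<in>J. ennreal_powr (\<integral>\<^sup>+y. ennreal (g j y) \<partial>sl (G j)) (q j))"
    by (rule le[OF mg g0])
  also have "\<dots> = c * (\<Prod>j\<in>J. ennreal_powr (\<integral>\<^sup>+y. ennreal (f j y) \<partial>subspace_lborel (G j)) (q j))"
    by (intro arg_cong2[where f = times] prod.cong refl) (simp only: ig)
  finally show "(\<integral>\<^sup>+x. (\<Prod>j\<in>J. ennreal (f j (blinfun_apply (l j) x) powr q j)) \<partial>subspace_lborel H)
         \<le> c * (\<Prod>j\<in>J. ennreal_powr (\<integral>\<^sup>+y. ennreal (f j y) \<partial>subspace_lborel (G j)) (q j))" .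
qed

text \<open>Criticality with positive weights forces all \<open>G j\<close> to be {0}, and the datum
  is geometric with zero adjoints. The case stands apart because coercivity speaks of a smallest and
  a largest eigenvalue.\<close>

lemma BL_constant_le_one_if_dim_0:
  assumes J: "finite J" and H: "subspace H" and G: "\<And>j. j \<in> J \<Longrightarrow> subspace (G j)"
    and D: "(l, q) \<in> bl_data J H G" and crit: "globally_critical J H G (l, q)" and n: "dim H = 0"
  shows "BL_constant J H G (l, q) \<le> 1"
proof -
  have q: "q j > 0" and lH: "blinfun_apply (l j) ` H \<subseteq> G j" if "j \<in> J" for j
    using D that by (auto simp: bl_data_def linear_maps_def PiE_iff)
  have H0: "H = {0}" using n H subspace_0 by auto
  have "(\<Sum>j\<in>J. q j * real (dim (G j))) = 0" using crit n by (simp add: globally_critical_def)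
  hence "q j * real (dim (G j)) = 0" if "j \<in> J" for j
    using sum_nonneg_eq_0_iff[OF J, of "\<lambda>j. q j * real (dim (G j))"] q that by (auto simp: less_imp_le)
  hence G0: "G j = {0}" if "j \<in> J" for j using q[OF that] that G[OF that] subspace_0 by fastforce
  interpret geo: geometric_datum J H G "\<lambda>j. blinfun_apply (l j)" "\<lambda>_ _. 0" q
  proof (rule geometric_datum.intro)
    show "linear (blinfun_apply (l j))" for j by (rule bounded_linear.linear[OF blinfun.bounded_linear_right])
    show "(\<Sum>j\<in>J. q j * real (dim (G j))) = real (dim H)" using crit by (simp add: globally_critical_def)
  qed (use J H G q lH H0 G0 in \<open>auto simp: linear_zero\<close>)
  show ?thesis
    by (rule BL_constant_le[OF J H G lH]) (use geo.bl_form_le in auto)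
qed

theorem corollary1p3:
  fixes J :: "'j set"
    and H :: "'a::euclidean_space set"
    and G :: "'j \<Rightarrow> 'b::euclidean_space set"
    and D :: "('j, 'a, 'b) bl_datum"
  assumes "finite J"
    and "subspace H"
    and "\<And>j. j \<in> J \<Longrightarrow> subspace (G j)"
    and "D \<in> bl_data J H G"
    and "simple_datum J H G D"
  shows "\<exists>(C::real) U. C > 0 \<and> openin (bl_data_topology J H G) U \<and> D \<in> U \<and>
           (\<forall>D'\<in>U. globally_critical J H G D' \<longrightarrow> BL_constant J H G D' < ennreal C)"
proof (cases "dim H = 0")
  case True
  \<comment> \<open>In dimension 0 every globally critical datum has constant at most 1, so the
    whole space is a suitable neighbourhood.\<close>
  show ?thesis
  proof (intro exI[of _ 2] exI[of _ "bl_data J H G"] conjI ballI impI)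
    show "openin (bl_data_topology J H G) (bl_data J H G)"
      unfolding topspace_bl_data_topology[symmetric] by (rule openin_topspace)
    fix D' assume D': "D' \<in> bl_data J H G" "globally_critical J H G D'"
    obtain l' q' where D'_eq: "D' = (l', q')" by (cases D')
    have "BL_constant J H G D' \<le> 1"
      unfolding D'_eq by (rule BL_constant_le_one_if_dim_0[OF assms(1,2)]) (use assms(3) D' True D'_eq in auto)
    also have "1 < ennreal 2" by simp
    finally show "BL_constant J H G D' < ennreal 2" .
  qed (use assms in auto)
next
  case False
  obtain l q where D: "D = (l, q)" by (cases D)
  have lq: "l \<in> (\<Pi>\<^sub>E j\<in>J. linear_maps H (G j))" "q \<in> (\<Pi>\<^sub>E j\<in>J. {0<..})"
    using assms(4) by (auto simp: D bl_data_def)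
  have lH: "blinfun_apply (l j) ` H \<subseteq> G j" and q: "q j > 0" if "j \<in> J" for j
    using lq that by (auto simp: linear_maps_def PiE_iff)
  have n: "dim H > 0" using False by linarith
  obtain r K \<delta> where r: "r > 0" and K: "K > 0" and \<delta>: "\<delta> > 0"
    and co: "\<forall>l' q' e. (\<forall>j\<in>J. norm (l' j - l j) \<le> r \<and> \<bar>q' j - q j\<bar> \<le> r) \<and>
       orthonormal_family {..<dim H} e \<and> e ` {..<dim H} \<subseteq> H
     \<longrightarrow> coercive_at J H G (\<lambda>j. blinfun_apply (l' j)) q' K \<delta> e"
    using simple_datum_coercive_near[of J H G l q, OF assms(1-3) lH q _ n] assms(5) unfolding D by auto
  define U1 where "U1 = (\<Pi>\<^sub>E j\<in>J. linear_maps H (G j) \<inter> ball (l j) r)"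
  \<comment> \<open>The radius \<open>q j / 2\<close> confines the new weight between
    \<open>q j / 2\<close> and \<open>2 * q j\<close>; the constant \<open>C\<close> depends on the
    weights and is bounded uniformly in this range.\<close>
  define U2 where "U2 = (\<Pi>\<^sub>E j\<in>J. {0<..} \<inter> ball (q j) (min r (q j / 2)))"
  \<comment> \<open>The Hadamard constant at the least weight \<open>q j / 2\<close>. The maximum
    with 1 makes its powers increase with the exponent, so that the exponent can be replaced by
    \<open>2 * q j\<close>.\<close>
  define M where "M j = max 1 ((K * (real (dim (G j)) + 1)) ^ dim (G j) * (1 / sqrt (q j / 2)) ^ dim (G j))" for j
  define B where "B = (\<Prod>j\<in>J. M j powr (2 * q j))"
  have B0: "B \<ge> 0" unfolding B_def by (intro prod_nonneg) auto
  \<comment> \<open>The summand 1 in \<open>B + 1\<close> makes the constant positive and the final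
    inequality strict.\<close>
  show ?thesis
  proof (intro exI[of _ "B + 1"] exI[of _ "U1 \<times> U2"] conjI ballI impI)
    show "B + 1 > 0" using B0 by simp
    have "openin (product_topology (\<lambda>j. subtopology euclidean (linear_maps H (G j))) J) U1"
      unfolding U1_def using assms(1) by (auto simp: openin_PiE intro: openin_open_Int)
    moreover have "openin (product_topology (\<lambda>j. subtopology euclidean {0<..}) J) U2"
      unfolding U2_def using assms(1) by (subst openin_PiE) (auto intro!: openin_open_Int)
    ultimately show "openin (bl_data_topology J H G) (U1 \<times> U2)"
      unfolding bl_data_topology_def by (simp add: openin_prod_Times_iff)
    show "D \<in> U1 \<times> U2" using lq q r by (auto simp: D U1_def U2_def PiE_iff)
    fix D' assume D': "D' \<in> U1 \<times> U2" "globally_critical J H G D'"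
    obtain l' q' where D'_eq: "D' = (l', q')" by (cases D')
    have U1: "l' j \<in> linear_maps H (G j)" "norm (l' j - l j) < r" if "j \<in> J" for j
      using D'(1) that by (auto simp: D'_eq U1_def PiE_iff dist_norm norm_minus_commute)
    have U2: "q' j > 0" "\<bar>q' j - q j\<bar> < r" "\<bar>q' j - q j\<bar> < q j / 2" if "j \<in> J" for j
      using D'(1) that by (auto simp: D'_eq U2_def PiE_iff dist_real_def abs_minus_commute)
    have l'H: "blinfun_apply (l' j) ` H \<subseteq> G j" if "j \<in> J" for j using U1(1)[OF that] by (auto simp: linear_maps_def)
    \<comment> \<open>Besides membership in the neighbourhood, only global criticality of the nearby
      datum enters; its coercivity is inherited from the given simple datum.\<close>
    interpret co: coercive_setting J H G "\<lambda>j. blinfun_apply (l' j)" q' K \<delta>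
    proof (rule coercive_setting.intro)
      show "bl_setting J H G (\<lambda>j. blinfun_apply (l' j)) q'"
      proof (rule bl_setting.intro)
        show "linear (blinfun_apply (l' j))" for j by (rule bounded_linear.linear[OF blinfun.bounded_linear_right])
        show "(\<Sum>j\<in>J. q' j * real (dim (G j))) = real (dim H)" using D'(2) by (simp add: D'_eq globally_critical_def)
      qed (use assms(1-3) U2(1) l'H in auto)
      show "coercive_setting_axioms J H G (\<lambda>j. blinfun_apply (l' j)) q' K \<delta>"
      proof (rule coercive_setting_axioms.intro[OF K \<delta> n])
        fix e assume e: "orthonormal_family {..<dim H} e" "e ` {..<dim H} \<subseteq> H"
        have "coercive_at J H G (\<lambda>j. blinfun_apply (l' j)) q' K \<delta> e"
          by (rule co[THEN spec, THEN spec, THEN spec, THEN mp]) (use e U1(2) U2(2) in \<open>auto intro: less_imp_le\<close>)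
        thus "\<exists>I. (\<forall>j\<in>J. I j \<subseteq> {..<dim H} \<and> card (I j) = dim (G j) \<and>
            (\<forall>\<alpha>. \<forall>i\<in>I j. \<bar>\<alpha> i\<bar> \<le> K * norm (\<Sum>k\<in>I j. \<alpha> k *\<^sub>R blinfun_apply (l' j) (e k)))) \<and>
          (\<forall>k. 0 < k \<and> k < dim H \<longrightarrow> (\<Sum>j\<in>J. q' j * real (card (I j \<inter> {..<k}))) \<ge> real k + \<delta>)"
          unfolding coercive_at_def .
      qed
    qed
    have "BL_constant J H G (l', q') \<le> ennreal co.C"
      by (rule BL_constant_le[OF assms(1-3) l'H]) (use co.bl_form_le_C in auto)
    also have "\<dots> \<le> ennreal B"
      unfolding co.C_def B_def
    proof (intro ennreal_leI prod_mono conjI)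
      fix j assume j: "j \<in> J"
      let ?x = "(K * (real (dim (G j)) + 1)) ^ dim (G j) * (1 / sqrt (q' j)) ^ dim (G j)"
      have qj: "q j / 2 \<le> q' j" "q' j \<le> 2 * q j" using U2(3)[OF j] q[OF j] by linarith+
      have x0: "0 \<le> ?x" using K U2(1)[OF j] by simp
      have "?x \<le> (K * (real (dim (G j)) + 1)) ^ dim (G j) * (1 / sqrt (q j / 2)) ^ dim (G j)"
        using K q[OF j] U2(1)[OF j] qj(1) by (intro mult_left_mono power_mono divide_left_mono) auto
      hence "?x \<le> M j" by (simp add: M_def)
      hence "?x powr q' j \<le> M j powr q' j" using x0 U2(1)[OF j] by (intro powr_mono2) auto
      also have "\<dots> \<le> M j powr (2 * q j)" using qj(2) by (intro powr_mono) (auto simp: M_def)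
      finally show "?x powr q' j \<le> M j powr (2 * q j)" .
    qed simp
    also have "\<dots> < ennreal (B + 1)" using B0 by (intro ennreal_lessI) auto
    finally show "BL_constant J H G D' < ennreal (B + 1)" unfolding D'_eq .
  qed
qed

end
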